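(* Let $\delta>0$ and let $\sigma^2:[0,1]\to(0,\infty)$ be strictly positive and $\alpha$-Hölder continuous for some $\alpha>1/2$. Observe $Y_i=X_{i/n}+\varepsilon_i$, $i=1,\dots,n$, where $X_t=\int_0^t\sigma(s)\,dB_s$ with $B$ a standard Brownian motion, $\varepsilon_i\sim N(0,\delta^2)$ i.i.d. independent of $B$, and set $Y_0:=0$. For a block length $g>0$ with $g^{-1}\in\mathbb N$, $j\ge1$ and $k=0,\dots,g^{-1}-1$ put $$\Phi^{(g)}_{jk}(t)=\frac{\sqrt{2g}}{\pi j}\sin\big(j\pi(t-kg)/g\big)\mathbf 1_{[kg,(k+1)g]}(t),\qquad y^{0,(g)}_{jk}=\sum_{i=1}^n\Big(-n\int_{(i-1)/n}^{i/n}\Phi^{(g)}_{jk}(t)\,dt\Big)(Y_i-Y_{i-1}).$$ Initial estimator: with $g'=\delta n^{-1/2}$ (assumed to satisfy $1/g'\in\mathbb N$), $y^0_k:=y^{0,(g')}_{1k}$, and a bandwidth $b\sim(n^{-1/2}\log n)^{1/(2\alpha+1)}$, let $$\tilde\sigma_n^2(t)=\frac{\delta}{2b\sqrt n}\sum_{k:\,|k\delta n^{-1/2}-t|\le b}\big(n\delta^{-2}\pi^2(y^0_k)^2-\pi^2\big).$$ Now let $h=h(n)$ with $h^{-1}\in\mathbb N$ and $h\sim n^{-1/2}\log n$, let $J=J(n)\in\mathbb N$ with $J/\log n\to\infty$, put $h_0:=h\sqrt n/\delta$, $y^0_{jk}:=y^{0,(h)}_{jk}$, and for a function $f$ define weights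 $$w^J_{jk}(f)=\frac{(f(kh)+h_0^{-2}\pi^2j^2)^{-2}}{\sum_{l=1}^J(f(kh)+h_0^{-2}\pi^2l^2)^{-2}}.$$ Define $$\widehat{IV}_n=\sum_{k=0}^{h^{-1}-1}h\sum_{j=1}^Jw^J_{jk}(\tilde\sigma_n^2)\,h^{-2}j^2\pi^2\big((y^0_{jk})^2-\delta^2n^{-1}\big).$$ Then, with $IV=\int_0^1\sigma^2(t)\,dt$, $$n^{1/4}(\widehat{IV}_n-IV)\xrightarrow{\ \mathcal L\ }N\Big(0,\,8\delta\int_0^1\sigma^3(t)\,dt\Big)\qquad(n\to\infty).$$
   Context: $\sigma=\sqrt{\sigma^2}$ and $\sigma^3=(\sigma^2)^{3/2}$. $a_n\sim b_n$ means $a_n=O(b_n)$ and $b_n=O(a_n)$. The estimator $\widehat{IV}_n$ is asserted to be asymptotically efficient in this sense. *)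

theory Defs
  imports "HOL-Probability.Probability" "HOL-Library.Landau_Symbols"
begin

definition holder_on :: "real \<Rightarrow> (real \<Rightarrow> real) \<Rightarrow> real set \<Rightarrow> bool" where
  "holder_on \<alpha> f S \<longleftrightarrow> (\<exists>C. \<forall>s\<in>S. \<forall>t\<in>S. \<bar>f s - f t\<bar> \<le> C * \<bar>s - t\<bar> powr \<alpha>)"

definition (in prob_space) std_brownian_motion :: "(real \<Rightarrow> 'a \<Rightarrow> real) \<Rightarrow> bool" where
  "std_brownian_motion B \<longleftrightarrow>
     (\<forall>t. random_variable borel (B t)) \<and>
     (\<forall>\<omega>\<in>space M. B 0 \<omega> = 0) \<and>
     (\<forall>\<omega>\<in>space M. continuous_on {0..} (\<lambda>t. B t \<omega>)) \<and>
     (\<forall>s t. 0 \<le> s \<longrightarrow> s < t \<longrightarrow>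
         distributed M lborel (\<lambda>\<omega>. B t \<omega> - B s \<omega>) (normal_density 0 (sqrt (t - s)))) \<and>
     (\<forall>ts::real list. sorted_wrt (<) ts \<longrightarrow> (\<forall>t\<in>set ts. 0 \<le> t) \<longrightarrow>
         indep_vars (\<lambda>_. borel) (\<lambda>i \<omega>. B (ts ! Suc i) \<omega> - B (ts ! i) \<omega>) {..<length ts - 1})"

text \<open>Z is the stochastic (Ito/Wiener) integral of the deterministic continuous integrand f
  against B over [0,t]: limit in probability of the left-point Riemann(-Ito) sums.\<close>
definition (in prob_space) wiener_integral ::
    "(real \<Rightarrow> 'a \<Rightarrow> real) \<Rightarrow> (real \<Rightarrow> real) \<Rightarrow> real \<Rightarrow> ('a \<Rightarrow> real) \<Rightarrow> bool" where
  "wiener_integral B f t Z \<longleftrightarrow> random_variable borel Z \<and>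
     (\<forall>e>0. ((\<lambda>m::nat. prob {\<omega>\<in>space M.
        \<bar>(\<Sum>i<m. f (t * real i / real m) * (B (t * real (Suc i) / real m) \<omega> - B (t * real i / real m) \<omega>))
          - Z \<omega>\<bar> > e}) \<longlongrightarrow> 0) sequentially)"

definition Phi :: "real \<Rightarrow> nat \<Rightarrow> nat \<Rightarrow> real \<Rightarrow> real" where
  "Phi g j k t = (if real k * g \<le> t \<and> t \<le> (real k + 1) * g
      then sqrt (2 * g) / (pi * real j) * sin (real j * pi * (t - real k * g) / g) else 0)"

definition Yobs :: "(real \<Rightarrow> 'a \<Rightarrow> real) \<Rightarrow> (nat \<Rightarrow> 'a \<Rightarrow> real) \<Rightarrow> nat \<Rightarrow> nat \<Rightarrow> 'a \<Rightarrow> real" where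
  "Yobs X eps n i \<omega> = (if i = 0 then 0 else X (real i / real n) \<omega> + eps i \<omega>)"

definition y0 :: "(real \<Rightarrow> 'a \<Rightarrow> real) \<Rightarrow> (nat \<Rightarrow> 'a \<Rightarrow> real) \<Rightarrow> nat \<Rightarrow> real \<Rightarrow> nat \<Rightarrow> nat \<Rightarrow> 'a \<Rightarrow> real" where
  "y0 X eps n g j k \<omega> = (\<Sum>i=1..n.
      (- real n * integral {real (i - 1) / real n .. real i / real n} (Phi g j k))
        * (Yobs X eps n i \<omega> - Yobs X eps n (i - 1) \<omega>))"

definition sigma_tilde :: "(real \<Rightarrow> 'a \<Rightarrow> real) \<Rightarrow> (nat \<Rightarrow> 'a \<Rightarrow> real) \<Rightarrow> real \<Rightarrow> nat \<Rightarrow> real \<Rightarrow> real \<Rightarrow> 'a \<Rightarrow> real" where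
  "sigma_tilde X eps \<delta> n b t \<omega> =
     (let g' = \<delta> / sqrt (real n); K = nat \<lfloor>sqrt (real n) / \<delta>\<rfloor> in
      \<delta> / (2 * b * sqrt (real n)) *
        (\<Sum>k\<in>{k. k < K \<and> \<bar>real k * \<delta> / sqrt (real n) - t\<bar> \<le> b}.
           real n / \<delta>\<^sup>2 * pi\<^sup>2 * (y0 X eps n g' 1 k \<omega>)\<^sup>2 - pi\<^sup>2))"

definition weight :: "nat \<Rightarrow> real \<Rightarrow> real \<Rightarrow> nat \<Rightarrow> real" where
  "weight J h0 c j = inverse ((c + pi\<^sup>2 * (real j)\<^sup>2 / h0\<^sup>2)\<^sup>2)
      / (\<Sum>l=1..J. inverse ((c + pi\<^sup>2 * (real l)\<^sup>2 / h0\<^sup>2)\<^sup>2))"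

definition IVhat :: "(real \<Rightarrow> 'a \<Rightarrow> real) \<Rightarrow> (nat \<Rightarrow> 'a \<Rightarrow> real) \<Rightarrow> real \<Rightarrow> nat \<Rightarrow> nat \<Rightarrow> nat \<Rightarrow> real \<Rightarrow> 'a \<Rightarrow> real" where
  "IVhat X eps \<delta> n H J b \<omega> =
     (let h = 1 / real H; h0 = h * sqrt (real n) / \<delta> in
      (\<Sum>k<H. h * (\<Sum>j=1..J.
          weight J h0 (sigma_tilde X eps \<delta> n b (real k * h) \<omega>) j
          * (real j)\<^sup>2 * pi\<^sup>2 / h\<^sup>2 * ((y0 X eps n h j k \<omega>)\<^sup>2 - \<delta>\<^sup>2 / real n))))"

end

theory Submission
  imports Defs "HOL-Real_Asymp.Real_Asymp"
begin

text \<open>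
  The statistics of all blocks are jointly Gaussian, with covariances that are almost diagonal: the functions
  $\Phi_{jk}$ are orthogonal, and a second-order recurrence for their cell averages controls the noise part.
  Write the pilot estimator at $kh$ as $f_k + V_k$ with $f_k$ deterministic and expand the weights in $V_k$.
  The zero-order term is a weighted sum of centred squares of Gaussian variables, that is, a quadratic form
  $Q = \sum A_{ij} (Z_i Z_j - \delta_{ij})$ in independent standard normals. Gaussian integration by parts
  turns $\frac{d}{dt} E e^{itQ}$ into $- v t\, E e^{itQ}$ with $v = 2 \|A\|^2$ up to a multiple of
  $t \|A^2\|$ (Frobenius norms), so the characteristic function is close to $e^{-v t^2/2}$, and $v$ converges to
  $8 \delta \int \sigma^3$ because the sum of the squared inverse variances of block $k$ is asymptotic to
  $h_0 f_k^{-3/2} / 4$. In the first-order term $\sum_k V_k A_k$ both factors depend on the same data. Since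
  $\sum_j w_{jk} = 1$ for every value of the pilot estimator, the $A_k$ are again centred second-chaos sums,
  and since $V_k$ varies slowly in $k$ while block sums of $A_k$ grow like square roots, a dyadic
  decomposition with the Cauchy--Schwarz inequality shows that this term is negligible at the price of a
  logarithm. The second-order term is bounded by fourth moments.
\<close>

section \<open>Gaussian integration by parts\<close>

text \<open>The exponent has to be below 1 for the sums against the weights to stay bounded
  uniformly in \<open>J\<close>, and above \<open>1/2\<close> for the total error to vanish after
  multiplication by \<open>n^(1/4)\<close>. Secondly, covariance errors always have the product form
  \<open>sqrt (e p * e q)\<close>, so that double and fourfold sums collapse to powers of a single
  sum. Thirdly, the stochastic integral is given only as a limit in probability, so independence and
  normality of the increments of \<open>X\<close> have to be recovered from Riemann sums before
  anything is Gaussian. The condition \<open>\<alpha> > 1/2\<close> acts through two rates: biases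
  of the type \<open>n^(1/4) h^\<alpha>\<close> vanish, and the bandwidth is so large that
  \<open>log n / (b n^(1/4))\<close> tends to 0, which pays for the logarithm lost in the
  chaining.\<close>

lemma prob_space_std_normal_distribution: "prob_space std_normal_distribution"
  by (rule prob_space_normal_density) simp

lemma integrable_std_normal_one_plus_sq_power:
  "integrable std_normal_distribution (\<lambda>y. y ^ m * (1 + y^2) ^ k)"
proof (induction k arbitrary: m)
  case 0
  then show ?case by (simp add: integrable_std_normal_distribution_moment)
next
  case (Suc k)
  have "(\<lambda>y::real. y ^ m * (1 + y^2) ^ Suc k) = (\<lambda>y. y ^ m * (1 + y^2) ^ k + y ^ (m + 2) * (1 + y^2) ^ k)"
    by (simp add: fun_eq_iff algebra_simps power_add power2_eq_square)
  then show ?case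
    using Bochner_Integration.integrable_add[OF Suc.IH[of m] Suc.IH[of "m + 2"]] by simp
qed

lemma integrable_std_normal_poly_bound:
  fixes g :: "real \<Rightarrow> real"
  assumes [measurable]: "g \<in> borel_measurable borel" and "\<And>y. \<bar>g y\<bar> \<le> C * (1 + y^2) ^ k"
  shows "integrable std_normal_distribution g"
proof (rule Bochner_Integration.integrable_bound)
  show "integrable std_normal_distribution (\<lambda>y. C * (1 + y^2) ^ k)"
    using integrable_std_normal_one_plus_sq_power[of 0 k] by simp
  show "AE x in std_normal_distribution. norm (g x) \<le> norm (C * (1 + x^2) ^ k)"
    using assms(2) by (auto intro!: AE_I2 order_trans[OF assms(2)])
qed simp

lemma abs_le_one_plus_sq: "\<bar>y::real\<bar> \<le> 1 + y^2"
proof -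
  have "0 \<le> (\<bar>y\<bar> - 1)^2 + \<bar>y\<bar>" by simp
  then show ?thesis by (simp add: power2_diff)
qed

text \<open>The density satisfies \<open>\<phi>' y = - y * \<phi> y\<close>, so the difference of
  the two integrands is the derivative of \<open>g y * \<phi> y\<close>, whose limits at both
  infinities vanish under polynomial growth.\<close>

lemma std_normal_ibp:
  fixes g g' :: "real \<Rightarrow> real"
  assumes D: "\<And>y. (g has_real_derivative g' y) (at y)" and C': "continuous_on UNIV g'"
    and B: "\<And>y. \<bar>g y\<bar> \<le> C * (1 + y^2) ^ k" "\<And>y. \<bar>g' y\<bar> \<le> C * (1 + y^2) ^ k"
  shows "(\<integral>y. y * g y \<partial>std_normal_distribution) = (\<integral>y. g' y \<partial>std_normal_distribution)"
proof -
  have cg: "continuous_on UNIV g"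
    using D by (meson DERIV_isCont continuous_at_imp_continuous_on)
  have [measurable]: "g \<in> borel_measurable borel" "g' \<in> borel_measurable borel"
    using cg C' by (auto intro: borel_measurable_continuous_onI)
  have ig': "integrable std_normal_distribution g'"
    by (rule integrable_std_normal_poly_bound[OF _ B(2)]) simp
  have ig: "integrable std_normal_distribution (\<lambda>y. y * g y)"
  proof (rule integrable_std_normal_poly_bound[where C = C and k = "Suc k"])
    fix y
    show "\<bar>y * g y\<bar> \<le> C * (1 + y^2) ^ Suc k"
      using mult_mono[OF abs_le_one_plus_sq[of y] B(1)[of y]] by (simp add: abs_mult mult_ac)
  qed simp
  define \<phi> where "\<phi> = (\<lambda>y::real. std_normal_density y)"
  have dphi: "(\<phi> has_real_derivative (- y * \<phi> y)) (at y)" for y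
    unfolding \<phi>_def std_normal_density_def by (rule derivative_eq_intros refl | simp)+
  have pos: "\<phi> y \<ge> 0" for y by (simp add: \<phi>_def)
  define F where "F = (\<lambda>y. g y * \<phi> y)"
  define f where "f = (\<lambda>y. \<phi> y * g' y - \<phi> y * (y * g y))"
  have dF: "(F has_real_derivative f y) (at y)" for y
    unfolding F_def f_def by (rule derivative_eq_intros D dphi refl)+ (simp add: algebra_simps)
  have i1: "integrable lborel (\<lambda>y. \<phi> y * g' y)" "integrable lborel (\<lambda>y. \<phi> y * (y * g y))"
    using ig ig' by (auto simp: \<phi>_def integrable_real_density integrable_density)
  then have intf: "integrable lborel f" unfolding f_def by simp
  have cphi: "continuous_on UNIV \<phi>"
    using dphi by (meson DERIV_isCont continuous_at_imp_continuous_on)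
  have cf: "continuous_on UNIV f" unfolding f_def by (intro continuous_intros cphi C' cg)
  have bF: "\<bar>F y\<bar> \<le> C * (1 + y^2) ^ k * \<phi> y" for y
    unfolding F_def using B(1)[of y] pos[of y] by (simp add: abs_mult mult_right_mono)
  have l1: "((\<lambda>y. C * (1 + y^2) ^ k * \<phi> y) \<longlongrightarrow> 0) at_top"
    unfolding \<phi>_def std_normal_density_def by real_asymp
  have l2: "((\<lambda>y. C * (1 + y^2) ^ k * \<phi> y) \<longlongrightarrow> 0) at_bot"
    unfolding \<phi>_def std_normal_density_def by real_asymp
  have L1: "(F \<longlongrightarrow> 0) at_top" "(F \<longlongrightarrow> 0) at_bot"
    by (rule Lim_null_comparison[OF _ l1] Lim_null_comparison[OF _ l2], simp add: bF)+
  have "(LBINT x=-\<infinity>..\<infinity>. f x) = 0 - 0"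
  proof (rule interval_integral_FTC_integrable)
    show "((F \<circ> real_of_ereal) \<longlongrightarrow> 0) (at_right (- \<infinity>))" "((F \<circ> real_of_ereal) \<longlongrightarrow> 0) (at_left \<infinity>)"
      using L1 by (simp_all add: ereal_tendsto_simps)
    show "(F has_vector_derivative f x) (at x)" for x
      using dF[of x] by (simp add: has_real_derivative_iff_has_vector_derivative)
    show "isCont f x" for x using cf by (simp add: continuous_on_eq_continuous_at)
  qed (use intf in \<open>auto simp: set_integrable_def\<close>)
  then have "integral\<^sup>L lborel f = 0"
    by (simp add: interval_lebesgue_integral_def set_lebesgue_integral_def)
  then have "(\<integral>y. \<phi> y * (y * g y) \<partial>lborel) = (\<integral>y. \<phi> y * g' y \<partial>lborel)"
    unfolding f_def using i1 by simp
  then show ?thesis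
    by (simp add: integral_density \<phi>_def)
qed

section \<open>Product Gaussian measures and integration by parts in one coordinate\<close>

definition gauss_measure :: "'i set \<Rightarrow> ('i \<Rightarrow> real) measure" where
  "gauss_measure I = (\<Pi>\<^sub>M i\<in>I. std_normal_distribution)"

text \<open>A product rather than a power of a norm: it factorises when one coordinate is singled
  out, so growth bounds survive Fubini, and its powers are integrable coordinate by
  coordinate.\<close>

definition poly_weight :: "'i set \<Rightarrow> ('i \<Rightarrow> real) \<Rightarrow> real" where
  "poly_weight I x = (\<Prod>i\<in>I. 1 + (x i)^2)"

interpretation std_normal_product: product_prob_space "\<lambda>_::'i. std_normal_distribution" UNIV
  using prob_space_std_normal_distribution
  by (intro product_prob_space.intro product_prob_space_axioms.intro product_sigma_finite.intro)
     (auto intro: prob_space_imp_sigma_finite)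

lemma prob_space_gauss_measure: "prob_space (gauss_measure I)"
  unfolding gauss_measure_def
  by (rule prob_space_PiM) (rule prob_space_std_normal_distribution)

lemma sets_gauss_measure [measurable_cong]: "sets (gauss_measure I) = sets (\<Pi>\<^sub>M i\<in>I. borel)"
  unfolding gauss_measure_def by (intro sets_PiM_cong) auto

lemma poly_weight_ge_1: "1 \<le> poly_weight I x"
  unfolding poly_weight_def by (rule prod_ge_1) simp

lemma abs_coord_le_poly_weight:
  assumes "finite I" "i \<in> I" shows "\<bar>x i\<bar> \<le> poly_weight I x"
proof -
  have "\<bar>x i\<bar> \<le> 1 + (x i)^2" by (rule abs_le_one_plus_sq)
  also have "\<dots> \<le> (1 + (x i)^2) * poly_weight (I - {i}) x"
    using poly_weight_ge_1[of "I - {i}" x] using mult_left_mono[of 1 "poly_weight (I - {i}) x" "1 + (x i)^2"] by simp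
  also have "\<dots> = poly_weight I x"
    unfolding poly_weight_def using assms by (simp add: prod.remove)
  finally show ?thesis .
qed

lemma poly_weight_upd:
  assumes "finite I" "i \<in> I"
  shows "poly_weight I (x(i := y)) = (1 + y^2) * poly_weight (I - {i}) x"
proof -
  have "poly_weight I (x(i := y)) = (1 + y^2) * poly_weight (I - {i}) (x(i := y))"
    unfolding poly_weight_def using assms by (simp add: prod.remove)
  also have "poly_weight (I - {i}) (x(i := y)) = poly_weight (I - {i}) x"
    unfolding poly_weight_def by (intro prod.cong) auto
  finally show ?thesis .
qed

lemma integrable_gauss_poly_bound:
  fixes f :: "('i \<Rightarrow> real) \<Rightarrow> 'b :: {banach, second_countable_topology}"
  assumes I: "finite I" and f [measurable]: "f \<in> borel_measurable (\<Pi>\<^sub>M i\<in>I. borel)"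
    and B: "\<And>x. norm (f x) \<le> C * poly_weight I x ^ k"
  shows "integrable (gauss_measure I) f"
proof (rule Bochner_Integration.integrable_bound)
  have "integrable (gauss_measure I) (\<lambda>x. \<Prod>i\<in>I. (1 + (x i)^2) ^ k)"
    unfolding gauss_measure_def
    by (rule std_normal_product.product_integrable_prod[OF I])
       (use integrable_std_normal_one_plus_sq_power[of 0 k] in simp)
  then show "integrable (gauss_measure I) (\<lambda>x. C * poly_weight I x ^ k)"
    unfolding poly_weight_def by (simp add: prod_power_distrib)
  show "f \<in> borel_measurable (gauss_measure I)" by measurable
  show "AE x in gauss_measure I. norm (f x) \<le> norm (C * poly_weight I x ^ k)"
    by (rule AE_I2, rule order_trans[OF B]) simp
qed

text \<open>Fubini isolates coordinate \<open>i\<close>. With the other coordinates frozen, the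
  growth bound splits off the constant \<open>C * poly_weight K x ^ k\<close>, and the
  one-dimensional formula applies under the outer integral.\<close>

lemma gauss_ibp:
  fixes F F' :: "('i \<Rightarrow> real) \<Rightarrow> real"
  assumes I: "finite I" "i \<in> I"
    and [measurable]: "F \<in> borel_measurable (\<Pi>\<^sub>M i\<in>I. borel)" "F' \<in> borel_measurable (\<Pi>\<^sub>M i\<in>I. borel)"
    and D: "\<And>x y. ((\<lambda>y. F (x(i := y))) has_real_derivative F' (x(i := y))) (at y)"
    and C': "\<And>x. continuous_on UNIV (\<lambda>y. F' (x(i := y)))"
    and B: "\<And>x. \<bar>F x\<bar> \<le> C * poly_weight I x ^ k" "\<And>x. \<bar>F' x\<bar> \<le> C * poly_weight I x ^ k"
  shows "(\<integral>x. x i * F x \<partial>gauss_measure I) = (\<integral>x. F' x \<partial>gauss_measure I)"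
proof -
  define K where "K = I - {i}"
  have K: "finite K" "i \<notin> K" "insert i K = I" using I by (auto simp: K_def)
  have [measurable]: "(\<lambda>x. x i) \<in> borel_measurable (\<Pi>\<^sub>M i\<in>I. borel)"
    using I by measurable
  have i1: "integrable (gauss_measure I) (\<lambda>x. x i * F x)"
  proof (rule integrable_gauss_poly_bound[OF I(1)])
    fix x
    have "\<bar>x i\<bar> * \<bar>F x\<bar> \<le> poly_weight I x * (C * poly_weight I x ^ k)"
      by (intro mult_mono abs_coord_le_poly_weight I B) (use poly_weight_ge_1[of I x] in auto)
    then show "norm (x i * F x) \<le> C * poly_weight I x ^ Suc k" by (simp add: abs_mult mult_ac)
  qed measurable
  have i2: "integrable (gauss_measure I) F'"
    by (rule integrable_gauss_poly_bound[OF I(1) _]) (use B in auto)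
  have "(\<integral>x. x i * F x \<partial>gauss_measure I) = (\<integral>x. (\<integral>y. y * F (x(i:=y)) \<partial>std_normal_distribution) \<partial>gauss_measure K)"
    using std_normal_product.product_integral_insert[OF K(1,2), of "\<lambda>x. x i * F x"] i1
    unfolding gauss_measure_def K(3) by simp
  also have "\<dots> = (\<integral>x. (\<integral>y. F' (x(i:=y)) \<partial>std_normal_distribution) \<partial>gauss_measure K)"
  proof (rule Bochner_Integration.integral_cong[OF refl])
    fix x
    show "(\<integral>y. y * F (x(i:=y)) \<partial>std_normal_distribution) = (\<integral>y. F' (x(i:=y)) \<partial>std_normal_distribution)"
    proof (rule std_normal_ibp[where C = "C * poly_weight K x ^ k" and k = k])
      fix y
      show "((\<lambda>y. F (x(i := y))) has_real_derivative F' (x(i := y))) (at y)" by (rule D)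
      show "continuous_on UNIV (\<lambda>y. F' (x(i := y)))" by (rule C')
      show "\<bar>F (x(i := y))\<bar> \<le> C * poly_weight K x ^ k * (1 + y^2) ^ k"
        using B(1)[of "x(i := y)"] poly_weight_upd[OF I, of x y] by (simp add: K_def power_mult_distrib mult_ac)
      show "\<bar>F' (x(i := y))\<bar> \<le> C * poly_weight K x ^ k * (1 + y^2) ^ k"
        using B(2)[of "x(i := y)"] poly_weight_upd[OF I, of x y] by (simp add: K_def power_mult_distrib mult_ac)
    qed
  qed
  also have "\<dots> = (\<integral>x. F' x \<partial>gauss_measure I)"
    using std_normal_product.product_integral_insert[OF K(1,2), of F'] i2
    unfolding gauss_measure_def K(3) by simp
  finally show ?thesis .
qed

section \<open>Quadratic forms of Gaussian vectors\<close>

definition lin_form :: "'i set \<Rightarrow> ('i \<Rightarrow> 'i \<Rightarrow> real) \<Rightarrow> ('i \<Rightarrow> real) \<Rightarrow> 'i \<Rightarrow> real" where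
  "lin_form I A x i = (\<Sum>j\<in>I. A i j * x j)"

text \<open>Subtracting the diagonal entries centres the form, because the trace of \<open>A\<close>
  is the mean of \<open>x . A x\<close> under the Gaussian measure. The result lies in the second
  Wiener chaos.\<close>

definition quad_form :: "'i set \<Rightarrow> ('i \<Rightarrow> 'i \<Rightarrow> real) \<Rightarrow> ('i \<Rightarrow> real) \<Rightarrow> real" where
  "quad_form I A x = (\<Sum>i\<in>I. x i * lin_form I A x i - A i i)"

definition frob_sq :: "'i set \<Rightarrow> ('i \<Rightarrow> 'i \<Rightarrow> real) \<Rightarrow> real" where
  "frob_sq I A = (\<Sum>i\<in>I. \<Sum>j\<in>I. (A i j)^2)"

definition mat_sq :: "'i set \<Rightarrow> ('i \<Rightarrow> 'i \<Rightarrow> real) \<Rightarrow> 'i \<Rightarrow> 'i \<Rightarrow> real" where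
  "mat_sq I A i j = (\<Sum>l\<in>I. A i l * A l j)"

definition sym_mat :: "('i \<Rightarrow> 'i \<Rightarrow> real) \<Rightarrow> bool" where
  "sym_mat A \<longleftrightarrow> (\<forall>i j. A i j = A j i)"

lemma sym_matD: "sym_mat A \<Longrightarrow> A i j = A j i"
  by (simp add: sym_mat_def)

text \<open>The gradient of \<open>quad_form I A\<close> is \<open>2 A x\<close>, so this is a
  quarter of its squared length. It is the factor that integration by parts produces (a Stein kernel
  up to a constant).\<close>

definition norm_sq_form :: "'i set \<Rightarrow> ('i \<Rightarrow> 'i \<Rightarrow> real) \<Rightarrow> ('i \<Rightarrow> real) \<Rightarrow> real" where
  "norm_sq_form I A x = (\<Sum>i\<in>I. (lin_form I A x i)^2)"

lemma has_derivative_coord: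
  "((\<lambda>y. (x(i := y)) l) has_real_derivative (if l = i then 1 else 0)) (at y)"
  by (cases "l = i") auto

lemma lin_form_measurable [measurable]: "(\<lambda>x. lin_form I A x i) \<in> borel_measurable (\<Pi>\<^sub>M i\<in>I. borel)"
  unfolding lin_form_def by measurable

lemma quad_form_measurable [measurable]: "quad_form I A \<in> borel_measurable (\<Pi>\<^sub>M i\<in>I. borel)"
  unfolding quad_form_def by measurable

lemma norm_sq_form_measurable [measurable]: "norm_sq_form I A \<in> borel_measurable (\<Pi>\<^sub>M i\<in>I. borel)"
  unfolding norm_sq_form_def by measurable

context
  fixes I :: "'i set" and A :: "'i \<Rightarrow> 'i \<Rightarrow> real"
  assumes fin: "finite I" and sym: "sym_mat A"
begin

lemma lin_form_bound:
  assumes "i \<in> I"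
  shows "\<bar>lin_form I A x i\<bar> \<le> (\<Sum>i\<in>I. \<Sum>j\<in>I. \<bar>A i j\<bar>) * poly_weight I x"
proof -
  have "\<bar>lin_form I A x i\<bar> \<le> (\<Sum>j\<in>I. \<bar>A i j\<bar> * poly_weight I x)"
    unfolding lin_form_def
    by (rule order_trans[OF sum_abs]) (auto intro!: sum_mono mult_left_mono abs_coord_le_poly_weight fin simp: abs_mult)
  also have "\<dots> = (\<Sum>j\<in>I. \<bar>A i j\<bar>) * poly_weight I x" by (simp add: sum_distrib_right)
  also have "\<dots> \<le> (\<Sum>i\<in>I. \<Sum>j\<in>I. \<bar>A i j\<bar>) * poly_weight I x"
    using poly_weight_ge_1[of I x] member_le_sum[of i I "\<lambda>i. \<Sum>j\<in>I. \<bar>A i j\<bar>"] assms fin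
    by (intro mult_right_mono) (auto simp: sum_nonneg)
  finally show ?thesis .
qed

lemma quad_form_bound:
  "\<bar>quad_form I A x\<bar> \<le> (real (card I) + 1) * (\<Sum>i\<in>I. \<Sum>j\<in>I. \<bar>A i j\<bar>) * poly_weight I x ^ 2"
proof -
  let ?K = "\<Sum>i\<in>I. \<Sum>j\<in>I. \<bar>A i j\<bar>" and ?G = "poly_weight I x"
  have G: "1 \<le> ?G" by (rule poly_weight_ge_1)
  have "\<bar>quad_form I A x\<bar> \<le> (\<Sum>i\<in>I. \<bar>x i * lin_form I A x i\<bar> + \<bar>A i i\<bar>)"
    unfolding quad_form_def by (rule order_trans[OF sum_abs]) (auto intro!: sum_mono)
  also have "\<dots> \<le> (\<Sum>i\<in>I. ?G * (?K * ?G) + (\<Sum>j\<in>I. \<bar>A i j\<bar>))"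
    using fin by (auto intro!: sum_mono add_mono mult_mono abs_coord_le_poly_weight lin_form_bound
        member_le_sum[where f = "\<lambda>j. \<bar>A _ j\<bar>"] simp: abs_mult order_trans[OF _ G])
  also have "\<dots> = real (card I) * ?K * ?G ^ 2 + ?K"
    by (simp add: sum.distrib power2_eq_square mult_ac)
  also have "\<dots> \<le> real (card I) * ?K * ?G ^ 2 + ?K * ?G ^ 2"
    using G by (auto intro!: mult_left_mono[of 1 "?G^2" ?K, simplified] sum_nonneg)
  finally show ?thesis by (simp add: algebra_simps)
qed

lemma has_derivative_lin_form:
  assumes "i \<in> I"
  shows "((\<lambda>y. lin_form I A (x(i := y)) l) has_real_derivative A l i) (at y)"
proof -
  have "((\<lambda>y. lin_form I A (x(i := y)) l) has_real_derivative (\<Sum>j\<in>I. A l j * (if j = i then 1 else 0))) (at y)"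
    unfolding lin_form_def by (intro DERIV_sum DERIV_cmult has_derivative_coord)
  then show ?thesis using assms fin by (simp add: if_distrib cong: if_cong)
qed

lemma has_derivative_quad_form:
  assumes "i \<in> I"
  shows "((\<lambda>y. quad_form I A (x(i := y))) has_real_derivative 2 * lin_form I A (x(i := y)) i) (at y)"
proof -
  let ?x = "x(i := y)"
  have "((\<lambda>y. quad_form I A (x(i := y))) has_real_derivative
      (\<Sum>l\<in>I. (if l = i then 1 else 0) * lin_form I A ?x l + A l i * ?x l - 0)) (at y)"
    unfolding quad_form_def
    by (intro DERIV_sum DERIV_diff DERIV_mult has_derivative_coord has_derivative_lin_form assms DERIV_const)
  also have "(\<Sum>l\<in>I. (if l = i then 1 else 0) * lin_form I A ?x l + A l i * ?x l - 0) = 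
      lin_form I A ?x i + (\<Sum>l\<in>I. A i l * ?x l)"
    using assms fin by (simp add: sum.distrib if_distrib[where f = "\<lambda>c. c * _"] sym_matD[OF sym, of _ i] cong: if_cong)
  also have "lin_form I A ?x i + (\<Sum>l\<in>I. A i l * ?x l) = 2 * lin_form I A ?x i" by (simp only: lin_form_def mult_2)
  finally show ?thesis .
qed

text \<open>Cubic growth covers all test functions that occur; the cube itself is the one that
  yields the fourth moment.\<close>

lemma quad_form_poly_bound:
  assumes C: "\<And>t. \<bar>\<psi> t\<bar> \<le> C * (1 + \<bar>t\<bar>) ^ 3"
  shows "\<bar>\<psi> (quad_form I A x)\<bar> \<le> 
    (C * (1 + (real (card I) + 1) * (\<Sum>i\<in>I. \<Sum>j\<in>I. \<bar>A i j\<bar>)) ^ 3) * poly_weight I x ^ 6"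
proof -
  let ?K = "(real (card I) + 1) * (\<Sum>i\<in>I. \<Sum>j\<in>I. \<bar>A i j\<bar>)" and ?G = "poly_weight I x"
  have C0: "C \<ge> 0" using C[of 0] by simp
  have K: "?K \<ge> 0" by (intro mult_nonneg_nonneg sum_nonneg) auto
  have "1 \<le> ?G ^ 2" using poly_weight_ge_1[of I x] by simp
  then have "1 + \<bar>quad_form I A x\<bar> \<le> (1 + ?K) * ?G ^ 2"
    using quad_form_bound[of x] by (simp add: algebra_simps)
  then have "(1 + \<bar>quad_form I A x\<bar>) ^ 3 \<le> ((1 + ?K) * ?G ^ 2) ^ 3"
    by (intro power_mono) auto
  also have "\<dots> = (1 + ?K) ^ 3 * ?G ^ 6" by (simp add: power_mult_distrib flip: power_mult)
  finally show ?thesis using C[of "quad_form I A x"] C0 by (smt (verit) mult.assoc mult_left_mono)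
qed

lemma norm_sq_form_bound:
  "\<bar>norm_sq_form I A x\<bar> \<le> (real (card I) * (\<Sum>i\<in>I. \<Sum>j\<in>I. \<bar>A i j\<bar>) ^ 2) * poly_weight I x ^ 2"
proof -
  let ?K = "(\<Sum>i\<in>I. \<Sum>j\<in>I. \<bar>A i j\<bar>)" and ?G = "poly_weight I x"
  have "(lin_form I A x i)^2 \<le> (?K * ?G)^2" if "i \<in> I" for i
    using power_mono[OF lin_form_bound[OF that, of x], of 2] by simp
  then have "norm_sq_form I A x \<le> (\<Sum>i\<in>I. (?K * ?G)^2)"
    unfolding norm_sq_form_def by (rule sum_mono)
  moreover have "0 \<le> norm_sq_form I A x" unfolding norm_sq_form_def by (intro sum_nonneg) auto
  ultimately have "\<bar>norm_sq_form I A x\<bar> \<le> (\<Sum>i\<in>I. (?K * ?G)^2)" by simp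
  then show ?thesis by (simp add: power_mult_distrib mult_ac)
qed

lemma integrable_psi_quad_form:
  assumes [measurable]: "\<psi> \<in> borel_measurable borel" and C: "\<And>t. \<bar>\<psi> t\<bar> \<le> C * (1 + \<bar>t\<bar>) ^ 3"
  shows "integrable (gauss_measure I) (\<lambda>x. \<psi> (quad_form I A x))"
    and "integrable (gauss_measure I) (\<lambda>x. quad_form I A x * \<psi> (quad_form I A x))"
    and "integrable (gauss_measure I) (\<lambda>x. norm_sq_form I A x * \<psi> (quad_form I A x))"
proof -
  obtain c where c: "\<And>x. \<bar>\<psi> (quad_form I A x)\<bar> \<le> c * poly_weight I x ^ 6"
    using quad_form_poly_bound[OF C] by blast
  obtain d where d: "\<And>x. \<bar>quad_form I A x\<bar> \<le> d * poly_weight I x ^ 2" using quad_form_bound by blast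
  obtain e where e: "\<And>x. \<bar>norm_sq_form I A x\<bar> \<le> e * poly_weight I x ^ 2" using norm_sq_form_bound by blast
  show "integrable (gauss_measure I) (\<lambda>x. \<psi> (quad_form I A x))"
    by (rule integrable_gauss_poly_bound[OF fin, of _ c 6]) (use c in auto)
  show "integrable (gauss_measure I) (\<lambda>x. quad_form I A x * \<psi> (quad_form I A x))"
  proof (rule integrable_gauss_poly_bound[OF fin, of _ "d * c" 8])
    show "norm (quad_form I A x * \<psi> (quad_form I A x)) \<le> d * c * poly_weight I x ^ 8" for x
      using mult_mono'[OF d[of x] c[of x]] by (simp add: abs_mult mult_ac flip: power_add)
  qed measurable
  show "integrable (gauss_measure I) (\<lambda>x. norm_sq_form I A x * \<psi> (quad_form I A x))"
  proof (rule integrable_gauss_poly_bound[OF fin, of _ "e * c" 8])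
    show "norm (norm_sq_form I A x * \<psi> (quad_form I A x)) \<le> e * c * poly_weight I x ^ 8" for x
      using mult_mono'[OF e[of x] c[of x]] by (simp add: abs_mult mult_ac flip: power_add)
  qed measurable
qed

text \<open>Integrate by parts in each \<open>x i\<close> against
  \<open>lin_form I A x i * \<psi> (quad_form I A x)\<close>. The derivative of the first factor
  gives \<open>A i i * \<psi>\<close>, which the centring of the form cancels; the derivative of the
  second gives twice the square of \<open>lin_form\<close>.\<close>

lemma quad_form_ibp:
  assumes D: "\<And>t. (\<psi> has_real_derivative \<psi>' t) (at t)" and C': "continuous_on UNIV \<psi>'"
    and B: "\<And>t. \<bar>\<psi> t\<bar> \<le> C * (1 + \<bar>t\<bar>) ^ 3" "\<And>t. \<bar>\<psi>' t\<bar> \<le> C * (1 + \<bar>t\<bar>) ^ 3"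
  shows "(\<integral>x. quad_form I A x * \<psi> (quad_form I A x) \<partial>gauss_measure I) =
    2 * (\<integral>x. norm_sq_form I A x * \<psi>' (quad_form I A x) \<partial>gauss_measure I)"
proof -
  have cp: "continuous_on UNIV \<psi>"
    using D by (meson DERIV_isCont continuous_at_imp_continuous_on)
  have [measurable]: "\<psi> \<in> borel_measurable borel" "\<psi>' \<in> borel_measurable borel"
    using cp C' by (auto intro: borel_measurable_continuous_onI)
  let ?Q = "quad_form I A" and ?L = "lin_form I A" and ?E = "integral\<^sup>L (gauss_measure I)"
  define K where "K = (\<Sum>i\<in>I. \<Sum>j\<in>I. \<bar>A i j\<bar>)"
  have K0: "K \<ge> 0" unfolding K_def by (intro sum_nonneg) auto
  define c where "c = C * (1 + (real (card I) + 1) * K) ^ 3"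
  have b: "\<bar>\<psi> (?Q x)\<bar> \<le> c * poly_weight I x ^ 6" "\<bar>\<psi>' (?Q x)\<bar> \<le> c * poly_weight I x ^ 6" for x
    using quad_form_poly_bound[OF B(1)] quad_form_poly_bound[OF B(2)] by (auto simp: c_def K_def)
  have c0: "c \<ge> 0" using B(1)[of 0] K0 by (auto simp: c_def)
  have bL: "\<bar>?L x i\<bar> \<le> K * poly_weight I x" if "i \<in> I" for x i
    using lin_form_bound[OF that] by (simp add: K_def)
  have bA: "\<bar>A i i\<bar> \<le> K" if "i \<in> I" for i
  proof -
    have "\<bar>A i i\<bar> \<le> (\<Sum>j\<in>I. \<bar>A i j\<bar>)" using that fin by (intro member_le_sum) auto
    also have "\<dots> \<le> K" unfolding K_def using that fin by (intro member_le_sum sum_nonneg) auto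
    finally show ?thesis .
  qed
  have s: "?E (\<lambda>x. x i * (?L x i * \<psi> (?Q x))) = ?E (\<lambda>x. A i i * \<psi> (?Q x) + 2 * ((?L x i)^2 * \<psi>' (?Q x)))"
    and i1: "integrable (gauss_measure I) (\<lambda>x. x i * (?L x i * \<psi> (?Q x)))"
    and i2: "integrable (gauss_measure I) (\<lambda>x. (?L x i)^2 * \<psi>' (?Q x))"
    if i: "i \<in> I" for i
  proof -
    have [measurable]: "(\<lambda>x. x i) \<in> borel_measurable (\<Pi>\<^sub>M i\<in>I. borel)" using i by measurable
    let ?G = "poly_weight I"
    have G: "1 \<le> ?G x" for x by (rule poly_weight_ge_1)
    have p: "?G x ^ 6 \<le> ?G x ^ 8" "?G x ^ 7 \<le> ?G x ^ 8" for x using G[of x] by (auto intro: power_increasing)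
    have b1: "\<bar>?L x i * \<psi> (?Q x)\<bar> \<le> K * c * ?G x ^ 7" for x
      using mult_mono'[OF bL[OF i, of x] b(1)[of x]] by (simp add: abs_mult mult_ac numeral_eq_Suc)
    have b1': "\<bar>?L x i * \<psi> (?Q x)\<bar> \<le> (K * c + 2 * (K * K * c)) * ?G x ^ 8" for x
    proof -
      have "K * c * ?G x ^ 7 \<le> (K * c + 2 * (K * K * c)) * ?G x ^ 8"
        using p[of x] G[of x] K0 c0 by (intro mult_mono) auto
      then show ?thesis using b1[of x] by simp
    qed
    have b2: "\<bar>(?L x i)\<^sup>2 * \<psi>' (?Q x)\<bar> \<le> K * K * c * ?G x ^ 8" for x
    proof -
      have "\<bar>?L x i\<bar>\<^sup>2 * \<bar>\<psi>' (?Q x)\<bar> \<le> (K * ?G x)^2 * (c * ?G x ^ 6)"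
        by (intro mult_mono power_mono bL i b) (use c0 in auto)
      then show ?thesis by (simp add: abs_mult power_mult_distrib mult_ac power2_eq_square numeral_eq_Suc)
    qed
    have b3: "\<bar>A i i * \<psi> (?Q x)\<bar> \<le> K * c * ?G x ^ 8" for x
    proof -
      have "\<bar>A i i\<bar> * \<bar>\<psi> (?Q x)\<bar> \<le> K * (c * ?G x ^ 6)" by (intro mult_mono bA i b K0) auto
      also have "\<dots> \<le> K * (c * ?G x ^ 8)" by (intro mult_left_mono p c0 K0)
      finally show ?thesis by (simp add: abs_mult mult_ac)
    qed
    show "?E (\<lambda>x. x i * (?L x i * \<psi> (?Q x))) = ?E (\<lambda>x. A i i * \<psi> (?Q x) + 2 * ((?L x i)^2 * \<psi>' (?Q x)))"
    proof (rule gauss_ibp[OF fin i, where C = "K * c + 2 * (K * K * c)" and k = 8])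
      fix x y
      show "((\<lambda>y. ?L (x(i := y)) i * \<psi> (?Q (x(i := y)))) has_real_derivative
         A i i * \<psi> (?Q (x(i := y))) + 2 * ((?L (x(i := y)) i)^2 * \<psi>' (?Q (x(i := y))))) (at y)"
        by (rule derivative_eq_intros has_derivative_lin_form[OF i] refl
             DERIV_chain2[where f = \<psi> and g = "\<lambda>y. ?Q (x(i := y))", OF D has_derivative_quad_form[OF i]])+
           (simp add: power2_eq_square algebra_simps)
    next
      fix x
      have "continuous_on UNIV (\<lambda>y. ?Q (x(i := y)))" "continuous_on UNIV (\<lambda>y. ?L (x(i := y)) i)"
        using has_derivative_quad_form[OF i] has_derivative_lin_form[OF i]
        by (meson DERIV_isCont continuous_at_imp_continuous_on)+
      then show "continuous_on UNIV (\<lambda>y. A i i * \<psi> (?Q (x(i := y))) + 2 * ((?L (x(i := y)) i)^2 * \<psi>' (?Q (x(i := y)))))"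
        by (intro continuous_intros continuous_on_compose2[OF cp] continuous_on_compose2[OF C']) auto
    next
      fix x
      show "\<bar>?L x i * \<psi> (?Q x)\<bar> \<le> (K * c + 2 * (K * K * c)) * ?G x ^ 8" by (rule b1')
      have "\<bar>A i i * \<psi> (?Q x) + 2 * ((?L x i)^2 * \<psi>' (?Q x))\<bar> \<le> K * c * ?G x ^ 8 + 2 * (K * K * c * ?G x ^ 8)"
        using b2[of x] b3[of x] by linarith
      then show "\<bar>A i i * \<psi> (?Q x) + 2 * ((?L x i)^2 * \<psi>' (?Q x))\<bar> \<le> (K * c + 2 * (K * K * c)) * ?G x ^ 8"
        by (simp add: algebra_simps)
    qed measurable
    show "integrable (gauss_measure I) (\<lambda>x. (?L x i)^2 * \<psi>' (?Q x))"
      by (rule integrable_gauss_poly_bound[OF fin, of _ "K * K * c" 8]) (use b2 in auto)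
    show "integrable (gauss_measure I) (\<lambda>x. x i * (?L x i * \<psi> (?Q x)))"
    proof (rule integrable_gauss_poly_bound[OF fin, of _ "K * c" 8])
      fix x
      have "\<bar>x i\<bar> * \<bar>?L x i * \<psi> (?Q x)\<bar> \<le> ?G x * (K * c * ?G x ^ 7)"
        by (intro mult_mono abs_coord_le_poly_weight fin i b1) (use G[of x] in auto)
      then show "norm (x i * (?L x i * \<psi> (?Q x))) \<le> K * c * ?G x ^ 8"
        by (simp add: abs_mult mult_ac numeral_eq_Suc)
    qed measurable
  qed
  have ip: "integrable (gauss_measure I) (\<lambda>x. \<psi> (?Q x))" by (rule integrable_psi_quad_form[OF _ B(1)]) simp
  have "?E (\<lambda>x. ?Q x * \<psi> (?Q x)) = ?E (\<lambda>x. \<Sum>i\<in>I. x i * (?L x i * \<psi> (?Q x)) - A i i * \<psi> (?Q x))"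
    unfolding quad_form_def[of I A] by (intro Bochner_Integration.integral_cong refl) (simp add: sum_distrib_right algebra_simps)
  also have "\<dots> = (\<Sum>i\<in>I. ?E (\<lambda>x. x i * (?L x i * \<psi> (?Q x))) - A i i * ?E (\<lambda>x. \<psi> (?Q x)))"
    using i1 ip by (simp add: Bochner_Integration.integral_sum)
  also have "\<dots> = (\<Sum>i\<in>I. 2 * ?E (\<lambda>x. (?L x i)^2 * \<psi>' (?Q x)))"
    using s i2 ip by (intro sum.cong refl) simp
  also have "\<dots> = 2 * ?E (\<lambda>x. \<Sum>i\<in>I. (?L x i)^2 * \<psi>' (?Q x))"
    using i2 by (simp add: Bochner_Integration.integral_sum sum_distrib_left)
  finally show ?thesis by (simp add: norm_sq_form_def sum_distrib_right)
qed

end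

section \<open>Moments and characteristic functions of quadratic forms\<close>

lemma trig_taylor2:
  fixes u u' :: "real \<Rightarrow> real"
  assumes D: "\<And>t. (u has_real_derivative u' t) (at t)" "\<And>t. (u' has_real_derivative - u t) (at t)"
    and B: "\<And>t. \<bar>u t\<bar> \<le> 1"
  shows "\<bar>u (x + d) - u x - d * u' x\<bar> \<le> d^2"
proof -
  let ?S = "{-\<bar>d\<bar>..\<bar>d\<bar>}"
  have 1: "\<bar>u' (x + s) - u' x\<bar> \<le> \<bar>s\<bar>" for s
  proof -
    have "norm (u' (x + s) - u' x) \<le> 1 * norm (x + s - x)"
      by (rule field_differentiable_bound[where S = UNIV and f' = "\<lambda>t. - u t"]) (use D(2) B in auto)
    then show ?thesis by simp
  qed
  have "norm ((u (x + d) - d * u' x) - (u (x + 0) - 0 * u' x)) \<le> \<bar>d\<bar> * norm (d - 0)"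
  proof (rule field_differentiable_bound[where S = ?S and f' = "\<lambda>s. u' (x + s) - u' x" and f = "\<lambda>s. u (x + s) - s * u' x"])
    show "((\<lambda>s. u (x + s) - s * u' x) has_field_derivative u' (x + s) - u' x) (at s within ?S)" for s
      by (rule has_field_derivative_at_within)
        (auto intro!: derivative_eq_intros DERIV_chain2[where f = u and g = "\<lambda>s. x + s", OF D(1)])
      show "norm (u' (x + s) - u' x) \<le> \<bar>d\<bar>" if "s \<in> ?S" for s
      using 1[of s] that by auto
  qed auto
  then show ?thesis by (simp add: power2_eq_square algebra_simps flip: abs_mult)
qed

text \<open>For the characteristic function $f$ of a quadratic form, integration by parts gives $f' = - v t f$ up to a small error; multiplying with $e^{v t^2 / 2}$ integrates this.\<close>
lemma gauss_ode_bound: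
  fixes f f' :: "real \<Rightarrow> real"
  assumes D: "\<And>t. (f has_real_derivative f' t) (at t)"
    and B: "\<And>t. \<bar>f' t + t * v * f t\<bar> \<le> \<bar>t\<bar> * R" and v: "0 \<le> v" and R: "0 \<le> R"
  shows "\<bar>f t - f 0 * exp (- (v * t^2 / 2))\<bar> \<le> t^2 * R"
proof -
  let ?S = "{-\<bar>t\<bar>..\<bar>t\<bar>}" and ?e = "\<lambda>s. exp (v * s^2 / 2)"
  have "norm (?e t * f t - ?e 0 * f 0) \<le> ?e t * (\<bar>t\<bar> * R) * norm (t - 0)"
  proof (rule field_differentiable_bound[where S = ?S and f' = "\<lambda>s. ?e s * (f' s + s * v * f s)" and f = "\<lambda>s. ?e s * f s"])
    show "((\<lambda>s. ?e s * f s) has_field_derivative ?e s * (f' s + s * v * f s)) (at s within ?S)" for s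
      by (rule has_field_derivative_at_within)
        (auto intro!: derivative_eq_intros D simp: algebra_simps)
    show "norm (?e s * (f' s + s * v * f s)) \<le> ?e t * (\<bar>t\<bar> * R)" if "s \<in> ?S" for s
    proof -
      have st: "\<bar>s\<bar> \<le> \<bar>t\<bar>" using that by auto
      have "?e s \<le> ?e t" using v st by (auto intro!: mult_left_mono simp: abs_le_square_iff)
      moreover have "\<bar>f' s + s * v * f s\<bar> \<le> \<bar>t\<bar> * R"
        by (rule order_trans[OF B mult_right_mono[OF st R]])
      ultimately show ?thesis by (simp add: abs_mult mult_mono)
    qed
  qed auto
  then have a: "\<bar>?e t * f t - f 0\<bar> \<le> ?e t * (t^2 * R)" by (simp add: power2_eq_square mult_ac flip: abs_mult)
  have "\<bar>f t - f 0 * exp (- (v * t^2 / 2))\<bar> = \<bar>exp (- (v * t^2 / 2)) * (?e t * f t - f 0)\<bar>"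
    by (simp add: exp_minus field_simps)
  also have "\<dots> \<le> exp (- (v * t^2 / 2)) * (?e t * (t^2 * R))" unfolding abs_mult by (intro mult_mono a) auto
  also have "\<dots> = t^2 * R" by (simp add: exp_minus field_simps)
  finally show ?thesis .
qed

lemma frob_sq_nonneg: "0 \<le> frob_sq I A"
  unfolding frob_sq_def by (intro sum_nonneg) auto

lemma mat_sq_sym:
  assumes "sym_mat A" shows "sym_mat (mat_sq I A)"
  unfolding mat_sq_def sym_mat_def
  by (intro allI sum.cong refl) (metis sym_matD[OF assms] mult.commute)

text \<open>Cauchy-Schwarz in the inner index, with symmetry identifying column sums and row sums.
  It replaces the norm of \<open>A^2\<close> in the fourth moment by the square of the norm of
  \<open>A\<close>.\<close>

lemma frob_sq_mat_sq_le:
  assumes "sym_mat A"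
  shows "frob_sq I (mat_sq I A) \<le> (frob_sq I A)^2"
proof -
  define a where "a i = (\<Sum>l\<in>I. (A i l)^2)" for i
  have col: "(\<Sum>l\<in>I. (A l j)^2) = a j" for j
    unfolding a_def by (intro sum.cong refl) (simp add: sym_matD[OF assms, of _ j])
  have "frob_sq I (mat_sq I A) \<le> (\<Sum>i\<in>I. \<Sum>j\<in>I. (\<Sum>l\<in>I. (A i l)^2) * (\<Sum>l\<in>I. (A l j)^2))"
    unfolding frob_sq_def mat_sq_def by (intro sum_mono Cauchy_Schwarz_ineq_sum)
  also have "\<dots> = (\<Sum>i\<in>I. a i) * (\<Sum>j\<in>I. a j)"
    by (simp add: sum_product col flip: a_def)
  finally show ?thesis by (simp only: frob_sq_def power2_eq_square[of "sum _ _"] a_def)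
qed

context
  fixes I :: "'i set" and A :: "'i \<Rightarrow> 'i \<Rightarrow> real"
  assumes fin: "finite I" and sym: "sym_mat A"
begin

interpretation P: prob_space "gauss_measure I" by (rule prob_space_gauss_measure)

text \<open>For symmetric \<open>A\<close> the squared length of \<open>A x\<close> is the form of
  \<open>A^2\<close>, whose trace is the squared Frobenius norm. So integration by parts leads back
  to a centred quadratic form plus a constant, and the recursion closes.\<close>

lemma norm_sq_form_eq: "norm_sq_form I A x = quad_form I (mat_sq I A) x + frob_sq I A"
proof -
  have "A i l * A l i = (A i l)^2" for i l
    using sym_matD[OF sym, of l i] by (simp add: power2_eq_square)
  then have tr: "(\<Sum>i\<in>I. mat_sq I A i i) = frob_sq I A"
    by (simp add: mat_sq_def frob_sq_def)
  have "norm_sq_form I A x = (\<Sum>l\<in>I. \<Sum>i\<in>I. \<Sum>j\<in>I. x i * x j * (A i l * A l j))"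
    unfolding norm_sq_form_def lin_form_def power2_eq_square sum_product
    proof (intro sum.cong refl)
    fix l i j
    show "A l i * x i * (A l j * x j) = x i * x j * (A i l * A l j)"
      using sym_matD[OF sym, of l i] by simp
  qed
  also have "\<dots> = (\<Sum>i\<in>I. \<Sum>j\<in>I. \<Sum>l\<in>I. x i * x j * (A i l * A l j))"
    by (subst sum.swap, intro sum.cong refl sum.swap)
  also have "\<dots> = (\<Sum>i\<in>I. x i * lin_form I (mat_sq I A) x i)"
    unfolding lin_form_def mat_sq_def by (simp add: sum_distrib_left sum_distrib_right mult_ac)
  finally show ?thesis
    by (simp add: quad_form_def sum_subtractf tr)
qed

lemma integral_quad_form: "(\<integral>x. quad_form I A x \<partial>gauss_measure I) = 0"
  using quad_form_ibp[OF fin sym, of "\<lambda>_. 1" "\<lambda>_. 0" 1] by simp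

lemma integrable_quad_form_pow:
  assumes "k \<le> 4" shows "integrable (gauss_measure I) (\<lambda>x. quad_form I A x ^ k)"
proof -
  obtain c where c: "\<And>x. \<bar>quad_form I A x\<bar> \<le> c * poly_weight I x ^ 2" using quad_form_bound[OF fin sym] by blast
  show ?thesis
  proof (rule integrable_gauss_poly_bound[OF fin, of _ "c ^ k" "2 * k"])
    show "norm (quad_form I A x ^ k) \<le> c ^ k * poly_weight I x ^ (2 * k)" for x
      using power_mono[OF c[of x], of k] by (simp add: power_abs power_mult_distrib power_mult)
  qed measurable
qed

end

context
  fixes I :: "'i set" and A :: "'i \<Rightarrow> 'i \<Rightarrow> real"
  assumes fin: "finite I" and sym: "sym_mat A"
begin

interpretation P: prob_space "gauss_measure I" by (rule prob_space_gauss_measure)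

lemma integral_norm_sq_form: "(\<integral>x. norm_sq_form I A x \<partial>gauss_measure I) = frob_sq I A"
proof -
  have "integrable (gauss_measure I) (quad_form I (mat_sq I A))"
    using integrable_quad_form_pow[OF fin mat_sq_sym[OF sym, of I], of 1] by simp
  then show ?thesis
    using integral_quad_form[OF fin mat_sq_sym[OF sym, of I]]
    by (simp add: norm_sq_form_eq[OF fin sym] P.prob_space)
qed

lemma integral_quad_form_sq: "(\<integral>x. (quad_form I A x)\<^sup>2 \<partial>gauss_measure I) = 2 * frob_sq I A"
proof -
  have "\<bar>t\<bar> \<le> 1 * (1 + \<bar>t\<bar>) ^ 3" "\<bar>1\<bar> \<le> 1 * (1 + \<bar>t\<bar>) ^ 3" for t :: real
    using power_increasing[of 1 3 "1 + \<bar>t\<bar>"] by simp_all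
  then show ?thesis
    using quad_form_ibp[OF fin sym, of "\<lambda>t. t" "\<lambda>_. 1" 1] integral_norm_sq_form
    by (simp add: power2_eq_square)
qed

end

context
  fixes I :: "'i set" and A :: "'i \<Rightarrow> 'i \<Rightarrow> real"
  assumes fin: "finite I" and sym: "sym_mat A"
begin

interpretation P: prob_space "gauss_measure I" by (rule prob_space_gauss_measure)

text \<open>Integration by parts with the cube leaves the mixed moment of \<open>Q^2\<close> and the
  form \<open>R\<close> of \<open>A^2\<close>. The inequality
  \<open>3 R Q^2 <= 9 R^2 + Q^4 / 4\<close> lets half of the fourth moment be absorbed on the left;
  the rest is at most \<open>2 * (36 + 12)\<close> times the squared Frobenius norm squared.\<close>

lemma integral_quad_form_pow4: "(\<integral>x. (quad_form I A x) ^ 4 \<partial>gauss_measure I) \<le> 96 * (frob_sq I A)^2"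
proof -
  let ?Q = "quad_form I A" and ?R = "quad_form I (mat_sq I A)" and ?E = "integral\<^sup>L (gauss_measure I)"
  note iQ = integrable_quad_form_pow[OF fin sym]
  note iR = integrable_quad_form_pow[OF fin mat_sq_sym[OF sym, of I]]
  have b: "\<bar>t ^ 3\<bar> \<le> 3 * (1 + \<bar>t\<bar>) ^ 3" "\<bar>3 * t^2\<bar> \<le> 3 * (1 + \<bar>t\<bar>) ^ 3" for t :: real
  proof -
    have "\<bar>t\<bar> ^ 3 \<le> (1 + \<bar>t\<bar>) ^ 3" "0 \<le> (1 + \<bar>t\<bar>) ^ 3" by (auto intro!: power_mono)
    then show "\<bar>t ^ 3\<bar> \<le> 3 * (1 + \<bar>t\<bar>) ^ 3" unfolding power_abs by linarith
    have "\<bar>t\<bar> ^ 2 \<le> (1 + \<bar>t\<bar>) ^ 2" "(1 + \<bar>t\<bar>) ^ 2 \<le> (1 + \<bar>t\<bar>) ^ 3"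
      by (rule power_mono power_increasing; simp)+
    then show "\<bar>3 * t^2\<bar> \<le> 3 * (1 + \<bar>t\<bar>) ^ 3" by simp
  qed
  have D: "((\<lambda>t. t ^ 3) has_real_derivative 3 * t^2) (at t)" for t :: real
    by (auto intro!: derivative_eq_intros)
  have "?E (\<lambda>x. ?Q x ^ 4) = 2 * ?E (\<lambda>x. norm_sq_form I A x * (3 * (?Q x)^2))"
    using quad_form_ibp[OF fin sym D _ b] by (simp add: continuous_intros numeral_eq_Suc)
  also have "\<dots> \<le> 2 * ?E (\<lambda>x. 9 * (?R x)^2 + ?Q x ^ 4 / 4 + 3 * frob_sq I A * (?Q x)^2)"
  proof (intro mult_left_mono integral_mono)
    show "integrable (gauss_measure I) (\<lambda>x. norm_sq_form I A x * (3 * (?Q x)^2))"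
      by (rule integrable_psi_quad_form[OF fin sym _ b(2)]) simp
    show "integrable (gauss_measure I) (\<lambda>x. 9 * (?R x)^2 + ?Q x ^ 4 / 4 + 3 * frob_sq I A * (?Q x)^2)"
      using iQ[of 2] iQ[of 4] iR[of 2] by simp
    show "norm_sq_form I A x * (3 * (?Q x)^2) \<le> 9 * (?R x)^2 + ?Q x ^ 4 / 4 + 3 * frob_sq I A * (?Q x)^2" for x
    proof -
      have "0 \<le> (3 * ?R x - (?Q x)\<^sup>2 / 2)^2" by simp
      then show ?thesis
        by (simp add: norm_sq_form_eq[OF fin sym] power2_diff algebra_simps power_divide power_mult_distrib flip: power_mult)
    qed
  qed simp
  also have "\<dots> = 36 * frob_sq I (mat_sq I A) + ?E (\<lambda>x. ?Q x ^ 4) / 2 + 12 * (frob_sq I A)^2"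
    using iQ[of 2] iQ[of 4] iR[of 2] integral_quad_form_sq[OF fin sym] integral_quad_form_sq[OF fin mat_sq_sym[OF sym, of I]]
    by (simp add: power2_eq_square)
  finally show ?thesis using frob_sq_mat_sq_le[of A I, OF sym] by linarith
qed

lemma abs_integral_le_sqrt:
  assumes [measurable]: "f \<in> borel_measurable (gauss_measure I)" "u \<in> borel_measurable (gauss_measure I)"
    and i: "integrable (gauss_measure I) f" "integrable (gauss_measure I) (\<lambda>x. (f x)^2)"
    and u: "\<And>x. \<bar>u x\<bar> \<le> 1"
  shows "\<bar>\<integral>x. f x * u x \<partial>gauss_measure I\<bar> \<le> sqrt (\<integral>x. (f x)\<^sup>2 \<partial>gauss_measure I)"
proof -
  have b: "\<bar>f x * u x\<bar> \<le> \<bar>f x\<bar>" for x using u[of x] by (simp add: abs_mult mult_left_le)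
  have i': "integrable (gauss_measure I) (\<lambda>x. f x * u x)"
    by (rule Bochner_Integration.integrable_bound[OF i(1)]) (use b in auto)
  have "\<bar>\<integral>x. f x * u x \<partial>gauss_measure I\<bar> \<le> (\<integral>x. \<bar>f x * u x\<bar> \<partial>gauss_measure I)"
    by (rule integral_abs_bound)
  also have "\<dots> \<le> (\<integral>x. \<bar>f x\<bar> \<partial>gauss_measure I)"
    by (intro integral_mono integrable_abs i i' b)
  also have "\<dots> \<le> sqrt (\<integral>x. (f x)\<^sup>2 \<partial>gauss_measure I)"
  proof (rule real_le_rsqrt)
    have "0 \<le> (\<integral>x. \<bar>f x\<bar>\<^sup>2 \<partial>gauss_measure I) - (\<integral>x. \<bar>f x\<bar> \<partial>gauss_measure I)\<^sup>2"
      using P.variance_eq[of "\<lambda>x. \<bar>f x\<bar>"] i P.variance_positive[of "\<lambda>x. \<bar>f x\<bar>"] by simp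
    then show "(\<integral>x. \<bar>f x\<bar> \<partial>gauss_measure I)^2 \<le> (\<integral>x. (f x)\<^sup>2 \<partial>gauss_measure I)" by simp
  qed
  finally show ?thesis .
qed

text \<open>Differentiation under the integral with an explicit remainder: the difference quotient
  misses the derivative by at most \<open>\<bar>s\<bar>\<close> times the second moment. A pair
  \<open>u\<close>, \<open>u'\<close> with second derivative \<open>- u\<close> covers cosine and
  sine at once, so no complex integrals are needed.\<close>

lemma quad_form_trig_derivative:
  fixes u u' :: "real \<Rightarrow> real"
  assumes D: "\<And>t. (u has_real_derivative u' t) (at t)" "\<And>t. (u' has_real_derivative - u t) (at t)"
    and B: "\<And>t. \<bar>u t\<bar> \<le> 1" "\<And>t. \<bar>u' t\<bar> \<le> 1"
  shows "((\<lambda>t. \<integral>x. u (t * quad_form I A x) \<partial>gauss_measure I) has_real_derivative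
     (\<integral>x. quad_form I A x * u' (t * quad_form I A x) \<partial>gauss_measure I)) (at t)"
proof -
  let ?Q = "quad_form I A" and ?E = "integral\<^sup>L (gauss_measure I)"
  have [measurable]: "u \<in> borel_measurable borel" "u' \<in> borel_measurable borel"
    using D by (auto intro!: borel_measurable_continuous_onI continuous_at_imp_continuous_on DERIV_isCont)
  have iQ: "integrable (gauss_measure I) ?Q" "integrable (gauss_measure I) (\<lambda>x. (?Q x)^2)"
    using integrable_quad_form_pow[OF fin sym, of 1] integrable_quad_form_pow[OF fin sym, of 2] by auto
  have iu: "integrable (gauss_measure I) (\<lambda>x. u (t * ?Q x))" for t
    by (rule P.integrable_const_bound[of _ 1]) (use B in auto)
  have iu': "integrable (gauss_measure I) (\<lambda>x. ?Q x * u' (t * ?Q x))" for t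
    by (rule Bochner_Integration.integrable_bound[OF iQ(1)]) (use B in \<open>auto simp: abs_mult mult_left_le\<close>)
  let ?f = "\<lambda>t. ?E (\<lambda>x. u (t * ?Q x))" and ?D = "?E (\<lambda>x. ?Q x * u' (t * ?Q x))"
  have "\<bar>?f (t + s) - ?f t - s * ?D\<bar> \<le> s^2 * ?E (\<lambda>x. (?Q x)^2)" for s
  proof -
    have iu2: "integrable (gauss_measure I) (\<lambda>x. u (t * ?Q x + s * ?Q x))"
      using iu[of "t + s"] by (simp add: distrib_right)
    have iu3: "integrable (gauss_measure I) (\<lambda>x. s * ?Q x * u' (t * ?Q x))"
      using integrable_mult_right[OF iu'[of t], of s] by (simp add: mult.assoc)
    have iu4: "integrable (gauss_measure I) (\<lambda>x. (s * ?Q x)^2)"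
      using integrable_mult_right[OF iQ(2), of "s^2"] by (simp add: power_mult_distrib)
    have tt: "\<bar>u (t * ?Q x + s * ?Q x) - u (t * ?Q x) - s * ?Q x * u' (t * ?Q x)\<bar> \<le> (s * ?Q x)^2" for x
      by (rule trig_taylor2[OF D B(1)])
    have "\<bar>?f (t + s) - ?f t - s * ?D\<bar> = \<bar>?E (\<lambda>x. u (t * ?Q x + s * ?Q x) - u (t * ?Q x) - s * ?Q x * u' (t * ?Q x))\<bar>"
      using iu[of t] iu2 iu3 by (simp add: distrib_right mult.assoc)
    also have "\<dots> \<le> ?E (\<lambda>x. \<bar>u (t * ?Q x + s * ?Q x) - u (t * ?Q x) - s * ?Q x * u' (t * ?Q x)\<bar>)"
      by (rule integral_abs_bound)
    also have "\<dots> \<le> ?E (\<lambda>x. (s * ?Q x)^2)"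
    proof (rule integral_mono[OF _ iu4 tt])
      show "integrable (gauss_measure I) (\<lambda>x. \<bar>u (t * ?Q x + s * ?Q x) - u (t * ?Q x) - s * ?Q x * u' (t * ?Q x)\<bar>)"
        by (rule integrable_abs, rule Bochner_Integration.integrable_diff[OF Bochner_Integration.integrable_diff[OF iu2 iu] iu3])
    qed
    finally show ?thesis by (simp add: power_mult_distrib)
  qed
  then have b: "\<bar>(?f (t + s) - ?f t) / s - ?D\<bar> \<le> \<bar>s\<bar> * ?E (\<lambda>x. (?Q x)^2)" if "s \<noteq> 0" for s
  proof -
    have "\<bar>(?f (t + s) - ?f t) / s - ?D\<bar> = \<bar>?f (t + s) - ?f t - s * ?D\<bar> / \<bar>s\<bar>"
      using that by (simp add: field_simps flip: abs_divide)
    also have "\<dots> \<le> s^2 * ?E (\<lambda>x. (?Q x)^2) / \<bar>s\<bar>"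
      by (intro divide_right_mono) (use \<open>\<bar>?f (t + s) - ?f t - s * ?D\<bar> \<le> _\<close> in auto)
    also have "\<dots> = \<bar>s\<bar> * ?E (\<lambda>x. (?Q x)^2)" using that by (simp add: power2_eq_square field_simps abs_if)
    finally show ?thesis .
  qed
  show ?thesis
    unfolding DERIV_def
  proof (rule LIM_zero_cancel)
    have l: "((\<lambda>s. \<bar>s\<bar> * ?E (\<lambda>x. (?Q x)^2)) \<longlongrightarrow> 0) (at 0)"
      by (rule tendsto_eq_intros refl | simp)+
    show "((\<lambda>s. (?f (t + s) - ?f t) / s - ?D) \<longlongrightarrow> 0) (at 0)"
      by (rule Lim_null_comparison[OF _ l])
         (use b in \<open>auto simp: eventually_at intro!: exI[of _ 1]\<close>)
  qed
qed

text \<open>Taking $u$ to be cosine and sine gives the real and imaginary part of the characteristic function.\<close>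
lemma quad_form_trig_normal_approx:
  fixes u u' :: "real \<Rightarrow> real"
  assumes D: "\<And>t. (u has_real_derivative u' t) (at t)" "\<And>t. (u' has_real_derivative - u t) (at t)"
    and B: "\<And>t. \<bar>u t\<bar> \<le> 1" "\<And>t. \<bar>u' t\<bar> \<le> 1"
  shows "\<bar>(\<integral>x. u (t * quad_form I A x) \<partial>gauss_measure I) - u 0 * exp (- (2 * frob_sq I A * t^2 / 2))\<bar>
    \<le> t^2 * (2 * sqrt (2 * frob_sq I (mat_sq I A)))"
proof -
  let ?Q = "quad_form I A" and ?R = "quad_form I (mat_sq I A)" and ?E = "integral\<^sup>L (gauss_measure I)"
  have cont: "continuous_on UNIV u" "continuous_on UNIV u'"
    using D by (auto intro!: continuous_at_imp_continuous_on DERIV_isCont)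
  then have [measurable]: "u \<in> borel_measurable borel" "u' \<in> borel_measurable borel"
    by (auto intro!: borel_measurable_continuous_onI)
  let ?f = "\<lambda>t. ?E (\<lambda>x. u (t * ?Q x))" and ?f' = "\<lambda>t. ?E (\<lambda>x. ?Q x * u' (t * ?Q x))"
  have iR: "integrable (gauss_measure I) ?R" "integrable (gauss_measure I) (\<lambda>x. (?R x)^2)"
    using integrable_quad_form_pow[OF fin mat_sq_sym[OF sym, of I], of 1] integrable_quad_form_pow[OF fin mat_sq_sym[OF sym, of I], of 2] by auto
  have iu: "integrable (gauss_measure I) (\<lambda>x. u (t * ?Q x))" for t
    by (rule P.integrable_const_bound[of _ 1]) (use B in auto)
  have iRu: "integrable (gauss_measure I) (\<lambda>x. ?R x * u (t * ?Q x))" for t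
    by (rule Bochner_Integration.integrable_bound[OF iR(1)]) (use B in \<open>auto simp: abs_mult mult_left_le\<close>)
  have d: "\<bar>?f' t + t * (2 * frob_sq I A) * ?f t\<bar> \<le> \<bar>t\<bar> * (2 * sqrt (2 * frob_sq I (mat_sq I A)))" for t
  proof -
    have "?f' t = 2 * ?E (\<lambda>x. norm_sq_form I A x * (- (t * u (t * ?Q x))))"
    proof (rule quad_form_ibp[OF fin sym, where C = "1 + \<bar>t\<bar>"])
      fix s
      show "((\<lambda>s. u' (t * s)) has_real_derivative - (t * u (t * s))) (at s)"
        by (rule DERIV_cong[OF DERIV_chain2[where f = u' and g = "(*) t", OF D(2) DERIV_cmult_Id]]) simp
      have 1: "1 \<le> (1 + \<bar>s\<bar>) ^ 3" by (rule one_le_power) simp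
      have "1 * 1 \<le> (1 + \<bar>t\<bar>) * (1 + \<bar>s\<bar>) ^ 3" by (intro mult_mono 1) auto
      then show "\<bar>u' (t * s)\<bar> \<le> (1 + \<bar>t\<bar>) * (1 + \<bar>s\<bar>) ^ 3" using B(2)[of "t * s"] by simp
      have "\<bar>t\<bar> * \<bar>u (t * s)\<bar> \<le> (1 + \<bar>t\<bar>) * (1 + \<bar>s\<bar>) ^ 3"
        by (intro mult_mono order_trans[OF B(1) 1]) auto
      then show "\<bar>- (t * u (t * s))\<bar> \<le> (1 + \<bar>t\<bar>) * (1 + \<bar>s\<bar>) ^ 3" by (simp add: abs_mult)
    next
      show "continuous_on UNIV (\<lambda>s. - (t * u (t * s)))"
        by (intro continuous_intros continuous_on_compose2[OF cont(1)]) auto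
    qed
    \<comment> \<open>Splitting \<open>norm_sq_form\<close> into its mean and a centred form
      separates the drift, a multiple of \<open>t * ?f t\<close>, from an error governed by the
      standard deviation of the form of \<open>A^2\<close>.\<close>
    also have "\<dots> = - 2 * t * (?E (\<lambda>x. ?R x * u (t * ?Q x)) + frob_sq I A * ?f t)"
      using iu[of t] iRu[of t] by (simp add: norm_sq_form_eq[OF fin sym] algebra_simps)
    finally have "?f' t + t * (2 * frob_sq I A) * ?f t = - 2 * t * ?E (\<lambda>x. ?R x * u (t * ?Q x))"
      by (simp add: algebra_simps)
    moreover have "\<bar>?E (\<lambda>x. ?R x * u (t * ?Q x))\<bar> \<le> sqrt (?E (\<lambda>x. (?R x)^2))"
      by (rule abs_integral_le_sqrt[OF _ _ iR]) (use B in auto)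
    ultimately show ?thesis
      using integral_quad_form_sq[OF fin mat_sq_sym[OF sym, of I]] by (simp add: abs_mult mult_left_mono)
  qed
  have "\<bar>?f t - ?f 0 * exp (- (2 * frob_sq I A * t^2 / 2))\<bar> \<le> t^2 * (2 * sqrt (2 * frob_sq I (mat_sq I A)))"
    by (rule gauss_ode_bound[OF quad_form_trig_derivative[OF D B] d])
       (auto simp: frob_sq_nonneg)
  then show ?thesis by (simp add: P.prob_space)
qed

end

section \<open>Gaussian arrays and their second chaos\<close>

text \<open>The index type of the independent normals $Z$ is fixed to a sum type so that Brownian increments and noise variables can be listed side by side.\<close>
definition (in prob_space) gaussian_array :: "'p set \<Rightarrow> ('p \<Rightarrow> 'a \<Rightarrow> real) \<Rightarrow> ('p \<Rightarrow> 'p \<Rightarrow> real) \<Rightarrow> bool" where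
  "gaussian_array P y C \<longleftrightarrow> finite P \<and> (\<exists>(I::(nat + nat) set) Z a. finite I \<and> I \<noteq> {} \<and>
     indep_vars (\<lambda>_. borel) Z I \<and> (\<forall>i\<in>I. distributed M lborel (Z i) std_normal_density) \<and>
     (\<forall>p\<in>P. \<forall>\<omega>\<in>space M. y p \<omega> = (\<Sum>i\<in>I. a p i * Z i \<omega>)) \<and>
     (\<forall>p\<in>P. \<forall>q\<in>P. C p q = (\<Sum>i\<in>I. a p i * a q i)))"

text \<open>The coefficients $c$ weight centred squares, so the matrix of the quadratic form in the variables $Z$ is a weighted Gram matrix; all moments depend on the covariances $C$ only.\<close>
definition chaos2 :: "'p set \<Rightarrow> ('p \<Rightarrow> 'a \<Rightarrow> real) \<Rightarrow> ('p \<Rightarrow> 'p \<Rightarrow> real) \<Rightarrow> ('p \<Rightarrow> real) \<Rightarrow> 'a \<Rightarrow> real" where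
  "chaos2 P y C c \<omega> = (\<Sum>p\<in>P. c p * ((y p \<omega>)^2 - C p p))"

text \<open>With \<open>D\<close> the diagonal matrix of \<open>c\<close>, this is the trace of
  \<open>(D C)^2\<close> and the next expression the trace of \<open>(D C)^4\<close>. By cyclicity
  of the trace they are the squared Frobenius norms of the Gram matrix and of its square.\<close>

definition chaos2_frob :: "'p set \<Rightarrow> ('p \<Rightarrow> 'p \<Rightarrow> real) \<Rightarrow> ('p \<Rightarrow> real) \<Rightarrow> real" where
  "chaos2_frob P C c = (\<Sum>p\<in>P. \<Sum>q\<in>P. c p * c q * (C p q)^2)"

definition chaos2_frob4 :: "'p set \<Rightarrow> ('p \<Rightarrow> 'p \<Rightarrow> real) \<Rightarrow> ('p \<Rightarrow> real) \<Rightarrow> real" where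
  "chaos2_frob4 P C c = (\<Sum>p\<in>P. \<Sum>r\<in>P. c p * c r * (\<Sum>q\<in>P. c q * C p q * C q r)^2)"

lemma sum_swap4:
  "(\<Sum>i\<in>I. \<Sum>j\<in>J. \<Sum>p\<in>P. \<Sum>q\<in>Q. f i j p q) = (\<Sum>p\<in>P. \<Sum>q\<in>Q. \<Sum>i\<in>I. \<Sum>j\<in>J. f i j p q)"
proof -
  have "(\<Sum>i\<in>I. \<Sum>j\<in>J. \<Sum>p\<in>P. \<Sum>q\<in>Q. f i j p q) = (\<Sum>i\<in>I. \<Sum>p\<in>P. \<Sum>q\<in>Q. \<Sum>j\<in>J. f i j p q)"
    by (intro sum.cong refl, subst sum.swap, intro sum.cong refl sum.swap)
  also have "\<dots> = (\<Sum>p\<in>P. \<Sum>q\<in>Q. \<Sum>i\<in>I. \<Sum>j\<in>J. f i j p q)"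
    by (subst sum.swap, intro sum.cong refl sum.swap)
  finally show ?thesis .
qed

section \<open>Weighted Gram matrices: traces in terms of the covariances\<close>

definition gram_mat :: "'p set \<Rightarrow> ('p \<Rightarrow> 'i \<Rightarrow> real) \<Rightarrow> ('p \<Rightarrow> real) \<Rightarrow> 'i \<Rightarrow> 'i \<Rightarrow> real" where
  "gram_mat P a c i j = (\<Sum>p\<in>P. c p * a p i * a p j)"

lemma sym_gram_mat: "sym_mat (gram_mat P a c)"
  by (simp add: sym_mat_def gram_mat_def mult_ac)

context
  fixes I :: "'i set" and P :: "'p set" and a :: "'p \<Rightarrow> 'i \<Rightarrow> real" and C :: "'p \<Rightarrow> 'p \<Rightarrow> real" and c :: "'p \<Rightarrow> real"
  assumes C: "\<And>p q. p \<in> P \<Longrightarrow> q \<in> P \<Longrightarrow> C p q = (\<Sum>i\<in>I. a p i * a q i)"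
begin

lemma mat_sq_gram: "mat_sq I (gram_mat P a c) i j = (\<Sum>p\<in>P. \<Sum>q\<in>P. c p * c q * C p q * (a p i * a q j))"
proof -
  have "mat_sq I (gram_mat P a c) i j = (\<Sum>l\<in>I. \<Sum>p\<in>P. \<Sum>q\<in>P. c p * a p i * a p l * (c q * a q l * a q j))"
    by (simp add: mat_sq_def gram_mat_def sum_product)
  also have "\<dots> = (\<Sum>p\<in>P. \<Sum>q\<in>P. \<Sum>l\<in>I. c p * a p i * a p l * (c q * a q l * a q j))"
    by (subst sum.swap, intro sum.cong refl sum.swap)
  also have "\<dots> = (\<Sum>p\<in>P. \<Sum>q\<in>P. c p * c q * C p q * (a p i * a q j))"
    by (intro sum.cong refl) (simp add: C sum_distrib_left sum_distrib_right mult_ac)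
  finally show ?thesis .
qed

text \<open>Both sides are the trace of \<open>m C m C\<close>. The middle matrix \<open>m\<close>
  is kept general because two cases are needed: \<open>m\<close> diagonal for the Gram matrix, and
  \<open>m p q = c p * c q * C p q\<close> for its square.\<close>

lemma frob_sq_gram_general:
  "frob_sq I (\<lambda>i j. \<Sum>p\<in>P. \<Sum>q\<in>P. m p q * (a p i * a q j)) =
    (\<Sum>p\<in>P. \<Sum>r\<in>P. (\<Sum>q\<in>P. m p q * C q r) * (\<Sum>q\<in>P. m r q * C q p))" if m: "\<And>p q. m p q = m q p"
proof -
  have "frob_sq I (\<lambda>i j. \<Sum>p\<in>P. \<Sum>q\<in>P. m p q * (a p i * a q j)) =
    (\<Sum>i\<in>I. \<Sum>j\<in>I. \<Sum>p\<in>P. \<Sum>r\<in>P. (\<Sum>q\<in>P. m p q * (a p i * a q j)) * (\<Sum>s\<in>P. m r s * (a r i * a s j)))"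
    by (simp add: frob_sq_def power2_eq_square sum_product)
  also have "\<dots> = (\<Sum>p\<in>P. \<Sum>r\<in>P. \<Sum>i\<in>I. \<Sum>j\<in>I. \<Sum>q\<in>P. \<Sum>s\<in>P. m p q * m r s * (a p i * a r i) * (a q j * a s j))"
    by (subst sum_swap4) (intro sum.cong refl, simp add: sum_product mult_ac)
  also have "\<dots> = (\<Sum>p\<in>P. \<Sum>r\<in>P. \<Sum>q\<in>P. \<Sum>s\<in>P. m p q * m r s * C p r * C q s)"
  proof (rule sum.cong[OF refl], rule sum.cong[OF refl])
    fix p r assume pr: "p \<in> P" "r \<in> P"
    have "(\<Sum>i\<in>I. \<Sum>j\<in>I. \<Sum>q\<in>P. \<Sum>s\<in>P. m p q * m r s * (a p i * a r i) * (a q j * a s j)) =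
      (\<Sum>q\<in>P. \<Sum>s\<in>P. m p q * m r s * (\<Sum>i\<in>I. \<Sum>j\<in>I. (a p i * a r i) * (a q j * a s j)))"
      by (subst sum_swap4) (simp add: sum_distrib_left mult_ac)
    also have "\<dots> = (\<Sum>q\<in>P. \<Sum>s\<in>P. m p q * m r s * C p r * C q s)"
      by (intro sum.cong refl) (simp add: C pr sum_product)
    finally show "(\<Sum>i\<in>I. \<Sum>j\<in>I. \<Sum>q\<in>P. \<Sum>s\<in>P. m p q * m r s * (a p i * a r i) * (a q j * a s j)) =
      (\<Sum>q\<in>P. \<Sum>s\<in>P. m p q * m r s * C p r * C q s)" .
  qed
  also have "\<dots> = (\<Sum>p\<in>P. \<Sum>s\<in>P. \<Sum>q\<in>P. \<Sum>r\<in>P. m p q * m r s * C p r * C q s)"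
  proof (rule sum.cong[OF refl])
    fix p
    have "(\<Sum>r\<in>P. \<Sum>q\<in>P. \<Sum>s\<in>P. m p q * m r s * C p r * C q s) = (\<Sum>r\<in>P. \<Sum>s\<in>P. \<Sum>q\<in>P. m p q * m r s * C p r * C q s)"
      by (intro sum.cong refl sum.swap)
    also have "\<dots> = (\<Sum>s\<in>P. \<Sum>r\<in>P. \<Sum>q\<in>P. m p q * m r s * C p r * C q s)" by (rule sum.swap)
    also have "\<dots> = (\<Sum>s\<in>P. \<Sum>q\<in>P. \<Sum>r\<in>P. m p q * m r s * C p r * C q s)" by (intro sum.cong refl sum.swap)
    finally show "(\<Sum>r\<in>P. \<Sum>q\<in>P. \<Sum>s\<in>P. m p q * m r s * C p r * C q s) = (\<Sum>s\<in>P. \<Sum>q\<in>P. \<Sum>r\<in>P. m p q * m r s * C p r * C q s)" .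
  qed
  also have "\<dots> = (\<Sum>p\<in>P. \<Sum>s\<in>P. (\<Sum>q\<in>P. m p q * C q s) * (\<Sum>r\<in>P. m s r * C r p))"
  proof (intro sum.cong refl)
    fix p s assume "p \<in> P" "s \<in> P"
    then have "m p q * m r s * C p r * C q s = m p q * C q s * (m s r * C r p)" if "r \<in> P" for q r
      using that m[of r s] by (simp add: C[of r p] C[of p r] mult_ac)
    then show "(\<Sum>q\<in>P. \<Sum>r\<in>P. m p q * m r s * C p r * C q s) = (\<Sum>q\<in>P. m p q * C q s) * (\<Sum>r\<in>P. m s r * C r p)"
      unfolding sum_product by (intro sum.cong refl) simp
  qed
  finally show ?thesis .
qed

lemma gram_sym: "p \<in> P \<Longrightarrow> q \<in> P \<Longrightarrow> C p q = C q p"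
  by (simp add: C mult.commute)

lemma frob_sq_gram: assumes "finite P" shows "frob_sq I (gram_mat P a c) = chaos2_frob P C c"
proof -
  let ?m = "\<lambda>p q. if p = q then c p else 0"
  have 1: "(\<Sum>q\<in>P. ?m p q * x q) = c p * x p" if "p \<in> P" for p x
    using that assms by (simp add: if_distrib[where f = "\<lambda>c. c * _"] cong: if_cong)
  have "(gram_mat P a c) = (\<lambda>i j. \<Sum>p\<in>P. \<Sum>q\<in>P. ?m p q * (a p i * a q j))"
    unfolding gram_mat_def by (intro ext sum.cong refl) (simp only: 1 mult.assoc)
  then have "frob_sq I (gram_mat P a c) = frob_sq I (\<lambda>i j. \<Sum>p\<in>P. \<Sum>q\<in>P. ?m p q * (a p i * a q j))" by simp
  also have "\<dots> = (\<Sum>p\<in>P. \<Sum>r\<in>P. (\<Sum>q\<in>P. ?m p q * C q r) * (\<Sum>q\<in>P. ?m r q * C q p))"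
    by (rule frob_sq_gram_general) auto
  also have "\<dots> = chaos2_frob P C c"
    unfolding chaos2_frob_def
    by (intro sum.cong refl, simp only: 1) (simp add: power2_eq_square gram_sym mult_ac)
  finally show ?thesis .
qed

lemma frob_sq_mat_sq_gram: "frob_sq I (mat_sq I (gram_mat P a c)) = chaos2_frob4 P C c"
proof -
  \<comment> \<open>Membership in \<open>P\<close> is built into the coefficient because
    \<open>C\<close> is known to be symmetric on \<open>P\<close> only, while the general identity
    asks for a middle matrix symmetric at all indices.\<close>
  have e: "c p * c q * C p q * z = (if p \<in> P \<and> q \<in> P then c p * c q * C p q else 0) * z" if "p \<in> P" "q \<in> P" for p q z
    using that by simp
  have "mat_sq I (gram_mat P a c) = (\<lambda>i j. \<Sum>p\<in>P. \<Sum>q\<in>P. (if p \<in> P \<and> q \<in> P then c p * c q * C p q else 0) * (a p i * a q j))"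
    unfolding mat_sq_gram[abs_def] fun_eq_iff by (intro allI sum.cong refl e)
  then have "frob_sq I (mat_sq I (gram_mat P a c)) =
      (\<Sum>p\<in>P. \<Sum>r\<in>P. (\<Sum>q\<in>P. (if p \<in> P \<and> q \<in> P then c p * c q * C p q else 0) * C q r) *
        (\<Sum>q\<in>P. (if r \<in> P \<and> q \<in> P then c r * c q * C r q else 0) * C q p))"
    by (simp only:) (rule frob_sq_gram_general, auto simp: gram_sym)
  also have "\<dots> = chaos2_frob4 P C c"
    unfolding chaos2_frob4_def
  proof (intro sum.cong refl)
    fix p r assume pr: "p \<in> P" "r \<in> P"
    have "(\<Sum>q\<in>P. (if p \<in> P \<and> q \<in> P then c p * c q * C p q else 0) * C q r) = c p * (\<Sum>q\<in>P. c q * C p q * C q r)"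
      "(\<Sum>q\<in>P. (if r \<in> P \<and> q \<in> P then c r * c q * C r q else 0) * C q p) = c r * (\<Sum>q\<in>P. c q * C p q * C q r)"
      unfolding sum_distrib_left using pr
      by (auto intro!: sum.cong simp: gram_sym[of r] gram_sym[of _ p] mult_ac)
    then show "(\<Sum>q\<in>P. (if p \<in> P \<and> q \<in> P then c p * c q * C p q else 0) * C q r) *
        (\<Sum>q\<in>P. (if r \<in> P \<and> q \<in> P then c r * c q * C r q else 0) * C q p) =
      c p * c r * (\<Sum>q\<in>P. c q * C p q * C q r)^2"
      by (simp add: power2_eq_square)
  qed
  finally show ?thesis .
qed

lemma quad_form_gram:
  assumes "\<And>p. p \<in> P \<Longrightarrow> y p \<omega> = (\<Sum>i\<in>I. a p i * z i)"
  shows "quad_form I (gram_mat P a c) z = chaos2 P y C c \<omega>"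
proof -
  have "(\<Sum>i\<in>I. z i * lin_form I (gram_mat P a c) z i) = (\<Sum>i\<in>I. \<Sum>j\<in>I. \<Sum>p\<in>P. c p * ((a p i * z i) * (a p j * z j)))"
    by (simp add: lin_form_def gram_mat_def sum_distrib_left sum_distrib_right mult_ac)
  also have "\<dots> = (\<Sum>i\<in>I. \<Sum>p\<in>P. \<Sum>j\<in>I. c p * ((a p i * z i) * (a p j * z j)))"
    by (intro sum.cong refl sum.swap)
  also have "\<dots> = (\<Sum>p\<in>P. \<Sum>i\<in>I. \<Sum>j\<in>I. c p * ((a p i * z i) * (a p j * z j)))"
    by (rule sum.swap)
  also have "\<dots> = (\<Sum>p\<in>P. c p * (y p \<omega>)^2)"
    by (intro sum.cong refl) (simp only: assms power2_eq_square sum_product, simp only: sum_distrib_left)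
  finally have 1: "(\<Sum>i\<in>I. z i * lin_form I (gram_mat P a c) z i) = (\<Sum>p\<in>P. c p * (y p \<omega>)^2)" .
  have "(\<Sum>i\<in>I. (gram_mat P a c) i i) = (\<Sum>p\<in>P. c p * C p p)"
    unfolding gram_mat_def by (subst sum.swap) (simp add: C sum_distrib_left mult_ac)
  with 1 show ?thesis
    by (simp add: quad_form_def chaos2_def sum_subtractf right_diff_distrib)
qed

end

lemma (in prob_space) distr_std_normal_family:
  assumes "I \<noteq> {}" "finite I" "indep_vars (\<lambda>_. borel) Z I" "\<And>i. i \<in> I \<Longrightarrow> distributed M lborel (Z i) std_normal_density"
  shows "distr M (\<Pi>\<^sub>M i\<in>I. borel) (\<lambda>\<omega>. \<lambda>i\<in>I. Z i \<omega>) = gauss_measure I"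
proof -
  have rv: "random_variable borel (Z i)" if "i \<in> I" for i
    using assms(3) that by (auto simp: indep_vars_def)
  have "distr M (\<Pi>\<^sub>M i\<in>I. borel) (\<lambda>\<omega>. \<lambda>i\<in>I. Z i \<omega>) = (\<Pi>\<^sub>M i\<in>I. distr M borel (Z i))"
    using indep_vars_iff_distr_eq_PiM'[of I Z "\<lambda>_. borel"] assms(1,3) rv by auto
  also have "\<dots> = gauss_measure I"
    unfolding gauss_measure_def
  proof (rule PiM_cong[OF refl])
    fix i assume "i \<in> I"
    have "distr M borel (Z i) = distr M lborel (Z i)" by (intro distr_cong) auto
    then show "distr M borel (Z i) = std_normal_distribution"
      using assms(4)[OF \<open>i \<in> I\<close>] by (simp add: distributed_def)
  qed
  finally show ?thesis .
qed

text \<open>On all of \<open>space M\<close> the sum is a quadratic form with Gram matrix in the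
  independent normals, so each expectation is an integral over \<open>gauss_measure\<close>, and the
  norms of that matrix depend only on the covariances.\<close>

lemma (in prob_space) gaussian_array_chaos2:
  assumes "gaussian_array P y C"
  shows "chaos2 P y C c \<in> borel_measurable M"
    and "\<And>k. k \<le> 4 \<Longrightarrow> integrable M (\<lambda>\<omega>. chaos2 P y C c \<omega> ^ k)"
    and "expectation (\<lambda>\<omega>. (chaos2 P y C c \<omega>)^2) = 2 * chaos2_frob P C c"
    and "expectation (\<lambda>\<omega>. chaos2 P y C c \<omega> ^ 4) \<le> 96 * (chaos2_frob P C c)^2"
    and "\<And>u u' t. (\<And>t. (u has_real_derivative u' t) (at t)) \<Longrightarrow> (\<And>t. (u' has_real_derivative - u t) (at t)) \<Longrightarrow>
      (\<And>t. \<bar>u t\<bar> \<le> 1) \<Longrightarrow> (\<And>t. \<bar>u' t\<bar> \<le> 1) \<Longrightarrow>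
      \<bar>expectation (\<lambda>\<omega>. u (t * chaos2 P y C c \<omega>)) - u 0 * exp (- (2 * chaos2_frob P C c * t^2 / 2))\<bar>
        \<le> t^2 * (2 * sqrt (2 * chaos2_frob4 P C c))"
proof -
  have fP: "finite P" and ex: "\<exists>(I::(nat + nat) set) Z a. finite I \<and> I \<noteq> {} \<and>
     indep_vars (\<lambda>_. borel) Z I \<and> (\<forall>i\<in>I. distributed M lborel (Z i) std_normal_density) \<and>
     (\<forall>p\<in>P. \<forall>\<omega>\<in>space M. y p \<omega> = (\<Sum>i\<in>I. a p i * Z i \<omega>)) \<and>
     (\<forall>p\<in>P. \<forall>q\<in>P. C p q = (\<Sum>i\<in>I. a p i * a q i))"
    using assms unfolding gaussian_array_def by (rule conjunct1, rule conjunct2)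
  obtain I :: "(nat + nat) set" and Z a where B: "finite I \<and> I \<noteq> {} \<and>
     indep_vars (\<lambda>_. borel) Z I \<and> (\<forall>i\<in>I. distributed M lborel (Z i) std_normal_density) \<and>
     (\<forall>p\<in>P. \<forall>\<omega>\<in>space M. y p \<omega> = (\<Sum>i\<in>I. a p i * Z i \<omega>)) \<and>
     (\<forall>p\<in>P. \<forall>q\<in>P. C p q = (\<Sum>i\<in>I. a p i * a q i))"
    using ex by (elim exE) (rule that)
  note I = B[THEN conjunct1] B[THEN conjunct2, THEN conjunct1] B[THEN conjunct2, THEN conjunct2, THEN conjunct1]
    B[THEN conjunct2, THEN conjunct2, THEN conjunct2, THEN conjunct1, rule_format]
  note y = B[THEN conjunct2, THEN conjunct2, THEN conjunct2, THEN conjunct2, THEN conjunct1, rule_format]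
  note C = B[THEN conjunct2, THEN conjunct2, THEN conjunct2, THEN conjunct2, THEN conjunct2, rule_format]
  define A where "A = gram_mat P a c"
  have sym: "sym_mat A" unfolding A_def by (rule sym_gram_mat)
  define z where "z \<omega> = (\<lambda>i\<in>I. Z i \<omega>)" for \<omega>
  have rv: "random_variable borel (Z i)" if "i \<in> I" for i
    using I(3) that by (auto simp: indep_vars_def)
  have zm [measurable]: "z \<in> measurable M (\<Pi>\<^sub>M i\<in>I. borel)"
    unfolding z_def by (intro measurable_restrict rv)
  have dz: "distr M (\<Pi>\<^sub>M i\<in>I. borel) z = gauss_measure I"
    unfolding z_def[abs_def] by (rule distr_std_normal_family[OF I(2,1,3,4)])
  have eq: "chaos2 P y C c \<omega> = quad_form I A (z \<omega>)" if "\<omega> \<in> space M" for \<omega>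
  proof -
    have "quad_form I A (z \<omega>) = chaos2 P y C c \<omega>"
      unfolding A_def
    proof (rule quad_form_gram)
      show "C p q = (\<Sum>i\<in>I. a p i * a q i)" if "p \<in> P" "q \<in> P" for p q using that by (rule C)
      show "y p \<omega> = (\<Sum>i\<in>I. a p i * z \<omega> i)" if "p \<in> P" for p
        using y[OF that \<open>\<omega> \<in> space M\<close>] by (simp add: z_def)
    qed
    then show ?thesis by simp
  qed
  show "chaos2 P y C c \<in> borel_measurable M"
    by (subst measurable_cong[OF eq]) auto
  have E: "expectation (\<lambda>\<omega>. f (chaos2 P y C c \<omega>)) = (\<integral>x. f (quad_form I A x) \<partial>gauss_measure I)"
    and Ei: "integrable (gauss_measure I) (\<lambda>x. f (quad_form I A x)) \<Longrightarrow> integrable M (\<lambda>\<omega>. f (chaos2 P y C c \<omega>))"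
    if [measurable]: "f \<in> borel_measurable borel" for f :: "real \<Rightarrow> real"
  proof -
    have "expectation (\<lambda>\<omega>. f (chaos2 P y C c \<omega>)) = expectation (\<lambda>\<omega>. f (quad_form I A (z \<omega>)))"
      by (intro Bochner_Integration.integral_cong refl) (simp add: eq)
    also have "\<dots> = (\<integral>x. f (quad_form I A x) \<partial>distr M (\<Pi>\<^sub>M i\<in>I. borel) z)"
      by (rule integral_distr[symmetric]) measurable
    finally show "expectation (\<lambda>\<omega>. f (chaos2 P y C c \<omega>)) = (\<integral>x. f (quad_form I A x) \<partial>gauss_measure I)"
      by (simp add: dz)
    assume "integrable (gauss_measure I) (\<lambda>x. f (quad_form I A x))"
    then have "integrable M (\<lambda>\<omega>. f (quad_form I A (z \<omega>)))"
      unfolding dz[symmetric] by (subst (asm) integrable_distr_eq) measurable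
    then show "integrable M (\<lambda>\<omega>. f (chaos2 P y C c \<omega>))"
      by (subst Bochner_Integration.integrable_cong[OF refl]) (auto simp: eq)
  qed
  have fr: "frob_sq I A = chaos2_frob P C c" "frob_sq I (mat_sq I A) = chaos2_frob4 P C c"
  proof -
    show "frob_sq I A = chaos2_frob P C c" unfolding A_def by (rule frob_sq_gram) (rule C fP; assumption)+
    show "frob_sq I (mat_sq I A) = chaos2_frob4 P C c" unfolding A_def by (rule frob_sq_mat_sq_gram) (rule C; assumption)
  qed
  show "integrable M (\<lambda>\<omega>. chaos2 P y C c \<omega> ^ k)" if "k \<le> 4" for k
    by (rule Ei[of "\<lambda>x. x ^ k"]) (simp_all add: integrable_quad_form_pow[OF I(1) sym that])
  show "expectation (\<lambda>\<omega>. (chaos2 P y C c \<omega>)^2) = 2 * chaos2_frob P C c"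
    using E[of "\<lambda>x. x^2"] integral_quad_form_sq[OF I(1) sym] fr by simp
  show "expectation (\<lambda>\<omega>. chaos2 P y C c \<omega> ^ 4) \<le> 96 * (chaos2_frob P C c)^2"
    using E[of "\<lambda>x. x ^ 4"] integral_quad_form_pow4[OF I(1) sym] fr by simp
  fix u u' :: "real \<Rightarrow> real" and t
  assume D: "\<And>t. (u has_real_derivative u' t) (at t)" "\<And>t. (u' has_real_derivative - u t) (at t)"
    "\<And>t. \<bar>u t\<bar> \<le> 1" "\<And>t. \<bar>u' t\<bar> \<le> 1"
  have [measurable]: "u \<in> borel_measurable borel"
    using D by (auto intro!: borel_measurable_continuous_onI continuous_at_imp_continuous_on DERIV_isCont)
  show "\<bar>expectation (\<lambda>\<omega>. u (t * chaos2 P y C c \<omega>)) - u 0 * exp (- (2 * chaos2_frob P C c * t^2 / 2))\<bar>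
        \<le> t^2 * (2 * sqrt (2 * chaos2_frob4 P C c))"
    using quad_form_trig_normal_approx[OF I(1) sym D, of t] E[of "\<lambda>x. u (t * x)"] fr by simp
qed

section \<open>Independence and limits in probability\<close>

definition (in prob_space) conv_prob :: "(nat \<Rightarrow> 'a \<Rightarrow> real) \<Rightarrow> ('a \<Rightarrow> real) \<Rightarrow> bool" where
  "conv_prob V v \<longleftrightarrow> (\<forall>e>0. ((\<lambda>q. prob {\<omega>\<in>space M. \<bar>V q \<omega> - v \<omega>\<bar> > e}) \<longlongrightarrow> 0) sequentially)"

context prob_space
begin

lemma conv_prob_lipschitz:
  assumes [measurable]: "\<And>q. random_variable borel (V q)" "random_variable borel v" "f \<in> borel_measurable borel"
    and c: "conv_prob V v" and B: "\<And>x. \<bar>f x\<bar> \<le> (1::real)" and L: "\<And>x y. \<bar>f x - f y\<bar> \<le> L * \<bar>x - y\<bar>"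
  shows "(\<lambda>q. expectation (\<lambda>\<omega>. \<bar>f (V q \<omega>) - f (v \<omega>)\<bar>)) \<longlonglongrightarrow> 0"
proof (rule LIMSEQ_I)
  fix r :: real assume r: "r > 0"
  have L0: "L \<ge> 0" using L[of 1 0] by simp
  define e where "e = r / (2 * (L + 1))"
  have e: "e > 0" "L * e \<le> r / 2" using r L0 by (auto simp: e_def field_simps)
  have "((\<lambda>q. prob {\<omega>\<in>space M. \<bar>V q \<omega> - v \<omega>\<bar> > e}) \<longlongrightarrow> 0) sequentially"
    using c e by (simp add: conv_prob_def)
  from LIMSEQ_D[OF this, of "r / 4"] r obtain N where N: "\<And>q. q \<ge> N \<Longrightarrow> prob {\<omega>\<in>space M. \<bar>V q \<omega> - v \<omega>\<bar> > e} < r / 4"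
    by auto
  show "\<exists>N. \<forall>q\<ge>N. norm (expectation (\<lambda>\<omega>. \<bar>f (V q \<omega>) - f (v \<omega>)\<bar>) - 0) < r"
  proof (intro exI[of _ N] allI impI)
    fix q assume q: "q \<ge> N"
    let ?A = "{\<omega>\<in>space M. \<bar>V q \<omega> - v \<omega>\<bar> > e}"
    have b: "\<bar>f x - f y\<bar> \<le> 2" for x y using B[of x] B[of y] by linarith
    have "expectation (\<lambda>\<omega>. \<bar>f (V q \<omega>) - f (v \<omega>)\<bar>) \<le> expectation (\<lambda>\<omega>. r / 2 + 2 * indicator ?A \<omega>)"
    proof (rule integral_mono)
      show "integrable M (\<lambda>\<omega>. \<bar>f (V q \<omega>) - f (v \<omega>)\<bar>)"
        by (rule integrable_const_bound[of _ 2]) (use b in auto)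
      show "integrable M (\<lambda>\<omega>. r / 2 + 2 * indicator ?A \<omega> :: real)"
        by (rule integrable_const_bound[of _ "r / 2 + 2"]) (use r in \<open>auto simp: indicator_def\<close>)
      fix \<omega> assume w: "\<omega> \<in> space M"
      show "\<bar>f (V q \<omega>) - f (v \<omega>)\<bar> \<le> r / 2 + 2 * indicator ?A \<omega>"
      proof (cases "\<omega> \<in> ?A")
        case True
        then show ?thesis using b[of "V q \<omega>" "v \<omega>"] r by simp
      next
        case False
        then have "L * \<bar>V q \<omega> - v \<omega>\<bar> \<le> L * e" using w L0 by (auto intro!: mult_left_mono)
        then show ?thesis using False L[of "V q \<omega>" "v \<omega>"] e by simp
      qed
    qed
    also have "\<dots> = r / 2 + 2 * prob ?A"
    proof -
      have "?A \<in> events" by measurable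
      then have e: "expectation (indicator ?A) = prob ?A" by simp
      have i: "integrable M (indicator ?A :: _ \<Rightarrow> real)"
        using \<open>?A \<in> events\<close> by (intro integrable_const_bound[of _ 1]) (auto simp: indicator_def)
      have "expectation (\<lambda>\<omega>. r / 2 + 2 * indicator ?A \<omega>) = expectation (\<lambda>\<omega>. r / 2) + 2 * expectation (indicator ?A)"
        using i by (subst Bochner_Integration.integral_add) auto
      then show ?thesis using e by (simp add: prob_space)
    qed
    also have "\<dots> < r" using N[OF q] by linarith
    finally show "norm (expectation (\<lambda>\<omega>. \<bar>f (V q \<omega>) - f (v \<omega>)\<bar>) - 0) < r" by simp
  qed
qed

lemma conv_prob_expectation:
  assumes [measurable]: "\<And>q. random_variable borel (V q)" "random_variable borel v" "f \<in> borel_measurable borel"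
    and c: "conv_prob V v" and B: "\<And>x. \<bar>f x\<bar> \<le> (1::real)" and L: "\<And>x y. \<bar>f x - f y\<bar> \<le> L * \<bar>x - y\<bar>"
  shows "(\<lambda>q. expectation (\<lambda>\<omega>. f (V q \<omega>))) \<longlonglongrightarrow> expectation (\<lambda>\<omega>. f (v \<omega>))"
proof (rule LIM_zero_cancel, rule Lim_null_comparison[OF _ conv_prob_lipschitz[OF assms]])
  have "integrable M (\<lambda>\<omega>. f (V q \<omega>))" "integrable M (\<lambda>\<omega>. f (v \<omega>))" for q
    by (rule integrable_const_bound[of _ 1]; use B in simp)+
  then have "norm (expectation (\<lambda>\<omega>. f (V q \<omega>)) - expectation (\<lambda>\<omega>. f (v \<omega>))) \<le> expectation (\<lambda>\<omega>. \<bar>f (V q \<omega>) - f (v \<omega>)\<bar>)" for q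
    using integral_abs_bound[of M "\<lambda>\<omega>. f (V q \<omega>) - f (v \<omega>)"] by simp
  then show "\<forall>\<^sub>F q in sequentially. norm (expectation (\<lambda>\<omega>. f (V q \<omega>)) - expectation (\<lambda>\<omega>. f (v \<omega>))) \<le> expectation (\<lambda>\<omega>. \<bar>f (V q \<omega>) - f (v \<omega>)\<bar>)"
    by simp
qed

definition lip01 :: "(real \<Rightarrow> real) \<Rightarrow> bool" where
  "lip01 f \<longleftrightarrow> (\<forall>x. 0 \<le> f x \<and> f x \<le> 1) \<and> (\<exists>L. \<forall>x y. \<bar>f x - f y\<bar> \<le> L * \<bar>x - y\<bar>)"

lemma lip01_measurable: "lip01 f \<Longrightarrow> f \<in> borel_measurable borel"
proof (rule borel_measurable_continuous_onI)
  assume "lip01 f"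
  then obtain L where L: "\<And>x y. \<bar>f x - f y\<bar> \<le> L * \<bar>x - y\<bar>" by (auto simp: lip01_def)
  have "((\<lambda>y. f y - f x) \<longlongrightarrow> 0) (at x)" for x
  proof (rule Lim_null_comparison)
    show "((\<lambda>y. L * \<bar>y - x\<bar>) \<longlongrightarrow> 0) (at x)" by (rule tendsto_eq_intros refl | simp)+
  qed (use L in auto)
  then show "continuous_on UNIV f"
    by (auto simp: continuous_on_eq_continuous_at continuous_at intro: LIM_zero_cancel)
qed

text \<open>Ramps that fall from 1 to 0 with slope \<open>r\<close> to the right of
  \<open>a\<close>. The whole line is listed besides the half-lines because a generator used to test
  independence has to contain the whole space.\<close>

lemma lip01_approx_indicator:
  assumes "A \<in> insert UNIV (range (\<lambda>a::real. {..a}))"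
  shows "\<exists>f. (\<forall>r::nat. lip01 (f r)) \<and> (\<forall>x. (\<lambda>r. f r x) \<longlonglongrightarrow> indicator A x)"
proof (cases "A = UNIV")
  case True
  then show ?thesis by (intro exI[of _ "\<lambda>_ _. 1"]) (auto simp: lip01_def intro!: exI[of _ 0])
next
  case False
  then obtain a where A: "A = {..a}" using assms by auto
  define f where "f = (\<lambda>(r::nat) x. max 0 (min 1 (1 - real r * (x - a))))"
  show ?thesis
  proof (intro exI[of _ f] conjI allI)
    fix r
    have "\<bar>f r x - f r y\<bar> \<le> real r * \<bar>x - y\<bar>" for x y
    proof -
      have "\<bar>f r x - f r y\<bar> \<le> \<bar>real r * (x - a) - real r * (y - a)\<bar>" unfolding f_def by linarith
      also have "\<dots> = real r * \<bar>x - y\<bar>" by (simp add: abs_mult flip: right_diff_distrib)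
      finally show ?thesis .
    qed
    then show "lip01 (f r)" by (auto simp: lip01_def f_def)
  next
    fix x
    show "(\<lambda>r. f r x) \<longlonglongrightarrow> indicator A x"
    proof (cases "x \<le> a")
      case True
      then have "f r x = 1" for r unfolding f_def by (simp add: mult_nonneg_nonpos)
      then show ?thesis using True A by simp
    next
      case False
      have "\<forall>\<^sub>F r in sequentially. f r x = 0"
      proof -
        obtain N :: nat where "real N * (x - a) > 1" using False reals_Archimedean3[of "x - a"] by auto
        have "f r x = 0" if "r \<ge> N" for r
        proof -
          have "real N * (x - a) \<le> real r * (x - a)" using that False by (intro mult_right_mono) auto
          then show ?thesis using \<open>real N * (x - a) > 1\<close> by (simp add: f_def)
        qed
        then show ?thesis by (auto simp: eventually_sequentially)
      qed
      then show ?thesis using False A by (simp add: tendsto_eventually)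
    qed
  qed
qed

text \<open>Only expectations of Lipschitz functions pass to limits in probability, so independence is tested on Lipschitz approximations of indicators of half-lines.\<close>
lemma indep_vars_of_lip01_products:
  assumes I: "finite I" "I \<noteq> {}" and rv: "\<And>i. i \<in> I \<Longrightarrow> random_variable borel (V i)"
    and prod: "\<And>f. (\<And>i. i \<in> I \<Longrightarrow> lip01 (f i)) \<Longrightarrow>
      expectation (\<lambda>\<omega>. \<Prod>i\<in>I. f i (V i \<omega>)) = (\<Prod>i\<in>I. expectation (\<lambda>\<omega>. f i (V i \<omega>)))"
  shows "indep_vars (\<lambda>_. borel) V I"
proof (subst indep_vars_finite[where E = "\<lambda>_. insert UNIV (range (\<lambda>a::real. {..a}))", OF I(2,1)])
  let ?E = "insert UNIV (range (\<lambda>a::real. {..a}))"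
  show "sets borel = sigma_sets (space borel) ?E"
  proof (rule antisym)
    show "sets borel \<subseteq> sigma_sets (space borel) ?E"
      unfolding borel_eq_atMost by (auto intro!: sigma_sets_mono sigma_sets.Basic simp: sets_measure_of_conv)
    show "sigma_sets (space borel) ?E \<subseteq> sets borel"
      by (rule sets.sigma_sets_subset) auto
  qed
  show "Int_stable ?E" by (auto simp: Int_stable_def)
  show "\<forall>A\<in>I \<rightarrow> ?E. prob (\<Inter>j\<in>I. V j -` A j \<inter> space M) = (\<Prod>j\<in>I. prob (V j -` A j \<inter> space M))"
  proof
    fix A assume A: "A \<in> I \<rightarrow> ?E"
    then have "\<forall>i\<in>I. \<exists>f. (\<forall>r::nat. lip01 (f r)) \<and> (\<forall>x. (\<lambda>r. f r x) \<longlonglongrightarrow> indicator (A i) x)"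
      by (intro ballI lip01_approx_indicator) (auto dest: Pi_mem)
    from bchoice[OF this] obtain f where
      f0: "\<forall>i\<in>I. (\<forall>r::nat. lip01 (f i r)) \<and> (\<forall>x. (\<lambda>r. f i r x) \<longlonglongrightarrow> indicator (A i) x)" by (elim exE)
    have f: "\<And>i r. i \<in> I \<Longrightarrow> lip01 (f i r)" "\<And>i x. i \<in> I \<Longrightarrow> (\<lambda>r. f i r x) \<longlonglongrightarrow> indicator (A i) x"
      using f0 by simp_all
    have Ab: "A i \<in> sets borel" if "i \<in> I" for i using Pi_mem[OF A that] by auto
    have [measurable]: "(\<lambda>\<omega>. f i r (V i \<omega>)) \<in> borel_measurable M" if "i \<in> I" for i r
      using measurable_compose[OF rv[OF that] lip01_measurable[OF f(1)[OF that]]] .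
    have meas: "V i -` A i \<inter> space M \<in> events" if "i \<in> I" for i
      using rv[OF that] Ab[OF that] by auto
    have fb: "0 \<le> f i r x" "f i r x \<le> 1" if "i \<in> I" for i r x using f(1)[OF that] by (auto simp: lip01_def)
    have 1: "(\<lambda>r. expectation (\<lambda>\<omega>. \<Prod>i\<in>I. f i r (V i \<omega>))) \<longlonglongrightarrow> expectation (\<lambda>\<omega>. \<Prod>i\<in>I. indicator (V i -` A i \<inter> space M) \<omega>)"
    proof (rule integral_dominated_convergence[where w = "\<lambda>_. 1"])
      show "AE \<omega> in M. (\<lambda>r. \<Prod>i\<in>I. f i r (V i \<omega>)) \<longlonglongrightarrow> (\<Prod>i\<in>I. indicator (V i -` A i \<inter> space M) \<omega>)"
      proof (rule AE_I2)
        fix \<omega> assume "\<omega> \<in> space M"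
        then show "(\<lambda>r. \<Prod>i\<in>I. f i r (V i \<omega>)) \<longlonglongrightarrow> (\<Prod>i\<in>I. indicator (V i -` A i \<inter> space M) \<omega>)"
          using f(2) by (intro tendsto_prod) (auto simp: indicator_def cong: if_cong)
      qed
      show "AE \<omega> in M. norm (\<Prod>i\<in>I. f i r (V i \<omega>)) \<le> 1" for r
        using fb by (auto intro!: AE_I2 prod_le_1 simp: abs_prod)
    qed (use meas in \<open>auto intro!: borel_measurable_prod borel_measurable_indicator\<close>)
    have 2: "(\<lambda>r. expectation (\<lambda>\<omega>. f i r (V i \<omega>))) \<longlonglongrightarrow> prob (V i -` A i \<inter> space M)" if i: "i \<in> I" for i
    proof -
      have "(\<lambda>r. expectation (\<lambda>\<omega>. f i r (V i \<omega>))) \<longlonglongrightarrow> expectation (\<lambda>\<omega>. indicator (V i -` A i \<inter> space M) \<omega>)"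
      proof (rule integral_dominated_convergence[where w = "\<lambda>_. 1"])
        show "AE \<omega> in M. (\<lambda>r. f i r (V i \<omega>)) \<longlonglongrightarrow> indicator (V i -` A i \<inter> space M) \<omega>"
        proof (rule AE_I2)
          fix \<omega> assume "\<omega> \<in> space M"
          then have "indicator (V i -` A i \<inter> space M) \<omega> = (indicator (A i) (V i \<omega>) :: real)" by (simp add: indicator_def)
          then show "(\<lambda>r. f i r (V i \<omega>)) \<longlonglongrightarrow> indicator (V i -` A i \<inter> space M) \<omega>"
            using f(2)[OF i] by simp
        qed
      qed (use meas[OF i] i fb in \<open>auto intro!: borel_measurable_indicator\<close>)
      then show ?thesis using meas[OF i] by simp
    qed
    have "(\<lambda>r. \<Prod>i\<in>I. expectation (\<lambda>\<omega>. f i r (V i \<omega>))) \<longlonglongrightarrow> (\<Prod>i\<in>I. prob (V i -` A i \<inter> space M))"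
      by (intro tendsto_prod 2)
    moreover have "expectation (\<lambda>\<omega>. \<Prod>i\<in>I. f i r (V i \<omega>)) = (\<Prod>i\<in>I. expectation (\<lambda>\<omega>. f i r (V i \<omega>)))" for r
      by (rule prod) (use f in auto)
    ultimately have "expectation (\<lambda>\<omega>. \<Prod>i\<in>I. indicator (V i -` A i \<inter> space M) \<omega>) = (\<Prod>i\<in>I. prob (V i -` A i \<inter> space M))"
      using 1 LIMSEQ_unique by auto
    moreover have "expectation (\<lambda>\<omega>. \<Prod>i\<in>I. indicator (V i -` A i \<inter> space M) \<omega>) = prob (\<Inter>j\<in>I. V j -` A j \<inter> space M)"
    proof -
      have "(\<Prod>i\<in>I. indicator (V i -` A i \<inter> space M) \<omega>) = (indicator (\<Inter>j\<in>I. V j -` A j \<inter> space M) \<omega> :: real)" for \<omega>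
        using I by (auto simp: indicator_def prod_zero_iff)
      moreover have "(\<Inter>j\<in>I. V j -` A j \<inter> space M) \<in> events"
        using meas I by (intro sets.finite_INT) auto
      ultimately show ?thesis by simp
    qed
    ultimately show "prob (\<Inter>j\<in>I. V j -` A j \<inter> space M) = (\<Prod>j\<in>I. prob (V j -` A j \<inter> space M))" by simp
  qed
qed (use rv in auto)

text \<open>Two products of factors in \<open>[0,1]\<close> differ by at most the sum of the
  differences of the factors, so product formulas pass to limits in probability. They are asked for
  at positive \<open>q\<close> only, since \<open>q = 0\<close> would mean a grid of mesh 0.\<close>

lemma indep_vars_limit:
  assumes I: "finite I" "I \<noteq> {}" and rv: "\<And>i. i \<in> I \<Longrightarrow> random_variable borel (V i)" "\<And>q i. i \<in> I \<Longrightarrow> random_variable borel (W q i)"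
    and conv: "\<And>i. i \<in> I \<Longrightarrow> conv_prob (\<lambda>q. W q i) (V i)"
    and prod: "\<And>f q. (\<And>i. i \<in> I \<Longrightarrow> lip01 (f i)) \<Longrightarrow> 0 < q \<Longrightarrow>
      expectation (\<lambda>\<omega>. \<Prod>i\<in>I. f i (W q i \<omega>)) = (\<Prod>i\<in>I. expectation (\<lambda>\<omega>. f i (W q i \<omega>)))"
  shows "indep_vars (\<lambda>_. borel) V I"
proof (rule indep_vars_of_lip01_products[OF I rv(1)])
  fix f assume f: "\<And>i. i \<in> I \<Longrightarrow> lip01 (f i)"
  have fm: "f i \<in> borel_measurable borel" if "i \<in> I" for i using f[OF that] by (rule lip01_measurable)
  have fb: "\<bar>f i x\<bar> \<le> 1" if "i \<in> I" for i x using f[OF that] by (auto simp: lip01_def)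
  have m1: "(\<lambda>\<omega>. f i (W q i \<omega>)) \<in> borel_measurable M" if "i \<in> I" for i q
    using measurable_compose[OF rv(2)[OF that] fm[OF that]] .
  have m2: "(\<lambda>\<omega>. f i (V i \<omega>)) \<in> borel_measurable M" if "i \<in> I" for i
    using measurable_compose[OF rv(1)[OF that] fm[OF that]] .
  have 0: "(\<lambda>q. expectation (\<lambda>\<omega>. \<bar>f i (W q i \<omega>) - f i (V i \<omega>)\<bar>)) \<longlonglongrightarrow> 0" 
    "(\<lambda>q. expectation (\<lambda>\<omega>. f i (W q i \<omega>))) \<longlonglongrightarrow> expectation (\<lambda>\<omega>. f i (V i \<omega>))" if i: "i \<in> I" for i
  proof -
    obtain L where L: "\<And>x y. \<bar>f i x - f i y\<bar> \<le> L * \<bar>x - y\<bar>" using f[OF i] by (auto simp: lip01_def)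
    show "(\<lambda>q. expectation (\<lambda>\<omega>. \<bar>f i (W q i \<omega>) - f i (V i \<omega>)\<bar>)) \<longlonglongrightarrow> 0" 
      by (rule conv_prob_lipschitz[OF rv(2)[OF i] rv(1)[OF i] fm[OF i] conv[OF i] fb[OF i] L])
    show "(\<lambda>q. expectation (\<lambda>\<omega>. f i (W q i \<omega>))) \<longlonglongrightarrow> expectation (\<lambda>\<omega>. f i (V i \<omega>))"
      by (rule conv_prob_expectation[OF rv(2)[OF i] rv(1)[OF i] fm[OF i] conv[OF i] fb[OF i] L])
  qed
  have i1: "integrable M (\<lambda>\<omega>. \<Prod>i\<in>I. f i (W q i \<omega>))" for q
    by (rule integrable_const_bound[of _ 1])
       (use fb m1 in \<open>auto intro!: AE_I2 prod_le_1 borel_measurable_prod simp: abs_prod\<close>)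
  have i2: "integrable M (\<lambda>\<omega>. \<Prod>i\<in>I. f i (V i \<omega>))"
    by (rule integrable_const_bound[of _ 1])
       (use fb m2 in \<open>auto intro!: AE_I2 prod_le_1 borel_measurable_prod simp: abs_prod\<close>)
  have i3: "integrable M (\<lambda>\<omega>. \<bar>f i (W q i \<omega>) - f i (V i \<omega>)\<bar>)" if "i \<in> I" for i q
  proof (rule integrable_const_bound[of _ 2])
    have "\<bar>f i x - f i y\<bar> \<le> 2" for x y using fb[OF that, of x] fb[OF that, of y] by linarith
    then show "AE \<omega> in M. norm \<bar>f i (W q i \<omega>) - f i (V i \<omega>)\<bar> \<le> 2" by simp
  qed (use m1[OF that] m2[OF that] in measurable)
  have "(\<lambda>q. expectation (\<lambda>\<omega>. \<Prod>i\<in>I. f i (W q i \<omega>))) \<longlonglongrightarrow> expectation (\<lambda>\<omega>. \<Prod>i\<in>I. f i (V i \<omega>))"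
  proof (rule LIM_zero_cancel, rule Lim_null_comparison)
    show "(\<lambda>q. \<Sum>i\<in>I. expectation (\<lambda>\<omega>. \<bar>f i (W q i \<omega>) - f i (V i \<omega>)\<bar>)) \<longlonglongrightarrow> 0"
      by (rule tendsto_null_sum) (rule 0)
    have "norm (expectation (\<lambda>\<omega>. \<Prod>i\<in>I. f i (W q i \<omega>)) - expectation (\<lambda>\<omega>. \<Prod>i\<in>I. f i (V i \<omega>))) \<le>
       (\<Sum>i\<in>I. expectation (\<lambda>\<omega>. \<bar>f i (W q i \<omega>) - f i (V i \<omega>)\<bar>))" for q
    proof -
      have "norm (expectation (\<lambda>\<omega>. \<Prod>i\<in>I. f i (W q i \<omega>)) - expectation (\<lambda>\<omega>. \<Prod>i\<in>I. f i (V i \<omega>))) \<le>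
          expectation (\<lambda>\<omega>. \<bar>(\<Prod>i\<in>I. f i (W q i \<omega>)) - (\<Prod>i\<in>I. f i (V i \<omega>))\<bar>)"
        using integral_abs_bound[of M "\<lambda>\<omega>. (\<Prod>i\<in>I. f i (W q i \<omega>)) - (\<Prod>i\<in>I. f i (V i \<omega>))"] i1[of q] i2 by simp
      also have "\<dots> \<le> expectation (\<lambda>\<omega>. \<Sum>i\<in>I. \<bar>f i (W q i \<omega>) - f i (V i \<omega>)\<bar>)"
      proof (rule integral_mono)
        show "\<bar>(\<Prod>i\<in>I. f i (W q i \<omega>)) - (\<Prod>i\<in>I. f i (V i \<omega>))\<bar> \<le> (\<Sum>i\<in>I. \<bar>f i (W q i \<omega>) - f i (V i \<omega>)\<bar>)" for \<omega>
          using norm_prod_diff[of I "\<lambda>i. f i (W q i \<omega>)" "\<lambda>i. f i (V i \<omega>)"] fb by simp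
      qed (use i1[of q] i2 i3 in auto)
      also have "\<dots> = (\<Sum>i\<in>I. expectation (\<lambda>\<omega>. \<bar>f i (W q i \<omega>) - f i (V i \<omega>)\<bar>))"
        by (rule Bochner_Integration.integral_sum) (rule i3)
      finally show ?thesis .
    qed
    then show "\<forall>\<^sub>F q in sequentially. norm (expectation (\<lambda>\<omega>. \<Prod>i\<in>I. f i (W q i \<omega>)) - expectation (\<lambda>\<omega>. \<Prod>i\<in>I. f i (V i \<omega>))) \<le>
       (\<Sum>i\<in>I. expectation (\<lambda>\<omega>. \<bar>f i (W q i \<omega>) - f i (V i \<omega>)\<bar>))" by simp
  qed
  note a = this
  have b: "(\<lambda>q. \<Prod>i\<in>I. expectation (\<lambda>\<omega>. f i (W q i \<omega>))) \<longlonglongrightarrow> (\<Prod>i\<in>I. expectation (\<lambda>\<omega>. f i (V i \<omega>)))"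
    by (intro tendsto_prod 0(2))
  have c: "\<forall>\<^sub>F q in sequentially. expectation (\<lambda>\<omega>. \<Prod>i\<in>I. f i (W q i \<omega>)) = (\<Prod>i\<in>I. expectation (\<lambda>\<omega>. f i (W q i \<omega>)))"
    using eventually_gt_at_top[of 0] by eventually_elim (rule prod[OF f])
  show "expectation (\<lambda>\<omega>. \<Prod>i\<in>I. f i (V i \<omega>)) = (\<Prod>i\<in>I. expectation (\<lambda>\<omega>. f i (V i \<omega>)))"
    by (rule LIMSEQ_unique[OF Lim_transform_eventually[OF a c] b])
qed

text \<open>Joins independence inside two families with independence between two generated
  sigma-algebras into one product formula. \<open>U\<close> and \<open>V\<close> need only be
  measurable for those sigma-algebras, so any finite sums of values of the Brownian motion are
  covered.\<close>

lemma expectation_prod_indep_set: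
  fixes U :: "'i \<Rightarrow> 'a \<Rightarrow> real" and V :: "'j \<Rightarrow> 'a \<Rightarrow> real"
  assumes fin: "finite I" "finite K"
    and iU: "indep_vars (\<lambda>_. borel) U I" and iV: "indep_vars (\<lambda>_. borel) V K"
    and GA: "GA \<subseteq> events" "GB \<subseteq> events"
    and mU: "\<And>i. i \<in> I \<Longrightarrow> U i \<in> borel_measurable (sigma (space M) GA)"
    and mV: "\<And>i. i \<in> K \<Longrightarrow> V i \<in> borel_measurable (sigma (space M) GB)"
    and ind: "indep_set (sigma_sets (space M) GA) (sigma_sets (space M) GB)"
    and f: "\<And>i. i \<in> I \<Longrightarrow> lip01 (f i)" "\<And>i. i \<in> K \<Longrightarrow> lip01 (g i)"
  shows "expectation (\<lambda>\<omega>. (\<Prod>i\<in>I. f i (U i \<omega>)) * (\<Prod>i\<in>K. g i (V i \<omega>))) =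
    (\<Prod>i\<in>I. expectation (\<lambda>\<omega>. f i (U i \<omega>))) * (\<Prod>i\<in>K. expectation (\<lambda>\<omega>. g i (V i \<omega>)))"
proof -
  have sub: "GA \<subseteq> Pow (space M)" "GB \<subseteq> Pow (space M)" using GA sets.space_closed[of M] by blast+
  let ?P = "\<lambda>\<omega>. \<Prod>i\<in>I. f i (U i \<omega>)" and ?Q = "\<lambda>\<omega>. \<Prod>i\<in>K. g i (V i \<omega>)"
  have mP: "?P \<in> borel_measurable (sigma (space M) GA)"
    by (intro borel_measurable_prod measurable_compose[OF mU lip01_measurable[OF f(1)]])
  have mQ: "?Q \<in> borel_measurable (sigma (space M) GB)"
    by (intro borel_measurable_prod measurable_compose[OF mV lip01_measurable[OF f(2)]])
  have mm: "h \<in> borel_measurable M" if "h \<in> borel_measurable (sigma (space M) G)" "G \<subseteq> events" for h :: "'a \<Rightarrow> real" and G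
  proof -
    have "sigma_sets (space M) G \<subseteq> events" using that(2) by (rule sets.sigma_sets_subset)
    moreover have "G \<subseteq> Pow (space M)" using that(2) sets.space_closed[of M] by blast
    ultimately show ?thesis using that(1) by (auto simp: measurable_def)
  qed
  have pre: "sigma_sets (space M) {h -` A \<inter> space M | A. A \<in> sets borel} \<subseteq> sigma_sets (space M) G"
    if "h \<in> borel_measurable (sigma (space M) G)" "G \<subseteq> Pow (space M)" for h :: "'a \<Rightarrow> real" and G
    using that measurable_sets[OF that(1)] by (intro sigma_sets_mono) auto
  have "indep_var borel ?P borel ?Q"
    unfolding indep_var_eq
  proof (intro conjI)
    show "indep_set (sigma_sets (space M) {?P -` A \<inter> space M | A. A \<in> sets borel}) (sigma_sets (space M) {?Q -` A \<inter> space M | A. A \<in> sets borel})"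
      using ind unfolding indep_set_def
      by (rule indep_sets_mono_sets) (use pre[OF mP sub(1)] pre[OF mQ sub(2)] in \<open>auto split: bool.splits\<close>)
  qed (use mm[OF mP GA(1)] mm[OF mQ GA(2)] in auto)
  moreover have "integrable M ?P"
    by (rule integrable_const_bound[of _ 1])
       (use f mm[OF mP GA(1)] in \<open>auto intro!: AE_I2 prod_le_1 simp: abs_prod lip01_def\<close>)
  moreover have "integrable M ?Q"
    by (rule integrable_const_bound[of _ 1])
       (use f mm[OF mQ GA(2)] in \<open>auto intro!: AE_I2 prod_le_1 simp: abs_prod lip01_def\<close>)
  ultimately have "expectation (\<lambda>\<omega>. ?P \<omega> * ?Q \<omega>) = expectation ?P * expectation ?Q"
    by (rule indep_var_lebesgue_integral)
  moreover have "expectation ?P = (\<Prod>i\<in>I. expectation (\<lambda>\<omega>. f i (U i \<omega>)))"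
  proof (rule indep_vars_lebesgue_integral[OF fin(1)])
    show "indep_vars (\<lambda>_. borel) (\<lambda>i \<omega>. f i (U i \<omega>)) I"
      by (rule indep_vars_compose2[OF iU]) (rule lip01_measurable[OF f(1)])
    show "integrable M (\<lambda>\<omega>. f i (U i \<omega>))" if "i \<in> I" for i
      by (rule integrable_const_bound[of _ 1])
         (use f(1)[OF that] mm[OF measurable_compose[OF mU[OF that] lip01_measurable[OF f(1)[OF that]]] GA(1)] in \<open>auto simp: lip01_def\<close>)
  qed
  moreover have "expectation ?Q = (\<Prod>i\<in>K. expectation (\<lambda>\<omega>. g i (V i \<omega>)))"
  proof (rule indep_vars_lebesgue_integral[OF fin(2)])
    show "indep_vars (\<lambda>_. borel) (\<lambda>i \<omega>. g i (V i \<omega>)) K"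
      by (rule indep_vars_compose2[OF iV]) (rule lip01_measurable[OF f(2)])
    show "integrable M (\<lambda>\<omega>. g i (V i \<omega>))" if "i \<in> K" for i
      by (rule integrable_const_bound[of _ 1])
         (use f(2)[OF that] mm[OF measurable_compose[OF mV[OF that] lip01_measurable[OF f(2)[OF that]]] GA(2)] in \<open>auto simp: lip01_def\<close>)
  qed
  ultimately show ?thesis by simp
qed

end

section \<open>The block statistics as a Gaussian array\<close>

text \<open>Every cell costs at most \<open>C * \<eta> powr a * \<eta>\<close>. Three Riemann sums
  rest on this: the variance of an increment of \<open>X\<close>, the bias of the estimator, and the
  limiting variance.\<close>

lemma holder_riemann:
  fixes f :: "real \<Rightarrow> real"
  assumes H: "\<And>s t. s \<in> {0..1} \<Longrightarrow> t \<in> {0..1} \<Longrightarrow> \<bar>f s - f t\<bar> \<le> C * \<bar>s - t\<bar> powr a"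
    and f: "continuous_on {0..1} f" and C: "C \<ge> 0" and a: "a > 0" and \<eta>: "\<eta> > 0" and x: "0 \<le> x"
  shows "x + real m * \<eta> \<le> 1 \<Longrightarrow>
    \<bar>(\<Sum>l<m. \<eta> * f (x + real l * \<eta>)) - integral {x..x + real m * \<eta>} f\<bar> \<le> real m * \<eta> * (C * \<eta> powr a)"
proof (induction m)
  case (Suc m)
  let ?y = "x + real m * \<eta>"
  have y: "0 \<le> ?y" "?y + \<eta> \<le> 1" "?y \<le> 1" using Suc.prems \<eta> x by (auto simp: algebra_simps)
  have ci: "f integrable_on {u..v}" if "0 \<le> u" "v \<le> 1" for u v
    using that by (intro integrable_continuous_real continuous_on_subset[OF f]) auto
  have split: "integral {x..x + real (Suc m) * \<eta>} f = integral {x..?y} f + integral {?y..?y + \<eta>} f"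
    using Henstock_Kurzweil_Integration.integral_combine[of x ?y "?y + \<eta>" f] ci[of x "?y + \<eta>"] x y \<eta>
    by (simp add: algebra_simps)
  have cell: "\<bar>integral {?y..?y + \<eta>} f - \<eta> * f ?y\<bar> \<le> C * \<eta> powr a * \<eta>"
  proof -
    have hi: "((\<lambda>t. f t - f ?y) has_integral (integral {?y..?y + \<eta>} f - \<eta> * f ?y)) (cbox ?y (?y + \<eta>))"
      using has_integral_diff[OF integrable_integral[OF ci[of ?y "?y + \<eta>"]] has_integral_const_real[of "f ?y" ?y "?y + \<eta>"]] y \<eta>
      by (simp add: content_real)
    have "norm (integral {?y..?y + \<eta>} f - \<eta> * f ?y) \<le> C * \<eta> powr a * measure lborel (cbox ?y (?y + \<eta>))"
    proof (rule has_integral_bound[OF _ hi])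
      fix t assume t: "t \<in> cbox ?y (?y + \<eta>)"
      then have "\<bar>f t - f ?y\<bar> \<le> C * \<bar>t - ?y\<bar> powr a" using y by (intro H) auto
      also have "\<dots> \<le> C * \<eta> powr a" using t a C by (intro mult_left_mono powr_mono2) auto
      finally show "norm (f t - f ?y) \<le> C * \<eta> powr a" by simp
    qed (use C in auto)
    then show ?thesis using \<eta> by (simp add: content_real)
  qed
  have "\<bar>(\<Sum>l<m. \<eta> * f (x + real l * \<eta>)) - integral {x..?y} f\<bar> \<le> real m * \<eta> * (C * \<eta> powr a)"
    using Suc y \<eta> by (intro Suc.IH) (auto simp: algebra_simps)
  moreover have "real (Suc m) * \<eta> * (C * \<eta> powr a) = real m * \<eta> * (C * \<eta> powr a) + C * \<eta> powr a * \<eta>"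
    by (simp add: algebra_simps)
  moreover have "(\<Sum>l<Suc m. \<eta> * f (x + real l * \<eta>)) = (\<Sum>l<m. \<eta> * f (x + real l * \<eta>)) + \<eta> * f ?y" by simp
  ultimately show ?case using cell split by linarith
qed simp

lemma char_normal_density:
  assumes "s > 0"
  shows "char (density lborel (normal_density 0 s)) t = complex_of_real (exp (- (s * t)\<^sup>2 / 2))"
proof -
  have "distributed std_normal_distribution lborel (\<lambda>x. x) std_normal_density"
    unfolding distributed_def by (auto intro!: distr_id2)
  from prob_space.normal_density_affine[OF prob_space_std_normal_distribution this, of s 0] assms
  have "distributed std_normal_distribution lborel (\<lambda>x. s * x) (normal_density 0 s)" by simp
  then have "density lborel (normal_density 0 s) = distr std_normal_distribution lborel (\<lambda>x. s * x)"
    by (simp add: distributed_def)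
  then have "char (density lborel (normal_density 0 s)) t = char std_normal_distribution (t * s)"
    by (simp add: char_def integral_distr mult_ac)
  then show ?thesis by (simp add: char_std_normal_distribution mult_ac)
qed

context prob_space
begin

lemma char_eq_cos_sin:
  assumes [measurable]: "random_variable borel V"
  shows "char (distr M borel V) t = complex_of_real (expectation (\<lambda>\<omega>. cos (t * V \<omega>))) + \<i> * complex_of_real (expectation (\<lambda>\<omega>. sin (t * V \<omega>)))"
proof -
  have i: "integrable M (\<lambda>\<omega>. cos (t * V \<omega>))" "integrable M (\<lambda>\<omega>. sin (t * V \<omega>))"
    by (rule integrable_const_bound[of _ 1]; simp)+
  have "char (distr M borel V) t = expectation (\<lambda>\<omega>. iexp (t * V \<omega>))"
    by (simp add: char_def integral_distr)
  also have "\<dots> = expectation (\<lambda>\<omega>. complex_of_real (cos (t * V \<omega>)) + \<i> * complex_of_real (sin (t * V \<omega>)))"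
    by (intro Bochner_Integration.integral_cong refl) (simp add: complex_eq_iff Re_exp Im_exp)
  also have "\<dots> = complex_of_real (expectation (\<lambda>\<omega>. cos (t * V \<omega>))) + \<i> * complex_of_real (expectation (\<lambda>\<omega>. sin (t * V \<omega>)))"
    using i by (subst Bochner_Integration.integral_add) auto
  finally show ?thesis .
qed

lemma distributed_normal_distr:
  "distributed M lborel V (normal_density 0 s) \<Longrightarrow> distr M borel V = density lborel (normal_density 0 s)"
  using distr_cong[of M M borel lborel V V] by (simp add: distributed_def)

lemma conv_prob_char:
  assumes rv: "\<And>q. random_variable borel (V q)" "random_variable borel v" and c: "conv_prob V v"
  shows "(\<lambda>q. char (distr M borel (V q)) t) \<longlonglongrightarrow> char (distr M borel v) t"
proof -
  have 1: "\<bar>cos (t * x) - cos (t * y)\<bar> \<le> \<bar>t\<bar> * \<bar>x - y\<bar>" "\<bar>sin (t * x) - sin (t * y)\<bar> \<le> \<bar>t\<bar> * \<bar>x - y\<bar>" for x y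
  proof -
    have "norm (cos (t * x) - cos (t * y)) \<le> 1 * norm (t * x - t * y)"
      by (rule field_differentiable_bound[where S = UNIV and f' = "\<lambda>x. - sin x"]) (auto intro!: derivative_eq_intros)
    then show "\<bar>cos (t * x) - cos (t * y)\<bar> \<le> \<bar>t\<bar> * \<bar>x - y\<bar>" by (simp flip: right_diff_distrib abs_mult)
    have "norm (sin (t * x) - sin (t * y)) \<le> 1 * norm (t * x - t * y)"
      by (rule field_differentiable_bound[where S = UNIV and f' = "\<lambda>x. cos x"]) (auto intro!: derivative_eq_intros)
    then show "\<bar>sin (t * x) - sin (t * y)\<bar> \<le> \<bar>t\<bar> * \<bar>x - y\<bar>" by (simp flip: right_diff_distrib abs_mult)
  qed
  show ?thesis
    unfolding char_eq_cos_sin[OF rv(1)] char_eq_cos_sin[OF rv(2)]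
    by (intro tendsto_intros tendsto_of_real conv_prob_expectation[OF rv _ c _ 1(1)] conv_prob_expectation[OF rv _ c _ 1(2)]) auto
qed

lemma conv_prob_diff:
  assumes [measurable]: "\<And>q. random_variable borel (V q)" "random_variable borel v"
    "\<And>q. random_variable borel (W q)" "random_variable borel w"
    and c: "conv_prob V v" "conv_prob W w"
  shows "conv_prob (\<lambda>q \<omega>. V q \<omega> - W q \<omega>) (\<lambda>\<omega>. v \<omega> - w \<omega>)"
  unfolding conv_prob_def
proof (intro allI impI)
  fix e :: real assume e: "e > 0"
  let ?A = "\<lambda>V v q. {\<omega> \<in> space M. e / 2 < \<bar>V q \<omega> - v \<omega>\<bar>}"
  have 1: "(\<lambda>q. prob (?A V v q)) \<longlonglongrightarrow> 0" "(\<lambda>q. prob (?A W w q)) \<longlonglongrightarrow> 0"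
    using c e half_gt_zero[OF e] unfolding conv_prob_def by blast+
  have l: "(\<lambda>q. prob (?A V v q) + prob (?A W w q)) \<longlonglongrightarrow> 0"
    using tendsto_add[OF 1] by simp
  show "(\<lambda>q. prob {\<omega> \<in> space M. e < \<bar>V q \<omega> - W q \<omega> - (v \<omega> - w \<omega>)\<bar>}) \<longlonglongrightarrow> 0"
  proof (rule Lim_null_comparison[OF _ l], rule always_eventually, rule allI)
    fix q
    have "prob {\<omega> \<in> space M. e < \<bar>V q \<omega> - W q \<omega> - (v \<omega> - w \<omega>)\<bar>} \<le> prob (?A V v q \<union> ?A W w q)"
    proof (rule finite_measure_mono)
      have "e / 2 < x \<or> e / 2 < y" if "e < x + y" for x y :: real using that by linarith
      then show "{\<omega> \<in> space M. e < \<bar>V q \<omega> - W q \<omega> - (v \<omega> - w \<omega>)\<bar>} \<subseteq> ?A V v q \<union> ?A W w q"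
        by (smt (verit, del_insts) UnCI mem_Collect_eq subsetI)
    qed measurable
    also have "\<dots> \<le> prob (?A V v q) + prob (?A W w q)"
      by (rule measure_subadditive) (auto simp: emeasure_eq_measure)
    finally show "norm (prob {\<omega> \<in> space M. e < \<bar>V q \<omega> - W q \<omega> - (v \<omega> - w \<omega>)\<bar>}) \<le> prob (?A V v q) + prob (?A W w q)"
      by simp
  qed
qed

section \<open>Riemann-Ito sums over blocks of a grid\<close>

lemma bm_grid_indep:
  assumes "std_brownian_motion B" "\<eta> > 0"
  shows "indep_vars (\<lambda>_. borel) (\<lambda>l \<omega>. B (real (Suc l) * \<eta>) \<omega> - B (real l * \<eta>) \<omega>) {..<m}"
proof -
  let ?ts = "map (\<lambda>l. real l * \<eta>) [0..<Suc m]"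
  have 1: "sorted_wrt (<) ?ts" unfolding sorted_wrt_map
    by (rule sorted_wrt_mono_rel[OF _ sorted_wrt_upt]) (use assms in auto)
  have 2: "\<forall>t\<in>set ?ts. 0 \<le> t" using assms by auto
  have "indep_vars (\<lambda>_. borel) (\<lambda>i \<omega>. B (?ts ! Suc i) \<omega> - B (?ts ! i) \<omega>) {..<length ?ts - 1}"
    using assms(1) 1 2 unfolding std_brownian_motion_def by blast
  moreover have "indep_vars (\<lambda>_. borel) (\<lambda>i \<omega>. B (?ts ! Suc i) \<omega> - B (?ts ! i) \<omega>) {..<length ?ts - 1} \<longleftrightarrow> ?thesis"
    by (intro indep_vars_cong) (auto simp del: upt_Suc)
  ultimately show ?thesis by blast
qed

definition ito_block :: "(real \<Rightarrow> 'a \<Rightarrow> real) \<Rightarrow> (real \<Rightarrow> real) \<Rightarrow> real \<Rightarrow> nat set \<Rightarrow> 'a \<Rightarrow> real" where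
  "ito_block B f \<eta> K \<omega> = (\<Sum>l\<in>K. f (real l * \<eta>) * (B (real (Suc l) * \<eta>) \<omega> - B (real l * \<eta>) \<omega>))"

lemma ito_block_measurable:
  assumes "std_brownian_motion B" shows "random_variable borel (ito_block B f \<eta> K)"
proof -
  have [measurable]: "random_variable borel (B t)" for t using assms by (simp add: std_brownian_motion_def)
  show ?thesis unfolding ito_block_def by measurable
qed

lemma ito_block_indep:
  assumes B: "std_brownian_motion B" "\<eta> > 0" and K: "\<And>i. i \<in> L \<Longrightarrow> K i \<subseteq> {..<m}" "disjoint_family_on K L"
  shows "indep_vars (\<lambda>_. borel) (\<lambda>i. ito_block B f \<eta> (K i)) L"
proof -
  note i = indep_vars_restrict[OF bm_grid_indep[OF B, of m] K]
  have "indep_vars (\<lambda>_. borel) (\<lambda>i \<omega>. (\<lambda>x. \<Sum>l\<in>K i. f (real l * \<eta>) * x l)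
      (restrict (\<lambda>l. B (real (Suc l) * \<eta>) \<omega> - B (real l * \<eta>) \<omega>) (K i))) L"
    by (rule indep_vars_compose2[OF i]) measurable
  then show ?thesis
    by (rule iffD1[OF indep_vars_cong, rotated 3]) (auto simp: ito_block_def fun_eq_iff)
qed

lemma ito_block_normal:
  assumes B: "std_brownian_motion B" "\<eta> > 0" and K: "finite K" "K \<noteq> {}"
    and f: "\<And>l. l \<in> K \<Longrightarrow> f (real l * \<eta>) > 0"
  shows "distributed M lborel (ito_block B f \<eta> K) (normal_density 0 (sqrt (\<Sum>l\<in>K. \<eta> * (f (real l * \<eta>))^2)))"
proof -
  have "indep_vars (\<lambda>_. borel) (\<lambda>l. ito_block B f \<eta> {l}) K"
    by (rule ito_block_indep[OF B, of _ _ "Suc (Max K)"]) (use K in \<open>auto simp: disjoint_family_on_def le_imp_less_Suc\<close>)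
  moreover have "distributed M lborel (ito_block B f \<eta> {l}) (normal_density 0 (f (real l * \<eta>) * sqrt \<eta>))" if l: "l \<in> K" for l
  proof -
    have "real l * \<eta> < real (Suc l) * \<eta>" "0 \<le> real l * \<eta>" using B(2) by auto
    then have "distributed M lborel (\<lambda>\<omega>. B (real (Suc l) * \<eta>) \<omega> - B (real l * \<eta>) \<omega>) (normal_density 0 (sqrt (real (Suc l) * \<eta> - real l * \<eta>)))"
      using B(1) unfolding std_brownian_motion_def by blast
    moreover have "real (Suc l) * \<eta> - real l * \<eta> = \<eta>" by (simp add: algebra_simps)
    ultimately have "distributed M lborel (\<lambda>\<omega>. B (real (Suc l) * \<eta>) \<omega> - B (real l * \<eta>) \<omega>) (normal_density 0 (sqrt \<eta>))" by simp
    from normal_density_affine[OF this, of "f (real l * \<eta>)" 0] f[OF l] B(2)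
    show ?thesis by (simp add: ito_block_def[abs_def])
  qed
  ultimately have "distributed M lborel (\<lambda>x. \<Sum>l\<in>K. ito_block B f \<eta> {l} x) (normal_density (\<Sum>l\<in>K. 0) (sqrt (\<Sum>l\<in>K. (f (real l * \<eta>) * sqrt \<eta>)^2)))"
    by (intro sum_indep_normal K) (use f B(2) in auto)
  moreover have "(\<lambda>x. \<Sum>l\<in>K. ito_block B f \<eta> {l} x) = ito_block B f \<eta> K" by (simp add: ito_block_def fun_eq_iff)
  ultimately show ?thesis using B(2) by (simp add: power_mult_distrib mult.commute)
qed

text \<open>The Riemann sums that define the integrals up to $i/n$ and up to $(i-1)/n$ use different grids; choosing $m = i q$ points in both puts them on the common grid of mesh $1/(n q)$.\<close>
lemma wiener_integral_conv_prob:
  assumes "wiener_integral B f (real j / real n) Z" "j > 0" "n > 0"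
  shows "conv_prob (\<lambda>q. ito_block B f (1 / (real n * real q)) {..<j * q}) Z"
  unfolding conv_prob_def
proof (intro allI impI)
  fix e :: real assume "e > 0"
  let ?t = "real j / real n"
  have "((\<lambda>m::nat. prob {\<omega>\<in>space M.
        \<bar>(\<Sum>i<m. f (?t * real i / real m) * (B (?t * real (Suc i) / real m) \<omega> - B (?t * real i / real m) \<omega>)) - Z \<omega>\<bar> > e}) \<longlongrightarrow> 0) sequentially"
    using assms(1) \<open>e > 0\<close> unfolding wiener_integral_def by blast
  from filterlim_compose[OF this mult_nat_left_at_top[OF assms(2)]]
  have "((\<lambda>q. prob {\<omega>\<in>space M.
        \<bar>(\<Sum>i<j * q. f (?t * real i / real (j * q)) * (B (?t * real (Suc i) / real (j * q)) \<omega> - B (?t * real i / real (j * q)) \<omega>)) - Z \<omega>\<bar> > e}) \<longlongrightarrow> 0) sequentially" .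
  moreover have "?t * x / real (j * q) = x * (1 / (real n * real q))" for x q
    using assms(2) by (simp add: field_simps)
  ultimately show "(\<lambda>q. prob {\<omega> \<in> space M. e < \<bar>ito_block B f (1 / (real n * real q)) {..<j * q} \<omega> - Z \<omega>\<bar>}) \<longlonglongrightarrow> 0"
    by (simp only: ito_block_def)
qed

end

text \<open>The value 0 outside the indices \<open>1\<close> to \<open>n\<close>, in particular at
  \<open>0\<close> and \<open>n + 1\<close>, removes the boundary terms in the summations by parts.
  The minus sign of \<open>y0\<close> is kept out.\<close>

definition cell_avg :: "real \<Rightarrow> nat \<Rightarrow> nat \<times> nat \<Rightarrow> nat \<Rightarrow> real" where
  "cell_avg g n p i = (if 1 \<le> i \<and> i \<le> n
     then real n * integral {real (i - 1) / real n .. real i / real n} (Phi g (fst p) (snd p)) else 0)"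

definition cell_var :: "(real \<Rightarrow> real) \<Rightarrow> nat \<Rightarrow> nat \<Rightarrow> real" where
  "cell_var s2 n i = integral {real (i - 1) / real n .. real i / real n} s2"

text \<open>The first sum comes from the independent increments of \<open>X\<close>, weighted with
  their variances. In the second, summation by parts has moved the differences from the noise
  variables to the cell averages.\<close>

definition y0_cov :: "(real \<Rightarrow> real) \<Rightarrow> real \<Rightarrow> nat \<Rightarrow> real \<Rightarrow> nat \<times> nat \<Rightarrow> nat \<times> nat \<Rightarrow> real" where
  "y0_cov s2 \<delta> n g p q = (\<Sum>i=1..n. cell_var s2 n i * (cell_avg g n p i * cell_avg g n q i)) +
     \<delta>^2 * (\<Sum>i=1..n. (cell_avg g n p (Suc i) - cell_avg g n p i) * (cell_avg g n q (Suc i) - cell_avg g n q i))"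

text \<open>The case \<open>i = 1\<close> is special because \<open>Yobs\<close> is 0 at index 0 and
  carries no noise there: the first increment contains the whole of the first observation.\<close>

lemma sum_by_parts_shift:
  fixes c e :: "nat \<Rightarrow> real"
  shows "(\<Sum>i=1..Suc n. c i * (e i - (if i = 1 then 0 else e (i - 1)))) =
     (\<Sum>i=1..Suc n. (c i - c (Suc i)) * e i) + c (Suc (Suc n)) * e (Suc n)"
  by (induction n) (auto simp: algebra_simps)

context prob_space
begin

text \<open>The Riemann sums are exactly normal with variances \<open>w q\<close> that converge to
  the integral of \<open>s2\<close> over the cell. Convergence in probability gives convergence of
  characteristic functions, and Levy uniqueness identifies the law of the limit.\<close>

lemma increment_distribution:
  fixes s2 :: "real \<Rightarrow> real"
  assumes B: "std_brownian_motion B" and n: "n > 0" and i: "i \<in> {1..n}"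
    and pos: "\<And>t. t \<in> {0..1} \<Longrightarrow> s2 t > 0" and cont: "continuous_on {0..1} s2"
    and H: "\<And>s t. s \<in> {0..1} \<Longrightarrow> t \<in> {0..1} \<Longrightarrow> \<bar>s2 s - s2 t\<bar> \<le> C * \<bar>s - t\<bar> powr a" and C: "C \<ge> 0" and a: "a > 0"
    and conv: "conv_prob (\<lambda>q. ito_block B (\<lambda>s. sqrt (s2 s)) (1 / (real n * real q)) {(i - 1) * q..<i * q}) \<xi>"
    and rv: "random_variable borel \<xi>"
  shows "cell_var s2 n i > 0" and "distributed M lborel \<xi> (normal_density 0 (sqrt (cell_var s2 n i)))"
proof -
  let ?x = "real (i - 1) / real n" and ?v = "cell_var s2 n i"
  have x: "0 \<le> ?x" "?x + 1 / real n = real i / real n" "real i / real n \<le> 1"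
    using i n by (auto simp: field_simps of_nat_diff)
  \<comment> \<open>A positive minimum of \<open>s2\<close> keeps the variance of the increment
    positive, as the normal density requires.\<close>
  obtain c where c: "c > 0" "\<And>t. t \<in> {0..1} \<Longrightarrow> s2 t \<ge> c"
  proof -
    obtain t0 where "t0 \<in> {0..1}" "\<forall>t\<in>{0..1}. s2 t0 \<le> s2 t"
      using continuous_attains_inf[OF _ _ cont] by auto
    then show ?thesis using that pos by blast
  qed
  have int: "s2 integrable_on {?x..real i / real n}"
    using x by (intro integrable_continuous_real continuous_on_subset[OF cont]) auto
  have "integral {?x..real i / real n} (\<lambda>_. c) \<le> ?v"
    unfolding cell_var_def
  proof (intro integral_le int)
    show "c \<le> s2 t" if "t \<in> {?x..real i / real n}" for t
      using that x order_trans[OF x(1), of t] by (intro c(2)) simp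
  qed (rule integrable_const_ivl)
  moreover have "integral {?x..real i / real n} (\<lambda>_. c) = c / real n"
    unfolding x(2)[symmetric] using n by simp
  ultimately show vpos: "?v > 0" using c n by (smt (verit) divide_pos_pos of_nat_0_less_iff)
  let ?\<eta> = "\<lambda>q. 1 / (real n * real q)"
  define w where "w q = (\<Sum>l\<in>{(i - 1) * q..<i * q}. ?\<eta> q * s2 (real l * ?\<eta> q))" for q
  have range: "real l * ?\<eta> q \<in> {0..1}" if "l < i * q" "q > 0" for l q
  proof -
    have "real l \<le> real (i * q)" using that by linarith
    also have "\<dots> \<le> real (n * q)" using i by (intro of_nat_mono mult_right_mono) auto
    finally show ?thesis using n that by (auto simp: field_simps)
  qed
  have reindex: "w q = (\<Sum>l<q. ?\<eta> q * s2 (?x + real l * ?\<eta> q))" if q: "q > 0" for q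
  proof -
    have iq: "i * q = (i - 1) * q + q" using i by (cases i) auto
    have "w q = (\<Sum>l\<in>{0 + (i - 1) * q..<q + (i - 1) * q}. ?\<eta> q * s2 (real l * ?\<eta> q))"
      unfolding w_def by (simp add: iq add.commute)
    also have "\<dots> = (\<Sum>l\<in>{0..<q}. ?\<eta> q * s2 (real (l + (i - 1) * q) * ?\<eta> q))"
      by (rule sum.shift_bounds_nat_ivl)
    also have "\<dots> = (\<Sum>l<q. ?\<eta> q * s2 (?x + real l * ?\<eta> q))"
      unfolding atLeast0LessThan
      by (intro sum.cong refl arg_cong[where f = "\<lambda>z. _ * s2 z"]) (use q n in \<open>simp add: field_simps\<close>)
    finally show ?thesis .
  qed
  have wv: "w \<longlonglongrightarrow> ?v"
  proof (rule LIM_zero_cancel, rule Lim_null_comparison)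
    show "(\<lambda>q. 1 / real n * (C * ?\<eta> q powr a)) \<longlonglongrightarrow> 0"
      using n a by real_asymp
    have "\<bar>w q - ?v\<bar> \<le> 1 / real n * (C * ?\<eta> q powr a)" if q: "q > 0" for q
      using holder_riemann[OF H cont C a, of "?\<eta> q" ?x q] x q n reindex[OF q] by (simp add: cell_var_def)
    then have "norm (w q - ?v) \<le> 1 / real n * (C * ?\<eta> q powr a)" if "q > 0" for q using that by simp
    then show "\<forall>\<^sub>F q in sequentially. norm (w q - ?v) \<le> 1 / real n * (C * ?\<eta> q powr a)"
      by (rule eventually_mono[OF eventually_gt_at_top[of 0]])
  qed
  have wpos: "w q > 0" if q: "q > 0" for q
    unfolding w_def by (intro sum_pos mult_pos_pos pos range) (use q i n in auto)
  let ?W = "\<lambda>q. ito_block B (\<lambda>s. sqrt (s2 s)) (?\<eta> q) {(i - 1) * q..<i * q}"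
  have cW: "char (distr M borel (?W q)) t = complex_of_real (exp (- (w q * t^2) / 2))" if q: "q > 0" for q t
  proof -
    have "distributed M lborel (?W q) (normal_density 0 (sqrt (\<Sum>l\<in>{(i - 1) * q..<i * q}. ?\<eta> q * (sqrt (s2 (real l * ?\<eta> q)))^2)))"
      by (rule ito_block_normal[OF B]) (use q i n pos[OF range] in auto)
    also have "(\<Sum>l\<in>{(i - 1) * q..<i * q}. ?\<eta> q * (sqrt (s2 (real l * ?\<eta> q)))^2) = w q"
      unfolding w_def by (intro sum.cong refl) (use pos[OF range] q in \<open>auto simp: less_imp_le\<close>)
    finally have "distr M borel (?W q) = density lborel (normal_density 0 (sqrt (w q)))"
      by (rule distributed_normal_distr)
    then show ?thesis
      using char_normal_density[of "sqrt (w q)" t] wpos[OF q] by (simp add: power_mult_distrib)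
  qed
  have "char (distr M borel \<xi>) t = complex_of_real (exp (- (?v * t^2) / 2))" for t
  proof (rule LIMSEQ_unique)
    show "(\<lambda>q. char (distr M borel (?W q)) t) \<longlonglongrightarrow> char (distr M borel \<xi>) t"
      by (rule conv_prob_char[OF ito_block_measurable[OF B] rv conv])
    have "(\<lambda>q. complex_of_real (exp (- (w q * t^2) / 2))) \<longlonglongrightarrow> complex_of_real (exp (- (?v * t^2) / 2))"
      by (intro tendsto_intros wv) auto
    then show "(\<lambda>q. char (distr M borel (?W q)) t) \<longlonglongrightarrow> complex_of_real (exp (- (?v * t^2) / 2))"
      by (rule Lim_transform_eventually) (rule eventually_mono[OF eventually_gt_at_top[of 0]], rule cW[symmetric])
  qed
  then have "char (distr M borel \<xi>) = char (density lborel (normal_density 0 (sqrt ?v)))"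
    using vpos by (auto simp: char_normal_density power_mult_distrib)
  then have "distr M borel \<xi> = density lborel (normal_density 0 (sqrt ?v))"
  proof (rule Levy_uniqueness[rotated 2])
    show "real_distribution (distr M borel \<xi>)" using rv by (rule real_distribution_distr)
    have "prob_space (density lborel (normal_density 0 (sqrt ?v)))" using vpos by (intro prob_space_normal_density) simp
    then show "real_distribution (density lborel (normal_density 0 (sqrt ?v)))"
      by (intro real_distribution.intro real_distribution_axioms.intro) auto
  qed
  moreover have "distr M borel \<xi> = distr M lborel \<xi>" by (intro distr_cong) auto
  ultimately show "distributed M lborel \<xi> (normal_density 0 (sqrt ?v))"
    using rv by (simp add: distributed_def)
qed

text \<open>The underlying normals are the \<open>n\<close> increments of the integral and the
  \<open>n\<close> noise variables, standardised. Their joint independence is first shown with the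
  increments replaced by Riemann sums on disjoint blocks of one grid, where it follows from the
  Brownian motion and its independence of the noise, and then carried to the limit.\<close>

theorem y0_gaussian_array:
  fixes s2 :: "real \<Rightarrow> real" and P :: "(nat \<times> nat) set"
  assumes B: "std_brownian_motion B" and n: "n > 0" and \<delta>: "\<delta> > 0"
    and X: "\<And>t. t \<in> {0..1} \<Longrightarrow> wiener_integral B (\<lambda>s. sqrt (s2 s)) t (X t)"
    and eps: "\<And>i. distributed M lborel (eps i) (normal_density 0 \<delta>)" "indep_vars (\<lambda>_. borel) eps UNIV"
    and ind: "indep_set
           (sigma_sets (space M) {B t -` U \<inter> space M | t U. U \<in> sets borel})
           (sigma_sets (space M) {eps i -` U \<inter> space M | i U. U \<in> sets borel})"
    and pos: "\<And>t. t \<in> {0..1} \<Longrightarrow> s2 t > 0" and cont: "continuous_on {0..1} s2"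
    and H: "\<And>s t. s \<in> {0..1} \<Longrightarrow> t \<in> {0..1} \<Longrightarrow> \<bar>s2 s - s2 t\<bar> \<le> C * \<bar>s - t\<bar> powr a" and C: "C \<ge> 0" and a: "a > 0"
    and P: "finite P"
  shows "gaussian_array P (\<lambda>p. y0 X eps n g (fst p) (snd p)) (y0_cov s2 \<delta> n g)"
proof -
  define \<sigma> where "\<sigma> = (\<lambda>s. sqrt (s2 s))"
  define I where "I = {1..n} <+> {1..n}"
  define \<xi> where "\<xi> i \<omega> = X (real i / real n) \<omega> - (if i = 1 then 0 else X (real (i - 1) / real n) \<omega>)" for i \<omega>
  define V where "V = case_sum \<xi> eps"
  let ?\<eta> = "\<lambda>q. 1 / (real n * real q)"
  \<comment> \<open>Approximations on the grid of mesh \<open>1 / (n q)\<close>: only the increments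
    of the integral are replaced by Riemann sums, the noise variables stay as they are.\<close>
  define W where "W q = case_sum (\<lambda>i. ito_block B \<sigma> (?\<eta> q) {(i - 1) * q..<i * q}) eps" for q :: nat
  have I: "finite I" "I \<noteq> {}" using n by (auto simp: I_def)
  have rvX: "random_variable borel (X (real i / real n))" if "i \<le> n" for i
    using X[of "real i / real n"] that n by (auto simp: wiener_integral_def)
  have rve: "random_variable borel (eps i)" for i
    using eps(2) by (simp add: indep_vars_def)
  have rv\<xi>: "random_variable borel (\<xi> i)" if "i \<in> {1..n}" for i
    unfolding \<xi>_def[abs_def] using that rvX[of i] rvX[of "i - 1"] by (cases "i = 1") auto
  have rvW: "random_variable borel (ito_block B \<sigma> \<eta> K)" for \<eta> K by (rule ito_block_measurable[OF B])
  have cS: "conv_prob (\<lambda>q. ito_block B \<sigma> (?\<eta> q) {..<j * q}) (X (real j / real n))" if "j \<in> {1..n}" for j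
    unfolding \<sigma>_def by (rule wiener_integral_conv_prob) (use X that n in auto)
  have c\<xi>: "conv_prob (\<lambda>q. ito_block B \<sigma> (?\<eta> q) {(i - 1) * q..<i * q}) (\<xi> i)" if i: "i \<in> {1..n}" for i
  proof (cases "i = 1")
    case True
    have "\<xi> i = X (real i / real n)" using True by (auto simp: \<xi>_def)
    then show ?thesis using cS[OF i] True by (simp add: atLeast0LessThan)
  next
    case False
    have e: "ito_block B \<sigma> (?\<eta> q) {(i - 1) * q..<i * q} \<omega> = ito_block B \<sigma> (?\<eta> q) {..<i * q} \<omega> - ito_block B \<sigma> (?\<eta> q) {..<(i - 1) * q} \<omega>" for q \<omega>
    proof -
      have "{..<i * q} = {..<(i - 1) * q} \<union> {(i - 1) * q..<i * q}" by (simp add: ivl_disj_un_one(2))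
      moreover have "{..<(i - 1) * q} \<inter> {(i - 1) * q..<i * q} = {}" by auto
      ultimately show ?thesis unfolding ito_block_def by (simp add: sum.union_disjoint)
    qed
    have "(\<lambda>q. ito_block B \<sigma> (?\<eta> q) {(i - 1) * q..<i * q}) = (\<lambda>q \<omega>. ito_block B \<sigma> (?\<eta> q) {..<i * q} \<omega> - ito_block B \<sigma> (?\<eta> q) {..<(i - 1) * q} \<omega>)"
      by (intro ext) (rule e)
    moreover have "conv_prob (\<lambda>q \<omega>. ito_block B \<sigma> (?\<eta> q) {..<i * q} \<omega> - ito_block B \<sigma> (?\<eta> q) {..<(i - 1) * q} \<omega>)
        (\<lambda>\<omega>. X (real i / real n) \<omega> - X (real (i - 1) / real n) \<omega>)"
      by (rule conv_prob_diff[OF rvW rvX rvW rvX cS cS]) (use i False in auto)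
    moreover have "\<xi> i = (\<lambda>\<omega>. X (real i / real n) \<omega> - X (real (i - 1) / real n) \<omega>)" using False by (auto simp: \<xi>_def)
    ultimately show ?thesis by (simp only:)
  qed
  have indV: "indep_vars (\<lambda>_. borel) V I"
  proof (rule indep_vars_limit[OF I, where W = W])
    fix i assume i: "i \<in> I"
    show "random_variable borel (V i)" using i rv\<xi> rve by (auto simp: V_def I_def)
    show "random_variable borel (W q i)" for q using i rvW rve by (auto simp: W_def I_def)
    show "conv_prob (\<lambda>q. W q i) (V i)"
    proof (cases i)
      case (Inl l)
      then show ?thesis using c\<xi>[of l] i by (auto simp: W_def V_def I_def)
    next
      case (Inr l)
      then show ?thesis by (simp add: W_def V_def conv_prob_def)
    qed
  next
    fix f and q :: nat assume f: "\<And>i. i \<in> I \<Longrightarrow> lip01 (f i)" and q: "0 < q"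
    let ?U = "\<lambda>i. ito_block B \<sigma> (?\<eta> q) {(i - 1) * q..<i * q}"
    let ?GA = "{B t -` U \<inter> space M | t U. U \<in> sets borel}" and ?GB = "{eps i -` U \<inter> space M | i U. U \<in> sets borel}"
    have [measurable]: "random_variable borel (B t)" for t using B by (simp add: std_brownian_motion_def)
    have GA: "?GA \<subseteq> events" "?GB \<subseteq> events" using rve by auto
    have mB: "B t \<in> borel_measurable (sigma (space M) ?GA)" for t
      by (rule measurableI) (use GA sets.space_closed[of M] in \<open>auto simp: space_measure_of_conv intro!: sigma_sets.Basic\<close>)
    have me: "eps t \<in> borel_measurable (sigma (space M) ?GB)" for t
      by (rule measurableI) (use GA sets.space_closed[of M] in \<open>auto simp: space_measure_of_conv intro!: sigma_sets.Basic\<close>)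
    have "expectation (\<lambda>\<omega>. (\<Prod>i\<in>{1..n}. f (Inl i) (?U i \<omega>)) * (\<Prod>i\<in>{1..n}. f (Inr i) (eps i \<omega>))) =
        (\<Prod>i\<in>{1..n}. expectation (\<lambda>\<omega>. f (Inl i) (?U i \<omega>))) * (\<Prod>i\<in>{1..n}. expectation (\<lambda>\<omega>. f (Inr i) (eps i \<omega>)))"
    proof (rule expectation_prod_indep_set[where U = ?U and V = eps and f = "\<lambda>i. f (Inl i)" and g = "\<lambda>i. f (Inr i)", OF _ _ _ _ GA _ me ind])
      show "indep_vars (\<lambda>_. borel) ?U {1..n}"
      proof (rule ito_block_indep[OF B, where m = "n * q"])
        show "{(i - 1) * q..<i * q} \<subseteq> {..<n * q}" if "i \<in> {1..n}" for i
        proof -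
          have "i * q \<le> n * q" using that by (intro mult_right_mono) auto
          then show ?thesis by (meson atLeastLessThan_iff lessThan_iff less_le_trans subsetI)
        qed
        show "disjoint_family_on (\<lambda>i. {(i - 1) * q..<i * q}) {1..n}"
          unfolding disjoint_family_on_def
        proof (intro ballI impI)
          fix i j assume ij: "i \<in> {1..n}" "j \<in> {1..n}" "i \<noteq> j"
          have *: "{(i - 1) * q..<i * q} \<inter> {(j - 1) * q..<j * q} = {}" if "i < j" for i j
          proof -
            have "i * q \<le> (j - 1) * q" using that by (intro mult_right_mono) auto
            then show ?thesis by auto
          qed
          show "{(i - 1) * q..<i * q} \<inter> {(j - 1) * q..<j * q} = {}"
            using ij *[of i j] *[of j i] by (cases "i < j") (auto simp: Int_commute)
        qed
      qed (use n q in simp)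
      show "indep_vars (\<lambda>_. borel) eps {1..n}" by (rule indep_vars_subset[OF eps(2)]) simp
      show "?U i \<in> borel_measurable (sigma (space M) ?GA)" for i
        unfolding ito_block_def by (intro borel_measurable_sum borel_measurable_times borel_measurable_diff mB) simp
    qed (auto intro!: f simp: I_def)
    then show "expectation (\<lambda>\<omega>. \<Prod>i\<in>I. f i (W q i \<omega>)) = (\<Prod>i\<in>I. expectation (\<lambda>\<omega>. f i (W q i \<omega>)))"
      unfolding I_def by (simp add: prod.Plus W_def)
  qed
  have d\<xi>: "cell_var s2 n i > 0" "distributed M lborel (\<xi> i) (normal_density 0 (sqrt (cell_var s2 n i)))" if "i \<in> {1..n}" for i
    using increment_distribution[OF B n that pos cont H C a _ rv\<xi>[OF that]] c\<xi>[OF that] by (auto simp: \<sigma>_def)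
  define sd where "sd = case_sum (\<lambda>i. sqrt (cell_var s2 n i)) (\<lambda>_::nat. \<delta>)"
  have sd: "sd i > 0" "distributed M lborel (V i) (normal_density 0 (sd i))" if "i \<in> I" for i
    using that d\<xi> eps(1) \<delta> by (auto simp: I_def sd_def V_def)
  define Z where "Z i \<omega> = V i \<omega> / sd i" for i \<omega>
  \<comment> \<open>The minus sign on the increments is that of \<open>y0\<close>; on the noise,
    summation by parts turns it into a plus sign and a forward difference.\<close>
  define co where "co p = case_sum (\<lambda>i. - cell_avg g n p i * sqrt (cell_var s2 n i)) (\<lambda>i. \<delta> * (cell_avg g n p (Suc i) - cell_avg g n p i))" for p
  show ?thesis
    unfolding gaussian_array_def
  proof (intro conjI P exI[of _ I] exI[of _ Z] exI[of _ co] I ballI)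
    show "indep_vars (\<lambda>_. borel) Z I"
      unfolding Z_def[abs_def] by (rule indep_vars_compose2[OF indV]) simp
    show "distributed M lborel (Z i) std_normal_density" if "i \<in> I" for i
      using sd[OF that] normal_standard_normal_convert[of "sd i" "V i" 0] by (simp add: Z_def[abs_def])
    show "y0_cov s2 \<delta> n g p q = (\<Sum>i\<in>I. co p i * co q i)" for p q
    proof -
      have "(\<Sum>i\<in>I. co p i * co q i) = (\<Sum>i\<in>{1..n}. cell_avg g n p i * sqrt (cell_var s2 n i) * (cell_avg g n q i * sqrt (cell_var s2 n i))) +
        (\<Sum>i\<in>{1..n}. \<delta> * (cell_avg g n p (Suc i) - cell_avg g n p i) * (\<delta> * (cell_avg g n q (Suc i) - cell_avg g n q i)))"
        unfolding I_def by (simp add: sum.Plus co_def)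
      also have "(\<Sum>i\<in>{1..n}. cell_avg g n p i * sqrt (cell_var s2 n i) * (cell_avg g n q i * sqrt (cell_var s2 n i))) =
         (\<Sum>i\<in>{1..n}. cell_var s2 n i * (cell_avg g n p i * cell_avg g n q i))"
      proof (intro sum.cong refl)
        fix i assume "i \<in> {1..n}"
        then have "sqrt (cell_var s2 n i) * sqrt (cell_var s2 n i) = cell_var s2 n i" using d\<xi>(1) by (simp add: less_imp_le)
        then show "cell_avg g n p i * sqrt (cell_var s2 n i) * (cell_avg g n q i * sqrt (cell_var s2 n i)) =
          cell_var s2 n i * (cell_avg g n p i * cell_avg g n q i)" by (metis mult.assoc mult.commute)
      qed
      also have "(\<Sum>i\<in>{1..n}. \<delta> * (cell_avg g n p (Suc i) - cell_avg g n p i) * (\<delta> * (cell_avg g n q (Suc i) - cell_avg g n q i))) =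
        \<delta>^2 * (\<Sum>i=1..n. (cell_avg g n p (Suc i) - cell_avg g n p i) * (cell_avg g n q (Suc i) - cell_avg g n q i))"
        by (simp add: sum_distrib_left power2_eq_square mult_ac)
      finally show ?thesis by (simp add: y0_cov_def)
    qed
    show "y0 X eps n g (fst p) (snd p) \<omega> = (\<Sum>i\<in>I. co p i * Z i \<omega>)" for p \<omega>
    proof -
      let ?c = "cell_avg g n p"
      have "(\<Sum>i\<in>I. co p i * Z i \<omega>) = (\<Sum>i\<in>{1..n}. co p (Inl i) * Z (Inl i) \<omega>) + (\<Sum>i\<in>{1..n}. co p (Inr i) * Z (Inr i) \<omega>)"
        unfolding I_def by (simp add: sum.Plus)
      also have "(\<Sum>i\<in>{1..n}. co p (Inl i) * Z (Inl i) \<omega>) = (\<Sum>i\<in>{1..n}. - ?c i * \<xi> i \<omega>)"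
        by (intro sum.cong refl) (use d\<xi>(1) in \<open>force simp: co_def Z_def V_def sd_def\<close>)
      also have "(\<Sum>i\<in>{1..n}. co p (Inr i) * Z (Inr i) \<omega>) = - (\<Sum>i\<in>{1..n}. (?c i - ?c (Suc i)) * eps i \<omega>)"
        unfolding sum_negf[symmetric]
        by (intro sum.cong refl) (use \<delta> in \<open>simp add: co_def Z_def V_def sd_def algebra_simps\<close>)
      also have "(\<Sum>i\<in>{1..n}. (?c i - ?c (Suc i)) * eps i \<omega>) = (\<Sum>i\<in>{1..n}. ?c i * (eps i \<omega> - (if i = 1 then 0 else eps (i - 1) \<omega>)))"
        using sum_by_parts_shift[of ?c "\<lambda>i. eps i \<omega>" "n - 1"] n by (simp add: cell_avg_def[of g n p "Suc n"])
      also have "(\<Sum>i\<in>{1..n}. - ?c i * \<xi> i \<omega>) + - \<dots> = (\<Sum>i\<in>{1..n}. - ?c i * (\<xi> i \<omega> + (eps i \<omega> - (if i = 1 then 0 else eps (i - 1) \<omega>))))"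
        by (simp add: sum_negf[symmetric] sum.distrib[symmetric] algebra_simps)
      also have "\<dots> = y0 X eps n g (fst p) (snd p) \<omega>"
        unfolding y0_def by (intro sum.cong refl) (auto simp: cell_avg_def \<xi>_def Yobs_def)
      finally show ?thesis by simp
    qed
  qed
qed

end

section \<open>Cell averages of the test functions\<close>

lemma card_nats_in_interval:
  assumes "S \<subseteq> {i::nat. a < real i \<and> real i < b}" "a \<le> b"
  shows "finite S" "real (card S) \<le> b - a + 1"
proof -
  have sub: "int ` S \<subseteq> {\<lfloor>a\<rfloor> + 1..\<lceil>b\<rceil> - 1}"
  proof
    fix x assume "x \<in> int ` S"
    then obtain i where i: "x = int i" "a < real i" "real i < b" using assms by auto
    then have "\<lfloor>a\<rfloor> < x" "x < \<lceil>b\<rceil>" by (simp_all add: floor_less_iff less_ceiling_iff)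
    then show "x \<in> {\<lfloor>a\<rfloor> + 1..\<lceil>b\<rceil> - 1}" by simp
  qed
  then have f: "finite (int ` S)" by (rule finite_subset) simp
  then show "finite S" by (simp add: finite_image_iff)
  have "card S = card (int ` S)" by (simp add: card_image)
  also have "\<dots> \<le> card {\<lfloor>a\<rfloor> + 1..\<lceil>b\<rceil> - 1}" by (rule card_mono[OF _ sub]) simp
  finally have "card S \<le> nat (\<lceil>b\<rceil> - 1 - \<lfloor>a\<rfloor>)" by simp
  moreover have "real_of_int (\<lceil>b\<rceil> - 1 - \<lfloor>a\<rfloor>) \<le> b - a + 1" by linarith
  moreover have "0 \<le> b - a + 1" using assms by simp
  ultimately show "real (card S) \<le> b - a + 1"
    by (smt (verit) of_nat_0 nat_eq_iff of_int_of_nat_eq of_nat_mono)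
qed

lemma abs_sin_diff_le: "\<bar>sin x - sin y\<bar> \<le> \<bar>x - y :: real\<bar>"
proof -
  have "norm (sin x - sin y) \<le> 1 * norm (x - y)"
    by (rule field_differentiable_bound[where S = UNIV and f' = "\<lambda>x. cos x"]) (auto intro!: derivative_eq_intros)
  then show ?thesis by simp
qed

text \<open>On a sine sampled with step \<open>y\<close>, minus the second difference has eigenvalue
  \<open>4 * (sin (y / 2))^2\<close>, against \<open>y^2\<close> in the continuous case. Factor the
  difference of squares and use the cubic remainder of the sine.\<close>

lemma abs_four_sin_sq_le: "\<bar>4 * (sin (y / 2))^2 - y\<^sup>2\<bar> \<le> y ^ 4 / 12" for y :: real
proof -
  have *: "\<bar>sin x - x\<bar> \<le> \<bar>x\<bar> ^ 3 / 6" for x :: real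
    using Maclaurin_sin_bound[of x 3] by (simp add: sin_coeff_def numeral_eq_Suc)
  have "\<bar>sin x\<bar> \<le> \<bar>x\<bar>" for x :: real using abs_sin_diff_le[of x 0] by simp
  let ?x = "y / 2"
  have "4 * (sin ?x)^2 - y\<^sup>2 = 4 * ((sin ?x - ?x) * (sin ?x + ?x))"
    by (simp add: power2_eq_square algebra_simps)
  then have "\<bar>4 * (sin ?x)^2 - y\<^sup>2\<bar> = 4 * (\<bar>sin ?x - ?x\<bar> * \<bar>sin ?x + ?x\<bar>)"
    by (simp only: abs_mult abs_numeral)
  also have "\<dots> \<le> 4 * ((\<bar>?x\<bar> ^ 3 / 6) * (2 * \<bar>?x\<bar>))"
    using \<open>\<And>x. \<bar>sin x\<bar> \<le> \<bar>x\<bar>\<close>[of ?x] by (intro mult_left_mono mult_mono *) (linarith | simp)+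
  also have "\<dots> = y ^ 4 / 12" by (simp add: field_simps numeral_eq_Suc)
  finally show ?thesis .
qed

context
  fixes g :: real and G :: nat
  assumes G: "G > 0" and g: "g = 1 / real G"
begin

lemma g_pos: "g > 0" using G g by simp

lemma Phi_eq_0: "t \<le> real k * g \<or> (real k + 1) * g \<le> t \<Longrightarrow> Phi g j k t = 0"
proof -
  assume t: "t \<le> real k * g \<or> (real k + 1) * g \<le> t"
  have "Phi g j k t = 0" if "t = (real k + 1) * g"
  proof -
    have "(t - real k * g) / g = 1" using that g_pos by (simp add: field_simps)
    then have "real j * pi * (t - real k * g) / g = real j * pi" by (metis mult.right_neutral times_divide_eq_right)
    then show ?thesis by (simp add: Phi_def)
  qed
  moreover have "Phi g j k t = 0" if "t = real k * g" using that by (simp add: Phi_def)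
  moreover have "Phi g j k t = 0" if "t < real k * g \<or> (real k + 1) * g < t" using that by (auto simp: Phi_def)
  ultimately show ?thesis using t by fastforce
qed

lemma Phi_grid: "Phi g j k (real m * g) = 0"
proof (rule Phi_eq_0)
  show "real m * g \<le> real k * g \<or> (real k + 1) * g \<le> real m * g"
  proof (cases "m \<le> k")
    case False
    then have "real k + 1 \<le> real m" by linarith
    then show ?thesis using g_pos by (simp add: mult_right_mono)
  qed (use g_pos in \<open>simp add: mult_right_mono\<close>)
qed

context
  fixes j :: nat
  assumes j: "j > 0"
begin

text \<open>Clamping the argument to \<open>[0,1]\<close> replaces the indicator, because the sine
  vanishes at both block ends. One formula on the whole line makes the global bounds below free of
  case distinctions.\<close>

lemma Phi_clamp: "Phi g j k t = sqrt (2 * g) / (pi * real j) * sin (real j * pi * max 0 (min 1 ((t - real k * g) / g)))"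
proof (cases "real k * g \<le> t \<and> t \<le> (real k + 1) * g")
  case True
  then have "0 \<le> (t - real k * g) / g" "(t - real k * g) / g \<le> 1"
    using g_pos by (auto simp: field_simps)
  then have "max 0 (min 1 ((t - real k * g) / g)) = (t - real k * g) / g" by simp
  then show ?thesis using True by (simp add: Phi_def)
next
  case False
  have "(t - real k * g) / g \<le> 0 \<or> (t - real k * g) / g \<ge> 1" using False g_pos by (auto simp: field_simps)
  then have "max 0 (min 1 ((t - real k * g) / g)) = 0 \<or> max 0 (min 1 ((t - real k * g) / g)) = 1" by auto
  moreover have "sin (real j * pi) = 0" by simp
  ultimately have "sin (real j * pi * max 0 (min 1 ((t - real k * g) / g))) = 0" by (elim disjE; simp only:; simp)
  moreover have "Phi g j k t = 0" using False by (auto simp: Phi_def)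
  ultimately show ?thesis by simp
qed

lemma Phi_bound: "\<bar>Phi g j k t\<bar> \<le> sqrt (2 * g) / (pi * real j)"
proof -
  have "\<bar>Phi g j k t\<bar> \<le> sqrt (2 * g) / (pi * real j) * 1"
    unfolding Phi_clamp abs_mult using g_pos j by (intro mult_mono) auto
  then show ?thesis by simp
qed

text \<open>The frequency cancels: the slope is at most \<open>sqrt (2 * g) / (pi * j)\<close> times
  \<open>j * pi / g\<close>. The constant is therefore uniform in \<open>j\<close>, which the bounds
  for high frequencies rely on.\<close>

lemma Phi_lipschitz: "\<bar>Phi g j k s - Phi g j k t\<bar> \<le> sqrt (2 / g) * \<bar>s - t\<bar>"
proof -
  let ?c = "\<lambda>t. max 0 (min 1 ((t - real k * g) / g))"
  have "\<bar>?c s - ?c t\<bar> \<le> \<bar>(s - real k * g) / g - (t - real k * g) / g\<bar>" by linarith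
  also have "\<dots> = \<bar>s - t\<bar> / g" using g_pos by (simp flip: diff_divide_distrib)
  finally have c: "\<bar>?c s - ?c t\<bar> \<le> \<bar>s - t\<bar> / g" .
  have "\<bar>Phi g j k s - Phi g j k t\<bar> = sqrt (2 * g) / (pi * real j) * \<bar>sin (real j * pi * ?c s) - sin (real j * pi * ?c t)\<bar>"
    unfolding Phi_clamp right_diff_distrib[symmetric] abs_mult using g_pos by simp
  also have "\<dots> \<le> sqrt (2 * g) / (pi * real j) * \<bar>real j * pi * ?c s - real j * pi * ?c t\<bar>"
    using g_pos by (intro mult_left_mono abs_sin_diff_le) auto
  also have "\<dots> = sqrt (2 * g) * \<bar>?c s - ?c t\<bar>"
    unfolding right_diff_distrib[symmetric] abs_mult using j by simp
  also have "\<dots> \<le> sqrt (2 * g) * (\<bar>s - t\<bar> / g)"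
    using c g_pos by (intro mult_left_mono) auto
  also have "\<dots> = sqrt (2 / g) * \<bar>s - t\<bar>"
    using g_pos by (simp add: real_sqrt_mult real_sqrt_divide field_simps)
  finally show ?thesis .
qed

lemma Phi_continuous: "continuous_on S (Phi g j k)"
proof -
  have "((\<lambda>y. Phi g j k y - Phi g j k x) \<longlongrightarrow> 0) (at x)" for x
  proof (rule Lim_null_comparison)
    show "((\<lambda>y. sqrt (2 / g) * \<bar>y - x\<bar>) \<longlongrightarrow> 0) (at x)" by (rule tendsto_eq_intros refl | simp)+
  qed (use Phi_lipschitz in auto)
  then have "continuous_on UNIV (Phi g j k)"
    by (auto simp: continuous_on_eq_continuous_at continuous_at intro: LIM_zero_cancel)
  then show ?thesis by (rule continuous_on_subset) simp
qed

lemma Phi_integrable: "Phi g j k integrable_on {x..y}"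
  by (intro integrable_continuous_real Phi_continuous)

end

lemma Phi_mult_disjoint: "k \<noteq> k' \<Longrightarrow> Phi g j k t * Phi g j' k' t = 0"
proof -
  assume kk: "k \<noteq> k'"
  have *: "Phi g j k t * Phi g j' k' t = 0" if "k < k'" for j j' k k'
  proof (cases "t \<le> real k' * g")
    case True then show ?thesis using Phi_eq_0[of t k'] by simp
  next
    case False
    have "(real k + 1) * g \<le> real k' * g" using that g_pos by (intro mult_right_mono) auto
    then show ?thesis using False Phi_eq_0[of t k] by simp
  qed
  show ?thesis using kk *[of k k' j j'] *[of k' k j' j] by (cases "k < k'") (auto simp: mult.commute)
qed

lemma sin_sin_integral:
  assumes "j > 0" "j' > 0"
  shows "((\<lambda>t. sin (real j * pi * (t - c) / g) * sin (real j' * pi * (t - c) / g)) has_integral (if j = j' then g / 2 else 0)) {c..c + g}"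
proof (cases "j = j'")
  case True
  define a where "a = real j * pi / g"
  have a: "a > 0" using assms g_pos by (simp add: a_def)
  define F where "F = (\<lambda>t. t / 2 - sin (2 * a * t) / (4 * a))"
  have "((\<lambda>t. sin (real j * pi * (t - c) / g) * sin (real j' * pi * (t - c) / g)) has_integral (F (c + g - c) - F (c - c))) {c..c + g}"
  proof (rule fundamental_theorem_of_calculus[where f = "\<lambda>t. F (t - c)"])
    fix s assume "s \<in> {c..c + g}"
    define t where "t = s - c"
    have "(F has_real_derivative (1 / 2 - cos (2 * a * t) / 2)) (at t)"
      unfolding F_def using a by (auto intro!: derivative_eq_intros simp: field_simps)
    moreover have "1 / 2 - cos (2 * a * t) / 2 = sin (a * t) * sin (a * t)"
      using cos_double_sin[of "a * t"] unfolding mult.assoc power2_eq_square by linarith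
    moreover have "sin (a * t) * sin (a * t) = sin (real j * pi * (s - c) / g) * sin (real j' * pi * (s - c) / g)"
      using True by (simp add: a_def t_def)
    ultimately have "(F has_real_derivative sin (real j * pi * (s - c) / g) * sin (real j' * pi * (s - c) / g)) (at (s + - c))"
      by (simp add: t_def)
    then show "((\<lambda>t. F (t - c)) has_vector_derivative sin (real j * pi * (s - c) / g) * sin (real j' * pi * (s - c) / g)) (at s within {c..c + g})"
      unfolding DERIV_shift by (simp add: has_real_derivative_iff_has_vector_derivative has_vector_derivative_at_within)
  qed (use g_pos in simp)
  moreover have "F g - F 0 = g / 2"
  proof -
    have "2 * a * g = real (2 * j) * pi" using g_pos by (simp add: a_def)
    then have "sin (2 * a * g) = 0" by (metis sin_npi)
    then show ?thesis by (simp add: F_def)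
  qed
  ultimately show ?thesis using True by simp
next
  case False
  define a b where "a = real j * pi / g" and "b = real j' * pi / g"
  have ab: "a - b \<noteq> 0" "a + b \<noteq> 0"
  proof -
    have "a > 0" "b > 0" using assms g_pos by (auto simp: a_def b_def)
    then show "a + b \<noteq> 0" by linarith
    have "a - b = (real j - real j') * pi / g" by (simp add: a_def b_def algebra_simps diff_divide_distrib)
    then show "a - b \<noteq> 0" using False g_pos by simp
  qed
  define F where "F = (\<lambda>t. sin ((a - b) * t) / (2 * (a - b)) - sin ((a + b) * t) / (2 * (a + b)))"
  have "((\<lambda>t. sin (real j * pi * (t - c) / g) * sin (real j' * pi * (t - c) / g)) has_integral (F (c + g - c) - F (c - c))) {c..c + g}"
  proof (rule fundamental_theorem_of_calculus[where f = "\<lambda>t. F (t - c)"])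
    fix s assume "s \<in> {c..c + g}"
    define t where "t = s - c"
    have "(F has_real_derivative ((a - b) * cos ((a - b) * t) / (2 * (a - b)) - (a + b) * cos ((a + b) * t) / (2 * (a + b)))) (at t)"
    proof -
      have "((\<lambda>t. sin (m * t) / (2 * m)) has_real_derivative m * cos (m * t) / (2 * m)) (at t)" for m
        by (rule DERIV_cdivide) (auto intro!: derivative_eq_intros)
      then show ?thesis unfolding F_def by (intro DERIV_diff)
    qed
    moreover have "(a - b) * cos ((a - b) * t) / (2 * (a - b)) - (a + b) * cos ((a + b) * t) / (2 * (a + b)) = sin (a * t) * sin (b * t)"
    proof -
      have "m * z / (2 * m) = z / 2" if "m \<noteq> 0" for m z :: real using that by simp
      from this[OF ab(1)] this[OF ab(2)]
      have "(a - b) * cos ((a - b) * t) / (2 * (a - b)) = cos ((a - b) * t) / 2" "(a + b) * cos ((a + b) * t) / (2 * (a + b)) = cos ((a + b) * t) / 2" .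
      moreover have "cos ((a - b) * t) = cos (a * t) * cos (b * t) + sin (a * t) * sin (b * t)"
        "cos ((a + b) * t) = cos (a * t) * cos (b * t) - sin (a * t) * sin (b * t)"
        by (simp_all only: left_diff_distrib distrib_right cos_diff cos_add)
      ultimately show ?thesis by linarith
    qed
    ultimately have "(F has_real_derivative sin (a * t) * sin (b * t)) (at t)" by (simp only:)
    moreover have "sin (a * t) * sin (b * t) = sin (real j * pi * (s - c) / g) * sin (real j' * pi * (s - c) / g)"
      by (simp add: a_def b_def t_def)
    ultimately have "(F has_real_derivative sin (real j * pi * (s - c) / g) * sin (real j' * pi * (s - c) / g)) (at (s + - c))"
      by (simp add: t_def)
    then show "((\<lambda>t. F (t - c)) has_vector_derivative sin (real j * pi * (s - c) / g) * sin (real j' * pi * (s - c) / g)) (at s within {c..c + g})"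
      unfolding DERIV_shift by (simp add: has_real_derivative_iff_has_vector_derivative has_vector_derivative_at_within)
  qed (use g_pos in simp)
  moreover have "F g - F 0 = 0"
  proof -
    have "(a - b) * g = of_int (int j - int j') * pi" "(a + b) * g = of_int (int j + int j') * pi"
      using g_pos by (simp_all add: a_def b_def field_simps)
    then have "sin ((a - b) * g) = 0" "sin ((a + b) * g) = 0" by (simp_all only: sin_times_pi_eq_0 Ints_of_int)
    then show ?thesis by (simp add: F_def)
  qed
  ultimately show ?thesis using False by simp
qed

lemma Phi_orthogonal:
  assumes "j > 0" "j' > 0" "k < G"
  shows "integral {0..1} (\<lambda>t. Phi g j k t * Phi g j' k' t) = (if j = j' \<and> k = k' then g\<^sup>2 / (pi * real j)^2 else 0)"
proof (cases "k = k'")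
  case False
  have "(\<lambda>t. Phi g j k t * Phi g j' k' t) = (\<lambda>_. 0)"
    using Phi_mult_disjoint[OF False] by (intro ext)
  then show ?thesis using False by simp
next
  case True
  let ?S = "{real k * g..(real k + 1) * g}" and ?c = "sqrt (2 * g) / (pi * real j) * (sqrt (2 * g) / (pi * real j'))"
  have "((\<lambda>t. sin (real j * pi * (t - real k * g) / g) * sin (real j' * pi * (t - real k * g) / g)) has_integral (if j = j' then g / 2 else 0)) ?S"
    using sin_sin_integral[OF assms(1,2), of "real k * g"] by (simp add: algebra_simps)
  from has_integral_mult_right[OF this, of ?c]
  have "((\<lambda>t. Phi g j k t * Phi g j' k' t) has_integral ?c * (if j = j' then g / 2 else 0)) ?S"
    by (rule has_integral_eq[rotated]) (auto simp: Phi_def True)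
  then have "((\<lambda>t. Phi g j k t * Phi g j' k' t) has_integral ?c * (if j = j' then g / 2 else 0)) {0..1}"
  proof (rule has_integral_on_superset)
    show "Phi g j k t * Phi g j' k' t = 0" if "t \<notin> ?S" for t using that Phi_eq_0[of t k] by auto
    have "real k + 1 \<le> real G" using assms by linarith
    then have "(real k + 1) * g \<le> real G * g" using g_pos by (intro mult_right_mono) auto
    also have "\<dots> = 1" using G g by simp
    finally have "(real k + 1) * g \<le> 1" .
    moreover have "0 \<le> real k * g" using g_pos by simp
    ultimately show "?S \<subseteq> {0..1}" by auto
  qed
  moreover have "?c * (if j = j' then g / 2 else 0) = (if j = j' then g\<^sup>2 / (pi * real j)^2 else 0)"
    using g_pos by (auto simp: power2_eq_square field_simps)
  ultimately show ?thesis using True integral_unique by auto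
qed

end

section \<open>Averages over a sliding cell and the discrete second difference\<close>

lemma average_near:
  fixes f :: "real \<Rightarrow> real"
  assumes n: "n > 0" and f: "f integrable_on {x..x + 1 / real n}"
    and b: "\<And>s. s \<in> {x..x + 1 / real n} \<Longrightarrow> \<bar>f s - v\<bar> \<le> r"
  shows "\<bar>real n * integral {x..x + 1 / real n} f - v\<bar> \<le> r"
proof -
  have r: "r \<ge> 0" using b[of x] n by simp
  have hi: "((\<lambda>s. f s - v) has_integral (integral {x..x + 1 / real n} f - v / real n)) (cbox x (x + 1 / real n))"
    using has_integral_diff[OF integrable_integral[OF f] has_integral_const_real[of v x "x + 1 / real n"]] n
    by (simp add: content_real)
  have "norm (integral {x..x + 1 / real n} f - v / real n) \<le> r * measure lborel (cbox x (x + 1 / real n))"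
    by (rule has_integral_bound[OF r hi]) (use b in auto)
  then have "\<bar>integral {x..x + 1 / real n} f - v / real n\<bar> \<le> r / real n" using n by (simp add: content_real)
  then have "real n * \<bar>integral {x..x + 1 / real n} f - v / real n\<bar> \<le> r" using n by (simp add: field_simps)
  moreover have "real n * \<bar>integral {x..x + 1 / real n} f - v / real n\<bar> = \<bar>real n * integral {x..x + 1 / real n} f - v\<bar>"
    using n abs_mult[of "real n" "integral {x..x + 1 / real n} f - v / real n"] by (simp add: right_diff_distrib)
  ultimately show ?thesis by simp
qed

text \<open>Taken at a real position rather than at a cell index, so that shifts by
  \<open>1 / n\<close> in both directions, also out of \<open>[0,1]\<close>, need no special
  treatment.\<close>

definition blk_avg :: "real \<Rightarrow> nat \<Rightarrow> nat \<times> nat \<Rightarrow> real \<Rightarrow> real" where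
  "blk_avg g n p x = real n * integral {x..x + 1 / real n} (Phi g (fst p) (snd p))"

context
  fixes g :: real and G n :: nat
  assumes G: "G > 0" and g: "g = 1 / real G" and n: "n \<ge> G"
begin

lemmas Phi_zero = Phi_eq_0[OF G g]

lemma n_pos: "n > 0" using G n by simp

lemma mesh_pos: "g > 0" using g_pos[OF G g] .

lemma gn_ge_1: "1 \<le> g * real n"
  using mult_left_mono[of "real G" "real n" g] mesh_pos G g n by simp

lemma inv_n_le_g: "1 / real n \<le> g" using gn_ge_1 n_pos by (simp add: field_simps)

definition valid :: "nat \<times> nat \<Rightarrow> bool" where "valid p \<longleftrightarrow> fst p > 0 \<and> snd p < G"

lemma block_end: "valid p \<Longrightarrow> (real (snd p) + 1) * g \<le> 1"
proof -
  assume "valid p"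
  then have "real (snd p) + 1 \<le> real G" by (simp add: valid_def)
  then have "(real (snd p) + 1) * g \<le> real G * g" using mesh_pos by (intro mult_right_mono) auto
  then show ?thesis using G g by simp
qed

lemma Phi_int: "valid p \<Longrightarrow> Phi g (fst p) (snd p) integrable_on {x..y}"
  by (rule Phi_integrable[OF G g]) (simp add: valid_def)

lemma blk_avg_near:
  assumes p: "valid p" and "\<And>s. s \<in> {x..x + 1 / real n} \<Longrightarrow> \<bar>Phi g (fst p) (snd p) s - v\<bar> \<le> r"
  shows "\<bar>blk_avg g n p x - v\<bar> \<le> r"
  unfolding blk_avg_def by (rule average_near[OF n_pos Phi_int[OF p] assms(2)])

lemma Phi_lip: "valid p \<Longrightarrow> \<bar>Phi g (fst p) (snd p) s - Phi g (fst p) (snd p) t\<bar> \<le> sqrt (2 / g) * \<bar>s - t\<bar>"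
  by (rule Phi_lipschitz[OF G g]) (simp add: valid_def)

lemma blk_avg_close:
  assumes p: "valid p" and t: "t \<in> {x..x + 1 / real n}"
  shows "\<bar>Phi g (fst p) (snd p) t - blk_avg g n p x\<bar> \<le> sqrt (2 / g) / real n"
proof -
  have "\<bar>blk_avg g n p x - Phi g (fst p) (snd p) t\<bar> \<le> sqrt (2 / g) * (1 / real n)"
  proof (rule blk_avg_near[OF p])
    fix s assume "s \<in> {x..x + 1 / real n}"
    then have "\<bar>s - t\<bar> \<le> 1 / real n" using t by auto
    then have "sqrt (2 / g) * \<bar>s - t\<bar> \<le> sqrt (2 / g) * (1 / real n)" using mesh_pos by (intro mult_left_mono) auto
    then show "\<bar>Phi g (fst p) (snd p) s - Phi g (fst p) (snd p) t\<bar> \<le> sqrt (2 / g) * (1 / real n)"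
      using Phi_lip[OF p, of s t] by linarith
  qed
  then show ?thesis by (simp add: abs_minus_commute)
qed

lemma blk_avg_bound: "valid p \<Longrightarrow> \<bar>blk_avg g n p x\<bar> \<le> sqrt (2 * g) / (pi * real (fst p))"
  using blk_avg_near[of p x 0 "sqrt (2 * g) / (pi * real (fst p))"] Phi_bound[OF G g, of "fst p" "snd p"]
  by (simp add: valid_def)

lemma blk_avg_zero: "valid p \<Longrightarrow> x + 1 / real n \<le> real (snd p) * g \<or> (real (snd p) + 1) * g \<le> x \<Longrightarrow> blk_avg g n p x = 0"
  using blk_avg_near[of p x 0 0] Phi_zero[of _ "snd p" "fst p"] by force

text \<open>Every \<open>Phi\<close> vanishes at all multiples of \<open>g\<close>, and a cell whose
  second difference sees such a point stays within \<open>2 / n\<close> of it. The range of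
  \<open>m\<close> describes exactly the cell and its two neighbours.\<close>

lemma blk_avg_grid:
  assumes p: "valid p" and m: "x - 1 / real n < real m * g" "real m * g < x + 2 / real n"
  shows "\<bar>blk_avg g n p x\<bar> \<le> sqrt (2 / g) * (2 / real n)"
proof -
  have "\<bar>blk_avg g n p x - 0\<bar> \<le> sqrt (2 / g) * (2 / real n)"
  proof (rule blk_avg_near[OF p])
    fix s assume s: "s \<in> {x..x + 1 / real n}"
    have "\<bar>s - real m * g\<bar> \<le> 2 / real n" using s m by (auto simp: abs_le_iff field_simps)
    then have "sqrt (2 / g) * \<bar>s - real m * g\<bar> \<le> sqrt (2 / g) * (2 / real n)" using mesh_pos by (intro mult_left_mono) auto
    then show "\<bar>Phi g (fst p) (snd p) s - 0\<bar> \<le> sqrt (2 / g) * (2 / real n)"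
      using Phi_lip[OF p, of s "real m * g"] Phi_grid[OF G g, of "fst p" "snd p" m] by simp
  qed
  then show ?thesis by simp
qed

lemma blk_avg_shift: "blk_avg g n p (x + c) = real n * integral {x..x + 1 / real n} (\<lambda>t. Phi g (fst p) (snd p) (t + c))"
proof -
  have "integral {x..x + 1 / real n} (Phi g (fst p) (snd p) \<circ> (+) c) = integral {x + c..x + 1 / real n + c} (Phi g (fst p) (snd p))"
    by (rule integral_shift_Icc_real)
  then show ?thesis by (simp add: blk_avg_def o_def add_ac)
qed

lemma Phi_shift_int: assumes p: "valid p" shows "(\<lambda>t. Phi g (fst p) (snd p) (t + c)) integrable_on {x..y}"
proof -
  have "continuous_on {x..y} (\<lambda>t. Phi g (fst p) (snd p) (t + c))"
    by (rule continuous_on_compose2[OF Phi_continuous[OF G g, of "fst p" UNIV]])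
       (use p in \<open>auto simp: valid_def intro!: continuous_intros\<close>)
  then show ?thesis by (rule integrable_continuous_real)
qed

lemma blk_avg_lip: assumes p: "valid p" shows "\<bar>blk_avg g n p (x + 1 / real n) - blk_avg g n p x\<bar> \<le> sqrt (2 / g) / real n"
proof -
  let ?f = "\<lambda>t. Phi g (fst p) (snd p) (t + 1 / real n) - Phi g (fst p) (snd p) t"
  have "\<bar>real n * integral {x..x + 1 / real n} ?f - 0\<bar> \<le> sqrt (2 / g) * (1 / real n)"
  proof (rule average_near[OF n_pos])
    show "?f integrable_on {x..x + 1 / real n}" by (intro integrable_diff Phi_shift_int Phi_int p)
    show "\<bar>?f s - 0\<bar> \<le> sqrt (2 / g) * (1 / real n)" for s
      using Phi_lip[OF p, of "s + 1 / real n" s] by simp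
  qed
  moreover have "real n * integral {x..x + 1 / real n} ?f = blk_avg g n p (x + 1 / real n) - blk_avg g n p x"
    unfolding blk_avg_shift using Phi_shift_int[OF p] Phi_int[OF p]
    by (subst Henstock_Kurzweil_Integration.integral_diff) (simp_all add: blk_avg_def right_diff_distrib)
  ultimately show ?thesis by simp
qed

text \<open>The cell averages of a sine satisfy an exact second-order recurrence with eigenvalue $-\lambda_j$; it fails only on the few cells next to the block boundary.\<close>
definition lam :: "nat \<Rightarrow> real" where "lam j = 4 * (sin (real j * pi / (g * real n) / 2))^2"

definition second_defect :: "nat \<times> nat \<Rightarrow> real \<Rightarrow> real" where
  "second_defect p x = blk_avg g n p (x + 1 / real n) - 2 * blk_avg g n p x + blk_avg g n p (x - 1 / real n) + lam (fst p) * blk_avg g n p x"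

lemma second_defect_zero:
  assumes p: "valid p" and x: "\<not> (x - 1 / real n < real (snd p) * g \<and> real (snd p) * g < x + 2 / real n)"
    "\<not> (x - 1 / real n < real (Suc (snd p)) * g \<and> real (Suc (snd p)) * g < x + 2 / real n)"
  shows "second_defect p x = 0"
proof -
  let ?k = "real (snd p)" and ?\<eta> = "1 / real n"
  have \<eta>: "?\<eta> > 0" using n_pos by simp
  have x2: "2 / real n = ?\<eta> + ?\<eta>" by simp
  \<comment> \<open>The three neighbouring cells lie to the left of the block, to its right, or
    inside it. The first two cases have only zero averages; in the third, \<open>Phi\<close> is a
    pure sine on all three cells.\<close>
  consider "x + ?\<eta> + ?\<eta> \<le> ?k * g" | "(?k + 1) * g \<le> x - ?\<eta>" | "?k * g \<le> x - ?\<eta>" "x + ?\<eta> + ?\<eta> \<le> (?k + 1) * g"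
    using x unfolding x2 of_nat_Suc by (smt (verit))
  then show ?thesis
  proof cases
    case 1
    then have "blk_avg g n p y = 0" if "y \<le> x + ?\<eta>" for y using that by (intro blk_avg_zero[OF p]) linarith
    then show ?thesis using \<eta> by (simp add: second_defect_def)
  next
    case 2
    then have "blk_avg g n p y = 0" if "y \<ge> x - ?\<eta>" for y using that by (intro blk_avg_zero[OF p]) linarith
    then show ?thesis using \<eta> by (simp add: second_defect_def)
  next
    case 3
    let ?F = "Phi g (fst p) (snd p)" and ?a = "real (fst p) * pi / (g * real n)"
    have eq: "?F (t + ?\<eta>) - 2 * ?F t + ?F (t + - ?\<eta>) + lam (fst p) * ?F t = 0" if t: "t \<in> {x..x + ?\<eta>}" for t
    proof -
      have i: "?F s = sqrt (2 * g) / (pi * real (fst p)) * sin (real (fst p) * pi * (s - ?k * g) / g)" if "\<bar>s - t\<bar> \<le> ?\<eta>" for s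
        using that t 3 by (auto simp: Phi_def)
      define u where "u = real (fst p) * pi * (t - ?k * g) / g"
      have au: "real (fst p) * pi * (t + ?\<eta> - ?k * g) / g = u + ?a" "real (fst p) * pi * (t + - ?\<eta> - ?k * g) / g = u - ?a"
        using mesh_pos n_pos by (simp_all add: u_def field_simps)
      have "sin (u + ?a) - 2 * sin u + sin (u - ?a) = - lam (fst p) * sin u"
      proof -
        have "sin (u + ?a) + sin (u - ?a) = 2 * sin u * cos ?a" by (simp add: sin_add sin_diff)
        moreover have "cos ?a = 1 - lam (fst p) / 2" using cos_double_sin[of "?a / 2"] by (simp add: lam_def)
        moreover have "2 * z * (1 - l / 2) = 2 * z - l * z" for z l :: real by (simp add: field_simps)
        ultimately show ?thesis by simp
      qed
      then have s: "sin (u + ?a) - 2 * sin u + sin (u - ?a) + lam (fst p) * sin u = 0" by simp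
      have "?F (t + ?\<eta>) - 2 * ?F t + ?F (t + - ?\<eta>) + lam (fst p) * ?F t =
        sqrt (2 * g) / (pi * real (fst p)) * (sin (u + ?a) - 2 * sin u + sin (u - ?a) + lam (fst p) * sin u)"
        using i[of "t + ?\<eta>"] i[of t] i[of "t + - ?\<eta>"] \<eta> unfolding au u_def[symmetric]
        by (simp add: algebra_simps)
      then show ?thesis using s by simp
    qed
    have "second_defect p x = real n * integral {x..x + ?\<eta>} (\<lambda>t. ?F (t + ?\<eta>) - 2 * ?F t + ?F (t + - ?\<eta>) + lam (fst p) * ?F t)"
    proof -
      have "integral {x..x + ?\<eta>} (\<lambda>t. ?F (t + ?\<eta>) - 2 * ?F t + ?F (t + - ?\<eta>) + lam (fst p) * ?F t) =
        integral {x..x + ?\<eta>} (\<lambda>t. ?F (t + ?\<eta>)) - 2 * integral {x..x + ?\<eta>} ?F + integral {x..x + ?\<eta>} (\<lambda>t. ?F (t + - ?\<eta>)) + lam (fst p) * integral {x..x + ?\<eta>} ?F"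
      proof (rule integral_unique, intro has_integral_add has_integral_diff has_integral_mult_right)
      qed (intro integrable_integral Phi_shift_int Phi_int p)+
      moreover have "blk_avg g n p (x - ?\<eta>) = real n * integral {x..x + ?\<eta>} (\<lambda>t. ?F (t + - ?\<eta>))"
        using blk_avg_shift[of p x "- ?\<eta>"] by simp
      moreover have "N * a - 2 * (N * b) + N * c + l * (N * b) = N * (a - 2 * b + c + l * b)" for N a b c l :: real
        by (simp add: algebra_simps)
      ultimately show ?thesis
        unfolding second_defect_def by (simp only: blk_avg_shift[of p x "?\<eta>"] blk_avg_def[of g n p x])
    qed
    also have "\<dots> = 0" using integral_cong[of "{x..x + ?\<eta>}", OF eq] by simp
    finally show ?thesis .
  qed
qed

lemma lam_bounds: "0 \<le> lam j" "lam j \<le> 4" "\<bar>lam j - (real j * pi / (g * real n))\<^sup>2\<bar> \<le> (real j * pi / (g * real n)) ^ 4 / 12"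
  "lam j \<le> (real j * pi / (g * real n))^2"
proof -
  show "0 \<le> lam j" by (simp add: lam_def)
  have "\<bar>sin x\<bar> ^ 2 \<le> 1" for x :: real by (rule power_le_one) auto
  then show "lam j \<le> 4" by (simp add: lam_def)
  show "\<bar>lam j - (real j * pi / (g * real n))\<^sup>2\<bar> \<le> (real j * pi / (g * real n)) ^ 4 / 12"
    unfolding lam_def by (rule abs_four_sin_sq_le)
  have "\<bar>sin x\<bar> \<le> \<bar>x\<bar>" for x :: real using abs_sin_diff_le[of x 0] by simp
  then have "\<bar>sin x\<bar>\<^sup>2 \<le> \<bar>x\<bar>\<^sup>2" for x :: real by (intro power_mono) auto
  from this[of "real j * pi / (g * real n) / 2"]
  have "(sin (real j * pi / (g * real n) / 2))^2 \<le> (real j * pi / (g * real n) / 2)^2" by (simp only: power2_abs)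
  then show "lam j \<le> (real j * pi / (g * real n))^2" by (simp add: lam_def power_divide)
qed

text \<open>At a block end nothing cancels, but each piece is small: the eigenvalue term contributes
  \<open>4 * 2\<close> and the two first differences contribute 1 each, in units of
  \<open>sqrt (2 / g) / n\<close>.\<close>

lemma second_defect_bound:
  assumes p: "valid p" and m: "x - 1 / real n < real m * g" "real m * g < x + 2 / real n"
  shows "\<bar>second_defect p x\<bar> \<le> 10 * (sqrt (2 / g) / real n)"
proof -
  have "\<bar>lam (fst p) * blk_avg g n p x\<bar> \<le> 4 * (sqrt (2 / g) * (2 / real n))"
    unfolding abs_mult using lam_bounds(1,2)[of "fst p"] blk_avg_grid[OF p m] by (intro mult_mono) auto
  moreover have "\<bar>blk_avg g n p (x + 1 / real n) - blk_avg g n p x\<bar> \<le> sqrt (2 / g) / real n"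
    "\<bar>blk_avg g n p x - blk_avg g n p (x - 1 / real n)\<bar> \<le> sqrt (2 / g) / real n"
    using blk_avg_lip[OF p, of x] blk_avg_lip[OF p, of "x - 1 / real n"] by simp_all
  ultimately show ?thesis unfolding second_defect_def by (simp; linarith)
qed

text \<open>The agreement extends to the indices 0 and \<open>n + 1\<close>: the cells just left of
  0 and just right of 1 lie outside every block, so both sides vanish.\<close>

lemma cell_avg_blk:
  assumes p: "valid p" and i: "i \<le> Suc n"
  shows "cell_avg g n p i = blk_avg g n p ((real i - 1) / real n)"
proof -
  consider "i = 0" | "i = Suc n" | "1 \<le> i" "i \<le> n" using i by linarith
  then show ?thesis
  proof cases
    case 1
    have "blk_avg g n p ((real i - 1) / real n) = 0" using 1 mesh_pos n_pos by (intro blk_avg_zero[OF p]) (auto simp: field_simps)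
    then show ?thesis using 1 by (simp add: cell_avg_def)
  next
    case 2
    have "blk_avg g n p ((real i - 1) / real n) = 0" using 2 block_end[OF p] n_pos by (intro blk_avg_zero[OF p]) auto
    then show ?thesis using 2 by (simp add: cell_avg_def)
  next
    case 3
    then have "real (i - 1) / real n = (real i - 1) / real n" "(real i - 1) / real n + 1 / real n = real i / real n"
      using n_pos by (simp_all add: of_nat_diff field_simps)
    then show ?thesis using 3 by (simp add: cell_avg_def blk_avg_def)
  qed
qed

end

section \<open>Covariances of the block statistics\<close>

lemma summation_by_parts:
  fixes c d :: "nat \<Rightarrow> real"
  shows "(\<Sum>i=1..m. (c (Suc i) - c i) * (d (Suc i) - d i)) =
    - (\<Sum>i=1..m. (c (Suc i) - 2 * c i + c (i - 1)) * d i) + (c (Suc m) - c m) * d (Suc m) - (c 1 - c 0) * d 1"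
  by (induction m) (simp_all add: algebra_simps)

lemma integral_cells:
  fixes f :: "real \<Rightarrow> real"
  assumes n: "n > 0" and f: "\<And>x y. f integrable_on {x..y}"
  shows "integral {0..real m / real n} f = (\<Sum>i=1..m. integral {real (i - 1) / real n..real i / real n} f)"
proof (induction m)
  case (Suc m)
  have "integral {0..real m / real n} f + integral {real m / real n..real (Suc m) / real n} f = integral {0..real (Suc m) / real n} f"
    by (rule Henstock_Kurzweil_Integration.integral_combine) (use n f in \<open>auto simp: divide_right_mono\<close>)
  then show ?case using Suc by simp
qed simp

context
  fixes g :: real and G n :: nat
  assumes G: "G > 0" and g: "g = 1 / real G" and n: "n \<ge> G"
begin

lemma sample_size_pos: "n > 0" using n_pos[OF G g n] .
lemma width_pos: "g > 0" using g_pos[OF G g] .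
lemma one_le_width_n: "1 \<le> g * real n" using gn_ge_1[OF G g n] .

text \<open>Indices of the cells that can meet block \<open>k\<close>. There are at most
  \<open>g n + 2\<close> of them, hence at most \<open>3 g n\<close> since \<open>g n\<close> is at
  least 1.\<close>

definition active :: "nat \<Rightarrow> nat set" where
  "active k = {i \<in> {1..n}. real n * (real k * g) < real i \<and> real i < real n * ((real k + 1) * g) + 1}"

lemma card_active: "finite (active k)" "real (card (active k)) \<le> 3 * (g * real n)"
proof -
  have "real (card (active k)) \<le> (real n * ((real k + 1) * g) + 1) - real n * (real k * g) + 1"
    by (rule card_nats_in_interval(2)) (use one_le_width_n width_pos in \<open>auto simp: active_def algebra_simps\<close>)
  also have "\<dots> = g * real n + 2" by (simp add: algebra_simps)
  finally show "real (card (active k)) \<le> 3 * (g * real n)" using one_le_width_n by linarith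
qed (simp add: active_def)

lemma inactive:
  assumes p: "valid G p" and i: "i \<in> {1..n}" "i \<notin> active (snd p)"
  shows "cell_avg g n p i = 0" "\<And>t. t \<in> {real (i - 1) / real n..real i / real n} \<Longrightarrow> Phi g (fst p) (snd p) t = 0"
proof -
  have eq: "real (i - 1) = real i - 1" using i by (simp add: of_nat_diff)
  have "real i / real n \<le> real (snd p) * g \<or> (real (snd p) + 1) * g \<le> (real i - 1) / real n"
    using i sample_size_pos by (auto simp: active_def field_simps)
  then show z: "Phi g (fst p) (snd p) t = 0" if "t \<in> {real (i - 1) / real n..real i / real n}" for t
    using that unfolding eq by (intro Phi_eq_0[OF G g]) auto
  have "integral {real (i - 1) / real n..real i / real n} (Phi g (fst p) (snd p)) = integral {real (i - 1) / real n..real i / real n} (\<lambda>_. 0)"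
    by (intro integral_cong z)
  then show "cell_avg g n p i = 0" by (simp add: cell_avg_def del: of_nat_diff)
qed

lemma cell_avg_bound: assumes "valid G p" "i \<le> Suc n" shows "\<bar>cell_avg g n p i\<bar> \<le> sqrt (2 * g) / (pi * real (fst p))"
  using blk_avg_bound[OF G g n assms(1)] cell_avg_blk[OF G g n assms] by simp

text \<open>Passing to cell averages is an orthogonal projection, so the error is the inner product
  of the two residuals and hence quadratic in the oscillation \<open>sqrt (2 / g) / n\<close>. Over
  at most \<open>3 g n\<close> cells of length \<open>1 / n\<close> this adds up to
  \<open>6 / n^2\<close>, free of \<open>g\<close> and of the frequencies.\<close>

lemma cells_inner_product:
  assumes p: "valid G p" and q: "valid G q"
  shows "\<bar>(\<Sum>i=1..n. cell_avg g n p i * cell_avg g n q i) / real n - (if p = q then g\<^sup>2 / (pi * real (fst p))^2 else 0)\<bar> \<le> 6 / (real n)^2"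
proof -
  let ?P = "Phi g (fst p) (snd p)" and ?Q = "Phi g (fst q) (snd q)" and ?c = "cell_avg g n p" and ?d = "cell_avg g n q"
  let ?cell = "\<lambda>i. {real (i - 1) / real n..real i / real n}"
  have cont: "continuous_on S ?P" "continuous_on S ?Q" for S
    using p q by (auto intro!: Phi_continuous[OF G g] simp: valid_def[OF G g n])
  have io: "(\<lambda>t. ?P t * ?Q t) integrable_on {x..y}" for x y
    by (intro integrable_continuous_real continuous_intros cont)
  have orth: "integral {0..1} (\<lambda>t. ?P t * ?Q t) = (if p = q then g\<^sup>2 / (pi * real (fst p))^2 else 0)"
    using Phi_orthogonal[OF G g, of "fst p" "fst q" "snd p" "snd q"] p q by (simp add: valid_def[OF G g n] prod_eq_iff)
  have split: "integral {0..1} (\<lambda>t. ?P t * ?Q t) = (\<Sum>i=1..n. integral (?cell i) (\<lambda>t. ?P t * ?Q t))"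
    using integral_cells[OF sample_size_pos io, of n] sample_size_pos by simp
  have cellb: "\<bar>?c i * ?d i / real n - integral (?cell i) (\<lambda>t. ?P t * ?Q t)\<bar> \<le> (if i \<in> active (snd p) then 2 / g / (real n) ^ 3 else 0)"
    if i: "i \<in> {1..n}" for i
  proof (cases "i \<in> active (snd p)")
    case False
    have "integral (?cell i) (\<lambda>t. ?P t * ?Q t) = integral (?cell i) (\<lambda>t. 0)"
      by (intro integral_cong) (use inactive(2)[OF p i False] in auto)
    then show ?thesis using inactive(1)[OF p i False] False by simp
  next
    case True
    let ?x = "(real i - 1) / real n"
    have cell: "?cell i = {?x..?x + 1 / real n}" using i sample_size_pos by (simp add: of_nat_diff field_simps)
    have ca: "?c i = blk_avg g n p ?x" "?d i = blk_avg g n q ?x"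
      using i cell_avg_blk[OF G g n] p q by auto
    have iP: "integral (?cell i) ?P = ?c i / real n" "integral (?cell i) ?Q = ?d i / real n"
      using sample_size_pos unfolding cell ca by (simp_all add: blk_avg_def)
    have hi: "((\<lambda>t. (?P t - ?c i) * (?Q t - ?d i)) has_integral (integral (?cell i) (\<lambda>t. ?P t * ?Q t) - ?c i * ?d i / real n)) (cbox ?x (?x + 1 / real n))"
    proof -
      have hP: "(?P has_integral ?c i / real n) (?cell i)" "(?Q has_integral ?d i / real n) (?cell i)"
        using integrable_integral[OF integrable_continuous_real[OF cont(1)], of "real (i - 1) / real n" "real i / real n"]
          integrable_integral[OF integrable_continuous_real[OF cont(2)], of "real (i - 1) / real n" "real i / real n"] iP by simp_all
      have hc: "((\<lambda>t. ?c i * ?d i) has_integral ?c i * ?d i / real n) (?cell i)"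
        unfolding cell using has_integral_const_real[of "?c i * ?d i" ?x "?x + 1 / real n"] sample_size_pos by simp
      have "((\<lambda>t. ?P t * ?Q t - ?d i * ?P t - ?c i * ?Q t + ?c i * ?d i) has_integral
         (integral (?cell i) (\<lambda>t. ?P t * ?Q t) - ?d i * (?c i / real n) - ?c i * (?d i / real n) + ?c i * ?d i / real n)) (?cell i)"
        by (intro has_integral_add has_integral_diff has_integral_mult_right hP hc integrable_integral io)
      then show ?thesis unfolding cell by (simp add: algebra_simps)
    qed
    have "norm (integral (?cell i) (\<lambda>t. ?P t * ?Q t) - ?c i * ?d i / real n) \<le> (sqrt (2 / g) / real n) * (sqrt (2 / g) / real n) * measure lborel (cbox ?x (?x + 1 / real n))"
    proof (rule has_integral_bound[OF _ hi])
      fix t assume "t \<in> cbox ?x (?x + 1 / real n)"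
      then have t: "t \<in> {?x..?x + 1 / real n}" by simp
      show "norm ((?P t - ?c i) * (?Q t - ?d i)) \<le> (sqrt (2 / g) / real n) * (sqrt (2 / g) / real n)"
        unfolding real_norm_def abs_mult ca using width_pos
        by (intro mult_mono blk_avg_close[OF G g n p t] blk_avg_close[OF G g n q t]) auto
    qed (use width_pos in auto)
    also have "\<dots> = 2 / g / (real n) ^ 3" using width_pos sample_size_pos by (simp add: field_simps power3_eq_cube)
    finally show ?thesis using True by (simp add: abs_minus_commute)
  qed
  have "\<bar>(\<Sum>i=1..n. ?c i * ?d i) / real n - integral {0..1} (\<lambda>t. ?P t * ?Q t)\<bar> =
     \<bar>\<Sum>i=1..n. ?c i * ?d i / real n - integral (?cell i) (\<lambda>t. ?P t * ?Q t)\<bar>"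
    unfolding split by (simp add: sum_subtractf sum_divide_distrib)
  also have "\<dots> \<le> (\<Sum>i=1..n. if i \<in> active (snd p) then 2 / g / (real n) ^ 3 else 0)"
    by (rule order_trans[OF sum_abs sum_mono]) (rule cellb)
  finally have "\<bar>(\<Sum>i=1..n. ?c i * ?d i) / real n - integral {0..1} (\<lambda>t. ?P t * ?Q t)\<bar> \<le> (\<Sum>i=1..n. if i \<in> active (snd p) then 2 / g / (real n) ^ 3 else 0)" .
  also have "\<dots> = (\<Sum>i\<in>{1..n} \<inter> active (snd p). 2 / g / (real n) ^ 3)" by (rule sum.inter_restrict[symmetric]) simp
  also have "{1..n} \<inter> active (snd p) = active (snd p)" by (auto simp: active_def)
  also have "(\<Sum>i\<in>active (snd p). 2 / g / (real n) ^ 3) = real (card (active (snd p))) * (2 / g / (real n) ^ 3)" by simp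
  also have "\<dots> \<le> 3 * (g * real n) * (2 / g / (real n) ^ 3)"
    by (intro mult_right_mono card_active) (use width_pos in auto)
  also have "\<dots> = 6 / (real n)^2" using width_pos sample_size_pos by (simp add: field_simps power3_eq_cube power2_eq_square)
  finally show ?thesis unfolding orth .
qed

text \<open>On the active cells \<open>s2\<close> differs from its value at the block start by at
  most \<open>C * (2 * g) powr a\<close>, and two cell averages multiply to at most
  \<open>2 g / (j j')\<close>. With \<open>3 g n\<close> cells this gives the first term; freezing
  \<open>s2\<close> leaves the inner product, which gives the second.\<close>

lemma signal_approx:
  fixes s2 :: "real \<Rightarrow> real"
  assumes p: "valid G p" and q: "valid G q"
    and cont: "continuous_on {0..1} s2"
    and H: "\<And>s t. s \<in> {0..1} \<Longrightarrow> t \<in> {0..1} \<Longrightarrow> \<bar>s2 s - s2 t\<bar> \<le> C * \<bar>s - t\<bar> powr a" and C: "C \<ge> 0" and a: "a > 0"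
    and S: "\<And>t. t \<in> {0..1} \<Longrightarrow> \<bar>s2 t\<bar> \<le> S"
  shows "\<bar>(\<Sum>i=1..n. cell_var s2 n i * (cell_avg g n p i * cell_avg g n q i)) - (if p = q then s2 (real (snd p) * g) * (g^2 / (pi * real (fst p))^2) else 0)\<bar>
    \<le> 6 * C * 2 powr a * (g powr (2 + a) / (real (fst p) * real (fst q))) + 6 * S / (real n)^2"
proof -
  let ?c = "cell_avg g n p" and ?d = "cell_avg g n q" and ?s = "s2 (real (snd p) * g)"
  have k1: "real (snd p) * g \<in> {0..1}" using block_end[OF G g n p] width_pos by (auto simp: algebra_simps)
  have jp: "real (fst p) \<ge> 1" "real (fst q) \<ge> 1" using p q by (auto simp: valid_def[OF G g n])
  have cellb: "\<bar>cell_var s2 n i * (?c i * ?d i) - ?s / real n * (?c i * ?d i)\<bar> \<le>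
     (if i \<in> active (snd p) then C * (2 * g) powr a / real n * (2 * g / (real (fst p) * real (fst q))) else 0)" if i: "i \<in> {1..n}" for i
  proof (cases "i \<in> active (snd p)")
    case False
    then show ?thesis using inactive(1)[OF p i False] by simp
  next
    case True
    let ?x = "(real i - 1) / real n"
    have cell: "{real (i - 1) / real n..real i / real n} = {?x..?x + 1 / real n}" using i sample_size_pos by (simp add: of_nat_diff field_simps)
    have rng: "0 \<le> ?x" "?x + 1 / real n \<le> 1" using i sample_size_pos by (auto simp: field_simps)
    have act: "real (snd p) * g < ?x + 1 / real n" "?x < (real (snd p) + 1) * g"
      using True sample_size_pos by (auto simp: active_def field_simps)
    have ng: "1 / real n \<le> g" by (rule inv_n_le_g[OF G g n])
    have "\<bar>real n * integral {?x..?x + 1 / real n} s2 - ?s\<bar> \<le> C * (2 * g) powr a"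
    proof (rule average_near[OF sample_size_pos])
      show "s2 integrable_on {?x..?x + 1 / real n}"
        by (intro integrable_continuous_real continuous_on_subset[OF cont]) (use rng in auto)
      fix s assume s: "s \<in> {?x..?x + 1 / real n}"
      then have s1: "s \<in> {0..1}" using rng by auto
      have "\<bar>s - real (snd p) * g\<bar> \<le> 2 * g" using s act ng by (auto simp: abs_le_iff algebra_simps)
      then have "C * \<bar>s - real (snd p) * g\<bar> powr a \<le> C * (2 * g) powr a" using C a by (intro mult_left_mono powr_mono2) auto
      then show "\<bar>s2 s - ?s\<bar> \<le> C * (2 * g) powr a" using H[OF s1 k1] by linarith
    qed
    then have v: "\<bar>cell_var s2 n i - ?s / real n\<bar> \<le> C * (2 * g) powr a / real n"
    proof -
      assume h: "\<bar>real n * integral {?x..?x + 1 / real n} s2 - ?s\<bar> \<le> C * (2 * g) powr a"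
      have "cell_var s2 n i - ?s / real n = (real n * integral {?x..?x + 1 / real n} s2 - ?s) / real n"
        using sample_size_pos unfolding cell_var_def cell by (simp add: field_simps)
      then show ?thesis using h sample_size_pos by (simp add: abs_divide divide_right_mono)
    qed
    have "\<bar>?c i * ?d i\<bar> \<le> sqrt (2 * g) / (pi * real (fst p)) * (sqrt (2 * g) / (pi * real (fst q)))"
      unfolding abs_mult using i width_pos by (intro mult_mono cell_avg_bound p q) auto
    also have "\<dots> = 2 * g / (pi^2 * (real (fst p) * real (fst q)))" using width_pos by (simp add: power2_eq_square mult_ac)
    also have "\<dots> \<le> 2 * g / (1 * (real (fst p) * real (fst q)))"
    proof (intro divide_left_mono mult_right_mono mult_pos_pos)
      show "1 \<le> pi^2" using pi_ge_two by (intro one_le_power) simp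
    qed (use width_pos jp in auto)
    finally have "\<bar>?c i * ?d i\<bar> \<le> 2 * g / (real (fst p) * real (fst q))" by simp
    then have "\<bar>cell_var s2 n i - ?s / real n\<bar> * \<bar>?c i * ?d i\<bar> \<le> C * (2 * g) powr a / real n * (2 * g / (real (fst p) * real (fst q)))"
      using C by (intro mult_mono v) auto
    then show ?thesis using True by (simp add: abs_mult[symmetric] left_diff_distrib)
  qed
  let ?B = "C * (2 * g) powr a / real n * (2 * g / (real (fst p) * real (fst q)))"
  have "\<bar>(\<Sum>i=1..n. cell_var s2 n i * (?c i * ?d i)) - ?s * ((\<Sum>i=1..n. ?c i * ?d i) / real n)\<bar> =
     \<bar>\<Sum>i=1..n. cell_var s2 n i * (?c i * ?d i) - ?s / real n * (?c i * ?d i)\<bar>"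
    by (simp add: sum_subtractf sum_distrib_left sum_divide_distrib)
  also have "\<dots> \<le> (\<Sum>i=1..n. if i \<in> active (snd p) then ?B else 0)"
    by (rule order_trans[OF sum_abs sum_mono]) (rule cellb)
  finally have "\<bar>(\<Sum>i=1..n. cell_var s2 n i * (?c i * ?d i)) - ?s * ((\<Sum>i=1..n. ?c i * ?d i) / real n)\<bar> \<le> (\<Sum>i=1..n. if i \<in> active (snd p) then ?B else 0)" .
  also have "\<dots> = (\<Sum>i\<in>{1..n} \<inter> active (snd p). ?B)" by (rule sum.inter_restrict[symmetric]) simp
  also have "{1..n} \<inter> active (snd p) = active (snd p)" by (auto simp: active_def)
  also have "(\<Sum>i\<in>active (snd p). ?B) = real (card (active (snd p))) * ?B" by simp
  also have "\<dots> \<le> 3 * (g * real n) * ?B"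
    by (intro mult_right_mono card_active) (use width_pos C in auto)
  also have "\<dots> = 6 * C * 2 powr a * (g powr (2 + a) / (real (fst p) * real (fst q)))"
  proof -
    have "(2 * g) powr a = 2 powr a * g powr a" using width_pos by (simp add: powr_mult)
    moreover have "g powr 2 = g * g" using width_pos powr_realpow[of g 2] by (simp add: power2_eq_square)
    then have "g powr (2 + a) = g * g * g powr a" by (simp add: powr_add)
    ultimately show ?thesis using sample_size_pos by (simp add: field_simps)
  qed
  finally have 1: "\<bar>(\<Sum>i=1..n. cell_var s2 n i * (?c i * ?d i)) - ?s * ((\<Sum>i=1..n. ?c i * ?d i) / real n)\<bar> \<le>
    6 * C * 2 powr a * (g powr (2 + a) / (real (fst p) * real (fst q)))" .
  let ?I = "if p = q then g\<^sup>2 / (pi * real (fst p))^2 else 0"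
  have "\<bar>?s\<bar> * \<bar>(\<Sum>i=1..n. ?c i * ?d i) / real n - ?I\<bar> \<le> S * (6 / (real n)^2)"
    using S[OF k1] by (intro mult_mono cells_inner_product p q) auto
  then have 2: "\<bar>?s * ((\<Sum>i=1..n. ?c i * ?d i) / real n) - ?s * ?I\<bar> \<le> S * (6 / (real n)^2)"
    by (simp only: abs_mult[symmetric] right_diff_distrib)
  have 3: "S * (6 / (real n)^2) = 6 * S / (real n)^2" by simp
  have "?s * ?I = (if p = q then ?s * (g^2 / (pi * real (fst p))^2) else 0)" by simp
  with 1 2 3 show ?thesis by linarith
qed

end

section \<open>The noise part of the covariance\<close>

context
  fixes g :: real and G n :: nat
  assumes G: "G > 0" and g: "g = 1 / real G" and n: "n \<ge> G"
begin

lemma sample_count_pos: "n > 0" using n_pos[OF G g n] .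
lemma block_width_pos: "g > 0" using g_pos[OF G g] .
lemma one_le_block_n: "1 \<le> g * real n" using gn_ge_1[OF G g n] .

definition noise_form :: "nat \<times> nat \<Rightarrow> nat \<times> nat \<Rightarrow> real" where
  "noise_form p q = (\<Sum>i=1..n. (cell_avg g n p (Suc i) - cell_avg g n p i) * (cell_avg g n q (Suc i) - cell_avg g n q i))"

lemma cell_avg_step: assumes p: "valid G p" and i: "i \<le> n"
  shows "\<bar>cell_avg g n p (Suc i) - cell_avg g n p i\<bar> \<le> sqrt (2 / g) / real n"
proof -
  have "(real (Suc i) - 1) / real n = (real i - 1) / real n + 1 / real n" by (simp add: add_divide_distrib diff_divide_distrib)
  then show ?thesis
    using blk_avg_lip[OF G g n p, of "(real i - 1) / real n"] cell_avg_blk[OF G g n p] i by simp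
qed

lemma cell_avg_0: "cell_avg g n p 0 = 0" "cell_avg g n p (Suc n) = 0"
  by (simp_all add: cell_avg_def)

text \<open>Only the Lipschitz bound and the number of active cells enter, so the estimate holds at
  every frequency. It takes over where \<open>j\<close> exceeds \<open>g n\<close> and the sampled
  sine no longer resembles the true one.\<close>

lemma noise_crude:
  assumes p: "valid G p" and q: "valid G q"
  shows "\<bar>noise_form p q\<bar> \<le> 8 / real n"
proof -
  let ?k = "snd p"
  define S where "S = {i \<in> {1..n}. real n * (real ?k * g) - 1 < real i \<and> real i < real n * ((real ?k + 1) * g) + 1}"
  have fS: "finite S" by (simp add: S_def)
  have cS: "real (card S) \<le> 4 * (g * real n)"
  proof -
    have "real (card S) \<le> (real n * ((real ?k + 1) * g) + 1) - (real n * (real ?k * g) - 1) + 1"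
      by (rule card_nats_in_interval(2)) (use one_le_block_n block_width_pos in \<open>auto simp: S_def algebra_simps\<close>)
    also have "\<dots> = g * real n + 3" by (simp add: algebra_simps)
    finally show ?thesis using one_le_block_n by linarith
  qed
  have z: "cell_avg g n p (Suc i) - cell_avg g n p i = 0" if i: "i \<in> {1..n}" "i \<notin> S" for i
  proof -
    have "i \<notin> active g n ?k" using i by (auto simp: S_def active_def[OF G g n])
    then have 1: "cell_avg g n p i = 0" using inactive(1)[OF G g n p i(1)] by simp
    have "Suc i \<notin> active g n ?k" using i by (auto simp: S_def active_def[OF G g n])
    then have "cell_avg g n p (Suc i) = 0"
      using inactive(1)[OF G g n p, of "Suc i"] i(1) cell_avg_0(2)[of p] by (cases "i = n") auto
    then show ?thesis using 1 by simp
  qed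
  have "\<bar>noise_form p q\<bar> \<le> (\<Sum>i=1..n. if i \<in> S then 2 / g / (real n)^2 else 0)"
    unfolding noise_form_def
  proof (rule order_trans[OF sum_abs sum_mono])
    fix i assume i: "i \<in> {1..n}"
    have "\<bar>cell_avg g n p (Suc i) - cell_avg g n p i\<bar> * \<bar>cell_avg g n q (Suc i) - cell_avg g n q i\<bar> \<le> sqrt (2 / g) / real n * (sqrt (2 / g) / real n)"
      using i block_width_pos by (intro mult_mono cell_avg_step p q) auto
    also have "\<dots> = 2 / g / (real n)^2" using block_width_pos by (simp add: power2_eq_square)
    finally show "\<bar>(cell_avg g n p (Suc i) - cell_avg g n p i) * (cell_avg g n q (Suc i) - cell_avg g n q i)\<bar> \<le> (if i \<in> S then 2 / g / (real n)^2 else 0)"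
      using z[OF i] by (auto simp: abs_mult)
  qed
  also have "\<dots> = (\<Sum>i\<in>{1..n} \<inter> S. 2 / g / (real n)^2)" by (rule sum.inter_restrict[symmetric]) simp
  also have "{1..n} \<inter> S = S" by (auto simp: S_def)
  also have "(\<Sum>i\<in>S. 2 / g / (real n)^2) = real (card S) * (2 / g / (real n)^2)" by simp
  also have "\<dots> \<le> 4 * (g * real n) * (2 / g / (real n)^2)" by (intro mult_right_mono cS) (use block_width_pos in auto)
  also have "\<dots> = 8 / real n" using block_width_pos sample_count_pos by (simp add: power2_eq_square)
  finally show ?thesis .
qed

text \<open>Summation by parts turns the gradient form into minus the second difference paired with
  \<open>?d\<close>. Away from the block ends the recurrence replaces it by the eigenvalue times the
  inner product, and the eigenvalue is close to \<open>(j * pi / (g n))^2\<close>, which cancels the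
  squared norm \<open>g^2 / (pi j)^2\<close> up to the factor \<open>1 / n\<close>.\<close>

lemma noise_fine:
  assumes p: "valid G p" and q: "valid G q"
  shows "\<bar>noise_form p q - (if p = q then 1 / real n else 0)\<bar>
     \<le> (70 * (real (fst p) / (g * real n))^2 + 322 / (g * real n)) / real n"
proof -
  let ?c = "cell_avg g n p" and ?d = "cell_avg g n q" and ?k = "snd p"
  let ?x = "\<lambda>i. (real i - 1) / real n"
  define D where "D i = second_defect g n p (?x i)" for i
  define L where "L = sqrt (2 / g) / real n"
  have LL: "L * L = 2 / g / (real n)^2" using block_width_pos by (simp add: L_def power2_eq_square)
  have L0: "L \<ge> 0" using block_width_pos by (simp add: L_def)
  have Dc: "?c (Suc i) - 2 * ?c i + ?c (i - 1) = D i - lam g n (fst p) * ?c i" if i: "i \<in> {1..n}" for i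
  proof -
    have "?c (Suc i) = blk_avg g n p (?x i + 1 / real n)" "?c i = blk_avg g n p (?x i)" "?c (i - 1) = blk_avg g n p (?x i - 1 / real n)"
      using cell_avg_blk[OF G g n p] i by (auto simp: of_nat_diff add_divide_distrib diff_divide_distrib)
    then show ?thesis by (simp add: D_def second_defect_def[OF G g n])
  qed
  define Bad where "Bad m = {i \<in> {1..n}. ?x i - 1 / real n < real m * g \<and> real m * g < ?x i + 2 / real n}" for m
  have cB: "finite (Bad m)" "real (card (Bad m)) \<le> 4" for m
  proof -
    show "finite (Bad m)" by (simp add: Bad_def)
    have "Bad m \<subseteq> {i. real n * (real m * g) - 1 < real i \<and> real i < real n * (real m * g) + 2}"
    proof
      fix i assume i: "i \<in> Bad m"
      have "real n * (?x i - 1 / real n) = real i - 2" "real n * (?x i + 2 / real n) = real i + 1"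
        using sample_count_pos by (simp_all add: field_simps)
      moreover have "real n * (?x i - 1 / real n) < real n * (real m * g)" "real n * (real m * g) < real n * (?x i + 2 / real n)"
        using i sample_count_pos by (simp_all add: Bad_def)
      ultimately show "i \<in> {i. real n * (real m * g) - 1 < real i \<and> real i < real n * (real m * g) + 2}" by simp
    qed
    from card_nats_in_interval(2)[OF this] show "real (card (Bad m)) \<le> 4" by simp
  qed
  have Dz: "D i = 0" if "i \<in> {1..n}" "i \<notin> Bad ?k \<union> Bad (Suc ?k)" for i
    unfolding D_def by (rule second_defect_zero[OF G g n p]) (use that in \<open>auto simp: Bad_def\<close>)
  have Db: "\<bar>D i * ?d i\<bar> \<le> 20 * (L * L)" if "i \<in> Bad ?k \<union> Bad (Suc ?k)" for i
  proof -
    obtain m where m: "i \<in> {1..n}" "?x i - 1 / real n < real m * g" "real m * g < ?x i + 2 / real n"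
      using \<open>i \<in> Bad ?k \<union> Bad (Suc ?k)\<close> by (auto simp: Bad_def simp del: of_nat_Suc)
    have "\<bar>D i\<bar> \<le> 10 * L" using second_defect_bound[OF G g n p m(2,3)] by (simp add: D_def L_def)
    moreover have "\<bar>?d i\<bar> \<le> 2 * L"
      using blk_avg_grid[OF G g n q m(2,3)] cell_avg_blk[OF G g n q, of i] m(1) by (simp add: L_def mult.commute)
    ultimately have "\<bar>D i\<bar> * \<bar>?d i\<bar> \<le> 10 * L * (2 * L)" using L0 by (intro mult_mono) auto
    then show ?thesis by (simp add: abs_mult)
  qed
  \<comment> \<open>Each of the two block ends spoils at most four cells, and on a spoiled cell both
    factors are small, since \<open>q\<close> has its zeros at the same grid points:
    \<open>8 * 20 = 160\<close>.\<close>
  have Dsum: "\<bar>\<Sum>i=1..n. D i * ?d i\<bar> \<le> 160 * (L * L)"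
  proof -
    have "(\<Sum>i=1..n. D i * ?d i) = (\<Sum>i\<in>Bad ?k \<union> Bad (Suc ?k). D i * ?d i)"
      by (rule sum.mono_neutral_right) (use Dz in \<open>auto simp: Bad_def\<close>)
    then have "\<bar>\<Sum>i=1..n. D i * ?d i\<bar> \<le> (\<Sum>i\<in>Bad ?k \<union> Bad (Suc ?k). 20 * (L * L))"
      by (simp only:) (rule order_trans[OF sum_abs sum_mono], rule Db)
    also have "\<dots> = real (card (Bad ?k \<union> Bad (Suc ?k))) * (20 * (L * L))" by simp
    also have "\<dots> \<le> 8 * (20 * (L * L))"
    proof (intro mult_right_mono)
      have "card (Bad ?k \<union> Bad (Suc ?k)) \<le> card (Bad ?k) + card (Bad (Suc ?k))" by (rule card_Un_le)
      then show "real (card (Bad ?k \<union> Bad (Suc ?k))) \<le> 8" using cB(2)[of ?k] cB(2)[of "Suc ?k"] by linarith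
    qed (use L0 in auto)
    finally show ?thesis by simp
  qed
  have first: "\<bar>?c 1 * ?d 1\<bar> \<le> L * L"
    using cell_avg_step[OF p, of 0] cell_avg_step[OF q, of 0] L0
    by (auto simp: cell_avg_0 abs_mult L_def[symmetric] intro!: mult_mono)
  define I where "I = (if p = q then g\<^sup>2 / (pi * real (fst p))^2 else 0)"
  define E where "E = (\<Sum>i=1..n. ?c i * ?d i) / real n - I"
  have E: "\<bar>E\<bar> \<le> 6 / (real n)^2" unfolding E_def I_def by (rule cells_inner_product[OF G g n p q])
  have N: "noise_form p q = lam g n (fst p) * real n * I + (lam g n (fst p) * (real n * E) - (\<Sum>i=1..n. D i * ?d i) - ?c 1 * ?d 1)"
  proof -
    have "noise_form p q = - (\<Sum>i=1..n. (?c (Suc i) - 2 * ?c i + ?c (i - 1)) * ?d i) - ?c 1 * ?d 1"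
      unfolding noise_form_def by (subst summation_by_parts) (simp add: cell_avg_0)
    also have "(\<Sum>i=1..n. (?c (Suc i) - 2 * ?c i + ?c (i - 1)) * ?d i) = (\<Sum>i=1..n. D i * ?d i) - lam g n (fst p) * (\<Sum>i=1..n. ?c i * ?d i)"
      unfolding sum_distrib_left sum_subtractf[symmetric]
    proof (rule sum.cong[OF refl])
      fix i assume i: "i \<in> {1..n}"
      show "(?c (Suc i) - 2 * ?c i + ?c (i - 1)) * ?d i = D i * ?d i - lam g n (fst p) * (?c i * ?d i)"
        unfolding Dc[OF i] by (simp add: left_diff_distrib)
    qed
    also have "(\<Sum>i=1..n. ?c i * ?d i) = real n * (I + E)" using sample_count_pos by (simp add: E_def)
    finally show ?thesis by (simp add: algebra_simps)
  qed
  define y where "y = real (fst p) * pi / (g * real n)"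
  have y: "y > 0" using p block_width_pos sample_count_pos by (simp add: y_def valid_def[OF G g n])
  have lamE: "\<bar>lam g n (fst p) * (real n * E)\<bar> \<le> 6 * y^2 / real n"
  proof -
    have "\<bar>lam g n (fst p)\<bar> * (real n * \<bar>E\<bar>) \<le> y^2 * (real n * (6 / (real n)^2))"
      using lam_bounds(1,4)[OF G g n, of "fst p"] E by (intro mult_mono) (auto simp: y_def)
    also have "\<dots> = 6 * y^2 / real n" using sample_count_pos by (simp add: power2_eq_square)
    finally show ?thesis by (simp add: abs_mult)
  qed
  have lamI: "\<bar>lam g n (fst p) * real n * I - (if p = q then 1 / real n else 0)\<bar> \<le> y^2 / 12 / real n"
  proof (cases "p = q")
    case True
    have nI: "real n * I = 1 / (real n * y^2)"
      using True block_width_pos sample_count_pos p by (simp add: I_def y_def power2_eq_square valid_def[OF G g n] field_simps)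
    have "lam g n (fst p) * real n * I - 1 / real n = (lam g n (fst p) - y\<^sup>2) / (real n * y^2)"
      using y sample_count_pos unfolding mult.assoc nI by (simp add: field_simps)
    moreover have "\<bar>(lam g n (fst p) - y\<^sup>2) / (real n * y^2)\<bar> \<le> (y ^ 4 / 12) / (real n * y^2)"
      unfolding abs_divide using lam_bounds(3)[OF G g n, of "fst p"] y sample_count_pos
      by (intro frac_le) (auto simp: y_def[symmetric] abs_mult)
    moreover have "(y ^ 4 / 12) / (real n * y^2) = y^2 / 12 / real n" using y sample_count_pos by (simp add: field_simps power2_eq_square numeral_eq_Suc)
    ultimately show ?thesis using True by simp
  next
    case False
    then show ?thesis by (simp add: I_def)
  qed
  \<comment> \<open>The 160 from the spoiled cells and 1 from the first cell make 161; with
    \<open>L * L = 2 / g / n^2\<close> this becomes 322. Below, 70 bounds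
    \<open>7 * pi^2\<close>.\<close>
  have "\<bar>noise_form p q - (if p = q then 1 / real n else 0)\<bar> \<le> y^2 / 12 / real n + 6 * y^2 / real n + 161 * (L * L)"
    using lamI lamE Dsum first N by linarith
  also have "\<dots> \<le> 7 * y^2 / real n + 322 / (g * real n) / real n"
  proof -
    have "y^2 / 12 / real n + 6 * y^2 / real n = (73 / 12) * (y^2 / real n)" by (simp add: field_simps)
    also have "\<dots> \<le> 7 * (y^2 / real n)" by (intro mult_right_mono) auto
    finally show ?thesis unfolding LL by (simp add: power2_eq_square)
  qed
  also have "7 * y^2 / real n \<le> 70 * (real (fst p) / (g * real n))^2 / real n"
  proof (intro divide_right_mono)
    have "pi \<le> 3.15" using pi_approx by simp
    then have "pi^2 \<le> 3.15^2" by (intro power_mono) auto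
    then have "pi^2 \<le> 10" by (simp add: power2_eq_square)
    then have "7 * (pi^2 * (real (fst p) / (g * real n))^2) \<le> 7 * (10 * (real (fst p) / (g * real n))^2)" by (intro mult_left_mono mult_right_mono) auto
    then show "7 * y^2 \<le> 70 * (real (fst p) / (g * real n))^2" by (simp add: y_def power_divide power_mult_distrib mult_ac)
  qed simp
  finally show ?thesis by (simp add: add_divide_distrib)
qed

lemma noise_form_sym: "noise_form p q = noise_form q p"
  unfolding noise_form_def by (simp add: mult.commute)

text \<open>Interpolates between the two bounds with \<open>z = j / (g n)\<close>. For
  \<open>z <= 1\<close> both \<open>z^2\<close> and \<open>1 / (g n)\<close> are at most
  \<open>z\<close>, hence at most \<open>z powr (3/4)\<close>, and \<open>70 + 322 = 392\<close>;
  for \<open>z > 1\<close> the crude bound suffices. Working with the smaller of the two frequencies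
  yields the geometric mean.\<close>

lemma noise_approx:
  assumes p: "valid G p" and q: "valid G q"
  shows "\<bar>noise_form p q - (if p = q then 1 / real n else 0)\<bar>
     \<le> 392 * sqrt ((real (fst p) / (g * real n)) powr (3/4) / real n * ((real (fst q) / (g * real n)) powr (3/4) / real n))"
proof -
  have main: "\<bar>noise_form p q - (if p = q then 1 / real n else 0)\<bar>
     \<le> 392 * sqrt ((real (fst p) / (g * real n)) powr (3/4) / real n * ((real (fst q) / (g * real n)) powr (3/4) / real n))"
    if p: "valid G p" and q: "valid G q" and le: "fst p \<le> fst q" for p q
  proof -
    define z where "z = real (fst p) / (g * real n)"
    have gn: "g * real n > 0" using one_le_block_n by linarith
    have z: "z > 0" using p gn by (simp add: z_def valid_def[OF G g n])
    have zi: "1 / (g * real n) \<le> z" using p gn by (auto simp: z_def valid_def[OF G g n] intro!: divide_right_mono)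
    have zq: "z \<le> real (fst q) / (g * real n)" using le gn by (auto simp: z_def intro!: divide_right_mono)
    have b: "\<bar>noise_form p q - (if p = q then 1 / real n else 0)\<bar> \<le> 392 * z powr (3/4) / real n"
    proof (cases "z \<le> 1")
      case True
      have z1: "z \<le> z powr (3/4)" using powr_mono'[of "3/4" 1 z] z True by simp
      have "z^2 \<le> z" using z True by (simp add: power2_eq_square mult_left_le)
      then have "70 * z^2 + 322 / (g * real n) \<le> 392 * z powr (3/4)" using zi z1 by (simp; linarith)
      then have "(70 * z^2 + 322 / (g * real n)) / real n \<le> 392 * z powr (3/4) / real n" by (intro divide_right_mono) auto
      then show ?thesis using noise_fine[OF p q] unfolding z_def by linarith
    next
      case False
      then have "1 \<le> z powr (3/4)" by (intro ge_one_powr_ge_zero) auto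
      have "\<bar>noise_form p q - (if p = q then 1 / real n else 0)\<bar> \<le> 9 / real n"
        using noise_crude[OF p q] by (auto simp: abs_le_iff split: if_splits; linarith?) 
      also have "\<dots> \<le> 392 * z powr (3/4) / real n" using \<open>1 \<le> z powr (3/4)\<close> by (intro divide_right_mono) auto
      finally show ?thesis .
    qed
    have "z powr (3/4) / real n = sqrt (z powr (3/4) / real n * (z powr (3/4) / real n))"
      using real_sqrt_abs2[of "z powr (3/4) / real n"] by simp
    also have "\<dots> \<le> sqrt (z powr (3/4) / real n * ((real (fst q) / (g * real n)) powr (3/4) / real n))"
      using z zq by (intro real_sqrt_le_mono mult_left_mono divide_right_mono powr_mono2) auto
    finally show ?thesis using b by (simp add: z_def[symmetric])
  qed
  show ?thesis
  proof (cases "fst p \<le> fst q")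
    case True
    then show ?thesis by (rule main[OF p q])
  next
    case False
    then have "fst q \<le> fst p" by simp
    show ?thesis
      unfolding noise_form_sym[of p q] eq_commute[of p q] mult.commute[of "(real (fst p) / (g * real n)) powr (3/4) / real n"]
      by (rule main[OF q p \<open>fst q \<le> fst p\<close>])
  qed
qed

text \<open>The three terms come from the Hoelder oscillation of $\sigma^2$, from replacing $\Phi$ by its cell averages, and from the cells at the block boundary.\<close>
definition block_err :: "real \<Rightarrow> real \<Rightarrow> nat \<Rightarrow> real" where
  "block_err K a j = K * (g powr (2 + a) / (real j)^2 + 1 / (real n)^2 + (real j / (g * real n)) powr (3/4) / real n)"

text \<open>Each of the three error sources is already a geometric mean of a quantity at
  \<open>p\<close> and one at \<open>q\<close>. By Cauchy-Schwarz the sum of geometric means is at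
  most the geometric mean of the sums, which gives the product form exploited in all later sums over
  pairs.\<close>

theorem gram_approx:
  fixes s2 :: "real \<Rightarrow> real"
  assumes p: "valid G p" and q: "valid G q"
    and cont: "continuous_on {0..1} s2"
    and H: "\<And>s t. s \<in> {0..1} \<Longrightarrow> t \<in> {0..1} \<Longrightarrow> \<bar>s2 s - s2 t\<bar> \<le> C * \<bar>s - t\<bar> powr a" and C: "C \<ge> 0" and a: "a > 0"
    and S: "\<And>t. t \<in> {0..1} \<Longrightarrow> \<bar>s2 t\<bar> \<le> S"
    and K: "K \<ge> 6 * C * 2 powr a" "K \<ge> 6 * S" "K \<ge> 392 * \<delta>^2"
  shows "\<bar>y0_cov s2 \<delta> n g p q - (if p = q then s2 (real (snd p) * g) * (g^2 / (pi * real (fst p))^2) + \<delta>^2 / real n else 0)\<bar>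
     \<le> sqrt (block_err K a (fst p) * block_err K a (fst q))"
proof -
  have K0: "K \<ge> 0" using K(3) by (smt (verit) zero_le_power2)
  define A where "A j = g powr (2 + a) / (real j)^2" for j
  define B where "B = 1 / (real n)^2"
  define D where "D j = (real j / (g * real n)) powr (3/4) / real n" for j
  have nn: "A j \<ge> 0" "B \<ge> 0" "D j \<ge> 0" for j by (auto simp: A_def B_def D_def)
  have jp: "real (fst p) > 0" "real (fst q) > 0" using p q by (auto simp: valid_def[OF G g n])
  let ?j = "fst p" and ?j' = "fst q"
  have sA: "sqrt (A ?j * A ?j') = g powr (2 + a) / (real ?j * real ?j')"
    using jp by (simp add: A_def real_sqrt_mult real_sqrt_divide)
  have sB: "sqrt (B * B) = B" using nn by simp
  let ?N = "noise_form p q" and ?I = "if p = q then 1 / real n else 0"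
  let ?Sg = "\<Sum>i=1..n. cell_var s2 n i * (cell_avg g n p i * cell_avg g n q i)"
  let ?T = "if p = q then s2 (real (snd p) * g) * (g^2 / (pi * real (fst p))^2) else 0"
  have "\<bar>?Sg - ?T\<bar> \<le> 6 * C * 2 powr a * sqrt (A ?j * A ?j') + 6 * S * B"
    using signal_approx[OF G g n p q cont H C a S] unfolding sA B_def by simp
  also have "\<dots> \<le> K * sqrt (A ?j * A ?j') + K * sqrt (B * B)"
    unfolding sB by (intro add_mono mult_right_mono K) (use nn in auto)
  finally have 1: "\<bar>?Sg - ?T\<bar> \<le> K * sqrt (A ?j * A ?j') + K * sqrt (B * B)" .
  have "\<delta>^2 * \<bar>?N - ?I\<bar> \<le> \<delta>^2 * (392 * sqrt (D ?j * D ?j'))"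
    unfolding D_def by (intro mult_left_mono noise_approx p q) auto
  also have "\<dots> \<le> K * sqrt (D ?j * D ?j')" using mult_right_mono[OF K(3), of "sqrt (D ?j * D ?j')"] nn by (simp add: mult_ac)
  finally have 2: "\<bar>\<delta>\<^sup>2 * ?N - \<delta>\<^sup>2 * ?I\<bar> \<le> K * sqrt (D ?j * D ?j')"
    by (simp only: right_diff_distrib[symmetric] abs_mult abs_power2)
  have "y0_cov s2 \<delta> n g p q - (if p = q then s2 (real (snd p) * g) * (g^2 / (pi * real (fst p))^2) + \<delta>^2 / real n else 0) =
     (?Sg - ?T) + (\<delta>^2 * ?N - \<delta>\<^sup>2 * ?I)"
    by (simp add: y0_cov_def noise_form_def)
  then have "\<bar>y0_cov s2 \<delta> n g p q - (if p = q then s2 (real (snd p) * g) * (g^2 / (pi * real (fst p))^2) + \<delta>^2 / real n else 0)\<bar>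
     \<le> K * (sqrt (A ?j * A ?j') + sqrt (B * B) + sqrt (D ?j * D ?j'))"
    using 1 2 unfolding distrib_left by linarith
  also have "\<dots> \<le> K * sqrt ((A ?j + B + D ?j) * (A ?j' + B + D ?j'))"
  proof (intro mult_left_mono K0)
    \<comment> \<open>Cauchy-Schwarz for two vectors of length two, applied twice to merge three
      terms.\<close>
    have cs: "sqrt (u * u') + sqrt (v * v') \<le> sqrt ((u + v) * (u' + v'))" if "u \<ge> 0" "v \<ge> 0" "u' \<ge> 0" "v' \<ge> 0" for u v u' v' :: real
    proof (rule real_le_rsqrt)
      have "sqrt (u * u') * sqrt (v * v') = sqrt (u * v') * sqrt (v * u')" by (simp add: real_sqrt_mult mult_ac)
      moreover have "0 \<le> (sqrt (u * v') - sqrt (v * u'))^2" by simp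
      ultimately have "2 * (sqrt (u * u') * sqrt (v * v')) \<le> u * v' + v * u'"
        using that by (simp add: power2_diff)
      then show "(sqrt (u * u') + sqrt (v * v'))^2 \<le> (u + v) * (u' + v')"
        using that by (simp add: power2_sum algebra_simps)
    qed
    have "sqrt (A ?j * A ?j') + sqrt (B * B) + sqrt (D ?j * D ?j') \<le> sqrt ((A ?j + B) * (A ?j' + B)) + sqrt (D ?j * D ?j')"
      by (intro add_right_mono cs nn)
    also have "\<dots> \<le> sqrt ((A ?j + B + D ?j) * (A ?j' + B + D ?j'))" by (intro cs add_nonneg_nonneg nn)
    finally show "sqrt (A ?j * A ?j') + sqrt (B * B) + sqrt (D ?j * D ?j') \<le> sqrt ((A ?j + B + D ?j) * (A ?j' + B + D ?j'))" .
  qed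
  also have "\<dots> = sqrt (block_err K a (fst p) * block_err K a (fst q))"
  proof -
    have "block_err K a (fst p) * block_err K a (fst q) = K * K * ((A ?j + B + D ?j) * (A ?j' + B + D ?j'))"
      by (simp add: block_err_def A_def B_def D_def mult_ac)
    then show ?thesis using K0 by (simp only: real_sqrt_mult real_sqrt_mult_self abs_of_nonneg)
  qed
  finally show ?thesis .
qed

end

section \<open>The weights\<close>

text \<open>The integral test, phrased with an antiderivative: by the mean value theorem each
  increment of \<open>F\<close> is squeezed between two neighbouring terms of the sum.\<close>

lemma decreasing_sum_bounds:
  fixes F f :: "real \<Rightarrow> real"
  assumes D: "\<And>x. x \<ge> 0 \<Longrightarrow> (F has_real_derivative f x) (at x)"
    and dec: "\<And>x y. 0 \<le> x \<Longrightarrow> x \<le> y \<Longrightarrow> f y \<le> f x" and h: "h > 0"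
  shows "(\<Sum>j=1..J. f (real j / h) / h) \<le> F (real J / h) - F 0"
    and "F (real (Suc J) / h) - F (1 / h) \<le> (\<Sum>j=1..J. f (real j / h) / h)"
proof -
  have step: "f (real (Suc j) / h) / h \<le> F (real (Suc j) / h) - F (real j / h)"
    "F (real (Suc j) / h) - F (real j / h) \<le> f (real j / h) / h" for j
  proof -
    have lt: "real j / h < real (Suc j) / h" using h by (simp add: divide_strict_right_mono)
    have ge: "0 \<le> real j / h" using h by simp
    obtain z where z: "real j / h < z" "z < real (Suc j) / h" "F (real (Suc j) / h) - F (real j / h) = (real (Suc j) / h - real j / h) * f z"
      using MVT2[OF lt, of F f] D ge by force
    have e: "real (Suc j) / h - real j / h = 1 / h" by (simp add: add_divide_distrib)
    have "f (real (Suc j) / h) \<le> f z" "f z \<le> f (real j / h)" using z ge by (auto intro!: dec)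
    then show "f (real (Suc j) / h) / h \<le> F (real (Suc j) / h) - F (real j / h)"
      "F (real (Suc j) / h) - F (real j / h) \<le> f (real j / h) / h"
      using h unfolding z(3) e by (simp_all add: divide_right_mono)
  qed
  show "(\<Sum>j=1..J. f (real j / h) / h) \<le> F (real J / h) - F 0"
  proof (induction J)
    case (Suc J)
    then show ?case using step(1)[of J] by simp
  qed simp
  show "F (real (Suc J) / h) - F (1 / h) \<le> (\<Sum>j=1..J. f (real j / h) / h)"
  proof (induction J)
    case (Suc J)
    then show ?case using step(2)[of "Suc J"] by simp
  qed simp
qed

text \<open>\<open>-5/8\<close> is the slowest decay met later: \<open>-2\<close> from the weights,
  \<open>+1\<close> from \<open>j^2\<close>, and \<open>+3/8\<close> from the noise error of order
  \<open>j powr (3/4)\<close>. The sum converges because the decay is of order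
  \<open>x powr (-5/4)\<close>; with an exponent 1 in place of \<open>3/4\<close> it would diverge.
  The value 8 is twice the integral of \<open>(1 + x) powr (-5/4)\<close>.\<close>

lemma sum_powr_bound:
  assumes h: "h > 0"
  shows "(\<Sum>j=1..J. (1 + (real j / h)^2) powr (-5/8) / h) \<le> 8"
proof -
  have b: "(1 + x^2) powr (-5/8) \<le> 2 * (1 + x) powr (-5/4)" if x: "x \<ge> 0" for x :: real
  proof -
    have "0 \<le> (1 - x)^2" by simp
    then have "(1 + x)^2 / 2 \<le> 1 + x^2" by (simp add: power2_diff power2_sum)
    then have "(1 + x^2) powr (-5/8) \<le> ((1 + x)^2 / 2) powr (-5/8)"
      using x by (intro powr_mono2') auto
    also have "\<dots> = (1 + x) powr (-5/4) * 2 powr (5/8)"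
      using x by (simp add: powr_divide powr_powr powr_minus_divide flip: powr_numeral)
    also have "\<dots> \<le> (1 + x) powr (-5/4) * 2 powr 1" by (intro mult_left_mono powr_mono) auto
    finally show ?thesis by simp
  qed
  let ?F = "\<lambda>x::real. - 4 * (1 + x) powr (-1/4)"
  have "(\<Sum>j=1..J. (1 + real j / h) powr (-5/4) / h) \<le> ?F (real J / h) - ?F 0"
  proof (rule decreasing_sum_bounds(1)[OF _ _ h])
    show "(?F has_real_derivative (1 + x) powr (-5/4)) (at x)" if "x \<ge> 0" for x :: real
      using that by (auto intro!: derivative_eq_intros)
    show "(1 + y) powr (-5/4) \<le> (1 + x) powr (-5/4)" if "0 \<le> x" "x \<le> y" for x y :: real
      using that by (intro powr_mono2') auto
  qed
  also have "\<dots> \<le> 4" by simp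
  finally have "2 * (\<Sum>j=1..J. (1 + real j / h) powr (-5/4) / h) \<le> 8" by simp
  moreover have "(\<Sum>j=1..J. (1 + (real j / h)^2) powr (-5/8) / h) \<le> 2 * (\<Sum>j=1..J. (1 + real j / h) powr (-5/4) / h)"
    unfolding sum_distrib_left
  proof (rule sum_mono)
    fix j
    have "(1 + (real j / h)^2) powr (-5/8) / h \<le> 2 * (1 + real j / h) powr (-5/4) / h"
      using h by (intro divide_right_mono b) auto
    then show "(1 + (real j / h)^2) powr (-5/8) / h \<le> 2 * ((1 + real j / h) powr (-5/4) / h)" by simp
  qed
  ultimately show ?thesis by linarith
qed

text \<open>Shape of the weights on the scale \<open>x = j / h\<close>, free of the pilot value; it
  serves as a common majorant for the weights and their derivatives.\<close>

definition wmaj :: "real \<Rightarrow> nat \<Rightarrow> real" where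
  "wmaj h j = 1 / (h * (1 + (real j / h)^2)^2)"

lemma wmaj_nonneg: "h > 0 \<Longrightarrow> 0 \<le> wmaj h j"
  by (simp add: wmaj_def)

text \<open>In terms of \<open>1 + (j / h)^2\<close> each summand is bounded by a power with
  exponent at most \<open>-5/8\<close>, so all five reduce to one sum. None of the bounds involves
  \<open>J\<close>.\<close>

lemma wmaj_sums:
  assumes h: "h > 0"
  shows "(\<Sum>j=1..J. wmaj h j) \<le> 8"
    and "(\<Sum>j=1..J. wmaj h j * (1 + (real j / h)^2)) \<le> 8"
    and "(\<Sum>j=1..J. wmaj h j * (real j)^2) \<le> 8 * h^2"
    and "(\<Sum>j=1..J. wmaj h j * (real j)^2 * (real j / h) powr (3/4)) \<le> 8 * h^2"
    and "(\<Sum>j=1..J. (wmaj h j * (1 + (real j / h)^2))^2) \<le> 8 / h"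
proof -
  have key: "(\<Sum>j=1..J. f j) \<le> 8 * c" if "c \<ge> 0" and f: "\<And>j. f j \<le> c * ((1 + (real j / h)^2) powr (-5/8) / h)" for f c
  proof -
    have "(\<Sum>j=1..J. f j) \<le> c * (\<Sum>j=1..J. (1 + (real j / h)^2) powr (-5/8) / h)"
      unfolding sum_distrib_left by (intro sum_mono f)
    also have "\<dots> \<le> c * 8" by (intro mult_left_mono sum_powr_bound h that)
    finally show ?thesis by (simp add: mult.commute)
  qed
  define q where "q j = 1 + (real j / h)^2" for j
  define pw where "pw a j = q j powr a" for a j
  have q1: "q j \<ge> 1" for j by (simp add: q_def)
  have key': "(\<Sum>j=1..J. f j) \<le> 8 * c" if "c \<ge> 0" and "\<And>j. f j \<le> c * (pw (-5/8) j / h)" for f c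
    using key[OF that(1), of f] that(2) by (simp add: pw_def q_def)
  have pwm: "pw a j * pw b j = pw (a + b) j" for a b j by (simp add: pw_def powr_add)
  have pw1: "pw 1 j = q j" for j using q1[of j] by (simp add: pw_def)
  have w: "wmaj h j = pw (-2) j / h" for j
    using q1[of j] by (simp add: wmaj_def pw_def q_def powr_minus_divide powr_realpow flip: powr_numeral)
  have qp: "pw a j \<le> pw b j" if "a \<le> b" for a b j unfolding pw_def by (intro powr_mono that q1)
  have pw0: "0 \<le> pw a j" for a j by (simp add: pw_def)
  have w2: "wmaj h j * q j = pw (-1) j / h" for j
    using pwm[of "-2" j 1] by (simp add: w pw1)
  show "(\<Sum>j=1..J. wmaj h j) \<le> 8"
    using key'[of 1 "wmaj h"] h qp[of "-2" "-5/8"] by (simp add: w divide_right_mono)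
  show "(\<Sum>j=1..J. wmaj h j * (1 + (real j / h)^2)) \<le> 8"
  proof -
    have "(\<Sum>j=1..J. wmaj h j * q j) \<le> 8 * 1"
      by (rule key') (use h qp[of "-1" "-5/8"] in \<open>simp_all add: w2 divide_right_mono\<close>)
    then show ?thesis by (simp add: q_def)
  qed
  have x2: "(real j)^2 \<le> h^2 * q j" for j using h by (simp add: q_def power_divide field_simps)
  have j2: "wmaj h j * (real j)^2 \<le> h^2 * (pw (-1) j / h)" for j
  proof -
    have "wmaj h j * (real j)^2 \<le> wmaj h j * (h^2 * q j)" by (intro mult_left_mono x2 wmaj_nonneg h)
    also have "\<dots> = h^2 * (wmaj h j * q j)" by simp
    finally show ?thesis by (simp only: w2)
  qed
  show "(\<Sum>j=1..J. wmaj h j * (real j)^2) \<le> 8 * h^2"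
  proof (rule key')
    fix j
    have "h^2 * (pw (-1) j / h) \<le> h^2 * (pw (-5/8) j / h)" using h by (intro mult_left_mono divide_right_mono qp) auto
    then show "wmaj h j * (real j)^2 \<le> h^2 * (pw (-5/8) j / h)" using j2[of j] by simp
  qed simp
  show "(\<Sum>j=1..J. wmaj h j * (real j)^2 * (real j / h) powr (3/4)) \<le> 8 * h^2"
  proof (rule key')
    fix j
    have "(real j / h) powr (3/4) \<le> pw (3/8) j"
    proof -
      have "real j / h \<le> q j powr (1/2)"
      proof -
        have "real j / h = sqrt ((real j / h)^2)" using h by simp
        also have "\<dots> \<le> sqrt (q j)" by (intro real_sqrt_le_mono) (simp add: q_def)
        finally show ?thesis using q1[of j] by (simp add: powr_half_sqrt)
      qed
      then have "(real j / h) powr (3/4) \<le> (q j powr (1/2)) powr (3/4)" using h by (intro powr_mono2) auto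
      then show ?thesis by (simp add: powr_powr pw_def)
    qed
    then have "wmaj h j * (real j)^2 * (real j / h) powr (3/4) \<le> h^2 * (pw (-1) j / h) * pw (3/8) j"
    proof (rule mult_mono[OF j2])
      show "0 \<le> h^2 * (pw (-1) j / h)" using h pw0 by simp
    qed simp
    also have "\<dots> = h^2 * (pw (-5/8) j / h)" using pwm[of "-1" j "3/8"] by simp
    finally show "wmaj h j * (real j)^2 * (real j / h) powr (3/4) \<le> h^2 * (pw (-5/8) j / h)" .
  qed simp
  have "(\<Sum>j=1..J. (wmaj h j * q j)^2) \<le> 8 * (1 / h)"
  proof (rule key')
    fix j
    have "(wmaj h j * q j)^2 = (pw (-2) j / h) * (1 / h)"
      unfolding w2 power_divide using pwm[of "-1" j "-1"] by (simp add: power2_eq_square)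
    also have "\<dots> \<le> (pw (-5/8) j / h) * (1 / h)" using h by (intro mult_right_mono divide_right_mono qp) auto
    finally show "(wmaj h j * q j)^2 \<le> 1 / h * (pw (-5/8) j / h)" by (simp add: mult.commute)
  qed (use h in simp)
  then show "(\<Sum>j=1..J. (wmaj h j * (1 + (real j / h)^2))^2) \<le> 8 / h" by (simp add: q_def)
qed

text \<open>Normalizer of the weights for $m = 2$; the other powers occur in its derivatives with respect to $c$.\<close>
definition wden :: "nat \<Rightarrow> real \<Rightarrow> nat \<Rightarrow> real \<Rightarrow> real" where
  "wden J h m c = (\<Sum>l=1..J. inverse (c + pi^2 * (real l)^2 / h^2) ^ m)"

text \<open>Derivative of the weight with respect to \<open>c\<close>, written as the weight times a
  logarithmic derivative: one part comes from the numerator, the ratio of normalizers from the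
  denominator.\<close>

definition dweight :: "nat \<Rightarrow> real \<Rightarrow> real \<Rightarrow> nat \<Rightarrow> real" where
  "dweight J h c j = weight J h c j * (2 * (wden J h 3 c / wden J h 2 c - inverse (c + pi^2 * (real j)^2 / h^2)))"

lemma weight_eq: "weight J h c j = inverse (c + pi^2 * (real j)^2 / h^2) ^ 2 / wden J h 2 c"
  by (simp add: weight_def wden_def power_inverse)

lemma wden_pos: "c > 0 \<Longrightarrow> J > 0 \<Longrightarrow> wden J h m c > 0"
  unfolding wden_def by (intro sum_pos zero_less_power positive_imp_inverse_positive) (auto simp: add_pos_nonneg)

lemma sum_weight: "c > 0 \<Longrightarrow> J > 0 \<Longrightarrow> (\<Sum>j=1..J. weight J h c j) = 1"
  using wden_pos[of c J h 2] unfolding weight_eq sum_divide_distrib[symmetric] by (simp add: wden_def)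

lemma weight_nonneg: "c > 0 \<Longrightarrow> J > 0 \<Longrightarrow> 0 \<le> weight J h c j"
  unfolding weight_eq using wden_pos[of c J h 2] by simp

text \<open>The first floor of \<open>h\<close> terms, at least \<open>h / 2\<close> in number, have
  \<open>l <= h\<close> and hence are bounded below; the condition \<open>real J >= h\<close> makes
  them available.\<close>

lemma wden_lower:
  assumes c: "0 < c" "c \<le> c2" and h: "h \<ge> 1" and J: "real J \<ge> h"
  shows "h / 2 * inverse ((c2 + pi^2)^2) \<le> wden J h 2 c"
proof -
  let ?m = "nat \<lfloor>h\<rfloor>"
  have "1 \<le> \<lfloor>h\<rfloor>" using h by simp
  then have "1 \<le> real_of_int \<lfloor>h\<rfloor>" "real ?m = real_of_int \<lfloor>h\<rfloor>" by simp_all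
  then have m: "real ?m \<le> h" "h / 2 \<le> real ?m" by linarith+
  then have "real ?m \<le> real J" using J by linarith
  then have mJ: "?m \<le> J" by simp
  have "h / 2 * inverse ((c2 + pi^2)^2) \<le> real ?m * inverse ((c2 + pi^2)^2)"
    by (intro mult_right_mono m) auto
  also have "\<dots> = (\<Sum>l=1..?m. inverse ((c2 + pi^2)^2))" by simp
  also have "\<dots> \<le> (\<Sum>l=1..?m. inverse (c + pi^2 * (real l)^2 / h^2) ^ 2)"
  proof (rule sum_mono)
    fix l assume "l \<in> {1..?m}"
    then have "real l \<le> h" using m by (metis atLeastAtMost_iff of_nat_mono order_trans)
    then have "(real l)^2 \<le> h^2" by (intro power_mono) auto
    then have "pi^2 * (real l)^2 / h^2 \<le> pi^2 * 1" using h by (simp add: field_simps)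
    then have "inverse (c2 + pi^2) \<le> inverse (c + pi^2 * (real l)^2 / h^2)"
      using c by (intro le_imp_inverse_le) (auto simp: add_pos_nonneg)
    then have "inverse (c2 + pi^2) ^ 2 \<le> inverse (c + pi^2 * (real l)^2 / h^2) ^ 2"
      using c by (intro power_mono) (auto simp: add_nonneg_nonneg)
    then show "inverse ((c2 + pi^2)^2) \<le> inverse (c + pi^2 * (real l)^2 / h^2) ^ 2" by (simp add: power_inverse)
  qed
  also have "\<dots> \<le> wden J h 2 c"
    unfolding wden_def by (rule sum_mono2) (use mJ c in \<open>auto simp: add_nonneg_nonneg\<close>)
  finally show ?thesis .
qed

text \<open>Since \<open>pi^2 >= 1\<close>, the numerator base \<open>c + pi^2 x^2\<close> is at
  least \<open>min c1 1\<close> times \<open>1 + x^2\<close>; the rest of the constant is the lower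
  bound of the normalizer.\<close>

lemma weight_le_wmaj:
  assumes c: "0 < c1" "c1 \<le> c" "c \<le> c2" and h: "h \<ge> 1" and J: "real J \<ge> h"
  shows "weight J h c j \<le> 2 * (c2 + pi^2)^2 / (min c1 1)^2 * wmaj h j"
proof -
  define m where "m = min c1 1"
  have m: "m > 0" "m \<le> c" "m \<le> 1" using c by (auto simp: m_def)
  let ?q = "1 + (real j / h)^2" and ?u = "c + pi^2 * (real j)^2 / h^2"
  have q: "?q > 0" by (simp add: add_pos_nonneg)
  have "1 \<le> pi^2" using pi_ge_two by (intro one_le_power) simp
  then have "m * (real j / h)^2 \<le> pi^2 * (real j / h)^2" using m by (intro mult_right_mono) auto
  then have u: "m * ?q \<le> ?u" using m by (simp add: power_divide algebra_simps)
  have "inverse ?u \<le> inverse (m * ?q)" using m q by (intro le_imp_inverse_le u mult_pos_pos)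
  moreover have "0 \<le> inverse ?u" using c by (simp add: add_nonneg_nonneg)
  ultimately have "inverse ?u ^ 2 \<le> inverse (m * ?q) ^ 2" by (intro power_mono)
  moreover have "h / 2 * inverse ((c2 + pi^2)^2) \<le> wden J h 2 c" by (rule wden_lower) (use c h J in auto)
  moreover have C2: "c2 + pi^2 > 0" using c by (intro add_pos_pos) auto
  then have "0 < h / 2 * inverse ((c2 + pi^2)^2)" using h by (intro mult_pos_pos) auto
  ultimately have "weight J h c j \<le> inverse (m * ?q) ^ 2 / (h / 2 * inverse ((c2 + pi^2)^2))"
    unfolding weight_eq by (intro frac_le) auto
  also have "\<dots> = 2 * (c2 + pi^2)^2 / m^2 * (1 / (h * ?q^2))"
  proof -
    have "inverse (m * Q) ^ 2 / (h / 2 * inverse (Z^2)) = 2 * Z^2 / m^2 * (1 / (h * Q^2))" if "Q > 0" "Z > 0" for Q Z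
      using m h that by (simp add: field_simps power2_eq_square)
    then show ?thesis using q C2 by blast
  qed
  finally show ?thesis by (simp add: m_def wmaj_def)
qed

section \<open>Dependence of the weights on the pilot value\<close>

lemma wden_ratio:
  assumes c: "0 < c1" "c1 \<le> c" and J: "J > 0"
  shows "wden J h (Suc m) c \<le> wden J h m c / c1"
proof -
  have "inverse (c + pi^2 * (real l)^2 / h^2) ^ Suc m \<le> inverse (c + pi^2 * (real l)^2 / h^2) ^ m / c1" for l
  proof -
    let ?v = "inverse (c + pi^2 * (real l)^2 / h^2)"
    have v: "0 \<le> ?v" "?v \<le> inverse c1" using c by (auto intro!: le_imp_inverse_le simp: add_nonneg_nonneg add_increasing2)
    have "?v ^ m * ?v \<le> ?v ^ m * inverse c1" using v by (intro mult_left_mono) auto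
    then show ?thesis by (simp add: divide_inverse mult_ac)
  qed
  then show ?thesis unfolding wden_def sum_divide_distrib by (intro sum_mono)
qed

lemma wden_derivative:
  assumes "c > 0"
  shows "((\<lambda>c. wden J h m c) has_real_derivative (- real m * wden J h (Suc m) c)) (at c)"
proof -
  have "((\<lambda>c. inverse (c + pi^2 * (real l)^2 / h^2) ^ m) has_real_derivative - real m * inverse (c + pi^2 * (real l)^2 / h^2) ^ Suc m) (at c)" for l
  proof -
    let ?e = "pi^2 * (real l)^2 / h^2"
    have ne: "c + ?e \<noteq> 0" using assms by (metis add_pos_nonneg divide_nonneg_nonneg less_irrefl mult_nonneg_nonneg zero_le_power2)
    have 1: "((\<lambda>c. inverse (c + ?e)) has_real_derivative - (inverse (c + ?e) ^ 2)) (at c)"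
      using ne by (auto intro!: derivative_eq_intros simp: power2_eq_square)
    show ?thesis
      by (rule DERIV_cong[OF DERIV_power[OF 1, of m]]) (cases m, simp_all add: power2_eq_square algebra_simps)
  qed
  from DERIV_sum[of "{1..J}", OF this] show ?thesis
    unfolding wden_def by (simp add: sum_distrib_left)
qed

text \<open>Every factor produced by differentiation is an inverse of
  \<open>c + pi^2 j^2 / h^2\<close> or a ratio of consecutive normalizers, and both are at most
  \<open>1 / c1\<close>. Derivatives of a weight are therefore bounded by the same majorant as the
  weight, which keeps the expansion summable in \<open>j\<close>.\<close>

lemma weight_taylor:
  assumes c: "0 < c1" "c1 \<le> c" "c \<le> c2" "c1 \<le> c'" "c' \<le> c2" and h: "h \<ge> 1" and J: "real J \<ge> h"
  defines "K \<equiv> 2 * (c2 + pi^2)^2 / (min c1 1)^2"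
  shows "\<bar>dweight J h c j\<bar> \<le> 2 / c1 * (K * wmaj h j)"
    and "\<bar>weight J h c' j - weight J h c j - (c' - c) * dweight J h c j\<bar> \<le> 16 / c1^2 * (K * wmaj h j) * (c' - c)^2"
proof -
  have J0: "J > 0" using h J by (cases J) auto
  define r where "r m c = wden J h m c" for m c
  define v where "v c = inverse (c + pi^2 * (real j)^2 / h^2)" for c
  define w where "w c = weight J h c j" for c
  have w: "w c = v c ^ 2 / r 2 c" for c unfolding w_def weight_eq v_def r_def ..
  define \<rho> where "\<rho> c = r 3 c / r 2 c" for c
  have W: "w c \<le> K * wmaj h j" "0 \<le> w c" if "c \<in> {c1..c2}" for c
  proof -
    show "w c \<le> K * wmaj h j" unfolding w_def K_def by (rule weight_le_wmaj) (use that c h J in auto)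
    show "0 \<le> w c" unfolding w_def by (rule weight_nonneg) (use that c J0 in auto)
  qed
  have K: "0 \<le> K * wmaj h j" using W[of c] c by simp
  have rpos: "r m c > 0" if "c \<in> {c1..c2}" for m c unfolding r_def using that c J0 by (intro wden_pos) auto
  have v01: "0 \<le> v c" "v c \<le> 1 / c1" if "c \<in> {c1..c2}" for c
    using that c unfolding v_def inverse_eq_divide[symmetric]
    by (auto intro!: le_imp_inverse_le simp: add_nonneg_nonneg add_increasing2)
  have rr: "r (Suc m) x \<le> r m x / c1" if "x \<in> {c1..c2}" for m x
    unfolding r_def using that c J0 by (intro wden_ratio) auto
  have rho: "0 \<le> \<rho> c" "\<rho> c \<le> 1 / c1" if "c \<in> {c1..c2}" for c
    using rr[OF that, of 2] rpos[OF that, of 2] rpos[OF that, of 3] c by (auto simp: \<rho>_def field_simps numeral_3_eq_3)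
  have r4: "r 4 c / r 2 c \<le> 1 / c1^2" if "c \<in> {c1..c2}" for c
  proof -
    have "r 4 c \<le> r 3 c / c1" using rr[OF that, of 3] by simp
    also have "\<dots> \<le> r 2 c / c1 / c1" using rr[OF that, of 2] c by (intro divide_right_mono) (auto simp: numeral_3_eq_3)
    finally show ?thesis using rpos[OF that, of 2] c by (simp add: field_simps power2_eq_square)
  qed
  have dr: "(r m has_real_derivative (- real m * r (Suc m) c)) (at c)" if "c \<in> {c1..c2}" for m c
    unfolding r_def using that c by (intro wden_derivative) auto
  have dv: "(v has_real_derivative - (v c)\<^sup>2) (at c)" if "c \<in> {c1..c2}" for c
  proof -
    have "c + pi^2 * (real j)^2 / h^2 \<noteq> 0"
      using that c by (metis add_pos_nonneg atLeastAtMost_iff divide_nonneg_nonneg less_irrefl less_le_trans mult_nonneg_nonneg zero_le_power2)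
    then show ?thesis unfolding v_def by (auto intro!: derivative_eq_intros simp: power2_eq_square)
  qed
  define d where "d c = w c * (2 * (\<rho> c - v c))" for c
  have dd: "d c = dweight J h c j" for c by (simp add: d_def dweight_def w_def \<rho>_def r_def v_def)
  have Dw: "(w has_real_derivative d c) (at c)" if "c \<in> {c1..c2}" for c
  proof -
    have "((\<lambda>c. v c ^ 2 / r 2 c) has_real_derivative ((2 * v c * (- (v c)\<^sup>2)) * r 2 c - v c ^ 2 * (- real 2 * r (Suc 2) c)) / (r 2 c * r 2 c)) (at c)"
    proof (rule DERIV_divide[OF _ dr[OF that]])
      show "((\<lambda>c. v c ^ 2) has_real_derivative 2 * v c * (- (v c)\<^sup>2)) (at c)"
        by (rule DERIV_cong[OF DERIV_power[OF dv[OF that], of 2]]) simp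
    qed (use rpos[OF that, of 2] in simp)
    moreover have "((2 * v c * (- (v c)\<^sup>2)) * r 2 c - v c ^ 2 * (- real 2 * r (Suc 2) c)) / (r 2 c * r 2 c) = d c"
      using rpos[OF that, of 2] by (simp add: d_def w \<rho>_def field_simps power2_eq_square numeral_3_eq_3)
    ultimately show ?thesis unfolding w[abs_def] by simp
  qed
  have Drho: "(\<rho> has_real_derivative (- 3 * (r 4 c / r 2 c) + 2 * (\<rho> c)^2)) (at c)" if "c \<in> {c1..c2}" for c
  proof -
    have "((\<lambda>c. r 3 c / r 2 c) has_real_derivative ((- real 3 * r (Suc 3) c) * r 2 c - r 3 c * (- real 2 * r (Suc 2) c)) / (r 2 c * r 2 c)) (at c)"
      by (rule DERIV_divide[OF dr[OF that] dr[OF that]]) (use rpos[OF that, of 2] in auto)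
    moreover have "((- real 3 * r (Suc 3) c) * r 2 c - r 3 c * (- real 2 * r (Suc 2) c)) / (r 2 c * r 2 c) = - 3 * (r 4 c / r 2 c) + 2 * (\<rho> c)^2"
      using rpos[OF that, of 2] by (simp add: \<rho>_def field_simps power2_eq_square)
    ultimately show ?thesis unfolding \<rho>_def[abs_def] by simp
  qed
  define e where "e c = d c * (2 * (\<rho> c - v c)) + w c * (2 * ((- 3 * (r 4 c / r 2 c) + 2 * (\<rho> c)^2) + (v c)^2))" for c
  have Dd: "(d has_real_derivative e c) (at c)" if "c \<in> {c1..c2}" for c
    unfolding d_def[abs_def] e_def
    by (rule derivative_eq_intros Dw[OF that] Drho[OF that] dv[OF that] refl)+ (simp add: d_def algebra_simps)
  have rv: "\<bar>2 * (\<rho> c - v c)\<bar> \<le> 2 / c1" if "c \<in> {c1..c2}" for c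
    using rho[OF that] v01[OF that] by (auto simp: abs_le_iff)
  have bd: "\<bar>d c\<bar> \<le> 2 / c1 * (K * wmaj h j)" if "c \<in> {c1..c2}" for c
  proof -
    have "\<bar>w c\<bar> * \<bar>2 * (\<rho> c - v c)\<bar> \<le> (K * wmaj h j) * (2 / c1)"
      using W[OF that] K by (intro mult_mono rv[OF that]) auto
    then show ?thesis by (simp add: d_def abs_mult mult_ac)
  qed
  show "\<bar>dweight J h c j\<bar> \<le> 2 / c1 * (K * wmaj h j)" using bd[of c] c by (simp add: dd)
  \<comment> \<open>The product \<open>d c * (2 * (\<rho> c - v c))\<close> contributes 4, and the
    derivative of the logarithmic derivative contributes \<open>2 * (3 + 2 + 1) = 12\<close>,
    together 16 in units of \<open>1 / c1^2\<close>.\<close>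
  have be: "\<bar>e c\<bar> \<le> 16 / c1^2 * (K * wmaj h j)" if "c \<in> {c1..c2}" for c
  proof -
    have "\<bar>d c\<bar> * \<bar>2 * (\<rho> c - v c)\<bar> \<le> (2 / c1 * (K * wmaj h j)) * (2 / c1)"
      using K c by (intro mult_mono bd[OF that] rv[OF that]) auto
    then have 1: "\<bar>d c * (2 * (\<rho> c - v c))\<bar> \<le> 4 / c1^2 * (K * wmaj h j)" by (simp add: abs_mult power2_eq_square mult_ac)
    have sq: "(\<rho> c)^2 \<le> 1 / c1^2" "(v c)^2 \<le> 1 / c1^2"
      using power_mono[OF rho(2)[OF that] rho(1)[OF that], of 2] power_mono[OF v01(2)[OF that] v01(1)[OF that], of 2] by (simp_all add: power_divide)
    have "0 \<le> r 4 c / r 2 c" using rpos[OF that, of 4] rpos[OF that, of 2] by simp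
    then have "\<bar>2 * ((- 3 * (r 4 c / r 2 c) + 2 * (\<rho> c)^2) + (v c)^2)\<bar> \<le> 12 * (1 / c1^2)"
    proof -
      have "\<bar>2 * ((- 3 * x + 2 * y) + z)\<bar> \<le> 12 * B" if "0 \<le> x" "x \<le> B" "y \<le> B" "z \<le> B" "0 \<le> y" "0 \<le> z" for x y z B :: real
      proof -
        have "2 * ((- 3 * x + 2 * y) + z) = 4 * y + 2 * z - 6 * x" by simp
        moreover have "4 * y + 2 * z - 6 * x \<le> 12 * B" using that by linarith
        moreover have "- (12 * B) \<le> 4 * y + 2 * z - 6 * x" using that by linarith
        ultimately show ?thesis by simp
      qed
      from this[OF \<open>0 \<le> r 4 c / r 2 c\<close> r4[OF that] sq zero_le_power2 zero_le_power2] show ?thesis .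
    qed
    then have "\<bar>w c\<bar> * \<bar>2 * ((- 3 * (r 4 c / r 2 c) + 2 * (\<rho> c)^2) + (v c)^2)\<bar> \<le> (K * wmaj h j) * (12 * (1 / c1^2))"
      using W[OF that] K by (intro mult_mono) auto
    then have 2: "\<bar>w c * (2 * ((- 3 * (r 4 c / r 2 c) + 2 * (\<rho> c)^2) + (v c)^2))\<bar> \<le> 12 / c1^2 * (K * wmaj h j)" by (simp add: abs_mult mult_ac)
    have "16 / c1^2 * (K * wmaj h j) = 4 / c1^2 * (K * wmaj h j) + 12 / c1^2 * (K * wmaj h j)" by (simp flip: distrib_right add_divide_distrib)
    then show ?thesis unfolding e_def using 1 2 by linarith
  qed
  let ?B = "16 / c1^2 * (K * wmaj h j)"
  let ?S = "{min c c'..max c c'}"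
  have S: "?S \<subseteq> {c1..c2}" using c by auto
  have d1: "\<bar>d x - d c\<bar> \<le> ?B * \<bar>x - c\<bar>" if "x \<in> {c1..c2}" for x
  proof -
    have "norm (d x - d c) \<le> ?B * norm (x - c)"
      by (rule field_differentiable_bound[where S = "{c1..c2}" and f' = e])
         (use that c be has_field_derivative_at_within[OF Dd] in auto)
    then show ?thesis by simp
  qed
  have "norm ((w c' - c' * d c) - (w c - c * d c)) \<le> (?B * \<bar>c' - c\<bar>) * norm (c' - c)"
  proof (rule field_differentiable_bound[where S = ?S and f' = "\<lambda>x. d x - d c" and f = "\<lambda>x. w x - x * d c"])
    fix x assume x: "x \<in> ?S"
    then have xs: "x \<in> {c1..c2}" using S by blast
    show "((\<lambda>x. w x - x * d c) has_field_derivative d x - d c) (at x within ?S)"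
      by (rule has_field_derivative_at_within) (auto intro!: derivative_eq_intros Dw[OF xs])
    have "\<bar>x - c\<bar> \<le> \<bar>c' - c\<bar>" using x by auto
    then have "?B * \<bar>x - c\<bar> \<le> ?B * \<bar>c' - c\<bar>" using K by (intro mult_left_mono) auto
    then show "norm (d x - d c) \<le> ?B * \<bar>c' - c\<bar>" using d1[OF xs] by simp
  qed auto
  note N = this
  have e1: "(w c' - c' * d c) - (w c - c * d c) = w c' - w c - (c' - c) * d c" by (simp add: algebra_simps)
  have e2: "(?B * \<bar>c' - c\<bar>) * norm (c' - c) = ?B * (c' - c)^2"
    unfolding mult.assoc real_norm_def abs_mult_self_eq power2_eq_square ..
  have "\<bar>w c' - w c - (c' - c) * d c\<bar> \<le> ?B * (c' - c)^2"
    using N[unfolded e1 e2] unfolding real_norm_def .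
  then show "\<bar>weight J h c' j - weight J h c j - (c' - c) * dweight J h c j\<bar> \<le> ?B * (c' - c)^2"
    by (simp add: w_def dd)
qed

text \<open>Riemann sum for $\int_0^\infty (c + \pi^2 x^2)^{-2} dx = c^{-3/2} / 4$; the antiderivative is explicit.\<close>
lemma wden_limit:
  assumes c: "0 < c1" "c1 \<le> c" and h: "h > 0" and J: "J > 0"
  shows "\<bar>wden J h 2 c / h - 1 / (4 * c powr (3/2))\<bar> \<le> 1 / (c1^2 * h) + h / (c1 * real J)"
proof -
  have c0: "c > 0" using c by simp
  define f where "f x = inverse (c + pi^2 * x^2) ^ 2" for x
  define F where "F x = x / (2 * c * (c + pi^2 * x^2)) + arctan (pi * x / sqrt c) / (2 * pi * c powr (3/2))" for x
  have u: "c + pi^2 * x^2 > 0" for x using c0 by (simp add: add_pos_nonneg)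
  have c32: "c powr (3/2) = c * sqrt c"
    using c0 powr_add[of c 1 "1/2"] by (simp add: powr_half_sqrt)
  have DF: "(F has_real_derivative f x) (at x)" for x
  proof -
    have 1: "((\<lambda>x. x / (2 * c * (c + pi^2 * x^2))) has_real_derivative
        ((c + pi^2 * x^2) - x * (2 * pi^2 * x)) / (2 * c * (c + pi^2 * x^2)^2)) (at x)"
    proof -
      have "((\<lambda>x. x / (2 * c * (c + pi^2 * x^2))) has_real_derivative
         (1 * (2 * c * (c + pi^2 * x^2)) - x * (2 * c * (pi^2 * (2 * x)))) / ((2 * c * (c + pi^2 * x^2)) * (2 * c * (c + pi^2 * x^2)))) (at x)"
        by (rule DERIV_divide) (use u[of x] c0 in \<open>auto intro!: derivative_eq_intros\<close>)
      moreover have "(1 * (2 * c * U) - x * (2 * c * (P * (2 * x)))) / ((2 * c * U) * (2 * c * U)) = (U - x * (2 * P * x)) / (2 * c * U^2)" if "U > 0" for U P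
        using c0 that by (simp add: field_simps power2_eq_square)
      ultimately show ?thesis using u[of x] by simp
    qed
    have 2: "((\<lambda>x. arctan (pi * x / sqrt c) / (2 * pi * c powr (3/2))) has_real_derivative
        (pi / sqrt c) / (1 + (pi * x / sqrt c)^2) / (2 * pi * c powr (3/2))) (at x)"
      by (rule DERIV_cdivide) (auto intro!: derivative_eq_intros simp: divide_inverse)
    have s: "(pi * x / sqrt c)^2 = pi^2 * x^2 / c" using c0 by (simp add: power_divide power_mult_distrib)
    have "(pi / sqrt c) / (1 + (pi * x / sqrt c)^2) / (2 * pi * c powr (3/2)) = 1 / (2 * c * (c + pi^2 * x^2))"
    proof -
      have "1 + pi^2 * x^2 / c = (c + pi^2 * x^2) / c" using c0 by (simp add: field_simps)
      moreover have "(pi / t) / (U / c) / (2 * pi * (c * t)) = 1 / (2 * c * U)" if "t * t = c" "U > 0" "t > 0" for t U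
        using c0 that pi_gt_zero by (simp add: field_simps)
      ultimately show ?thesis unfolding s c32 using c0 u[of x] by (simp add: )
    qed
    moreover have "((U - x * (2 * P * x)) / (2 * c * U^2)) + 1 / (2 * c * U) = inverse U ^ 2" if "U > 0" "U = c + P * x^2" for U P
    proof -
      have "((U - x * (2 * P * x)) / (2 * c * U^2)) + 1 / (2 * c * U) = ((U - x * (2 * P * x)) + U) / (2 * c * U^2)"
        using that(1) c0 by (simp add: field_simps power2_eq_square)
      also have "(U - x * (2 * P * x)) + U = 2 * c" using that(2) by (simp add: power2_eq_square)
      finally show ?thesis using that(1) c0 by (simp add: field_simps power_inverse)
    qed
    from this[OF u[of x] refl] have "((c + pi^2 * x^2) - x * (2 * pi^2 * x)) / (2 * c * (c + pi^2 * x^2)^2) + 1 / (2 * c * (c + pi^2 * x^2)) = f x"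
      by (simp add: f_def)
    ultimately show ?thesis unfolding F_def[abs_def] using DERIV_add[OF 1 2] by (simp only:)
  qed
  have dec: "f y \<le> f x" if "0 \<le> x" "x \<le> y" for x y
    unfolding f_def using that u[of x] u[of y] by (intro power_mono le_imp_inverse_le add_left_mono mult_left_mono) (auto simp: less_imp_le)
  have sum: "(\<Sum>j=1..J. f (real j / h) / h) = wden J h 2 c / h"
    by (simp add: wden_def f_def sum_divide_distrib power_divide)
  note B = decreasing_sum_bounds[OF DF dec h, of J, unfolded sum]
  have F0: "F 0 = 0" by (simp add: F_def)
  let ?L = "1 / (4 * c powr (3/2))"
  have L: "?L = (pi / 2) / (2 * pi * c powr (3/2))" by simp
  have cp: "c powr (3/2) > 0" using c0 by simp
  have F_le: "F x \<le> ?L + x / (2 * c * (c + pi^2 * x^2))" for x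
  proof -
    have "arctan (pi * x / sqrt c) / (2 * pi * c powr (3/2)) \<le> (pi / 2) / (2 * pi * c powr (3/2))"
      using arctan_ubound[of "pi * x / sqrt c"] cp by (intro divide_right_mono) auto
    then show ?thesis unfolding F_def L by linarith
  qed
  \<comment> \<open>The complement of the arctangent to \<open>pi / 2\<close> is the arctangent of
    the inverse, hence at most the inverse; the rational part of \<open>F\<close> is at most
    \<open>1 / (c1 * x)\<close>.\<close>
  have tail: "?L - F x \<le> 1 / (c1 * x)" and upper: "F x \<le> ?L + 1 / (c1 * x)" if x: "x > 0" for x
  proof -
    have t: "pi * x / sqrt c > 0" using x c0 by simp
    have "pi / 2 - arctan (pi * x / sqrt c) = arctan (1 / (pi * x / sqrt c))"
      using arctan_inverse[of "pi * x / sqrt c"] t by simp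
    also have "\<dots> \<le> 1 / (pi * x / sqrt c)" by (intro arctan_le_self) (use c0 x in simp)
    finally have a: "pi / 2 - arctan (pi * x / sqrt c) \<le> sqrt c / (pi * x)" by simp
    have "?L - F x \<le> (pi / 2 - arctan (pi * x / sqrt c)) / (2 * pi * c powr (3/2))"
      unfolding F_def L diff_divide_distrib using x c0 u[of x] by simp
    also have "\<dots> \<le> (sqrt c / (pi * x)) / (2 * pi * c powr (3/2))" using a cp by (intro divide_right_mono) auto
    also have "\<dots> = 1 / (2 * pi^2 * (c * x))" unfolding c32 using c0 x by (simp add: field_simps power2_eq_square)
    also have "\<dots> \<le> 1 / (1 * (c1 * x))"
    proof (intro divide_left_mono mult_mono)
      have "1 \<le> pi^2" using pi_ge_two by (intro one_le_power) simp
      then show "1 \<le> 2 * pi^2" by simp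
    qed (use c x in \<open>auto intro!: mult_pos_pos\<close>)
    finally show "?L - F x \<le> 1 / (c1 * x)" by simp
    have "x / (2 * c * (c + pi^2 * x^2)) \<le> x / (c1 * x^2)"
    proof (intro divide_left_mono)
      have "1 \<le> pi^2" using pi_ge_two by (intro one_le_power) simp
      then have "1 * x^2 \<le> pi^2 * x^2" by (intro mult_right_mono) auto
      then have "x^2 \<le> c + pi^2 * x^2" using c0 by simp
      then show "c1 * x^2 \<le> 2 * c * (c + pi^2 * x^2)" using c by (intro mult_mono) auto
    qed (use c c0 x u[of x] in auto)
    also have "x / (c1 * x^2) = 1 / (c1 * x)" using x by (simp add: power2_eq_square)
    finally show "F x \<le> ?L + 1 / (c1 * x)" using F_le[of x] by linarith
  qed
  \<comment> \<open>The lower bound for the sum starts at \<open>1 / h\<close> instead of 0. The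
    missing piece is at most \<open>1 / h\<close> times the maximum \<open>f 0\<close> of the
    decreasing integrand.\<close>
  have F1: "F (1 / h) \<le> 1 / (c1^2 * h)"
  proof -
    obtain z where z: "0 < z" "z < 1 / h" "F (1 / h) - F 0 = (1 / h - 0) * f z"
      using MVT2[of 0 "1 / h" F f] DF h by auto
    have "f z \<le> f 0" using z by (intro dec) auto
    also have "f 0 \<le> 1 / c1^2" using c by (auto simp: f_def divide_inverse power_inverse intro!: le_imp_inverse_le power_mono)
    finally have "f z / h \<le> 1 / c1^2 / h" using h by (intro divide_right_mono) auto
    moreover have "F (1 / h) = f z / h" using z(3) F0 by simp
    ultimately show ?thesis by simp
  qed
  have xJ: "real J / h > 0" using J h by simp
  have "wden J h 2 c / h \<le> ?L + h / (c1 * real J)" using B(1) upper[OF xJ] F0 by simp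
  moreover have "?L - (1 / (c1^2 * h) + h / (c1 * real J)) \<le> wden J h 2 c / h"
  proof -
    have "1 / (c1 * (real (Suc J) / h)) \<le> 1 / (c1 * (real J / h))" using c h J by (intro divide_left_mono mult_left_mono divide_right_mono) auto
    then have "?L - F (real (Suc J) / h) \<le> h / (c1 * real J)" using tail[of "real (Suc J) / h"] h by simp
    then show ?thesis using B(2) F1 by linarith
  qed
  moreover have "0 \<le> 1 / (c1^2 * h)" using h by simp
  ultimately show ?thesis unfolding abs_le_iff by (intro conjI; linarith)
qed

section \<open>Dyadic chaining\<close>

definition (in prob_space) sq_int :: "('a \<Rightarrow> real) \<Rightarrow> bool" where
  "sq_int X \<longleftrightarrow> random_variable borel X \<and> integrable M (\<lambda>\<omega>. (X \<omega>)^2)"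

context prob_space
begin

lemma sq_int_mult:
  assumes "sq_int X" "sq_int Y" shows "integrable M (\<lambda>\<omega>. X \<omega> * Y \<omega>)"
proof (rule Bochner_Integration.integrable_bound)
  show "integrable M (\<lambda>\<omega>. (X \<omega>)^2 + (Y \<omega>)^2)" using assms by (simp add: sq_int_def)
  show "AE \<omega> in M. norm (X \<omega> * Y \<omega>) \<le> norm ((X \<omega>)^2 + (Y \<omega>)^2)"
  proof (rule AE_I2)
    fix \<omega>
    have "0 \<le> (\<bar>X \<omega>\<bar> - \<bar>Y \<omega>\<bar>)^2" by simp
    then have "2 * (\<bar>X \<omega>\<bar> * \<bar>Y \<omega>\<bar>) \<le> (X \<omega>)^2 + (Y \<omega>)^2" by (simp add: power2_diff)
    moreover have "0 \<le> \<bar>X \<omega>\<bar> * \<bar>Y \<omega>\<bar>" "0 \<le> (X \<omega>)^2 + (Y \<omega>)^2" by simp_all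
    ultimately show "norm (X \<omega> * Y \<omega>) \<le> norm ((X \<omega>)^2 + (Y \<omega>)^2)" unfolding real_norm_def abs_mult by linarith
  qed
qed (use assms in \<open>auto simp: sq_int_def\<close>)

lemma sq_int_add: "sq_int X \<Longrightarrow> sq_int Y \<Longrightarrow> sq_int (\<lambda>\<omega>. X \<omega> + Y \<omega>)"
  using sq_int_mult[of X Y] by (auto simp: sq_int_def power2_sum mult.assoc)

lemma sq_int_diff: "sq_int X \<Longrightarrow> sq_int Y \<Longrightarrow> sq_int (\<lambda>\<omega>. X \<omega> - Y \<omega>)"
  using sq_int_mult[of X Y] by (auto simp: sq_int_def power2_diff mult.assoc)

lemma sq_int_0: "sq_int (\<lambda>_. 0)" by (simp add: sq_int_def)

lemma sq_int_sum: "(\<And>i. i \<in> I \<Longrightarrow> sq_int (X i)) \<Longrightarrow> sq_int (\<lambda>\<omega>. \<Sum>i\<in>I. X i \<omega>)"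
  by (induction I rule: infinite_finite_induct) (auto simp: sq_int_0 sq_int_add)

lemma expectation_abs_mult_le:
  assumes "sq_int X" "sq_int Y" and b: "expectation (\<lambda>\<omega>. (X \<omega>)^2) \<le> x^2" "expectation (\<lambda>\<omega>. (Y \<omega>)^2) \<le> y^2"
    and xy: "0 \<le> x" "0 \<le> y"
  shows "expectation (\<lambda>\<omega>. \<bar>X \<omega> * Y \<omega>\<bar>) \<le> x * y"
proof -
  have i: "integrable M (\<lambda>\<omega>. (X \<omega>)^2)" "integrable M (\<lambda>\<omega>. (Y \<omega>)^2)" "integrable M (\<lambda>\<omega>. \<bar>X \<omega> * Y \<omega>\<bar>)"
    using assms sq_int_mult[OF assms(1,2)] by (auto simp: sq_int_def)
  \<comment> \<open>The balancing factors \<open>d / c\<close> and \<open>c / d\<close> need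
    positive bounds, whereas \<open>x\<close> or \<open>y\<close> may be 0; both are enlarged by
    \<open>e\<close>, which then tends to 0.\<close>
  have main: "expectation (\<lambda>\<omega>. \<bar>X \<omega> * Y \<omega>\<bar>) \<le> (x + e) * (y + e)" if e: "e > 0" for e
  proof -
    define c d where "c = x + e" and "d = y + e"
    have cd: "c > 0" "d > 0" using e xy by (auto simp: c_def d_def)
    have "expectation (\<lambda>\<omega>. \<bar>X \<omega> * Y \<omega>\<bar>) \<le> expectation (\<lambda>\<omega>. (d / c * (X \<omega>)^2 + c / d * (Y \<omega>)^2) / 2)"
    proof (rule integral_mono)
      fix \<omega>
      have "0 \<le> (d * \<bar>X \<omega>\<bar> - c * \<bar>Y \<omega>\<bar>)^2 / (c * d)" using cd by simp
      also have "\<dots> = d / c * (X \<omega>)^2 + c / d * (Y \<omega>)^2 - 2 * \<bar>X \<omega> * Y \<omega>\<bar>"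
        using cd by (simp add: power2_diff power_mult_distrib abs_mult field_simps power2_eq_square)
      finally have *: "0 \<le> d / c * (X \<omega>)^2 + c / d * (Y \<omega>)^2 - 2 * \<bar>X \<omega> * Y \<omega>\<bar>" .
      have "z \<le> (p + q) / 2" if "0 \<le> p + q - 2 * z" for p q z :: real using that by simp
      from this[OF *] show "\<bar>X \<omega> * Y \<omega>\<bar> \<le> (d / c * (X \<omega>)^2 + c / d * (Y \<omega>)^2) / 2" .
    qed (use i in auto)
    also have "\<dots> = (d / c * expectation (\<lambda>\<omega>. (X \<omega>)^2) + c / d * expectation (\<lambda>\<omega>. (Y \<omega>)^2)) / 2"
      using i by simp
    also have "\<dots> \<le> (d / c * c^2 + c / d * d^2) / 2"
    proof -
      have "x^2 \<le> c^2" "y^2 \<le> d^2" using xy e by (auto simp: c_def d_def intro!: power_mono)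
      then show ?thesis using b cd by (intro divide_right_mono add_mono mult_left_mono) auto
    qed
    also have "\<dots> = c * d" using cd by (simp add: power2_eq_square)
    finally show ?thesis by (simp add: c_def d_def)
  qed
  have "((\<lambda>e. (x + e) * (y + e)) \<longlongrightarrow> (x + 0) * (y + 0)) (at_right 0)"
    by (intro tendsto_intros)
  then show ?thesis
    using tendsto_lowerbound[of "\<lambda>e. (x + e) * (y + e)" "x * y" "at_right 0"] main
    by (simp add: eventually_at_right_less eventually_at_filter)
qed

text \<open>Only Cauchy--Schwarz: splitting at the midpoint replaces the increment $V_k - V_s$ on the right half by $V_k - V_{s'}$ plus one increment between the two left endpoints, and independence of $V$ and $A$ is never needed.\<close>
lemma dyadic_chaining:
  fixes V A :: "nat \<Rightarrow> 'a \<Rightarrow> real"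
  assumes sq: "\<And>k. sq_int (V k)" "\<And>k. sq_int (A k)" and va: "0 \<le> v" "0 \<le> a"
    and V: "\<And>k l. k \<le> l \<Longrightarrow> expectation (\<lambda>\<omega>. (V l \<omega> - V k \<omega>)^2) \<le> v^2 * real (l - k)"
    and A: "\<And>s m. expectation (\<lambda>\<omega>. (\<Sum>k\<in>{s..<s + m}. A k \<omega>)^2) \<le> a^2 * real m"
  shows "expectation (\<lambda>\<omega>. \<bar>\<Sum>k\<in>{s..<s + 2 ^ L}. (V k \<omega> - V s \<omega>) * A k \<omega>\<bar>) \<le> real L * (v * a * 2 ^ L / 2)"
proof (induction L arbitrary: s)
  case (Suc L)
  let ?m = "2 ^ L :: nat"
  let ?T = "\<lambda>s \<omega>. \<Sum>k\<in>{s..<s + ?m}. (V k \<omega> - V s \<omega>) * A k \<omega>"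
  let ?D = "\<lambda>\<omega>. V (s + ?m) \<omega> - V s \<omega>" and ?A = "\<lambda>\<omega>. \<Sum>k\<in>{s + ?m..<s + ?m + ?m}. A k \<omega>"
  have eq: "(\<Sum>k\<in>{s..<s + 2 ^ Suc L}. (V k \<omega> - V s \<omega>) * A k \<omega>) = ?T s \<omega> + ?T (s + ?m) \<omega> + ?D \<omega> * ?A \<omega>" for \<omega>
  proof -
    have "(\<Sum>k\<in>{s..<s + 2 ^ Suc L}. (V k \<omega> - V s \<omega>) * A k \<omega>) =
        ?T s \<omega> + (\<Sum>k\<in>{s + ?m..<s + ?m + ?m}. (V k \<omega> - V s \<omega>) * A k \<omega>)"
      using sum.atLeastLessThan_concat[of s "s + ?m" "s + ?m + ?m" "\<lambda>k. (V k \<omega> - V s \<omega>) * A k \<omega>"] by (simp add: add.assoc mult_2)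
    also have "(\<Sum>k\<in>{s + ?m..<s + ?m + ?m}. (V k \<omega> - V s \<omega>) * A k \<omega>) =
        (\<Sum>k\<in>{s + ?m..<s + ?m + ?m}. (V k \<omega> - V (s + ?m) \<omega>) * A k \<omega> + ?D \<omega> * A k \<omega>)"
      by (intro sum.cong refl) (simp add: algebra_simps)
    finally show ?thesis by (simp add: sum.distrib sum_distrib_left)
  qed
  have iT: "integrable M (\<lambda>\<omega>. \<bar>?T s \<omega>\<bar>)" for s
    by (intro integrable_abs Bochner_Integration.integrable_sum sq_int_mult sq_int_diff sq)
  have iD: "integrable M (\<lambda>\<omega>. \<bar>?D \<omega> * ?A \<omega>\<bar>)"
    by (intro integrable_abs sq_int_mult sq_int_diff sq_int_sum sq)
  have "expectation (\<lambda>\<omega>. \<bar>\<Sum>k\<in>{s..<s + 2 ^ Suc L}. (V k \<omega> - V s \<omega>) * A k \<omega>\<bar>) \<le>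
     expectation (\<lambda>\<omega>. \<bar>?T s \<omega>\<bar> + \<bar>?T (s + ?m) \<omega>\<bar> + \<bar>?D \<omega> * ?A \<omega>\<bar>)"
  proof (rule integral_mono)
    show "integrable M (\<lambda>\<omega>. \<bar>\<Sum>k\<in>{s..<s + 2 ^ Suc L}. (V k \<omega> - V s \<omega>) * A k \<omega>\<bar>)"
      by (intro integrable_abs Bochner_Integration.integrable_sum sq_int_mult sq_int_diff sq)
    show "\<bar>\<Sum>k\<in>{s..<s + 2 ^ Suc L}. (V k \<omega> - V s \<omega>) * A k \<omega>\<bar> \<le> \<bar>?T s \<omega>\<bar> + \<bar>?T (s + ?m) \<omega>\<bar> + \<bar>?D \<omega> * ?A \<omega>\<bar>" for \<omega>
      unfolding eq by linarith
  qed (use iT iD in auto)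
  also have "\<dots> = expectation (\<lambda>\<omega>. \<bar>?T s \<omega>\<bar>) + expectation (\<lambda>\<omega>. \<bar>?T (s + ?m) \<omega>\<bar>) + expectation (\<lambda>\<omega>. \<bar>?D \<omega> * ?A \<omega>\<bar>)"
    using iT[of s] iT[of "s + ?m"] iD by simp
  also have "\<dots> \<le> real L * (v * a * 2 ^ L / 2) + real L * (v * a * 2 ^ L / 2) + (v * sqrt (real ?m)) * (a * sqrt (real ?m))"
  proof (intro add_mono Suc.IH expectation_abs_mult_le)
    show "expectation (\<lambda>\<omega>. (?D \<omega>)^2) \<le> (v * sqrt (real ?m))^2" using V[of s "s + ?m"] by (simp add: power_mult_distrib)
    show "expectation (\<lambda>\<omega>. (?A \<omega>)^2) \<le> (a * sqrt (real ?m))^2" using A[of "s + ?m" ?m] by (simp add: power_mult_distrib)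
  qed (use va in \<open>auto intro!: sq_int_diff sq_int_sum sq\<close>)
  also have "(v * sqrt (real ?m)) * (a * sqrt (real ?m)) = v * a * 2 ^ L"
  proof -
    have "sqrt (real ?m) * sqrt (real ?m) = 2 ^ L" by simp
    then show ?thesis by (metis mult.assoc mult.commute)
  qed
  finally show ?case by (simp add: algebra_simps add_divide_distrib)
qed simp

text \<open>Extends the sum from \<open>H\<close> to a power of two by freezing \<open>V\<close> at
  its last index and setting \<open>A\<close> to zero beyond it, which preserves both moment
  conditions. The chaining controls \<open>V k - V 0\<close> only, so \<open>V 0\<close> times the
  full sum of \<open>A\<close> is added.\<close>

lemma dyadic_chaining_full:
  fixes V A :: "nat \<Rightarrow> 'a \<Rightarrow> real"
  assumes sq: "\<And>k. sq_int (V k)" "\<And>k. sq_int (A k)" and va: "0 \<le> v" "0 \<le> a" "0 \<le> x"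
    and V: "\<And>k l. k \<le> l \<Longrightarrow> l < H \<Longrightarrow> expectation (\<lambda>\<omega>. (V l \<omega> - V k \<omega>)^2) \<le> v^2 * real (l - k)"
    and V0: "expectation (\<lambda>\<omega>. (V 0 \<omega>)^2) \<le> x^2"
    and A: "\<And>s m. s + m \<le> H \<Longrightarrow> expectation (\<lambda>\<omega>. (\<Sum>k\<in>{s..<s + m}. A k \<omega>)^2) \<le> a^2 * real m"
    and H: "0 < H" "H \<le> 2 ^ L"
  shows "expectation (\<lambda>\<omega>. \<bar>\<Sum>k<H. V k \<omega> * A k \<omega>\<bar>) \<le> real L * (v * a * 2 ^ L / 2) + x * (a * sqrt (real H))"
proof -
  define V' where "V' k = V (min k (H - 1))" for k
  define A' where "A' k = (if k < H then A k else (\<lambda>_. 0))" for k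
  have sq': "sq_int (V' k)" "sq_int (A' k)" for k using sq by (auto simp: V'_def A'_def sq_int_0)
  have V'b: "expectation (\<lambda>\<omega>. (V' l \<omega> - V' k \<omega>)^2) \<le> v^2 * real (l - k)" if "k \<le> l" for k l
  proof -
    have "expectation (\<lambda>\<omega>. (V' l \<omega> - V' k \<omega>)^2) \<le> v^2 * real (min l (H - 1) - min k (H - 1))"
      unfolding V'_def by (rule V) (use that H in auto)
    also have "\<dots> \<le> v^2 * real (l - k)" using that by (intro mult_left_mono) auto
    finally show ?thesis .
  qed
  have A'b: "expectation (\<lambda>\<omega>. (\<Sum>k\<in>{s..<s + m}. A' k \<omega>)^2) \<le> a^2 * real m" for s m
  proof (cases "s \<le> H")
    case True
    define m' where "m' = min m (H - s)"
    have "(\<Sum>k\<in>{s..<s + m}. A' k \<omega>) = (\<Sum>k\<in>{s..<s + m'}. A k \<omega>)" for \<omega>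
      by (rule sum.mono_neutral_cong_right) (use True in \<open>auto simp: A'_def m'_def\<close>)
    then have "expectation (\<lambda>\<omega>. (\<Sum>k\<in>{s..<s + m}. A' k \<omega>)^2) \<le> a^2 * real m'" using A[of s m'] True by (simp add: m'_def)
    also have "\<dots> \<le> a^2 * real m" by (intro mult_left_mono) (auto simp: m'_def)
    finally show ?thesis .
  next
    case False
    then have "(\<Sum>k\<in>{s..<s + m}. A' k \<omega>) = 0" for \<omega> by (intro sum.neutral) (auto simp: A'_def)
    then show ?thesis by simp
  qed
  have eq: "(\<Sum>k<H. V k \<omega> * A k \<omega>) = (\<Sum>k\<in>{0..<0 + 2 ^ L}. (V' k \<omega> - V' 0 \<omega>) * A' k \<omega>) + V 0 \<omega> * (\<Sum>k\<in>{0..<0 + H}. A k \<omega>)" for \<omega>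
  proof -
    have "(\<Sum>k\<in>{0..<0 + 2 ^ L}. (V' k \<omega> - V' 0 \<omega>) * A' k \<omega>) = (\<Sum>k<H. (V k \<omega> - V 0 \<omega>) * A k \<omega>)"
      by (rule sum.mono_neutral_cong_right) (use H in \<open>auto simp: A'_def V'_def min_def\<close>)
    then show ?thesis by (simp add: left_diff_distrib sum_subtractf sum_distrib_left atLeast0LessThan)
  qed
  let ?T = "\<lambda>\<omega>. \<Sum>k\<in>{0..<0 + 2 ^ L}. (V' k \<omega> - V' 0 \<omega>) * A' k \<omega>" and ?A = "\<lambda>\<omega>. \<Sum>k\<in>{0..<0 + H}. A k \<omega>"
  have iT: "integrable M (\<lambda>\<omega>. \<bar>?T \<omega>\<bar>)"
    by (intro integrable_abs Bochner_Integration.integrable_sum sq_int_mult sq_int_diff sq')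
  have iA: "integrable M (\<lambda>\<omega>. \<bar>V 0 \<omega> * ?A \<omega>\<bar>)"
    by (intro integrable_abs sq_int_mult sq_int_sum sq)
  have "expectation (\<lambda>\<omega>. \<bar>\<Sum>k<H. V k \<omega> * A k \<omega>\<bar>) \<le> expectation (\<lambda>\<omega>. \<bar>?T \<omega>\<bar> + \<bar>V 0 \<omega> * ?A \<omega>\<bar>)"
  proof (rule integral_mono)
    show "integrable M (\<lambda>\<omega>. \<bar>\<Sum>k<H. V k \<omega> * A k \<omega>\<bar>)"
      by (intro integrable_abs Bochner_Integration.integrable_sum sq_int_mult sq)
    show "\<bar>\<Sum>k<H. V k \<omega> * A k \<omega>\<bar> \<le> \<bar>?T \<omega>\<bar> + \<bar>V 0 \<omega> * ?A \<omega>\<bar>" for \<omega> unfolding eq by (rule abs_triangle_ineq)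
  qed (use iT iA in auto)
  also have "\<dots> = expectation (\<lambda>\<omega>. \<bar>?T \<omega>\<bar>) + expectation (\<lambda>\<omega>. \<bar>V 0 \<omega> * ?A \<omega>\<bar>)" using iT iA by simp
  also have "\<dots> \<le> real L * (v * a * 2 ^ L / 2) + x * (a * sqrt (real H))"
  proof (intro add_mono dyadic_chaining expectation_abs_mult_le)
    show "expectation (\<lambda>\<omega>. (?A \<omega>)^2) \<le> (a * sqrt (real H))^2" using A[of 0 H] by (simp add: power_mult_distrib)
  qed (use va V0 V'b A'b sq sq' in \<open>auto intro!: sq_int_sum\<close>)
  finally show ?thesis .
qed

end

section \<open>Second chaos with nearly diagonal covariance\<close>

lemma abs_sum_mult_le:
  fixes f g :: "'p \<Rightarrow> real"
  assumes "\<And>p. p \<in> P \<Longrightarrow> \<bar>f p\<bar> \<le> g p"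
  shows "\<bar>\<Sum>p\<in>P. f p\<bar> \<le> (\<Sum>p\<in>P. g p)"
  by (rule order_trans[OF sum_abs sum_mono]) (rule assms)

context
  fixes P :: "'p set" and C :: "'p \<Rightarrow> 'p \<Rightarrow> real" and D e c :: "'p \<Rightarrow> real"
  assumes P: "finite P" and C: "\<And>p q. p \<in> P \<Longrightarrow> q \<in> P \<Longrightarrow> \<bar>C p q - (if p = q then D p else 0)\<bar> \<le> sqrt (e p * e q)"
    and e: "\<And>p. p \<in> P \<Longrightarrow> 0 \<le> e p" and D: "\<And>p. p \<in> P \<Longrightarrow> 0 \<le> D p"
begin

lemma sum_delta_P: "(\<Sum>p\<in>P. \<Sum>q\<in>P. if p = q then f p else 0) = (\<Sum>p\<in>P. f p :: real)"
  using P by simp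

text \<open>Writing a covariance as diagonal part plus error, its square is at most twice the sum of
  the squares. The product form of the error makes the double sum the square of a single
  one.\<close>

lemma chaos2_frob_le:
  "chaos2_frob P C c \<le> 2 * (\<Sum>p\<in>P. (c p * D p)^2) + 2 * (\<Sum>p\<in>P. \<bar>c p\<bar> * e p)^2"
proof -
  have "chaos2_frob P C c \<le> (\<Sum>p\<in>P. \<Sum>q\<in>P. (if p = q then 2 * (c p * D p)^2 else 0) + 2 * ((\<bar>c p\<bar> * e p) * (\<bar>c q\<bar> * e q)))"
    unfolding chaos2_frob_def
  proof (intro sum_mono)
    fix p q assume pq: "p \<in> P" "q \<in> P"
    let ?d = "if p = q then D p else 0"
    have "(C p q - ?d)^2 \<le> (sqrt (e p * e q))^2"
      using power_mono[OF C[OF pq], of 2] by simp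
    then have E: "(C p q - ?d)^2 \<le> e p * e q" using e pq by simp
    have "0 \<le> (C p q - 2 * ?d)^2" by simp
    then have "(C p q)^2 \<le> 2 * ?d^2 + 2 * (C p q - ?d)^2" by (simp only: power2_diff) (simp add: power2_eq_square algebra_simps)
    then have "(C p q)^2 \<le> 2 * ?d^2 + 2 * (e p * e q)" using E by linarith
    then have "\<bar>c p * c q\<bar> * (C p q)^2 \<le> \<bar>c p * c q\<bar> * (2 * ?d^2 + 2 * (e p * e q))" by (intro mult_left_mono) auto
    moreover have "c p * c q * (C p q)^2 \<le> \<bar>c p * c q\<bar> * (C p q)^2" by (intro mult_right_mono) auto
    moreover have "\<bar>c p * c q\<bar> * (2 * ?d^2 + 2 * (e p * e q)) =
       (if p = q then 2 * (c p * D p)^2 else 0) + 2 * ((\<bar>c p\<bar> * e p) * (\<bar>c q\<bar> * e q))"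
      by (auto simp: abs_mult power2_eq_square algebra_simps)
    ultimately show "c p * c q * (C p q)^2 \<le> (if p = q then 2 * (c p * D p)^2 else 0) + 2 * ((\<bar>c p\<bar> * e p) * (\<bar>c q\<bar> * e q))"
      by linarith
  qed
  also have "\<dots> = 2 * (\<Sum>p\<in>P. (c p * D p)^2) + 2 * (\<Sum>p\<in>P. \<bar>c p\<bar> * e p)^2"
    unfolding sum.distrib sum_delta_P power2_eq_square[of "\<Sum>p\<in>P. \<bar>c p\<bar> * e p"] sum_product by (simp add: sum_distrib_left)
  finally show ?thesis .
qed

text \<open>Expanding the square of diagonal plus error, the cross term lives on the diagonal, so it
  is a single sum in which one factor is at most \<open>dm\<close>; the squared error
  factorises.\<close>

lemma chaos2_frob_approx:
  assumes dm: "\<And>p. p \<in> P \<Longrightarrow> \<bar>c p\<bar> * D p \<le> dm"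
  shows "\<bar>chaos2_frob P C c - (\<Sum>p\<in>P. (c p * D p)^2)\<bar> \<le> 2 * dm * (\<Sum>p\<in>P. \<bar>c p\<bar> * e p) + (\<Sum>p\<in>P. \<bar>c p\<bar> * e p)^2"
proof -
  have "chaos2_frob P C c - (\<Sum>p\<in>P. (c p * D p)^2) = (\<Sum>p\<in>P. \<Sum>q\<in>P. c p * c q * (C p q)^2 - (if p = q then (c p * D p)\<^sup>2 else 0))"
    unfolding chaos2_frob_def sum_subtractf sum_delta_P ..
  note eq = this
  have "\<bar>chaos2_frob P C c - (\<Sum>p\<in>P. (c p * D p)^2)\<bar> \<le>
     (\<Sum>p\<in>P. \<Sum>q\<in>P. (if p = q then 2 * dm * (\<bar>c p\<bar> * e p) else 0) + (\<bar>c p\<bar> * e p) * (\<bar>c q\<bar> * e q))"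
    unfolding eq
  proof (rule abs_sum_mult_le, rule abs_sum_mult_le)
    fix p q assume pq: "p \<in> P" "q \<in> P"
    let ?d = "if p = q then D p else 0"
    let ?E = "C p q - ?d"
    have "?E^2 \<le> (sqrt (e p * e q))^2"
      using power_mono[OF C[OF pq], of 2] by simp
    then have E: "?E^2 \<le> e p * e q" using e pq by simp
    have Ed: "?d * \<bar>?E\<bar> \<le> ?d * e p"
      using C[OF pq] D[OF pq(1)] e[OF pq(1)] by (cases "p = q") (auto intro!: mult_left_mono)
    have "c p * c q * (C p q)^2 - (if p = q then (c p * D p)\<^sup>2 else 0) = c p * c q * (2 * ?d * ?E + ?E^2)"
      by (auto simp: power2_eq_square algebra_simps)
    then have "\<bar>c p * c q * (C p q)^2 - (if p = q then (c p * D p)\<^sup>2 else 0)\<bar> \<le> \<bar>c p * c q\<bar> * (2 * (?d * \<bar>?E\<bar>) + ?E^2)"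
    proof (simp only: abs_mult, intro mult_left_mono)
      have "\<bar>2 * ?d * ?E + ?E^2\<bar> \<le> \<bar>2 * ?d * ?E\<bar> + \<bar>?E\<^sup>2\<bar>" by (rule abs_triangle_ineq)
      also have "\<dots> = 2 * (?d * \<bar>?E\<bar>) + ?E^2" using D[OF pq(1)] D[OF pq(2)] by (auto simp: abs_mult)
      finally show "\<bar>2 * ?d * ?E + ?E^2\<bar> \<le> 2 * (?d * \<bar>?E\<bar>) + ?E^2" .
    qed auto
    also have "\<dots> \<le> \<bar>c p * c q\<bar> * (2 * (?d * e p) + e p * e q)"
      by (intro mult_left_mono add_mono Ed E) auto
    also have "\<dots> \<le> (if p = q then 2 * dm * (\<bar>c p\<bar> * e p) else 0) + (\<bar>c p\<bar> * e p) * (\<bar>c q\<bar> * e q)"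
    proof (cases "p = q")
      case True
      have "(\<bar>c p\<bar> * D p) * (\<bar>c p\<bar> * e p) \<le> dm * (\<bar>c p\<bar> * e p)" using dm[OF pq(1)] e[OF pq(1)] by (intro mult_right_mono) auto
      then show ?thesis using True by (simp add: abs_mult algebra_simps)
    qed (simp add: abs_mult mult_ac)
    finally show "\<bar>c p * c q * (C p q)^2 - (if p = q then (c p * D p)\<^sup>2 else 0)\<bar> \<le>
      (if p = q then 2 * dm * (\<bar>c p\<bar> * e p) else 0) + (\<bar>c p\<bar> * e p) * (\<bar>c q\<bar> * e q)" .
  qed
  also have "\<dots> = 2 * dm * (\<Sum>p\<in>P. \<bar>c p\<bar> * e p) + (\<Sum>p\<in>P. \<bar>c p\<bar> * e p)^2"
    unfolding sum.distrib sum_delta_P power2_eq_square[of "\<Sum>p\<in>P. \<bar>c p\<bar> * e p"] sum_product by (simp add: sum_distrib_left)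
  finally show ?thesis .
qed

text \<open>Expands \<open>C D C\<close> into diagonal, mixed and pure error parts. Every part ends
  up with a factor \<open>dm^2\<close> or a power of \<open>S\<close>, so the norm of the squared
  matrix is small once no single coordinate dominates and the covariance errors are summable. This
  is the condition behind the normal limit.\<close>

lemma chaos2_frob4_le:
  assumes c: "\<And>p. p \<in> P \<Longrightarrow> 0 \<le> c p" and dm: "\<And>p. p \<in> P \<Longrightarrow> c p * D p \<le> dm" and dm0: "0 \<le> dm"
  defines "S \<equiv> \<Sum>p\<in>P. c p * e p"
  shows "chaos2_frob4 P C c \<le> 3 * (dm^2 * (\<Sum>p\<in>P. (c p * D p)^2) + 4 * dm^2 * S^2 + S ^ 4)"
proof -
  have S0: "S \<ge> 0" unfolding S_def using c e by (intro sum_nonneg) auto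
  define E where "E p q = C p q - (if p = q then D p else 0)" for p q
  have CE: "C p q = (if p = q then D p else 0) + E p q" for p q by (simp add: E_def)
  have Eb: "\<bar>E p q\<bar> \<le> sqrt (e p) * sqrt (e q)" if "p \<in> P" "q \<in> P" for p q
    using C[OF that] by (simp add: E_def real_sqrt_mult)
  have main: "c p * c r * (\<Sum>q\<in>P. c q * C p q * C q r)^2 \<le>
     3 * ((if p = r then dm\<^sup>2 * (c p * D p)^2 else 0) + 4 * dm^2 * ((c p * e p) * (c r * e r)) + S^2 * ((c p * e p) * (c r * e r)))"
    if pr: "p \<in> P" "r \<in> P" for p r
  proof -
    let ?s = "sqrt (e p) * sqrt (e r)"
    have s2: "?s^2 = e p * e r" using e pr by (simp add: power_mult_distrib)
    have s0: "0 \<le> ?s" using e pr by simp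
    let ?T = "\<Sum>q\<in>P. c q * E p q * E q r"
    have 1: "(\<Sum>q\<in>P. c q * (if p = q then D p else 0) * X q) = c p * D p * X p" for X :: "'p \<Rightarrow> real"
    proof -
      have "(\<Sum>q\<in>P. c q * (if p = q then D p else 0) * X q) = (\<Sum>q\<in>P. if p = q then c p * D p * X p else 0)"
        by (intro sum.cong refl) auto
      then show ?thesis using P pr by simp
    qed
    have 2: "(\<Sum>q\<in>P. X q * (if q = r then D q else 0)) = X r * D r" for X :: "'p \<Rightarrow> real"
    proof -
      have "(\<Sum>q\<in>P. X q * (if q = r then D q else 0)) = (\<Sum>q\<in>P. if q = r then X r * D r else 0)"
        by (intro sum.cong refl) auto
      then show ?thesis using P pr by simp
    qed
    have "(\<Sum>q\<in>P. c q * C p q * C q r) =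
       (\<Sum>q\<in>P. c q * (if p = q then D p else 0) * C q r) + ((\<Sum>q\<in>P. (c q * E p q) * (if q = r then D q else 0)) + ?T)"
      unfolding sum.distrib[symmetric] by (intro sum.cong refl) (simp add: CE[of p] CE[of _ r] algebra_simps)
    also have "\<dots> = c p * D p * C p r + (c r * E p r * D r + ?T)" unfolding 1 2 ..
    also have "c p * D p * C p r = (if p = r then c p * D p * D p else 0) + c p * D p * E p r" by (simp add: CE algebra_simps)
    finally have eq: "(\<Sum>q\<in>P. c q * C p q * C q r) = (if p = r then c p * D p * D p else 0) + (c p * D p + c r * D r) * E p r + ?T"
      by (simp add: algebra_simps)
    let ?x = "if p = r then c p * D p * D p else 0" and ?y = "(c p * D p + c r * D r) * E p r"
    have "(?x + ?y + ?T)^2 \<le> 3 * (?x^2 + ?y^2 + ?T^2)"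
    proof -
      have "(x + y + z)^2 \<le> 3 * (x^2 + y^2 + z^2)" for x y z :: real
      proof -
        have "0 \<le> (x - y)^2 + (y - z)^2 + (x - z)^2" by simp
        then show ?thesis by (simp add: power2_eq_square algebra_simps)
      qed
      then show ?thesis .
    qed
    moreover have "?y^2 \<le> 4 * dm^2 * (e p * e r)"
    proof -
      have "\<bar>c p * D p + c r * D r\<bar> * \<bar>E p r\<bar> \<le> (2 * dm) * ?s"
        using dm[OF pr(1)] dm[OF pr(2)] c[OF pr(1)] c[OF pr(2)] D[OF pr(1)] D[OF pr(2)] dm0
        by (intro mult_mono Eb pr) auto
      then have "\<bar>?y\<bar>\<^sup>2 \<le> ((2 * dm) * ?s)^2" unfolding abs_mult by (intro power_mono) auto
      then show ?thesis by (simp add: power_mult_distrib s2[unfolded power_mult_distrib])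
    qed
    moreover have "?T^2 \<le> S^2 * (e p * e r)"
    proof -
      have "\<bar>?T\<bar> \<le> (\<Sum>q\<in>P. c q * e q * ?s)"
      proof (rule abs_sum_mult_le)
        fix q assume q: "q \<in> P"
        have "\<bar>E p q\<bar> * \<bar>E q r\<bar> \<le> (sqrt (e p) * sqrt (e q)) * (sqrt (e q) * sqrt (e r))"
          using e pr q by (intro mult_mono Eb pr q) auto
        also have "\<dots> = e q * ?s" using e[OF q] by simp
        finally have "c q * (\<bar>E p q\<bar> * \<bar>E q r\<bar>) \<le> c q * (e q * ?s)" using c[OF q] by (intro mult_left_mono)
        then show "\<bar>c q * E p q * E q r\<bar> \<le> c q * e q * ?s" using c[OF q] by (simp add: abs_mult mult.assoc)
      qed
      also have "\<dots> = S * ?s" by (simp add: S_def sum_distrib_right)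
      finally have "\<bar>?T\<bar>\<^sup>2 \<le> (S * ?s)^2" by (intro power_mono) auto
      then show ?thesis by (simp add: power_mult_distrib s2[unfolded power_mult_distrib])
    qed
    moreover have "A \<le> 3 * (x + y' + z')" if "A \<le> 3 * (x + y + z)" "y \<le> y'" "z \<le> z'" for A x y z y' z' :: real
    proof (rule order_trans[OF that(1)])
      show "3 * (x + y + z) \<le> 3 * (x + y' + z')" using that(2,3) by (intro mult_left_mono add_mono order_refl) auto
    qed
    ultimately have "(\<Sum>q\<in>P. c q * C p q * C q r)^2 \<le> 3 * (?x^2 + 4 * dm^2 * (e p * e r) + S^2 * (e p * e r))"
      unfolding eq by blast
    then have "c p * c r * (\<Sum>q\<in>P. c q * C p q * C q r)^2 \<le> c p * c r * (3 * (?x^2 + 4 * dm^2 * (e p * e r) + S^2 * (e p * e r)))"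
      using c pr by (intro mult_left_mono) auto
    moreover have "c p * c r * ?x^2 \<le> (if p = r then dm\<^sup>2 * (c p * D p)^2 else 0)"
    proof (cases "p = r")
      case True
      have "(c p * D p)^2 * (c p * D p)^2 \<le> dm^2 * (c p * D p)^2"
        using dm[OF pr(1)] c[OF pr(1)] D[OF pr(1)] by (intro mult_right_mono power_mono) auto
      then show ?thesis using True by (simp add: power2_eq_square mult_ac)
    qed simp
    ultimately show ?thesis by (simp add: algebra_simps)
  qed
  have "chaos2_frob4 P C c \<le> (\<Sum>p\<in>P. \<Sum>r\<in>P. 3 * ((if p = r then dm\<^sup>2 * (c p * D p)^2 else 0) + 4 * dm^2 * ((c p * e p) * (c r * e r)) + S^2 * ((c p * e p) * (c r * e r))))"
    unfolding chaos2_frob4_def by (intro sum_mono main)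
  also have "\<dots> = 3 * ((\<Sum>p\<in>P. dm^2 * (c p * D p)^2) + 4 * dm^2 * (S * S) + S^2 * (S * S))"
    unfolding S_def sum_product sum_distrib_left[symmetric] sum.distrib sum_delta_P ..
  finally show ?thesis by (simp add: sum_distrib_left power2_eq_square numeral_eq_Suc mult_ac)
qed

end

text \<open>\<open>B\<close> dominates the exact second moment, which is twice the Frobenius
  quantity; hence the factor 96 of the fourth moment turns into \<open>96 / 4 = 24\<close>.\<close>

lemma (in prob_space) chaos2_moment_bounds:
  assumes ga: "gaussian_array P y C"
    and C: "\<And>p q. p \<in> P \<Longrightarrow> q \<in> P \<Longrightarrow> \<bar>C p q - (if p = q then D p else 0)\<bar> \<le> sqrt (e p * e q)"
    and e: "\<And>p. p \<in> P \<Longrightarrow> 0 \<le> e p" and D: "\<And>p. p \<in> P \<Longrightarrow> 0 \<le> D p"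
    and B: "4 * (\<Sum>p\<in>P. (c p * D p)^2) + 4 * (\<Sum>p\<in>P. \<bar>c p\<bar> * e p)^2 \<le> B"
  shows "expectation (\<lambda>\<omega>. (chaos2 P y C c \<omega>)^2) \<le> B"
    and "expectation (\<lambda>\<omega>. chaos2 P y C c \<omega> ^ 4) \<le> 24 * B^2"
proof -
  have P: "finite P" using ga by (simp add: gaussian_array_def)
  have f: "2 * chaos2_frob P C c \<le> B" using chaos2_frob_le[OF P C e D, of c] B by linarith
  have f0: "0 \<le> 2 * chaos2_frob P C c" unfolding gaussian_array_chaos2(3)[OF ga, symmetric] by simp
  show "expectation (\<lambda>\<omega>. (chaos2 P y C c \<omega>)^2) \<le> B" using f gaussian_array_chaos2(3)[OF ga] by simp
  have "(2 * chaos2_frob P C c)^2 \<le> B^2" by (intro power_mono f f0)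
  then show "expectation (\<lambda>\<omega>. chaos2 P y C c \<omega> ^ 4) \<le> 24 * B^2"
    using gaussian_array_chaos2(4)[OF ga, of c] by (simp add: power_mult_distrib)
qed

section \<open>The pilot estimator\<close>

lemma card_nats_closed_interval:
  assumes "S \<subseteq> {i::nat. a \<le> real i \<and> real i \<le> b}" "a \<le> b"
  shows "finite S" "real (card S) \<le> b - a + 3"
proof -
  have sub: "S \<subseteq> {i::nat. a - 1 < real i \<and> real i < b + 1}" using assms(1) by auto
  show "finite S" using card_nats_in_interval(1)[OF sub] assms(2) by simp
  show "real (card S) \<le> b - a + 3" using card_nats_in_interval(2)[OF sub] assms(2) by simp
qed

lemma card_nats_interval_lower:
  assumes S: "{i::nat. a \<le> real i \<and> real i \<le> b} \<subseteq> S" "finite S" and a: "0 \<le> a"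
  shows "b - a - 1 \<le> real (card S)"
proof -
  let ?T = "{nat \<lceil>a\<rceil>..<nat (\<lfloor>b\<rfloor> + 1)}"
  have "?T \<subseteq> S"
  proof
    fix i assume i: "i \<in> ?T"
    have "a \<le> real i" using i by (simp add: nat_le_iff ceiling_le_iff)
    moreover have "int i \<le> \<lfloor>b\<rfloor>" using i by (simp add: zless_nat_eq_int_zless)
    then have "real i \<le> b" by (simp add: le_floor_iff)
    ultimately show "i \<in> S" using S by auto
  qed
  then have "card ?T \<le> card S" using S by (intro card_mono) auto
  moreover have "b - a - 1 \<le> real (card ?T)"
  proof -
    have "real (nat \<lceil>a\<rceil>) \<le> a + 1" using a by linarith
    moreover have "b \<le> real (nat (\<lfloor>b\<rfloor> + 1))" by linarith
    ultimately show ?thesis by (simp; linarith)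
  qed
  ultimately show ?thesis by linarith
qed

definition pilot_win :: "real \<Rightarrow> nat \<Rightarrow> real \<Rightarrow> real \<Rightarrow> nat set" where
  "pilot_win g G b t = {k. k < G \<and> \<bar>real k * g - t\<bar> \<le> b}"

text \<open>A single sample size with explicit inequalities, so that limits are taken only at the
  end. Only the frequency 1 occurs, hence one error bound \<open>e\<close>; the last assumption
  keeps the bias of each summand of the pilot estimator below \<open>s0 / 4\<close>.\<close>

locale pilot = prob_space M for M :: "'a measure" +
  fixes y :: "nat \<times> nat \<Rightarrow> 'a \<Rightarrow> real" and Cv :: "nat \<times> nat \<Rightarrow> nat \<times> nat \<Rightarrow> real"
    and s2 :: "real \<Rightarrow> real" and g b \<delta> C a S s0 e :: real and G n :: nat
  assumes ga: "gaussian_array ({1} \<times> {..<G}) y Cv"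
    and G: "G > 0" "g = 1 / real G" and n: "n > 0" and \<delta>: "\<delta> > 0" "g = \<delta> / sqrt (real n)" and b: "b > 0" "b \<le> 1/2" "g / b \<le> 1/4"
    and approx: "\<And>p q. p \<in> {1} \<times> {..<G} \<Longrightarrow> q \<in> {1} \<times> {..<G} \<Longrightarrow>
       \<bar>Cv p q - (if p = q then s2 (real (snd p) * g) * (g^2 / (pi * real (fst p))^2) + \<delta>^2 / real n else 0)\<bar> \<le> sqrt (e * e)"
    and H: "\<And>s t. s \<in> {0..1} \<Longrightarrow> t \<in> {0..1} \<Longrightarrow> \<bar>s2 s - s2 t\<bar> \<le> C * \<bar>s - t\<bar> powr a" and C: "C \<ge> 0" and a: "a > 0"
    and s0: "s0 > 0" and s2b: "\<And>t. t \<in> {0..1} \<Longrightarrow> s0 \<le> s2 t \<and> s2 t \<le> S"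
    and e: "0 \<le> e" "real n / \<delta>^2 * pi^2 * e \<le> s0 / 4"
begin

text \<open>Coefficient of a squared statistic in the pilot estimator: \<open>g / (2 * b)\<close>
  times \<open>n * pi^2 / \<delta>^2\<close>, simplified by
  \<open>g = \<delta> / sqrt n\<close>.\<close>

definition "kap = pi^2 * sqrt (real n) / (2 * b * \<delta>)"

definition coef :: "real \<Rightarrow> nat \<times> nat \<Rightarrow> real" where
  "coef t p = (if snd p \<in> pilot_win g G b t then kap else 0)"

text \<open>Mean and fluctuation of the pilot estimator at $t$.\<close>
definition "pdet t = (\<Sum>k\<in>pilot_win g G b t. g / (2 * b) * (real n / \<delta>^2 * pi^2 * Cv (1, k) (1, k) - pi\<^sup>2))"

definition "pvar t = chaos2 ({1} \<times> {..<G}) y Cv (coef t)"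

lemma g0: "g > 0" using G by simp

lemma win_sub: "pilot_win g G b t \<subseteq> {..<G}" "finite (pilot_win g G b t)"
  by (auto simp: pilot_win_def)

lemma sum_P: "(\<Sum>p\<in>{1} \<times> {..<G}. f p) = (\<Sum>k<G. f (1, k))" for f :: "nat \<times> nat \<Rightarrow> real"
proof -
  have "{1::nat} \<times> {..<G} = Pair 1 ` {..<G}" by auto
  then show ?thesis by (simp add: sum.reindex inj_on_def)
qed

lemma pilot_decomp:
  "(\<Sum>k\<in>pilot_win g G b t. g / (2 * b) * (real n / \<delta>^2 * pi^2 * (y (1, k) \<omega>)^2 - pi\<^sup>2)) = pdet t + pvar t \<omega>"
proof -
  have k: "g / (2 * b) * (real n / \<delta>^2 * pi^2) = kap"
  proof -
    have "real n / sqrt (real n) = sqrt (real n)" using n by (simp add: real_div_sqrt)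
    moreover have "g / (2 * b) * (real n / \<delta>^2 * pi^2) = pi^2 * (real n / sqrt (real n)) / (2 * b * \<delta>)"
      using \<delta> b n by (simp add: field_simps power2_eq_square)
    ultimately show ?thesis by (simp add: kap_def)
  qed
  have "pvar t \<omega> = (\<Sum>k<G. coef t (1, k) * ((y (1, k) \<omega>)^2 - Cv (1, k) (1, k)))"
    unfolding pvar_def chaos2_def sum_P by (rule refl)
  also have "\<dots> = (\<Sum>k\<in>pilot_win g G b t. kap * ((y (1, k) \<omega>)^2 - Cv (1, k) (1, k)))"
    by (rule sum.mono_neutral_cong_right) (use win_sub in \<open>auto simp: coef_def\<close>)
  finally have "pdet t + pvar t \<omega> = (\<Sum>k\<in>pilot_win g G b t. g / (2 * b) * (real n / \<delta>^2 * pi^2 * Cv (1, k) (1, k) - pi\<^sup>2) + kap * ((y (1, k) \<omega>)^2 - Cv (1, k) (1, k)))"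
    by (simp add: pdet_def sum.distrib)
  also have "\<dots> = (\<Sum>k\<in>pilot_win g G b t. g / (2 * b) * (real n / \<delta>^2 * pi^2 * (y (1, k) \<omega>)^2 - pi\<^sup>2))"
  proof -
    have "u * (N * c - q) + u * N * (z - c) = u * (N * z - q)" for u N c q z :: real by (simp add: algebra_simps)
    then show ?thesis unfolding k[symmetric] by (intro sum.cong[OF refl])
  qed
  finally show ?thesis ..
qed

definition "Dbar = \<delta>^2 / real n * (S + 1)"

text \<open>Second moment contributed by each block of a window. The covariance errors enter
  quadratically in the window size; one factor is bounded by the total number \<open>G\<close> of
  blocks, so that the bound becomes linear.\<close>

definition "Bq = 4 * kap^2 * (Dbar^2 + real G * e^2)"

lemma S0: "0 < S" using s2b[of 0] s0 by auto

lemma kap0: "0 < kap" using b \<delta> n by (simp add: kap_def)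

lemma Bq0: "0 \<le> Bq" by (simp add: Bq_def)

lemma grid01: "k < G \<Longrightarrow> real k * g \<in> {0..1}"
proof -
  assume "k < G"
  then have "real k * g \<le> real G * g" using g0 by (intro mult_right_mono) auto
  then show ?thesis using G g0 by simp
qed

lemma D_bounds:
  assumes "p \<in> {1} \<times> {..<G}"
  shows "0 \<le> s2 (real (snd p) * g) * (g^2 / (pi * real (fst p))^2) + \<delta>^2 / real n"
    and "s2 (real (snd p) * g) * (g^2 / (pi * real (fst p))^2) + \<delta>^2 / real n \<le> Dbar"
proof -
  have s: "s0 \<le> s2 (real (snd p) * g)" "s2 (real (snd p) * g) \<le> S" using assms s2b[OF grid01[of "snd p"]] by auto
  have g2: "g^2 = \<delta>^2 / real n" using \<delta> by (simp add: power_divide)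
  show "0 \<le> s2 (real (snd p) * g) * (g^2 / (pi * real (fst p))^2) + \<delta>^2 / real n" using s s0 by (intro add_nonneg_nonneg mult_nonneg_nonneg) auto
  have "1 \<le> pi^2" using pi_ge_two by (intro one_le_power) simp
  then have "g^2 / (pi * real (fst p))^2 \<le> g^2 / 1" using assms by (intro divide_left_mono) auto
  then have "s2 (real (snd p) * g) * (g^2 / (pi * real (fst p))^2) \<le> S * (\<delta>^2 / real n)" using s s0 by (intro mult_mono) (auto simp: g2)
  then show "s2 (real (snd p) * g) * (g^2 / (pi * real (fst p))^2) + \<delta>^2 / real n \<le> Dbar"
    using distrib_left[of "\<delta>^2 / real n" S 1] unfolding Dbar_def by (simp add: mult.commute)
qed

text \<open>Stated for an arbitrary index set \<open>W\<close> because it is used for windows, which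
  gives the size of the fluctuation, and for symmetric differences of windows, which gives its
  increments in \<open>t\<close>.\<close>

lemma pilot_chaos_moments:
  assumes c: "\<And>p. p \<in> {1} \<times> {..<G} \<Longrightarrow> \<bar>c p\<bar> \<le> (if snd p \<in> W then kap else 0)" and W: "W \<subseteq> {..<G}"
    and w: "real (card W) \<le> w"
  shows "expectation (\<lambda>\<omega>. (chaos2 ({1} \<times> {..<G}) y Cv c \<omega>)^2) \<le> w * Bq"
    and "expectation (\<lambda>\<omega>. chaos2 ({1} \<times> {..<G}) y Cv c \<omega> ^ 4) \<le> 24 * (w * Bq)^2"
proof -
  let ?P = "{1::nat} \<times> {..<G}"
  define D where "D p = s2 (real (snd p) * g) * (g^2 / (pi * real (fst p))^2) + \<delta>^2 / real n" for p
  have fW: "finite W" using W finite_subset by blast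
  have cW: "real (card W) \<le> real G" using card_mono[OF _ W] by simp
  have restr: "(\<Sum>k<G. if k \<in> W then z else 0) = real (card W) * z" for z :: real
  proof -
    have "{..<G} \<inter> W = W" using W by auto
    then show ?thesis using sum.inter_restrict[of "{..<G}" "\<lambda>_. z" W] by simp
  qed
  have "(\<Sum>p\<in>?P. (c p * D p)^2) \<le> (\<Sum>p\<in>?P. if snd p \<in> W then kap\<^sup>2 * Dbar^2 else 0)"
  proof (rule sum_mono)
    fix p assume p: "p \<in> ?P"
    have "(\<bar>c p\<bar> * D p)^2 \<le> ((if snd p \<in> W then kap else 0) * Dbar)^2"
      using c[OF p] D_bounds[OF p] kap0 by (intro power_mono mult_mono) (auto simp: D_def)
    then show "(c p * D p)^2 \<le> (if snd p \<in> W then kap\<^sup>2 * Dbar^2 else 0)" by (auto simp: power_mult_distrib split: if_splits)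
  qed
  also have "\<dots> = real (card W) * (kap^2 * Dbar^2)" unfolding sum_P using restr by simp
  finally have 1: "(\<Sum>p\<in>?P. (c p * D p)^2) \<le> real (card W) * (kap^2 * Dbar^2)" .
  have "(\<Sum>p\<in>?P. \<bar>c p\<bar> * e) \<le> (\<Sum>p\<in>?P. if snd p \<in> W then kap * e else 0)"
  proof (rule sum_mono)
    fix p assume p: "p \<in> ?P"
    show "\<bar>c p\<bar> * e \<le> (if snd p \<in> W then kap * e else 0)" using mult_right_mono[OF c[OF p] e(1)] by (auto split: if_splits)
  qed
  also have "\<dots> = real (card W) * (kap * e)" unfolding sum_P using restr by simp
  finally have "(\<Sum>p\<in>?P. \<bar>c p\<bar> * e)^2 \<le> (real (card W) * (kap * e))^2" using e by (intro power_mono sum_nonneg) auto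
  also have "\<dots> = real (card W) * (real (card W) * (kap^2 * e^2))" by (simp add: power2_eq_square)
  also have "\<dots> \<le> real (card W) * (real G * (kap^2 * e^2))" by (intro mult_left_mono mult_right_mono cW) auto
  finally have 2: "(\<Sum>p\<in>?P. \<bar>c p\<bar> * e)^2 \<le> real (card W) * (real G * (kap^2 * e^2))" .
  have "4 * (\<Sum>p\<in>?P. (c p * D p)^2) + 4 * (\<Sum>p\<in>?P. \<bar>c p\<bar> * e)^2 \<le> real (card W) * Bq"
    using 1 2 by (simp add: Bq_def algebra_simps)
  also have "\<dots> \<le> w * Bq" by (intro mult_right_mono w Bq0)
  finally have B: "4 * (\<Sum>p\<in>?P. (c p * D p)^2) + 4 * (\<Sum>p\<in>?P. \<bar>c p\<bar> * e)^2 \<le> w * Bq" .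
  have ap: "\<bar>Cv p q - (if p = q then D p else 0)\<bar> \<le> sqrt (e * e)" if "p \<in> ?P" "q \<in> ?P" for p q
    unfolding D_def by (rule approx[OF that])
  have D0: "0 \<le> D p" if "p \<in> ?P" for p unfolding D_def by (rule D_bounds(1)[OF that])
  show "expectation (\<lambda>\<omega>. (chaos2 ?P y Cv c \<omega>)^2) \<le> w * Bq"
    by (rule chaos2_moment_bounds(1)[OF ga ap e(1) D0 B])
  show "expectation (\<lambda>\<omega>. chaos2 ?P y Cv c \<omega> ^ 4) \<le> 24 * (w * Bq)^2"
    by (rule chaos2_moment_bounds(2)[OF ga ap e(1) D0 B])
qed

lemma win_card: "real (card (pilot_win g G b t)) \<le> 3 * (b / g)"
proof -
  have "pilot_win g G b t \<subseteq> {i. (t - b) / g \<le> real i \<and> real i \<le> (t + b) / g}"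
    using g0 by (auto simp: pilot_win_def field_simps abs_le_iff)
  then have "real (card (pilot_win g G b t)) \<le> (t + b) / g - (t - b) / g + 3"
    by (rule card_nats_closed_interval(2)) (use g0 b in \<open>simp add: divide_right_mono\<close>)
  also have "\<dots> = 2 * (b / g) + 3" by (simp add: add_divide_distrib diff_divide_distrib)
  finally have *: "real (card (pilot_win g G b t)) \<le> 2 * (b / g) + 3" .
  have "4 \<le> b / g" using b g0 by (simp add: field_simps)
  then show ?thesis using * by linarith
qed

lemma pvar_moments:
  shows "sq_int (pvar t)" "integrable M (\<lambda>\<omega>. pvar t \<omega> ^ 4)"
    "expectation (\<lambda>\<omega>. (pvar t \<omega>)^2) \<le> 3 * (b / g) * Bq"
    "expectation (\<lambda>\<omega>. pvar t \<omega> ^ 4) \<le> 24 * (3 * (b / g) * Bq)^2"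
proof -
  show "sq_int (pvar t)" "integrable M (\<lambda>\<omega>. pvar t \<omega> ^ 4)"
    using gaussian_array_chaos2(1,2)[OF ga] by (auto simp: sq_int_def pvar_def)
  show "expectation (\<lambda>\<omega>. (pvar t \<omega>)^2) \<le> 3 * (b / g) * Bq" "expectation (\<lambda>\<omega>. pvar t \<omega> ^ 4) \<le> 24 * (3 * (b / g) * Bq)^2"
    unfolding pvar_def
    by (rule pilot_chaos_moments[OF _ win_sub(1) win_card[of t]], simp add: coef_def less_imp_le[OF kap0])+
qed

text \<open>Coefficients cancel on the overlap of the two windows. What remains are two strips of
  width \<open>t - s\<close>, each with at most \<open>(t - s) / g + 3\<close> blocks, so the
  variance grows linearly in the distance.\<close>

lemma pvar_increment:
  assumes st: "s \<le> t"
  shows "expectation (\<lambda>\<omega>. (pvar t \<omega> - pvar s \<omega>)^2) \<le> (2 * ((t - s) / g) + 6) * Bq"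
proof -
  let ?P = "{1::nat} \<times> {..<G}"
  have eq: "pvar t \<omega> - pvar s \<omega> = chaos2 ?P y Cv (\<lambda>p. coef t p - coef s p) \<omega>" for \<omega>
    by (simp add: pvar_def chaos2_def sum_subtractf left_diff_distrib)
  define W where "W = (pilot_win g G b t - pilot_win g G b s) \<union> (pilot_win g G b s - pilot_win g G b t)"
  have i1: "pilot_win g G b t - pilot_win g G b s \<subseteq> {i. (s + b) / g \<le> real i \<and> real i \<le> (t + b) / g}"
    and i2: "pilot_win g G b s - pilot_win g G b t \<subseteq> {i. (s - b) / g \<le> real i \<and> real i \<le> (t - b) / g}"
    using g0 st by (auto simp: pilot_win_def field_simps abs_le_iff)
  have d: "(s + b) / g \<le> (t + b) / g" "(s - b) / g \<le> (t - b) / g" using g0 st by (auto intro!: divide_right_mono)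
  have "card W \<le> card (pilot_win g G b t - pilot_win g G b s) + card (pilot_win g G b s - pilot_win g G b t)"
    unfolding W_def by (rule card_Un_le)
  then have "real (card W) \<le> ((t + b) / g - (s + b) / g + 3) + ((t - b) / g - (s - b) / g + 3)"
    using card_nats_closed_interval(2)[OF i1 d(1)] card_nats_closed_interval(2)[OF i2 d(2)] by linarith
  also have "\<dots> = 2 * ((t - s) / g) + 6" by (simp add: add_divide_distrib diff_divide_distrib)
  finally have w: "real (card W) \<le> 2 * ((t - s) / g) + 6" .
  have "W \<subseteq> {..<G}" using win_sub by (auto simp: W_def)
  then show ?thesis
    unfolding eq by (rule pilot_chaos_moments(1)[OF _ _ w, rotated]) (use kap0 in \<open>auto simp: coef_def W_def\<close>)
qed

lemma pdet_term:
  assumes "k < G"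
  shows "\<bar>(real n / \<delta>^2 * pi^2 * Cv (1, k) (1, k) - pi\<^sup>2) - s2 (real k * g)\<bar> \<le> real n / \<delta>^2 * pi^2 * e"
proof -
  let ?D = "s2 (real k * g) * (g^2 / pi^2) + \<delta>^2 / real n"
  have "\<bar>Cv (1, k) (1, k) - ?D\<bar> \<le> e" using approx[of "(1, k)" "(1, k)"] assms e by simp
  then have "real n / \<delta>^2 * pi^2 * \<bar>Cv (1, k) (1, k) - ?D\<bar> \<le> real n / \<delta>^2 * pi^2 * e" by (intro mult_left_mono) auto
  moreover have "real n / \<delta>^2 * pi^2 * \<bar>Cv (1, k) (1, k) - ?D\<bar> = \<bar>real n / \<delta>^2 * pi^2 * (Cv (1, k) (1, k) - ?D)\<bar>"
    by (simp add: abs_mult)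
  moreover have "real n / \<delta>^2 * pi^2 * ?D = s2 (real k * g) + pi^2"
  proof -
    have "g^2 = \<delta>^2 / real n" using \<delta> by (simp add: power_divide)
    then show ?thesis using \<delta>(1) n by (simp only:) (simp add: field_simps)
  qed
  ultimately show ?thesis by (simp add: right_diff_distrib algebra_simps)
qed

text \<open>Near the ends of $[0,1]$ up to half of the window is missing, which is why the lower bound is far below $s_0$.\<close>
lemma pdet_range:
  assumes t: "0 \<le> t" "t < 1"
  shows "s0 / 4 \<le> pdet t" "pdet t \<le> 2 * S"
proof -
  let ?W = "pilot_win g G b t" and ?z = "\<lambda>k. real n / \<delta>^2 * pi^2 * Cv (1, k) (1, k) - pi\<^sup>2"
  have zb: "3 / 4 * s0 \<le> ?z k" "?z k \<le> 5 / 4 * S" if "k \<in> ?W" for k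
  proof -
    have k: "k < G" using that win_sub by auto
    have "s0 \<le> s2 (real k * g)" "s2 (real k * g) \<le> S" using s2b[OF grid01[OF k]] by auto
    then have "s0 - s0 / 4 \<le> ?z k" "?z k \<le> S + s0 / 4" "s0 / 4 \<le> S / 4" using pdet_term[OF k] e(2) by linarith+
    moreover have "s0 - s0 / 4 = 3 / 4 * s0" "S + S / 4 = 5 / 4 * S" by simp_all
    ultimately show "3 / 4 * s0 \<le> ?z k" "?z k \<le> 5 / 4 * S" by linarith+
  qed
  have pd: "pdet t = g / (2 * b) * (\<Sum>k\<in>?W. ?z k)" by (simp add: pdet_def sum_distrib_left)
  have gb: "0 < g / (2 * b)" using g0 b by simp
  have bg: "4 \<le> b / g" using b g0 by (simp add: field_simps)
  have lower: "b / g - 1 \<le> real (card ?W)"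
  proof (cases "t < 1 / 2")
    case True
    have "{i::nat. t / g \<le> real i \<and> real i \<le> (t + b) / g} \<subseteq> ?W"
    proof
      fix i assume "i \<in> {i::nat. t / g \<le> real i \<and> real i \<le> (t + b) / g}"
      then have i: "t \<le> real i * g" "real i * g \<le> t + b" using g0 by (auto simp: field_simps)
      then have "real i * g < 1" using True b by linarith
      then have "real i < real G" using G by (simp add: field_simps)
      then show "i \<in> ?W" using i by (auto simp: pilot_win_def)
    qed
    from card_nats_interval_lower[OF this win_sub(2)] show ?thesis using t g0 by (simp add: add_divide_distrib)
  next
    case False
    have "{i::nat. (t - b) / g \<le> real i \<and> real i \<le> t / g} \<subseteq> ?W"
    proof
      fix i assume "i \<in> {i::nat. (t - b) / g \<le> real i \<and> real i \<le> t / g}"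
      then have i: "t - b \<le> real i * g" "real i * g \<le> t" using g0 by (auto simp: field_simps)
      then have "real i * g < 1" using t by linarith
      then have "real i < real G" using G by (simp add: field_simps)
      then show "i \<in> ?W" using i by (auto simp: pilot_win_def)
    qed
    moreover have "0 \<le> (t - b) / g" using False b g0 by simp
    ultimately have "t / g - (t - b) / g - 1 \<le> real (card ?W)" by (intro card_nats_interval_lower win_sub(2))
    then show ?thesis by (simp add: diff_divide_distrib)
  qed
  \<comment> \<open>A window that keeps one full side has relative mass at least
    \<open>(1 - 1/4) / 2 = 3/8\<close>, and each summand is at least \<open>3/4 * s0\<close>; the
    product \<open>9/32\<close> exceeds \<open>1/4\<close>.\<close>
  have "s0 / 4 \<le> g / (2 * b) * ((b / g - 1) * (3 / 4 * s0))"
  proof -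
    have "g / (2 * b) * (b / g - 1) = (1 - g / b) / 2" using g0 b by (simp add: field_simps)
    moreover have "3 / 8 \<le> (1 - g / b) / 2" using b by simp
    ultimately have "3 / 8 * (3 / 4 * s0) \<le> g / (2 * b) * (b / g - 1) * (3 / 4 * s0)" using s0 by (intro mult_right_mono) auto
    moreover have "s0 / 4 \<le> 3 / 8 * (3 / 4 * s0)" using s0 by simp
    ultimately show ?thesis unfolding mult.assoc by (rule order_trans[rotated])
  qed
  also have "\<dots> \<le> g / (2 * b) * (real (card ?W) * (3 / 4 * s0))"
    using gb lower s0 by (intro mult_left_mono mult_right_mono) auto
  also have "\<dots> \<le> g / (2 * b) * (\<Sum>k\<in>?W. ?z k)"
    using gb sum_bounded_below[of ?W "3 / 4 * s0" ?z] zb by (intro mult_left_mono) auto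
  finally show "s0 / 4 \<le> pdet t" by (simp add: pd)
  have "(\<Sum>k\<in>?W. ?z k) \<le> real (card ?W) * (5 / 4 * S)" using sum_bounded_above[of ?W ?z "5 / 4 * S"] zb by auto
  also have "\<dots> \<le> 3 * (b / g) * (5 / 4 * S)" using win_card S0 by (intro mult_right_mono) auto
  finally have "pdet t \<le> g / (2 * b) * (3 * (b / g) * (5 / 4 * S))" unfolding pd using gb by (intro mult_left_mono) auto
  also have "\<dots> = 15 / 8 * S" using g0 b by simp
  finally show "pdet t \<le> 2 * S" using S0 by linarith
qed

text \<open>Here the whole window fits into \<open>[0,1]\<close>, so its relative mass
  \<open>m\<close> is 1 up to \<open>2 g / b\<close>. The other errors are the Hoelder oscillation
  over the bandwidth and the covariance error of one statistic.\<close>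

lemma pdet_approx:
  assumes t: "b \<le> t" "t + b < 1"
  shows "\<bar>pdet t - s2 t\<bar> \<le> 2 * (C * b powr a + real n / \<delta>^2 * pi^2 * e) + 2 * S * (g / b)"
proof -
  let ?W = "pilot_win g G b t" and ?z = "\<lambda>k. real n / \<delta>^2 * pi^2 * Cv (1, k) (1, k) - pi\<^sup>2"
  let ?r = "C * b powr a + real n / \<delta>^2 * pi^2 * e"
  have gb: "0 < g / (2 * b)" using g0 b by simp
  have t01: "t \<in> {0..1}" using t b by auto
  have r0: "0 \<le> ?r" using C e by simp
  have zb: "\<bar>?z k - s2 t\<bar> \<le> ?r" if "k \<in> ?W" for k
  proof -
    have k: "k < G" "\<bar>real k * g - t\<bar> \<le> b" using that by (auto simp: pilot_win_def)
    have "C * \<bar>real k * g - t\<bar> powr a \<le> C * b powr a" using k a C by (intro mult_left_mono powr_mono2) auto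
    then show ?thesis using H[OF grid01[OF k(1)] t01] pdet_term[OF k(1)] by linarith
  qed
  have up: "real (card ?W) \<le> 2 * (b / g) + 3"
  proof -
    have "?W \<subseteq> {i. (t - b) / g \<le> real i \<and> real i \<le> (t + b) / g}"
      using g0 by (auto simp: pilot_win_def field_simps abs_le_iff)
    then have "real (card ?W) \<le> (t + b) / g - (t - b) / g + 3"
      by (rule card_nats_closed_interval(2)) (use g0 b in \<open>simp add: divide_right_mono\<close>)
    then show ?thesis by (simp add: add_divide_distrib diff_divide_distrib)
  qed
  have lo: "2 * (b / g) - 1 \<le> real (card ?W)"
  proof -
    have "{i::nat. (t - b) / g \<le> real i \<and> real i \<le> (t + b) / g} \<subseteq> ?W"
    proof
      fix i assume "i \<in> {i::nat. (t - b) / g \<le> real i \<and> real i \<le> (t + b) / g}"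
      then have i: "t - b \<le> real i * g" "real i * g \<le> t + b" using g0 by (auto simp: field_simps)
      then have "real i * g < 1" using t by linarith
      then have "real i < real G" using G by (simp add: field_simps)
      then show "i \<in> ?W" using i by (auto simp: pilot_win_def)
    qed
    moreover have "0 \<le> (t - b) / g" using t g0 by simp
    ultimately have "(t + b) / g - (t - b) / g - 1 \<le> real (card ?W)" by (intro card_nats_interval_lower win_sub(2))
    then show ?thesis by (simp add: add_divide_distrib diff_divide_distrib)
  qed
  define m where "m = g / (2 * b) * real (card ?W)"
  have m: "\<bar>m - 1\<bar> \<le> 2 * (g / b)"
  proof -
    have "g / (2 * b) * real (card ?W) \<le> g / (2 * b) * (2 * (b / g) + 3)" "g / (2 * b) * (2 * (b / g) - 1) \<le> g / (2 * b) * real (card ?W)"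
      by (rule mult_left_mono[OF up less_imp_le[OF gb]], rule mult_left_mono[OF lo less_imp_le[OF gb]])
    moreover have "g / (2 * b) * (2 * (b / g) + 3) = 1 + 3 / 2 * (g / b)" "g / (2 * b) * (2 * (b / g) - 1) = 1 - 1 / 2 * (g / b)"
      using g0 b by (simp_all add: field_simps)
    moreover have "0 < g / b" using g0 b by simp
    ultimately show ?thesis unfolding m_def abs_le_iff by (intro conjI; linarith)
  qed
  have "2 * (g / b) \<le> 1 / 2" using b(3) by linarith
  then have m2: "m \<le> 2" using m by linarith
  have m3: "0 \<le> m" unfolding m_def using gb by (intro mult_nonneg_nonneg) auto
  have "pdet t - s2 t = g / (2 * b) * (\<Sum>k\<in>?W. ?z k - s2 t) + (m - 1) * s2 t"
    by (simp add: pdet_def m_def sum_distrib_left sum_subtractf right_diff_distrib left_diff_distrib)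
  moreover have "\<bar>g / (2 * b) * (\<Sum>k\<in>?W. ?z k - s2 t)\<bar> \<le> 2 * ?r"
  proof -
    have "\<bar>\<Sum>k\<in>?W. ?z k - s2 t\<bar> \<le> (\<Sum>k\<in>?W. ?r)" by (rule abs_sum_mult_le) (rule zb)
    then have "g / (2 * b) * \<bar>\<Sum>k\<in>?W. ?z k - s2 t\<bar> \<le> g / (2 * b) * (real (card ?W) * ?r)" using gb by (intro mult_left_mono) auto
    also have "\<dots> = m * ?r" by (simp add: m_def)
    also have "\<dots> \<le> 2 * ?r" by (intro mult_right_mono m2 r0)
    finally show ?thesis unfolding abs_mult abs_of_pos[OF gb] .
  qed
  moreover have "\<bar>(m - 1) * s2 t\<bar> \<le> 2 * S * (g / b)"
  proof -
    have "\<bar>m - 1\<bar> * \<bar>s2 t\<bar> \<le> (2 * (g / b)) * S" using m s2b[OF t01] s0 g0 b by (intro mult_mono) auto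
    then show ?thesis by (simp add: abs_mult mult_ac)
  qed
  ultimately show ?thesis by linarith
qed

end

section \<open>Linearization in the pilot error\<close>

text \<open>\<open>y\<close> are the pilot statistics on blocks of width \<open>g\<close> and
  \<open>z\<close> those of the estimator on \<open>N\<close> blocks of width \<open>h\<close>. Each
  array is Gaussian by itself; nothing is assumed about their joint law, which is how the use of the
  same data in both is accommodated.\<close>

locale stage = pilot M y Cv s2 g b \<delta> C a S s0 e G n
  for M :: "'a measure" and y Cv s2 g b \<delta> C a S s0 e G n +
  fixes z :: "nat \<times> nat \<Rightarrow> 'a \<Rightarrow> real" and Cz :: "nat \<times> nat \<Rightarrow> nat \<times> nat \<Rightarrow> real" and N J :: nat and h h0 :: real
    and ee :: "nat \<Rightarrow> real"
  assumes gz: "gaussian_array ({1..J} \<times> {..<N}) z Cz"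
    and N: "N > 0" "h = 1 / real N" and h0: "h0 = h * sqrt (real n) / \<delta>" "h0 \<ge> 1" and J: "real J \<ge> h0"
    and approxz: "\<And>p q. p \<in> {1..J} \<times> {..<N} \<Longrightarrow> q \<in> {1..J} \<times> {..<N} \<Longrightarrow>
       \<bar>Cz p q - (if p = q then s2 (real (snd p) * h) * (h^2 / (pi * real (fst p))^2) + \<delta>^2 / real n else 0)\<bar> \<le> sqrt (ee (fst p) * ee (fst q))"
    and ee: "\<And>j. 0 \<le> ee j" and cont: "continuous_on {0..1} s2"
begin

abbreviation "P \<equiv> {1..J} \<times> {..<N}"
definition "f k = pdet (real k * h)"
definition "V k = pvar (real k * h)"
text \<open>Half the lower bound \<open>s0 / 4\<close> of the pilot mean: as long as the fluctuation
  stays below \<open>c1\<close>, the pilot value lies between \<open>c1\<close> and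
  \<open>c2\<close>, the range on which the weights are expanded.\<close>

definition "c1 = s0 / 8"
definition "c2 = 2 * S + s0 / 8"
definition "Kw = 2 * (c2 + pi^2)^2 / (min c1 1)^2"
definition "r = real n powr (1/4)"
text \<open>The scaling \<open>r\<close> of the error, times the block width \<open>h\<close>, times
  the factor \<open>h^(-2) j^2 pi^2\<close> of the estimator. The next expression majorises
  \<open>q j\<close> times a weight.\<close>

definition "q j = r * real N * ((real j)^2 * pi^2)"
definition "cb j = q j * (Kw * wmaj h0 j)"
definition zeta :: "nat \<times> nat \<Rightarrow> 'a \<Rightarrow> real" where "zeta p \<omega> = (z p \<omega>)^2 - Cz p p"
text \<open>Coefficients of the zero-order term: the weights at the deterministic pilot mean of the
  block.\<close>

definition mcoef :: "nat \<times> nat \<Rightarrow> real" where "mcoef p = q (fst p) * weight J h0 (f (snd p)) (fst p)"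
definition "main_term = chaos2 P z Cz mcoef"
text \<open>Indexed by a set of blocks so that the sum of \<open>A k\<close> over consecutive blocks
  is itself one second-chaos sum, as the chaining requires.\<close>

definition acoef :: "nat set \<Rightarrow> nat \<times> nat \<Rightarrow> real" where
  "acoef K p = (if snd p \<in> K then q (fst p) * dweight J h0 (f (snd p)) (fst p) else 0)"
definition "A k = chaos2 P z Cz (acoef {k})"
definition Dz :: "nat \<times> nat \<Rightarrow> real" where
  "Dz p = s2 (real (snd p) * h) * (h^2 / (pi * real (fst p))^2) + \<delta>^2 / real n"
definition "m0 = pi^2 * Kw * (S + 1)"
text \<open>Total effect of all covariance errors, weighted by the coefficient majorants. Every
  later error term with \<open>ee\<close> is expressed through it, and it tends to 0.\<close>

definition "ks = real N * (\<Sum>j=1..J. cb j * ee j)"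
definition "err_stat = (\<lambda>\<omega>. r * ((\<Sum>k<N. h * (\<Sum>j=1..J. weight J h0 (f k + V k \<omega>) j * (real j)^2 * pi^2 / h^2 * ((z (j, k) \<omega>)^2 - \<delta>\<^sup>2 / real n)))
     - integral {0..1} s2))"

lemma hpos: "h > 0" using N by simp
lemma h0pos: "h0 > 0" using h0 by simp
lemma Jpos: "J > 0" using J h0 by (cases J) auto
lemma rpos: "r > 0" using n by (simp add: r_def)
lemma c12: "0 < c1" "c1 < c2" "c1 \<le> s0 / 4 - c1" using s0 S0 by (auto simp: c1_def c2_def)
lemma Kw0: "Kw > 0"
proof -
  have "c2 + pi^2 > 0" using c12 by (intro add_pos_pos) auto
  then show ?thesis using c12 by (simp add: Kw_def)
qed
lemma q0: "0 \<le> q j" using rpos by (simp add: q_def)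
lemma cb0: "0 \<le> cb j" using q0 Kw0 wmaj_nonneg[OF h0pos] by (simp add: cb_def)
lemma m00: "m0 > 0" using Kw0 S0 by (simp add: m0_def)
lemma ks0: "0 \<le> ks" unfolding ks_def using cb0 ee by (intro mult_nonneg_nonneg sum_nonneg) auto

lemma kh01: "k < N \<Longrightarrow> 0 \<le> real k * h \<and> real k * h < 1"
  using N(1) unfolding N(2) by auto

lemma f_range: "k < N \<Longrightarrow> 2 * c1 \<le> f k \<and> f k \<le> 2 * S"
  using pdet_range[of "real k * h"] kh01[of k] by (auto simp: f_def c1_def)

lemma f_range': "k < N \<Longrightarrow> f k \<in> {c1..c2}"
  using f_range[of k] c12 s0 by (auto simp: c2_def)

lemma Dz_bounds:
  assumes "p \<in> P"
  shows "0 \<le> Dz p" and "Dz p \<le> (S + 1) * (h^2 / (real (fst p))^2 * (1 + (real (fst p) / h0)^2))"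
proof -
  have k01: "real (snd p) * h \<in> {0..1}" using assms kh01[of "snd p"] by auto
  have s: "0 < s2 (real (snd p) * h)" "s2 (real (snd p) * h) \<le> S" using s2b[OF k01] s0 by auto
  have j: "real (fst p) > 0" using assms by auto
  show "0 \<le> Dz p" unfolding Dz_def using s by (intro add_nonneg_nonneg mult_nonneg_nonneg) auto
  have "1 \<le> pi^2" using pi_ge_two by (intro one_le_power) simp
  then have "h^2 / (pi * real (fst p))^2 \<le> h^2 / (real (fst p))^2"
    using j by (intro divide_left_mono) (auto simp: power_mult_distrib)
  then have 1: "s2 (real (snd p) * h) * (h^2 / (pi * real (fst p))^2) \<le> S * (h^2 / (real (fst p))^2)" using s by (intro mult_mono) auto
  have dn: "\<delta>^2 / real n = h^2 / (real (fst p))^2 * (real (fst p) / h0)^2"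
  proof -
    have "h0^2 = h^2 * real n / \<delta>^2" unfolding h0(1) by (simp add: power_mult_distrib power_divide)
    then show ?thesis using j hpos n \<delta>(1) h0pos by (simp add: power_divide)
  qed
  define u v where "u = h^2 / (real (fst p))^2" and "v = (real (fst p) / h0)^2"
  have "s2 (real (snd p) * h) * (h^2 / (pi * real (fst p))^2) \<le> S * u" "\<delta>^2 / real n = u * v"
    using 1 dn by (simp_all only: u_def v_def)
  moreover have "0 \<le> u" "0 \<le> S * (u * v)" using S0 by (auto simp: u_def v_def)
  moreover have "(S + 1) * (u * (1 + v)) = S * u + u + S * (u * v) + u * v" by (simp add: algebra_simps)
  ultimately have "Dz p \<le> (S + 1) * (u * (1 + v))"
    unfolding Dz_def by linarith
  then show "Dz p \<le> (S + 1) * (h^2 / (real (fst p))^2 * (1 + (real (fst p) / h0)^2))"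
    by (simp only: u_def v_def)
qed

text \<open>The factor \<open>j^2\<close> in \<open>q j\<close> cancels the \<open>1 / j^2\<close>
  in the bound for the variance of a statistic. What is left decays like
  \<open>1 / (1 + (j / h0)^2)\<close>, summable uniformly in \<open>J\<close>.\<close>

lemma cbD_bound:
  assumes "p \<in> P"
  shows "cb (fst p) * Dz p \<le> m0 * (r * h) * (wmaj h0 (fst p) * (1 + (real (fst p) / h0)^2))"
proof -
  have j: "real (fst p) > 0" using assms by auto
  have "cb (fst p) * Dz p \<le> cb (fst p) * ((S + 1) * (h^2 / (real (fst p))^2 * (1 + (real (fst p) / h0)^2)))"
    by (intro mult_left_mono Dz_bounds assms cb0)
  also have "\<dots> = m0 * (r * (real N * h^2)) * (wmaj h0 (fst p) * (1 + (real (fst p) / h0)^2)) * ((real (fst p))^2 / (real (fst p))^2)"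
    by (simp add: cb_def q_def m0_def mult_ac)
  also have "(real (fst p))^2 / (real (fst p))^2 = 1" using j by simp
  also have "real N * h^2 = h" using N by (simp add: power2_eq_square)
  finally show ?thesis by simp
qed

lemma sum_P_split: "(\<Sum>p\<in>P. F p) = (\<Sum>k<N. \<Sum>j=1..J. F (j, k))" for F :: "nat \<times> nat \<Rightarrow> real"
  by (subst sum.swap) (simp add: sum.cartesian_product)

lemma sum_cbD: "(\<Sum>j=1..J. cb j * Dz (j, k)) \<le> 8 * m0 * (r * h)" if "k < N"
proof -
  have "(\<Sum>j=1..J. cb j * Dz (j, k)) \<le> (\<Sum>j=1..J. m0 * (r * h) * (wmaj h0 j * (1 + (real j / h0)^2)))"
    using cbD_bound[of "(_, k)"] that by (intro sum_mono) auto
  also have "\<dots> \<le> m0 * (r * h) * 8"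
    unfolding sum_distrib_left[symmetric] using m00 rpos hpos by (intro mult_left_mono wmaj_sums h0pos) auto
  finally show ?thesis by (simp add: mult_ac)
qed

lemma sum_cbD_sq: "(\<Sum>j=1..J. (cb j * Dz (j, k))^2) \<le> 8 * m0^2 * (r * h)^2 / h0" if "k < N"
proof -
  have "(\<Sum>j=1..J. (cb j * Dz (j, k))^2) \<le> (\<Sum>j=1..J. (m0 * (r * h))^2 * (wmaj h0 j * (1 + (real j / h0)^2))^2)"
  proof (rule sum_mono)
    fix j assume "j \<in> {1..J}"
    then have p: "(j, k) \<in> P" using that by auto
    have "(cb j * Dz (j, k))^2 \<le> (m0 * (r * h) * (wmaj h0 j * (1 + (real j / h0)^2)))^2"
      using cbD_bound[OF p] cb0[of j] Dz_bounds(1)[OF p] by (intro power_mono) auto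
    then show "(cb j * Dz (j, k))^2 \<le> (m0 * (r * h))^2 * (wmaj h0 j * (1 + (real j / h0)^2))^2" by (simp add: power_mult_distrib)
  qed
  also have "\<dots> \<le> (m0 * (r * h))^2 * (8 / h0)"
    unfolding sum_distrib_left[symmetric] by (intro mult_left_mono wmaj_sums h0pos) auto
  finally show ?thesis by (simp add: power_mult_distrib mult_ac)
qed

lemma approxz': "p \<in> P \<Longrightarrow> p' \<in> P \<Longrightarrow> \<bar>Cz p p' - (if p = p' then Dz p else 0)\<bar> \<le> sqrt (ee (fst p) * ee (fst p'))"
  unfolding Dz_def by (rule approxz)

lemma weight_bounds:
  assumes "k < N" "\<bar>v\<bar> \<le> c1"
  shows "0 \<le> weight J h0 (f k + v) j" "weight J h0 (f k + v) j \<le> Kw * wmaj h0 j"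
    "\<bar>dweight J h0 (f k) j\<bar> \<le> 2 / c1 * (Kw * wmaj h0 j)"
    "\<bar>weight J h0 (f k + v) j - weight J h0 (f k) j - v * dweight J h0 (f k) j\<bar> \<le> 16 / c1^2 * (Kw * wmaj h0 j) * v^2"
    "(\<Sum>j=1..J. weight J h0 (f k + v) j) = 1"
proof -
  have fv: "c1 \<le> f k + v" "f k + v \<le> c2" using f_range[OF assms(1)] assms(2) c12 by (auto simp: c1_def c2_def)
  have fk: "c1 \<le> f k" "f k \<le> c2" using f_range'[OF assms(1)] by auto
  have fv0: "0 < f k + v" using fv c12 by linarith
  show "0 \<le> weight J h0 (f k + v) j" by (rule weight_nonneg[OF fv0 Jpos])
  show "weight J h0 (f k + v) j \<le> Kw * wmaj h0 j"
    unfolding Kw_def by (rule weight_le_wmaj[OF c12(1) fv h0(2) J])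
  show "\<bar>dweight J h0 (f k) j\<bar> \<le> 2 / c1 * (Kw * wmaj h0 j)"
    unfolding Kw_def by (rule weight_taylor(1)[OF c12(1) fk fv h0(2) J])
  show "\<bar>weight J h0 (f k + v) j - weight J h0 (f k) j - v * dweight J h0 (f k) j\<bar> \<le> 16 / c1^2 * (Kw * wmaj h0 j) * v^2"
    using weight_taylor(2)[OF c12(1) fk fv h0(2) J, of j] unfolding Kw_def by simp
  show "(\<Sum>j=1..J. weight J h0 (f k + v) j) = 1" by (rule sum_weight[OF fv0 Jpos])
qed

lemma mcoef_bounds:
  assumes "p \<in> P" shows "0 \<le> mcoef p" "mcoef p \<le> cb (fst p)"
proof -
  have k: "snd p < N" using assms by auto
  show "0 \<le> mcoef p" "mcoef p \<le> cb (fst p)"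
    using weight_bounds(1,2)[OF k, of 0 "fst p"] c12 q0[of "fst p"] by (auto simp: mcoef_def cb_def intro!: mult_nonneg_nonneg mult_left_mono)
qed

text \<open>Per-block standard deviation of sums of \<open>A k\<close>. The factor
  \<open>2 / c1\<close> comes from the derivative of the weights, and \<open>32 = 4 * 8\<close> from
  the moment bound for the chaos and the sum of the squared majorants.\<close>

definition "alpha = 2 / c1 * sqrt (32 * m0^2 * (r * h)^2 / h0 + 4 * ks^2 * h)"

lemma alpha0: "0 \<le> alpha" using c12 h0pos hpos by (simp add: alpha_def)

lemma A_moment:
  assumes sm: "s + m \<le> N"
  shows "expectation (\<lambda>\<omega>. (\<Sum>k\<in>{s..<s + m}. A k \<omega>)^2) \<le> alpha^2 * real m"
proof -
  let ?K = "{s..<s + m}"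
  have eq: "(\<Sum>k\<in>?K. A k \<omega>) = chaos2 P z Cz (acoef ?K) \<omega>" for \<omega>
  proof -
    have "(\<Sum>k\<in>?K. A k \<omega>) = (\<Sum>p\<in>P. (\<Sum>k\<in>?K. acoef {k} p) * zeta p \<omega>)"
      unfolding A_def chaos2_def zeta_def by (subst sum.swap) (simp add: sum_distrib_right)
    also have "\<dots> = (\<Sum>p\<in>P. acoef ?K p * zeta p \<omega>)"
      by (simp add: acoef_def)
    finally show ?thesis by (simp add: chaos2_def zeta_def)
  qed
  have ab: "\<bar>acoef ?K p\<bar> \<le> (if snd p \<in> ?K then 2 / c1 * cb (fst p) else 0)" if p: "p \<in> P" for p
  proof (cases "snd p \<in> ?K")
    case True
    have "snd p < N" using p by auto
    have "q (fst p) * \<bar>dweight J h0 (f (snd p)) (fst p)\<bar> \<le> q (fst p) * (2 / c1 * (Kw * wmaj h0 (fst p)))"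
      using weight_bounds(3)[OF \<open>snd p < N\<close>, of 0] c12 q0 by (intro mult_left_mono) auto
    then show ?thesis using True q0[of "fst p"] by (simp add: acoef_def cb_def abs_mult mult_ac)
  next
    case False
    then show ?thesis by (auto simp: acoef_def)
  qed
  have sumK: "(\<Sum>k<N. if k \<in> ?K then F k else 0) = (\<Sum>k\<in>?K. F k)" for F :: "nat \<Rightarrow> real"
  proof -
    have "{..<N} \<inter> ?K = ?K" using sm by auto
    then show ?thesis using sum.inter_restrict[of "{..<N}" F ?K] by simp
  qed
  have "(\<Sum>p\<in>P. (acoef ?K p * Dz p)^2) \<le> (\<Sum>p\<in>P. if snd p \<in> ?K then (2 / c1)\<^sup>2 * (cb (fst p) * Dz p)^2 else 0)"
  proof (rule sum_mono)
    fix p assume p: "p \<in> P"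
    have "(\<bar>acoef ?K p\<bar> * Dz p)^2 \<le> ((if snd p \<in> ?K then 2 / c1 * cb (fst p) else 0) * Dz p)^2"
      using ab[OF p] Dz_bounds(1)[OF p] by (intro power_mono mult_right_mono) auto
    also have "\<dots> = (if snd p \<in> ?K then (2 / c1)\<^sup>2 * (cb (fst p) * Dz p)^2 else 0)"
    proof (cases "snd p \<in> ?K")
      case True
      then show ?thesis by (simp only: if_True power_mult_distrib mult.assoc)
    next
      case False
      then show ?thesis by (simp only: if_False mult_zero_left) simp
    qed
    finally show "(acoef ?K p * Dz p)^2 \<le> (if snd p \<in> ?K then (2 / c1)\<^sup>2 * (cb (fst p) * Dz p)^2 else 0)"
      by (simp only: power_mult_distrib power2_abs)
  qed
  also have "\<dots> = (\<Sum>k\<in>?K. (2 / c1)^2 * (\<Sum>j=1..J. (cb j * Dz (j, k))^2))"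
    unfolding sum_P_split sumK[symmetric] by (rule sum.cong[OF refl]) (auto simp: sum_distrib_left)
  also have "\<dots> \<le> (\<Sum>k\<in>?K. (2 / c1)^2 * (8 * m0^2 * (r * h)^2 / h0))"
    using sm by (intro sum_mono mult_left_mono sum_cbD_sq) auto
  finally have 1: "(\<Sum>p\<in>P. (acoef ?K p * Dz p)^2) \<le> real m * ((2 / c1)^2 * (8 * m0^2 * (r * h)^2 / h0))" by simp
  have "(\<Sum>p\<in>P. \<bar>acoef ?K p\<bar> * ee (fst p)) \<le> (\<Sum>p\<in>P. if snd p \<in> ?K then 2 / c1 * (cb (fst p) * ee (fst p)) else 0)"
  proof (rule sum_mono)
    fix p assume p: "p \<in> P"
    show "\<bar>acoef ?K p\<bar> * ee (fst p) \<le> (if snd p \<in> ?K then 2 / c1 * (cb (fst p) * ee (fst p)) else 0)"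
      using mult_right_mono[OF ab[OF p] ee[of "fst p"]] by (auto split: if_splits)
  qed
  also have "\<dots> = (\<Sum>k\<in>?K. 2 / c1 * (\<Sum>j=1..J. cb j * ee j))"
    unfolding sum_P_split sumK[symmetric] by (rule sum.cong[OF refl]) (auto simp: sum_distrib_left)
  also have "\<dots> = 2 / c1 * (real m * (ks * h))"
    using N by (simp add: ks_def)
  finally have "(\<Sum>p\<in>P. \<bar>acoef ?K p\<bar> * ee (fst p))^2 \<le> (2 / c1 * (real m * (ks * h)))^2"
    using ee by (intro power_mono sum_nonneg) auto
  also have "\<dots> = (2 / c1)^2 * (real m * (ks^2 * h * (real m * h)))" by (simp add: power2_eq_square)
  also have "\<dots> \<le> (2 / c1)^2 * (real m * (ks^2 * h * 1))"
  proof -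
    have "real m * h \<le> 1" using sm N(1) unfolding N(2) by auto
    then show ?thesis using hpos by (intro mult_left_mono) auto
  qed
  finally have 2: "(\<Sum>p\<in>P. \<bar>acoef ?K p\<bar> * ee (fst p))^2 \<le> (2 / c1)^2 * (real m * (ks^2 * h))" by simp
  have al: "alpha^2 = (2 / c1)^2 * (32 * m0^2 * (r * h)^2 / h0 + 4 * ks^2 * h)"
    unfolding alpha_def power_mult_distrib using h0pos hpos by simp
  have B: "4 * (\<Sum>p\<in>P. (acoef ?K p * Dz p)^2) + 4 * (\<Sum>p\<in>P. \<bar>acoef ?K p\<bar> * ee (fst p))^2 \<le> alpha^2 * real m"
  proof -
    have "4 * (real m * ((2 / c1)^2 * (8 * m0^2 * (r * h)^2 / h0))) + 4 * ((2 / c1)^2 * (real m * (ks^2 * h))) = alpha^2 * real m"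
      unfolding al by (simp add: algebra_simps)
    then show ?thesis using 1 2 by linarith
  qed
  show ?thesis
    unfolding eq by (rule chaos2_moment_bounds(1)[OF gz approxz' _ Dz_bounds(1) B]) (use ee in auto)
qed

definition "xx = 3 * (b / g) * Bq"
text \<open>Moving from one block to the next shifts the pilot window by \<open>h = h0 * g\<close>,
  which changes at most \<open>2 * h0 + 6\<close> of its entries, hence at most
  \<open>8 * h0\<close>.\<close>

definition "vv = sqrt (8 * h0 * Bq)"

lemma xx0: "0 \<le> xx" using b g0 Bq0 by (simp add: xx_def)

lemma V_increment:
  assumes "k \<le> l" shows "expectation (\<lambda>\<omega>. (V l \<omega> - V k \<omega>)^2) \<le> vv^2 * real (l - k)"
proof (cases "k = l")
  case False
  then have kl: "k < l" using assms by simp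
  have "expectation (\<lambda>\<omega>. (V l \<omega> - V k \<omega>)^2) \<le> (2 * ((real l * h - real k * h) / g) + 6) * Bq"
    unfolding V_def by (rule pvar_increment) (use assms hpos in \<open>auto intro!: mult_right_mono\<close>)
  also have "(real l * h - real k * h) / g = real (l - k) * h0"
  proof -
    have "h / g = h0" using \<delta> n by (simp add: h0(1))
    then show ?thesis using assms by (simp add: of_nat_diff left_diff_distrib diff_divide_distrib flip: times_divide_eq_right)
  qed
  also have "(2 * (real (l - k) * h0) + 6) * Bq \<le> (8 * h0 * real (l - k)) * Bq"
  proof (intro mult_right_mono Bq0)
    have "1 \<le> real (l - k)" using kl by simp
    then have "1 * 1 \<le> real (l - k) * h0" using h0 by (intro mult_mono) auto
    then show "2 * (real (l - k) * h0) + 6 \<le> 8 * h0 * real (l - k)" by (simp add: mult.commute mult.left_commute del: of_nat_diff)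
  qed
  also have "\<dots> = vv^2 * real (l - k)" using h0pos Bq0 by (simp add: vv_def)
  finally show ?thesis .
qed simp

lemma sq_int_V: "sq_int (V k)" and V4: "integrable M (\<lambda>\<omega>. V k \<omega> ^ 4)" "expectation (\<lambda>\<omega>. V k \<omega> ^ 4) \<le> 24 * xx^2"
  and V2: "expectation (\<lambda>\<omega>. (V k \<omega>)^2) \<le> xx"
  using pvar_moments[of "real k * h"] by (auto simp: V_def xx_def)

lemma sq_int_A: "sq_int (A k)"
  using gaussian_array_chaos2(1)[OF gz] gaussian_array_chaos2(2)[OF gz, of 2] by (auto simp: sq_int_def A_def)

lemma sq_int_V2: "sq_int (\<lambda>\<omega>. (V k \<omega>)^2)"
  using V4(1)[of k] sq_int_V[of k] by (auto simp: sq_int_def simp flip: power_mult)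

lemma zeta_chaos: assumes "p \<in> P" shows "zeta p = chaos2 P z Cz (\<lambda>q. if q = p then 1 else 0)"
proof
  fix \<omega>
  have "chaos2 P z Cz (\<lambda>q. if q = p then 1 else 0) \<omega> = (\<Sum>q\<in>P. if q = p then zeta q \<omega> else 0)"
    unfolding chaos2_def zeta_def by (intro sum.cong refl) auto
  then show "zeta p \<omega> = chaos2 P z Cz (\<lambda>q. if q = p then 1 else 0) \<omega>" using assms by (simp add: sum.delta)
qed

lemma zeta_moment:
  assumes p: "p \<in> P"
  shows "sq_int (zeta p)" "expectation (\<lambda>\<omega>. (zeta p \<omega>)^2) \<le> (2 * (Dz p + ee (fst p)))^2"
proof -
  let ?c = "\<lambda>q. if q = p then 1 else 0 :: real"
  show "sq_int (zeta p)"
    using gaussian_array_chaos2(1)[OF gz] gaussian_array_chaos2(2)[OF gz, of 2] by (auto simp: sq_int_def zeta_chaos[OF p])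
  have "(\<Sum>q\<in>P. (?c q * Dz q)^2) = (\<Sum>q\<in>P. if q = p then (Dz q)\<^sup>2 else 0)" by (intro sum.cong refl) auto
  then have 1: "(\<Sum>q\<in>P. (?c q * Dz q)^2) = (Dz p)^2" using p by (simp add: sum.delta)
  have "(\<Sum>q\<in>P. \<bar>?c q\<bar> * ee (fst q)) = (\<Sum>q\<in>P. if q = p then ee (fst q) else 0)" by (intro sum.cong refl) auto
  then have 2: "(\<Sum>q\<in>P. \<bar>?c q\<bar> * ee (fst q)) = ee (fst p)" using p by (simp add: sum.delta)
  have "0 \<le> Dz p * ee (fst p)" using Dz_bounds(1)[OF p] ee by simp
  then have B: "4 * (\<Sum>q\<in>P. (?c q * Dz q)^2) + 4 * (\<Sum>q\<in>P. \<bar>?c q\<bar> * ee (fst q))^2 \<le> (2 * (Dz p + ee (fst p)))^2"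
    unfolding 1 2 by (simp add: power2_eq_square algebra_simps)
  show "expectation (\<lambda>\<omega>. (zeta p \<omega>)^2) \<le> (2 * (Dz p + ee (fst p)))^2"
    unfolding zeta_chaos[OF p] by (rule chaos2_moment_bounds(1)[OF gz approxz' _ Dz_bounds(1) B]) (use ee in auto)
qed

lemma err_stat_decomp:
  "err_stat \<omega> = (\<Sum>k<N. \<Sum>j=1..J. q j * weight J h0 (f k + V k \<omega>) j * ((z (j, k) \<omega>)^2 - \<delta>\<^sup>2 / real n)) - r * integral {0..1} s2"
proof -
  have "r * (h * (w * j2 * p2 / h^2 * X)) = r * real N * (j2 * p2) * w * X" for w j2 p2 X
    using N by (simp add: power2_eq_square)
  then have "r * (\<Sum>k<N. h * (\<Sum>j=1..J. weight J h0 (f k + V k \<omega>) j * (real j)^2 * pi^2 / h^2 * ((z (j, k) \<omega>)^2 - \<delta>\<^sup>2 / real n)))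
     = (\<Sum>k<N. \<Sum>j=1..J. q j * weight J h0 (f k + V k \<omega>) j * ((z (j, k) \<omega>)^2 - \<delta>\<^sup>2 / real n))"
    unfolding sum_distrib_left q_def by (simp only:)
  then show ?thesis
    unfolding err_stat_def right_diff_distrib by (simp only:)
qed

lemma det_term: "\<bar>r * ((\<Sum>k<N. h * s2 (real k * h)) - integral {0..1} s2)\<bar> \<le> r * (C * h powr a)"
proof -
  have "\<bar>(\<Sum>k<N. h * s2 (0 + real k * h)) - integral {0..0 + real N * h} s2\<bar> \<le> real N * h * (C * h powr a)"
    by (rule holder_riemann[OF H cont C a hpos]) (use N in auto)
  then have "\<bar>(\<Sum>k<N. h * s2 (real k * h)) - integral {0..1} s2\<bar> \<le> C * h powr a" using N by simp
  then show ?thesis unfolding abs_mult using rpos by (intro mult_mono) auto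
qed

lemma err_stat_pointwise:
  "min 1 \<bar>err_stat \<omega> - main_term \<omega>\<bar> \<le> (\<Sum>k<N. V k \<omega> ^ 4 / c1 ^ 4) + \<bar>\<Sum>k<N. V k \<omega> * A k \<omega>\<bar>
     + (\<Sum>k<N. \<Sum>j=1..J. 16 / c1^2 * cb j * \<bar>(V k \<omega>)\<^sup>2 * zeta (j, k) \<omega>\<bar>) + (ks + r * (C * h powr a))"
proof (cases "\<forall>k<N. \<bar>V k \<omega>\<bar> \<le> c1")
  case False
  then obtain k where k: "k < N" "c1 < \<bar>V k \<omega>\<bar>" by force
  have p4: "V k \<omega> ^ 4 = \<bar>V k \<omega>\<bar> ^ 4" for k by (simp flip: power_abs)
  have "c1 ^ 4 \<le> V k \<omega> ^ 4" unfolding p4 using k c12 by (intro power_mono) auto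
  then have "1 \<le> V k \<omega> ^ 4 / c1 ^ 4" using c12 by simp
  also have "\<dots> \<le> (\<Sum>k<N. V k \<omega> ^ 4 / c1 ^ 4)"
    using k c12 by (intro member_le_sum[where f = "\<lambda>k. V k \<omega> ^ 4 / c1 ^ 4"]) auto
  finally have "1 \<le> (\<Sum>k<N. V k \<omega> ^ 4 / c1 ^ 4)" .
  moreover have "0 \<le> (\<Sum>k<N. \<Sum>j=1..J. 16 / c1^2 * cb j * \<bar>(V k \<omega>)\<^sup>2 * zeta (j, k) \<omega>\<bar>)"
    using cb0 by (intro sum_nonneg) auto
  moreover have "0 \<le> ks + r * (C * h powr a)" using ks0 rpos C by simp
  ultimately show ?thesis by linarith
next
  case True
  define w where "w k j = weight J h0 (f k + V k \<omega>) j" for k j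
  define R where "R k j = w k j - weight J h0 (f k) j - V k \<omega> * dweight J h0 (f k) j" for k j
  have wb: "0 \<le> w k j" "w k j \<le> Kw * wmaj h0 j" "\<bar>R k j\<bar> \<le> 16 / c1^2 * (Kw * wmaj h0 j) * (V k \<omega>)^2" "(\<Sum>j=1..J. w k j) = 1" if "k < N" for k j
    using weight_bounds(1-4)[OF that, of "V k \<omega>" j] weight_bounds(5)[OF that, of "V k \<omega>"] True that by (auto simp: w_def R_def)
  have mt: "main_term \<omega> = (\<Sum>k<N. \<Sum>j=1..J. q j * weight J h0 (f k) j * zeta (j, k) \<omega>)"
    unfolding main_term_def chaos2_def sum_P_split by (simp add: mcoef_def zeta_def)
  have At: "A k \<omega> = (\<Sum>j=1..J. q j * dweight J h0 (f k) j * zeta (j, k) \<omega>)" if "k < N" for k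
  proof -
    have "A k \<omega> = (\<Sum>l<N. if l = k then (\<Sum>j=1..J. q j * dweight J h0 (f l) j * zeta (j, l) \<omega>) else 0)"
      unfolding A_def chaos2_def sum_P_split by (intro sum.cong refl) (simp add: acoef_def zeta_def)
    then show ?thesis using that by (simp add: sum.delta)
  qed
  have expand: "(\<Sum>j=1..J. q j * w k j * ((z (j, k) \<omega>)^2 - \<delta>\<^sup>2 / real n)) =
      (\<Sum>j=1..J. q j * weight J h0 (f k) j * zeta (j, k) \<omega>) + V k \<omega> * A k \<omega> +
      (\<Sum>j=1..J. q j * R k j * zeta (j, k) \<omega>) + (\<Sum>j=1..J. q j * w k j * (Cz (j, k) (j, k) - Dz (j, k))) + r * (h * s2 (real k * h))"
    if k: "k < N" for k
  proof -
    have "q j * w k j * ((z (j, k) \<omega>)^2 - \<delta>\<^sup>2 / real n) =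
      q j * weight J h0 (f k) j * zeta (j, k) \<omega> + V k \<omega> * (q j * dweight J h0 (f k) j * zeta (j, k) \<omega>) +
      q j * R k j * zeta (j, k) \<omega> + q j * w k j * (Cz (j, k) (j, k) - Dz (j, k)) + r * (h * s2 (real k * h)) * w k j" if j: "j \<in> {1..J}" for j
    proof -
      have w: "w k j = weight J h0 (f k) j + V k \<omega> * dweight J h0 (f k) j + R k j" by (simp add: R_def)
      \<comment> \<open>The signal part of the variance times \<open>q j\<close> does not depend on
        \<open>j\<close>. Summed against weights of total mass 1 it is reproduced exactly for any
        pilot value in range, so an error of the pilot creates no bias.\<close>
      have "q j * (s2 (real k * h) * (h^2 / (pi * real j)^2)) = r * (h * s2 (real k * h))"
        using j N by (simp add: q_def power2_eq_square field_simps)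
      then have "r * (h * s2 (real k * h)) * w k j = q j * w k j * (s2 (real k * h) * (h^2 / (pi * real j)^2))" by (metis mult.assoc mult.commute)
      moreover have "(z (j, k) \<omega>)^2 - \<delta>\<^sup>2 / real n = zeta (j, k) \<omega> + (Cz (j, k) (j, k) - Dz (j, k)) + s2 (real k * h) * (h^2 / (pi * real j)^2)"
        by (simp add: zeta_def Dz_def)
      ultimately have "q j * w k j * ((z (j, k) \<omega>)^2 - \<delta>\<^sup>2 / real n) = q j * w k j * zeta (j, k) \<omega> + q j * w k j * (Cz (j, k) (j, k) - Dz (j, k)) + r * (h * s2 (real k * h)) * w k j"
        by (simp only: distrib_left)
      moreover have "q j * w k j * zeta (j, k) \<omega> = q j * weight J h0 (f k) j * zeta (j, k) \<omega> + V k \<omega> * (q j * dweight J h0 (f k) j * zeta (j, k) \<omega>) + q j * R k j * zeta (j, k) \<omega>"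
        unfolding w by (simp add: algebra_simps)
      ultimately show ?thesis by simp
    qed
    then have "(\<Sum>j=1..J. q j * w k j * ((z (j, k) \<omega>)^2 - \<delta>\<^sup>2 / real n)) = (\<Sum>j=1..J. q j * weight J h0 (f k) j * zeta (j, k) \<omega> + V k \<omega> * (q j * dweight J h0 (f k) j * zeta (j, k) \<omega>) +
      q j * R k j * zeta (j, k) \<omega> + q j * w k j * (Cz (j, k) (j, k) - Dz (j, k)) + r * (h * s2 (real k * h)) * w k j)"
      by (intro sum.cong refl)
    also have "\<dots> = (\<Sum>j=1..J. q j * weight J h0 (f k) j * zeta (j, k) \<omega>) + V k \<omega> * A k \<omega> +
      (\<Sum>j=1..J. q j * R k j * zeta (j, k) \<omega>) + (\<Sum>j=1..J. q j * w k j * (Cz (j, k) (j, k) - Dz (j, k))) + r * (h * s2 (real k * h)) * (\<Sum>j=1..J. w k j)"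
      unfolding sum.distrib At[OF k] sum_distrib_left ..
    finally show ?thesis unfolding wb(4)[OF k] by simp
  qed
  have "err_stat \<omega> = (\<Sum>k<N. (\<Sum>j=1..J. q j * weight J h0 (f k) j * zeta (j, k) \<omega>) + V k \<omega> * A k \<omega> +
      (\<Sum>j=1..J. q j * R k j * zeta (j, k) \<omega>) + (\<Sum>j=1..J. q j * w k j * (Cz (j, k) (j, k) - Dz (j, k))) + r * (h * s2 (real k * h))) - r * integral {0..1} s2"
    unfolding err_stat_decomp w_def[symmetric] using expand by simp
  also have "\<dots> = main_term \<omega> + (\<Sum>k<N. V k \<omega> * A k \<omega>) + (\<Sum>k<N. \<Sum>j=1..J. q j * R k j * zeta (j, k) \<omega>) +
     (\<Sum>k<N. \<Sum>j=1..J. q j * w k j * (Cz (j, k) (j, k) - Dz (j, k))) + r * ((\<Sum>k<N. h * s2 (real k * h)) - integral {0..1} s2)"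
    unfolding sum.distrib mt right_diff_distrib sum_distrib_left by simp
  finally have eq: "err_stat \<omega> - main_term \<omega> = (\<Sum>k<N. V k \<omega> * A k \<omega>) + (\<Sum>k<N. \<Sum>j=1..J. q j * R k j * zeta (j, k) \<omega>) +
     (\<Sum>k<N. \<Sum>j=1..J. q j * w k j * (Cz (j, k) (j, k) - Dz (j, k))) + r * ((\<Sum>k<N. h * s2 (real k * h)) - integral {0..1} s2)" by simp
  have Rb: "\<bar>\<Sum>k<N. \<Sum>j=1..J. q j * R k j * zeta (j, k) \<omega>\<bar> \<le> (\<Sum>k<N. \<Sum>j=1..J. 16 / c1^2 * cb j * \<bar>(V k \<omega>)\<^sup>2 * zeta (j, k) \<omega>\<bar>)"
  proof (rule abs_sum_mult_le, rule abs_sum_mult_le)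
    fix k j assume "k \<in> {..<N}"
    then have "q j * \<bar>R k j\<bar> * \<bar>zeta (j, k) \<omega>\<bar> \<le> q j * (16 / c1^2 * (Kw * wmaj h0 j) * (V k \<omega>)^2) * \<bar>zeta (j, k) \<omega>\<bar>"
      using wb(3)[of k j] q0 by (intro mult_right_mono mult_left_mono) auto
    then show "\<bar>q j * R k j * zeta (j, k) \<omega>\<bar> \<le> 16 / c1^2 * cb j * \<bar>(V k \<omega>)\<^sup>2 * zeta (j, k) \<omega>\<bar>"
      using q0[of j] by (simp add: abs_mult cb_def mult_ac)
  qed
  have Cb: "\<bar>\<Sum>k<N. \<Sum>j=1..J. q j * w k j * (Cz (j, k) (j, k) - Dz (j, k))\<bar> \<le> ks"
  proof -
    have "\<bar>\<Sum>k<N. \<Sum>j=1..J. q j * w k j * (Cz (j, k) (j, k) - Dz (j, k))\<bar> \<le> (\<Sum>k<N. \<Sum>j=1..J. cb j * ee j)"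
    proof (rule abs_sum_mult_le, rule abs_sum_mult_le)
      fix k j assume kj: "k \<in> {..<N}" "j \<in> {1..J}"
      have "\<bar>Cz (j, k) (j, k) - Dz (j, k)\<bar> \<le> ee j" using approxz'[of "(j, k)" "(j, k)"] kj ee[of j] by simp
      moreover have "q j * w k j \<le> cb j" "0 \<le> q j * w k j" using wb(1,2)[of k j] kj q0[of j] by (auto simp: cb_def intro!: mult_left_mono)
      ultimately show "\<bar>q j * w k j * (Cz (j, k) (j, k) - Dz (j, k))\<bar> \<le> cb j * ee j"
        unfolding abs_mult[of "q j * w k j"] by (intro mult_mono) auto
    qed
    then show ?thesis by (simp add: ks_def)
  qed
  have "0 \<le> (\<Sum>k<N. V k \<omega> ^ 4 / c1 ^ 4)" using c12 by (intro sum_nonneg) auto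
  then show ?thesis unfolding eq using Rb Cb det_term by linarith
qed

lemma err_stat_measurable: "err_stat \<in> borel_measurable M" "main_term \<in> borel_measurable M"
proof -
  have [measurable]: "V k \<in> borel_measurable M" for k using sq_int_V[of k] by (simp add: sq_int_def)
  have zm: "(\<lambda>\<omega>. (z (j, k) \<omega>)^2) \<in> borel_measurable M" if "j \<in> {1..J}" "k \<in> {..<N}" for j k
  proof -
    have "zeta (j, k) \<in> borel_measurable M" using zeta_moment(1)[of "(j, k)"] that by (auto simp: sq_int_def)
    moreover have "(\<lambda>\<omega>. (z (j, k) \<omega>)^2) = (\<lambda>\<omega>. zeta (j, k) \<omega> + Cz (j, k) (j, k))" by (simp add: zeta_def)
    ultimately show ?thesis by simp
  qed
  show "main_term \<in> borel_measurable M" unfolding main_term_def by (rule gaussian_array_chaos2(1)[OF gz])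
  show "err_stat \<in> borel_measurable M"
    unfolding err_stat_def weight_def
    by (intro borel_measurable_times borel_measurable_diff borel_measurable_sum borel_measurable_divide borel_measurable_const zm) (auto, measurable)
qed

text \<open>The four summands bound the event that some pilot error exceeds $c_1$, the first-order and second-order terms of the Taylor expansion of the weights, and the deterministic bias.\<close>
theorem err_stat_bound:
  assumes L: "N \<le> 2 ^ L"
  shows "expectation (\<lambda>\<omega>. min 1 \<bar>err_stat \<omega> - main_term \<omega>\<bar>) \<le> real N * (24 * xx^2 / c1 ^ 4)
     + (real L * (vv * alpha * 2 ^ L / 2) + sqrt xx * (alpha * sqrt (real N)))
     + 160 / c1^2 * xx * (8 * m0 * r + ks) + (ks + r * (C * h powr a))"
proof -
  have [measurable]: "err_stat \<in> borel_measurable M" "main_term \<in> borel_measurable M" by (rule err_stat_measurable)+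
  have i1: "integrable M (\<lambda>\<omega>. \<Sum>k<N. V k \<omega> ^ 4 / c1 ^ 4)" using V4(1) by simp
  have i2: "integrable M (\<lambda>\<omega>. \<bar>\<Sum>k<N. V k \<omega> * A k \<omega>\<bar>)"
    by (intro integrable_abs Bochner_Integration.integrable_sum sq_int_mult sq_int_V sq_int_A)
  have i3: "integrable M (\<lambda>\<omega>. \<bar>(V k \<omega>)\<^sup>2 * zeta (j, k) \<omega>\<bar>)" if "k \<in> {..<N}" "j \<in> {1..J}" for k j
    by (intro integrable_abs sq_int_mult sq_int_V2 zeta_moment(1)) (use that in auto)
  have i3': "integrable M (\<lambda>\<omega>. \<Sum>k<N. \<Sum>j=1..J. 16 / c1^2 * cb j * \<bar>(V k \<omega>)\<^sup>2 * zeta (j, k) \<omega>\<bar>)"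
    by (intro Bochner_Integration.integrable_sum integrable_mult_right i3)
  let ?c = "ks + r * (C * h powr a)"
  have "expectation (\<lambda>\<omega>. min 1 \<bar>err_stat \<omega> - main_term \<omega>\<bar>) \<le>
     expectation (\<lambda>\<omega>. (\<Sum>k<N. V k \<omega> ^ 4 / c1 ^ 4) + \<bar>\<Sum>k<N. V k \<omega> * A k \<omega>\<bar>
     + (\<Sum>k<N. \<Sum>j=1..J. 16 / c1^2 * cb j * \<bar>(V k \<omega>)\<^sup>2 * zeta (j, k) \<omega>\<bar>) + ?c)"
  proof (rule integral_mono)
    show "integrable M (\<lambda>\<omega>. min 1 \<bar>err_stat \<omega> - main_term \<omega>\<bar>)"
      by (rule integrable_const_bound[of _ 1]) auto
    show "integrable M (\<lambda>\<omega>. (\<Sum>k<N. V k \<omega> ^ 4 / c1 ^ 4) + \<bar>\<Sum>k<N. V k \<omega> * A k \<omega>\<bar>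
     + (\<Sum>k<N. \<Sum>j=1..J. 16 / c1^2 * cb j * \<bar>(V k \<omega>)\<^sup>2 * zeta (j, k) \<omega>\<bar>) + ?c)"
      by (intro Bochner_Integration.integrable_add i1 i2 i3') simp_all
  qed (rule err_stat_pointwise)
  also have "\<dots> = expectation (\<lambda>\<omega>. \<Sum>k<N. V k \<omega> ^ 4 / c1 ^ 4) + expectation (\<lambda>\<omega>. \<bar>\<Sum>k<N. V k \<omega> * A k \<omega>\<bar>)
     + expectation (\<lambda>\<omega>. \<Sum>k<N. \<Sum>j=1..J. 16 / c1^2 * cb j * \<bar>(V k \<omega>)\<^sup>2 * zeta (j, k) \<omega>\<bar>) + ?c"
    using i1 i2 i3' by (simp add: prob_space)
  also have "\<dots> \<le> real N * (24 * xx^2 / c1 ^ 4) + (real L * (vv * alpha * 2 ^ L / 2) + sqrt xx * (alpha * sqrt (real N)))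
     + 160 / c1^2 * xx * (8 * m0 * r + ks) + ?c"
  proof (intro add_mono order_refl)
    have "expectation (\<lambda>\<omega>. \<Sum>k<N. V k \<omega> ^ 4 / c1 ^ 4) = (\<Sum>k<N. expectation (\<lambda>\<omega>. V k \<omega> ^ 4) / c1 ^ 4)"
      using V4(1) by (subst Bochner_Integration.integral_sum) auto
    also have "\<dots> \<le> (\<Sum>k<N. 24 * xx^2 / c1 ^ 4)" using c12 by (intro sum_mono divide_right_mono V4) auto
    finally show "expectation (\<lambda>\<omega>. \<Sum>k<N. V k \<omega> ^ 4 / c1 ^ 4) \<le> real N * (24 * xx^2 / c1 ^ 4)" by simp
    show "expectation (\<lambda>\<omega>. \<bar>\<Sum>k<N. V k \<omega> * A k \<omega>\<bar>) \<le> real L * (vv * alpha * 2 ^ L / 2) + sqrt xx * (alpha * sqrt (real N))"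
      by (rule dyadic_chaining_full[OF sq_int_V sq_int_A _ alpha0 _ V_increment _ A_moment N(1) L])
         (use xx0 V2[of 0] h0pos Bq0 in \<open>auto simp: vv_def\<close>)
    \<comment> \<open>Cauchy-Schwarz with the fourth moment of \<open>V k\<close>; 5 replaces the
      square root of 24, and \<open>5 * 2 * 16 = 160\<close> is the constant of the bound.\<close>
    have z1: "expectation (\<lambda>\<omega>. \<bar>(V k \<omega>)\<^sup>2 * zeta (j, k) \<omega>\<bar>) \<le> (5 * xx) * (2 * (Dz (j, k) + ee j))" if kj: "k \<in> {..<N}" "j \<in> {1..J}" for k j
    proof (rule expectation_abs_mult_le[OF sq_int_V2 zeta_moment(1)])
      have "24 * xx^2 \<le> (5 * xx)^2" by (simp add: power_mult_distrib)
      then have "expectation (\<lambda>\<omega>. V k \<omega> ^ 4) \<le> (5 * xx)^2" using V4(2)[of k] by linarith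
      then show "expectation (\<lambda>\<omega>. ((V k \<omega>)^2)^2) \<le> (5 * xx)^2" by (simp flip: power_mult)
      show "expectation (\<lambda>\<omega>. (zeta (j, k) \<omega>)^2) \<le> (2 * (Dz (j, k) + ee j))^2" using zeta_moment(2)[of "(j, k)"] kj by simp
      show "0 \<le> 2 * (Dz (j, k) + ee j)" using Dz_bounds(1)[of "(j, k)"] ee[of j] kj by simp
    qed (use kj xx0 in auto)
    have "expectation (\<lambda>\<omega>. \<Sum>k<N. \<Sum>j=1..J. 16 / c1^2 * cb j * \<bar>(V k \<omega>)\<^sup>2 * zeta (j, k) \<omega>\<bar>) =
       (\<Sum>k<N. \<Sum>j=1..J. 16 / c1^2 * cb j * expectation (\<lambda>\<omega>. \<bar>(V k \<omega>)\<^sup>2 * zeta (j, k) \<omega>\<bar>))"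
    proof -
      have "expectation (\<lambda>\<omega>. \<Sum>k<N. \<Sum>j=1..J. 16 / c1^2 * cb j * \<bar>(V k \<omega>)\<^sup>2 * zeta (j, k) \<omega>\<bar>) =
         (\<Sum>k<N. expectation (\<lambda>\<omega>. \<Sum>j=1..J. 16 / c1^2 * cb j * \<bar>(V k \<omega>)\<^sup>2 * zeta (j, k) \<omega>\<bar>))"
        by (rule Bochner_Integration.integral_sum) (intro Bochner_Integration.integrable_sum integrable_mult_right i3)
      also have "\<dots> = (\<Sum>k<N. \<Sum>j=1..J. expectation (\<lambda>\<omega>. 16 / c1^2 * cb j * \<bar>(V k \<omega>)\<^sup>2 * zeta (j, k) \<omega>\<bar>))"
        by (rule sum.cong[OF refl], rule Bochner_Integration.integral_sum) (intro integrable_mult_right i3)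
      finally show ?thesis by (simp only: integral_mult_right_zero)
    qed
    also have "\<dots> \<le> (\<Sum>k<N. \<Sum>j=1..J. 16 / c1^2 * cb j * ((5 * xx) * (2 * (Dz (j, k) + ee j))))"
      using cb0 by (intro sum_mono mult_left_mono z1) auto
    also have "\<dots> = (\<Sum>k<N. 160 / c1^2 * xx * ((\<Sum>j=1..J. cb j * Dz (j, k)) + (\<Sum>j=1..J. cb j * ee j)))"
      unfolding sum.distrib[symmetric] sum_distrib_left by (intro sum.cong refl) (simp add: algebra_simps)
    also have "\<dots> \<le> (\<Sum>k<N. 160 / c1^2 * xx * (8 * m0 * (r * h) + ks * h))"
    proof (intro sum_mono mult_left_mono add_mono)
      show "(\<Sum>j=1..J. cb j * Dz (j, k)) \<le> 8 * m0 * (r * h)" if "k \<in> {..<N}" for k using sum_cbD[of k] that by simp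
      show "(\<Sum>j=1..J. cb j * ee j) \<le> ks * h" using N by (simp add: ks_def)
    qed (use xx0 in auto)
    also have "\<dots> = 160 / c1^2 * xx * ((8 * m0 * r + ks) * (real N * h))"
      by (simp add: algebra_simps add_divide_distrib)
    also have "real N * h = 1" using N by simp
    also have "160 / c1^2 * xx * ((8 * m0 * r + ks) * 1) = 160 / c1^2 * xx * (8 * m0 * r + ks)" by simp
    finally show "expectation (\<lambda>\<omega>. \<Sum>k<N. \<Sum>j=1..J. 16 / c1^2 * cb j * \<bar>(V k \<omega>)\<^sup>2 * zeta (j, k) \<omega>\<bar>) \<le> 160 / c1^2 * xx * (8 * m0 * r + ks)" .
  qed
  finally show ?thesis .
qed

end

section \<open>Variance and normal approximation of the linear part\<close>

lemma powr_three_halves: "x \<ge> 0 \<Longrightarrow> x powr (3/2) = x * sqrt x" for x :: real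
  using powr_add[of x 1 "1/2"] by (simp add: powr_half_sqrt)

text \<open>In terms of square roots the difference is
  \<open>p^3 - q^3 = (p - q) * (p^2 + p * q + q^2)\<close>, and the last factor is at most
  \<open>2 * m * (p + q)\<close>.\<close>

lemma powr_three_halves_lipschitz:
  fixes x y c :: real
  assumes "0 \<le> x" "x \<le> c" "0 \<le> y" "y \<le> c"
  shows "\<bar>x powr (3/2) - y powr (3/2)\<bar> \<le> 2 * sqrt c * \<bar>x - y\<bar>"
proof -
  define p q m where "p = sqrt x" and "q = sqrt y" and "m = sqrt c"
  have b: "0 \<le> p" "p \<le> m" "0 \<le> q" "q \<le> m" using assms by (auto simp: p_def q_def m_def)
  have xy: "x = p * p" "y = q * q" using assms by (auto simp: p_def q_def)
  have "p * p \<le> m * p" "q * q \<le> m * q" "p * q \<le> m * q" using b by (auto intro: mult_right_mono)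
  moreover have "0 \<le> m * p" using b by simp
  ultimately have 1: "p * p + p * q + q * q \<le> 2 * m * (p + q)" by (simp add: algebra_simps)
  have 2: "0 \<le> p * p + p * q + q * q" using b by simp
  have "\<bar>x powr (3/2) - y powr (3/2)\<bar> = \<bar>p - q\<bar> * (p * p + p * q + q * q)"
  proof -
    have "x powr (3/2) - y powr (3/2) = (p - q) * (p * p + p * q + q * q)"
      unfolding powr_three_halves[OF assms(1)] powr_three_halves[OF assms(3)] p_def[symmetric] q_def[symmetric]
      by (simp add: xy algebra_simps)
    then show ?thesis using 2 by (simp add: abs_mult)
  qed
  also have "\<dots> \<le> \<bar>p - q\<bar> * (2 * m * (p + q))" using 1 by (intro mult_left_mono) auto
  also have "\<dots> = 2 * m * \<bar>(p - q) * (p + q)\<bar>" using b by (simp add: abs_mult)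
  also have "(p - q) * (p + q) = x - y" by (simp add: xy algebra_simps)
  finally show ?thesis by (simp add: m_def)
qed

context stage begin

lemma r_sq: "r^2 = sqrt (real n)"
proof -
  have "r^2 = real n powr (1/4) * real n powr (1/4)" by (simp add: r_def power2_eq_square)
  also have "\<dots> = real n powr (1/2)" by (subst powr_add[symmetric]) simp
  finally show ?thesis by (simp add: powr_half_sqrt)
qed

lemma r_sq_h: "r^2 * h = \<delta> * h0" using \<delta>(1) by (simp add: r_sq h0(1))

lemma rh_sq: "(r * h)^2 = \<delta> * h * h0"
  using r_sq_h by (simp add: power_mult_distrib power2_eq_square mult_ac)

text \<open>The largest normalised coefficient is of order \<open>1 / r\<close>, while the sum of
  squares stays bounded. This is the Lindeberg-type smallness that feeds the bound on the
  fourth-order trace.\<close>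

lemma mcoef_Dz_le:
  assumes "p \<in> P" shows "mcoef p * Dz p \<le> m0 * \<delta> / r"
proof -
  let ?x = "(real (fst p) / h0)^2"
  have x: "1 \<le> 1 + ?x" by simp
  have "mcoef p * Dz p \<le> cb (fst p) * Dz p" using mcoef_bounds[OF assms] Dz_bounds[OF assms] by (intro mult_right_mono) auto
  also have "\<dots> \<le> m0 * (r * h) * (wmaj h0 (fst p) * (1 + ?x))" by (rule cbD_bound[OF assms])
  also have "wmaj h0 (fst p) * (1 + ?x) = 1 / (h0 * (1 + ?x))"
  proof -
    have "1 / (h0 * y^2) * y = 1 / (h0 * y)" if "y \<ge> 1" for y using that h0pos by (simp add: power2_eq_square)
    then show ?thesis unfolding wmaj_def using x by blast
  qed
  also have "\<dots> \<le> 1 / h0"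
    using h0pos x mult_left_mono[OF x, of h0] by (intro divide_left_mono mult_pos_pos) (auto simp: add_pos_nonneg)
  also have "m0 * (r * h) * (1 / h0) = m0 * \<delta> / r"
    using r_sq_h rpos h0pos by (simp add: field_simps power2_eq_square)
  finally show ?thesis using m00 rpos hpos by (simp add: mult_left_mono)
qed

lemma sum_mcoef_Dz_sq: "(\<Sum>p\<in>P. (mcoef p * Dz p)^2) \<le> 8 * m0^2 * \<delta>"
proof -
  have "(\<Sum>p\<in>P. (mcoef p * Dz p)^2) \<le> (\<Sum>p\<in>P. (cb (fst p) * Dz p)^2)"
  proof (rule sum_mono)
    fix p assume p: "p \<in> P"
    show "(mcoef p * Dz p)^2 \<le> (cb (fst p) * Dz p)^2"
      using mcoef_bounds[OF p] Dz_bounds[OF p] by (intro power_mono mult_right_mono mult_nonneg_nonneg) auto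
  qed
  also have "\<dots> = (\<Sum>k<N. \<Sum>j=1..J. (cb j * Dz (j, k))^2)" unfolding sum_P_split by simp
  also have "\<dots> \<le> (\<Sum>k<N. 8 * m0^2 * (r * h)^2 / h0)" by (intro sum_mono sum_cbD_sq) auto
  also have "\<dots> = 8 * m0^2 * \<delta> * (real N * h)" unfolding rh_sq using h0pos by simp
  also have "real N * h = 1" using N by simp
  finally show ?thesis by simp
qed

lemma sum_mcoef_ee: "(\<Sum>p\<in>P. \<bar>mcoef p\<bar> * ee (fst p)) \<le> ks" "0 \<le> (\<Sum>p\<in>P. \<bar>mcoef p\<bar> * ee (fst p))"
proof -
  have "(\<Sum>p\<in>P. \<bar>mcoef p\<bar> * ee (fst p)) \<le> (\<Sum>p\<in>P. cb (fst p) * ee (fst p))"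
  proof (rule sum_mono)
    fix p assume p: "p \<in> P"
    show "\<bar>mcoef p\<bar> * ee (fst p) \<le> cb (fst p) * ee (fst p)"
      using mcoef_bounds[OF p] ee by (intro mult_right_mono) auto
  qed
  also have "\<dots> = (\<Sum>k<N. \<Sum>j=1..J. cb j * ee j)" unfolding sum_P_split by simp
  finally show "(\<Sum>p\<in>P. \<bar>mcoef p\<bar> * ee (fst p)) \<le> ks" by (simp add: ks_def)
  show "0 \<le> (\<Sum>p\<in>P. \<bar>mcoef p\<bar> * ee (fst p))" using ee by (intro sum_nonneg) auto
qed

lemma finP: "finite P" by simp

lemma main_frob4:
  "chaos2_frob4 P Cz mcoef \<le> 3 * ((m0 * \<delta> / r)^2 * (8 * m0^2 * \<delta>) + 4 * (m0 * \<delta> / r)^2 * ks^2 + ks ^ 4)"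
proof -
  let ?s = "\<Sum>p\<in>P. mcoef p * ee (fst p)"
  have s: "0 \<le> ?s" "?s \<le> ks"
  proof -
    have "?s = (\<Sum>p\<in>P. \<bar>mcoef p\<bar> * ee (fst p))" using mcoef_bounds(1) by (intro sum.cong refl) auto
    then show "0 \<le> ?s" "?s \<le> ks" using sum_mcoef_ee by auto
  qed
  have "0 \<le> m0 * \<delta> / r" using m00 \<delta>(1) rpos by simp
  then have "chaos2_frob4 P Cz mcoef \<le> 3 * ((m0 * \<delta> / r)^2 * (\<Sum>p\<in>P. (mcoef p * Dz p)^2) + 4 * (m0 * \<delta> / r)^2 * ?s^2 + ?s ^ 4)"
    by (intro chaos2_frob4_le[where D = Dz] finP approxz' ee Dz_bounds(1) mcoef_bounds(1) mcoef_Dz_le)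
  also have "\<dots> \<le> 3 * ((m0 * \<delta> / r)^2 * (8 * m0^2 * \<delta>) + 4 * (m0 * \<delta> / r)^2 * ks^2 + ks ^ 4)"
    using s by (intro mult_left_mono add_mono sum_mcoef_Dz_sq power_mono) auto
  finally show ?thesis .
qed

lemma main_frob:
  "\<bar>chaos2_frob P Cz mcoef - (\<Sum>p\<in>P. (mcoef p * Dz p)^2)\<bar> \<le> 2 * (m0 * \<delta> / r) * ks + ks^2"
proof -
  let ?s = "\<Sum>p\<in>P. \<bar>mcoef p\<bar> * ee (fst p)"
  have "\<bar>mcoef p\<bar> * Dz p \<le> m0 * \<delta> / r" if "p \<in> P" for p using mcoef_Dz_le[OF that] mcoef_bounds(1)[OF that] by simp
  then have "\<bar>chaos2_frob P Cz mcoef - (\<Sum>p\<in>P. (mcoef p * Dz p)^2)\<bar> \<le> 2 * (m0 * \<delta> / r) * ?s + ?s^2"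
    by (intro chaos2_frob_approx finP approxz' ee Dz_bounds(1))
  also have "\<dots> \<le> 2 * (m0 * \<delta> / r) * ks + ks^2"
    using sum_mcoef_ee m00 \<delta>(1) rpos by (intro add_mono mult_left_mono power_mono) auto
  finally show ?thesis .
qed

text \<open>\<open>kden\<close> bounds the normalizer of the weights from below in units of
  \<open>h0\<close>, and \<open>eta1\<close> is the error of its Riemann-sum limit;
  \<open>K2\<close> collects the constants of the variance of one block.\<close>

definition "kden = 1 / (2 * (c2 + pi^2)^2)"
definition "eta1 = 1 / (c1^2 * h0) + h0 / (c1 * real J)"
definition "K2 = (2 / c1 + c2 / c1^2) / kden + 4 * c2 powr (3/2) / kden + 8 * sqrt c2"

lemma kden0: "kden > 0"
proof -
  have "c2 + pi^2 > 0" using c12 by (intro add_pos_pos) auto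
  then show ?thesis by (simp add: kden_def)
qed

lemma eta10: "0 \<le> eta1" using c12 h0pos by (simp add: eta1_def)

text \<open>With \<open>d\<close> the bias of the pilot mean, weight times variance is
  \<open>r h / W * v j * (1 + d * v j)\<close>: for \<open>d = 0\<close> the weights fit the true
  variances and the sum of squares is \<open>\<delta> h\<close> times \<open>h0 / W\<close>. The
  limit \<open>1 / (4 f^(3/2))\<close> of \<open>W / h0\<close> then produces
  \<open>4 * \<delta> * h * s powr (3/2)\<close>.\<close>

lemma block_sum:
  assumes k: "k < N"
  defines "s \<equiv> s2 (real k * h)"
  shows "\<bar>(\<Sum>j=1..J. (mcoef (j, k) * Dz (j, k))^2) - 4 * \<delta> * (h * s powr (3/2))\<bar> \<le> \<delta> * h * (K2 * (\<bar>f k - s\<bar> + eta1))"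
proof -
  define v where "v j = inverse (f k + pi^2 * (real j)^2 / h0^2)" for j :: nat
  define W d where "W = wden J h0 2 (f k)" and "d = s - f k"
  have fk: "c1 \<le> f k" "f k \<le> c2" "2 * c1 \<le> f k" "f k \<le> 2 * S" using f_range'[OF k] f_range[OF k] by auto
  have s: "s0 \<le> s" "s \<le> S" "0 < s" "s \<le> c2" using s2b[of "real k * h"] kh01[OF k] s0 S0 by (auto simp: s_def c2_def)
  have fpos: "f k > 0" using fk c12 by linarith
  have u: "f k + pi^2 * (real j)^2 / h0^2 \<ge> c1" for j using fk by (simp add: add_increasing2)
  have v: "0 < v j" "v j \<le> 1 / c1" "(f k + pi^2 * (real j)^2 / h0^2) * v j = 1" for j
  proof -
    have p: "f k + pi^2 * (real j)^2 / h0^2 > 0" using u[of j] c12 by linarith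
    show "0 < v j" "(f k + pi^2 * (real j)^2 / h0^2) * v j = 1" using p by (auto simp: v_def)
    show "v j \<le> 1 / c1" unfolding v_def inverse_eq_divide using u[of j] c12 by (intro divide_left_mono mult_pos_pos) auto
  qed
  have Wv: "W = (\<Sum>j=1..J. (v j)^2)" by (simp add: W_def wden_def v_def)
  have Wpos: "W > 0" unfolding W_def by (rule wden_pos[OF fpos Jpos])
  have expand: "(mcoef (j, k) * Dz (j, k))^2 = \<delta> * h * h0 / W^2 * ((v j)^2 * (1 + d * v j)^2)" if j: "j \<in> {1..J}" for j
  proof -
    have dn: "\<delta>^2 / real n = h^2 / h0^2" unfolding h0(1) using hpos n \<delta>(1) by (simp add: power_mult_distrib power_divide)
    have Nh: "real N * h^2 = h" using N by (simp add: power2_eq_square)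
    have "(real j)^2 * pi^2 * Dz (j, k) = h^2 * (s + pi^2 * (real j)^2 / h0^2)"
      using j by (simp add: Dz_def dn s_def power_mult_distrib field_simps)
    then have "mcoef (j, k) * Dz (j, k) = r * (real N * h^2) * ((v j)^2 / W) * (s + pi^2 * (real j)^2 / h0^2)"
      by (simp add: mcoef_def q_def weight_eq W_def v_def mult_ac)
    also have "s + pi^2 * (real j)^2 / h0^2 = (f k + pi^2 * (real j)^2 / h0^2) + d" by (simp add: d_def)
    also have "r * (real N * h^2) * ((v j)^2 / W) * ((f k + pi^2 * (real j)^2 / h0^2) + d)
       = r * h / W * (v j * ((f k + pi^2 * (real j)^2 / h0^2) * v j + d * v j))"
      unfolding Nh by (simp add: power2_eq_square algebra_simps)
    finally have "mcoef (j, k) * Dz (j, k) = r * h / W * (v j * (1 + d * v j))" unfolding v(3) .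
    then have "(mcoef (j, k) * Dz (j, k))^2 = (r * h)^2 / W^2 * ((v j)^2 * (1 + d * v j)^2)"
      by (simp only: power_mult_distrib power_divide)
    then show ?thesis unfolding rh_sq .
  qed
  define T where "T = (\<Sum>j=1..J. (v j)^2 * (1 + d * v j)^2)"
  have sumT: "(\<Sum>j=1..J. (mcoef (j, k) * Dz (j, k))^2) = \<delta> * h * (h0 / W * (T / W))"
  proof -
    have "(\<Sum>j=1..J. (mcoef (j, k) * Dz (j, k))^2) = \<delta> * h * h0 / W^2 * T"
      unfolding T_def sum_distrib_left using expand by (intro sum.cong refl)
    then show ?thesis by (simp add: power2_eq_square)
  qed
  have db: "\<bar>d\<bar> \<le> c2" unfolding d_def c2_def using fk(4) fpos s(2,3) s0 by linarith
  \<comment> \<open>Bounds \<open>(1 + d * v j)^2 - 1 = 2 d v + (d v)^2\<close>, using that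
    \<open>v j\<close> is at most \<open>1 / c1\<close> and that one factor
    \<open>\<bar>d\<bar>\<close> of the square is at most \<open>c2\<close>.\<close>
  define E where "E = \<bar>d\<bar> * (2 / c1 + c2 / c1^2)"
  have E0: "0 \<le> E" using c12 by (simp add: E_def)
  have TW: "\<bar>T / W - 1\<bar> \<le> E"
  proof -
    have "\<bar>T - W\<bar> \<le> (\<Sum>j=1..J. (v j)^2 * E)"
      unfolding T_def Wv sum_subtractf[symmetric]
    proof (rule abs_sum_mult_le)
      fix j assume "j \<in> {1..J}"
      have vd: "\<bar>d * v j\<bar> \<le> \<bar>d\<bar> * (1 / c1)" unfolding abs_mult using v[of j] by (intro mult_left_mono) auto
      have "\<bar>d * v j\<bar> * \<bar>d * v j\<bar> \<le> (\<bar>d\<bar> * (1 / c1)) * (c2 * (1 / c1))"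
        using vd db c12 by (intro mult_mono order_trans[OF vd mult_right_mono]) auto
      then have "\<bar>2 * (d * v j) + (d * v j) * (d * v j)\<bar> \<le> 2 * (\<bar>d\<bar> * (1 / c1)) + (\<bar>d\<bar> * (1 / c1)) * (c2 * (1 / c1))"
        using vd abs_triangle_ineq[of "2 * (d * v j)" "(d * v j) * (d * v j)"] unfolding abs_mult[of "d * v j" "d * v j"] by linarith
      also have "\<dots> = E" by (simp add: E_def power2_eq_square algebra_simps)
      finally have "\<bar>2 * (d * v j) + (d * v j) * (d * v j)\<bar> \<le> E" .
      moreover have "(v j)^2 * (1 + d * v j)^2 - (v j)\<^sup>2 = (v j)^2 * (2 * (d * v j) + (d * v j) * (d * v j))"
        by (simp add: power2_eq_square algebra_simps)
      ultimately show "\<bar>(v j)\<^sup>2 * (1 + d * v j)^2 - (v j)\<^sup>2\<bar> \<le> (v j)^2 * E"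
        by (simp add: abs_mult mult_left_mono)
    qed
    also have "\<dots> = W * E" unfolding Wv sum_distrib_right ..
    finally have "\<bar>T - W\<bar> / W \<le> E" using Wpos by (simp add: pos_divide_le_eq mult.commute)
    moreover have "T / W - 1 = (T - W) / W" using Wpos by (simp add: diff_divide_distrib)
    ultimately show ?thesis using Wpos by (simp add: abs_divide)
  qed
  have hW: "0 < h0 / W" "h0 / W \<le> 1 / kden"
  proof -
    show "0 < h0 / W" using h0pos Wpos by simp
    have "h0 / 2 * inverse ((c2 + pi^2)^2) \<le> W" unfolding W_def by (rule wden_lower[OF fpos fk(2) h0(2) J])
    moreover have "h0 / 2 * inverse ((c2 + pi^2)^2) = h0 * kden" by (simp add: kden_def inverse_eq_divide)
    ultimately have "h0 * kden \<le> W" by (simp only:)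
    then show "h0 / W \<le> 1 / kden"
      by (simp only: pos_divide_le_eq[OF Wpos] pos_le_divide_eq[OF kden0] times_divide_eq_left mult_1)
  qed
  have hWl: "\<bar>h0 / W - 4 * f k powr (3/2)\<bar> \<le> 4 * c2 powr (3/2) / kden * eta1"
  proof -
    have l: "\<bar>W / h0 - 1 / (4 * f k powr (3/2))\<bar> \<le> eta1"
      unfolding W_def eta1_def by (rule wden_limit[OF c12(1) fk(1) h0pos Jpos])
    define y where "y = 4 * f k powr (3/2)"
    have y: "0 < y" "y \<le> 4 * c2 powr (3/2)" unfolding y_def using fpos fk by (auto intro: powr_mono2)
    have "h0 / W - y = - (y * (h0 / W) * (W / h0 - 1 / y))"
      using y Wpos h0pos by (simp add: field_simps)
    then have "\<bar>h0 / W - y\<bar> = y * (h0 / W) * \<bar>W / h0 - 1 / y\<bar>" using y hW h0pos Wpos by (simp add: abs_mult)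
    also have "\<dots> \<le> (4 * c2 powr (3/2)) * (1 / kden) * eta1"
      using y hW l kden0 by (intro mult_mono) (auto simp: y_def)
    finally show ?thesis by (simp add: y_def)
  qed
  have lip: "\<bar>f k powr (3/2) - s powr (3/2)\<bar> \<le> 2 * sqrt c2 * \<bar>d\<bar>"
    using powr_three_halves_lipschitz[of "f k" c2 s] fk fpos s by (simp add: d_def abs_minus_commute)
  have "\<bar>h0 / W * (T / W) - h0 / W\<bar> \<le> 1 / kden * E"
  proof -
    have "h0 / W * (T / W) - h0 / W = h0 / W * (T / W - 1)" by (simp add: algebra_simps)
    then have "\<bar>h0 / W * (T / W) - h0 / W\<bar> = h0 / W * \<bar>T / W - 1\<bar>" using hW h0pos Wpos by (simp add: abs_mult)
    also have "\<dots> \<le> 1 / kden * E" using hW TW kden0 by (intro mult_mono) auto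
    finally show ?thesis .
  qed
  then have 1: "\<bar>h0 / W * (T / W) - 4 * s powr (3/2)\<bar> \<le> 1 / kden * E + 4 * c2 powr (3/2) / kden * eta1 + 4 * (2 * sqrt c2 * \<bar>d\<bar>)"
    using hWl lip by linarith
  also have "\<dots> \<le> K2 * (\<bar>d\<bar> + eta1)"
  proof -
    define A1 A2 A3 where "A1 = (2 / c1 + c2 / c1^2) / kden" and "A2 = 4 * c2 powr (3/2) / kden" and "A3 = 8 * sqrt c2"
    have "0 \<le> A1" "0 \<le> A2" "0 \<le> A3" using c12 kden0 by (auto simp: A1_def A2_def A3_def)
    then have "0 \<le> A1 * eta1" "0 \<le> A2 * \<bar>d\<bar>" "0 \<le> A3 * eta1" using eta10 by auto
    moreover have "1 / kden * E = A1 * \<bar>d\<bar>" by (simp add: A1_def E_def mult_ac)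
    moreover have "K2 * (\<bar>d\<bar> + eta1) = A1 * \<bar>d\<bar> + A1 * eta1 + A2 * \<bar>d\<bar> + A2 * eta1 + A3 * \<bar>d\<bar> + A3 * eta1"
      unfolding K2_def A1_def[symmetric] A2_def[symmetric] A3_def[symmetric] by (simp add: algebra_simps)
    ultimately show ?thesis by (simp add: A2_def A3_def)
  qed
  finally have 2: "\<bar>h0 / W * (T / W) - 4 * s powr (3/2)\<bar> \<le> K2 * (\<bar>d\<bar> + eta1)" .
  have "(\<Sum>j=1..J. (mcoef (j, k) * Dz (j, k))^2) - 4 * \<delta> * (h * s powr (3/2)) = \<delta> * h * (h0 / W * (T / W) - 4 * s powr (3/2))"
    unfolding sumT by (simp add: algebra_simps)
  then have "\<bar>(\<Sum>j=1..J. (mcoef (j, k) * Dz (j, k))^2) - 4 * \<delta> * (h * s powr (3/2))\<bar> = \<delta> * h * \<bar>h0 / W * (T / W) - 4 * s powr (3/2)\<bar>"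
    using \<delta>(1) hpos by (simp add: abs_mult)
  also have "\<dots> \<le> \<delta> * h * (K2 * (\<bar>d\<bar> + eta1))" using 2 \<delta>(1) hpos by (intro mult_left_mono) auto
  finally show ?thesis by (simp add: d_def abs_minus_commute)
qed

definition "eta2 = 2 * (C * b powr a + real n / \<delta>^2 * pi^2 * e) + 2 * S * (g / b)"

lemma eta20: "0 \<le> eta2" using C e b g0 S0 by (simp add: eta2_def)

text \<open>The biased boundary blocks make up a fraction of order $b + h$ only.\<close>
lemma pilot_bias_sum: "(\<Sum>k<N. h * \<bar>f k - s2 (real k * h)\<bar>) \<le> eta2 + c2 * (2 * b + 6 * h)"
proof -
  define Bd where "Bd = {k. k < N \<and> \<not> (b \<le> real k * h \<and> real k * h + b < 1)}"
  let ?A = "{i::nat. 0 \<le> real i \<and> real i \<le> b * real N}" and ?B = "{i::nat. (1 - b) * real N \<le> real i \<and> real i \<le> real N}"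
  have hN: "real k * h = real k / real N" for k using N by simp
  have c2p: "0 < c2" using c12 by linarith
  have sub: "Bd \<subseteq> ?A \<union> ?B"
  proof
    fix i assume "i \<in> Bd"
    then have i: "i < N" "\<not> (b \<le> real i / real N \<and> real i / real N + b < 1)" by (auto simp: Bd_def hN)
    have "real i / real N < b \<or> 1 - b \<le> real i / real N" using i(2) by linarith
    then have "real i \<le> b * real N \<or> (1 - b) * real N \<le> real i"
      using N(1) by (simp add: pos_divide_less_eq pos_le_divide_eq) linarith
    then show "i \<in> ?A \<union> ?B" using i(1) by auto
  qed
  have finA: "finite ?A" "real (card ?A) \<le> b * real N + 3"
    using card_nats_closed_interval[of ?A 0 "b * real N"] b by auto
  have finB: "finite ?B" "real (card ?B) \<le> b * real N + 3"
    using card_nats_closed_interval[of ?B "(1 - b) * real N" "real N"] b N by (auto simp: algebra_simps)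
  have "card Bd \<le> card (?A \<union> ?B)" by (rule card_mono) (use finA finB sub in auto)
  also have "\<dots> \<le> card ?A + card ?B" by (rule card_Un_le)
  finally have cB: "real (card Bd) \<le> 2 * b * real N + 6" using finA(2) finB(2) by linarith
  have fin: "finite Bd" by (simp add: Bd_def)
  have each: "h * \<bar>f k - s2 (real k * h)\<bar> \<le> h * eta2 + (if k \<in> Bd then h * c2 else 0)" if k: "k \<in> {..<N}" for k
  proof (cases "k \<in> Bd")
    case True
    have "s0 \<le> s2 (real k * h)" "s2 (real k * h) \<le> S" using s2b[of "real k * h"] kh01[of k] k by auto
    then have "\<bar>f k - s2 (real k * h)\<bar> \<le> c2" using f_range[of k] k s0 S0 c12 by (auto simp: c2_def)
    then have "h * \<bar>f k - s2 (real k * h)\<bar> \<le> h * c2" using hpos by (intro mult_left_mono) auto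
    then show ?thesis using True hpos eta20 by (simp add: add_increasing)
  next
    case False
    then have "b \<le> real k * h" "real k * h + b < 1" using k by (auto simp: Bd_def)
    then have "\<bar>f k - s2 (real k * h)\<bar> \<le> eta2" unfolding f_def eta2_def by (rule pdet_approx)
    then show ?thesis using False hpos by (simp add: mult_left_mono)
  qed
  have "(\<Sum>k<N. h * \<bar>f k - s2 (real k * h)\<bar>) \<le> (\<Sum>k<N. h * eta2 + (if k \<in> Bd then h * c2 else 0))" by (rule sum_mono) (rule each)
  also have "\<dots> = real N * h * eta2 + (\<Sum>k\<in>Bd. h * c2)"
  proof -
    have "{..<N} \<inter> Bd = Bd" by (auto simp: Bd_def)
    then have "(\<Sum>k<N. if k \<in> Bd then h * c2 else 0) = (\<Sum>k\<in>Bd. h * c2)" using sum.inter_restrict[of "{..<N}" "\<lambda>_. h * c2" Bd] by simp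
    then show ?thesis by (simp add: sum.distrib)
  qed
  also have "\<dots> = eta2 + real (card Bd) * (h * c2)" using N by simp
  also have "\<dots> \<le> eta2 + (2 * b * real N + 6) * (h * c2)" using cB hpos c2p by (intro add_left_mono mult_right_mono) auto
  also have "\<dots> = eta2 + c2 * (2 * b * (real N * h) + 6 * h)" by (simp add: algebra_simps)
  also have "real N * h = 1" using N by simp
  finally show ?thesis by simp
qed

lemma continuous_powr_s2: "continuous_on {0..1} (\<lambda>t. s2 t powr (3/2))"
  using s2b s0 by (intro continuous_on_powr cont continuous_on_const) fastforce

text \<open>Three errors are added: off-diagonal and diagonal covariance errors, the replacement of
  the pilot mean and of the normalizer in each block, and the Riemann sum of
  \<open>s2 powr (3/2)\<close>, which is again Hoelder because the power is Lipschitz on a bounded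
  range.\<close>

lemma main_variance:
  "\<bar>2 * chaos2_frob P Cz mcoef - 8 * \<delta> * integral {0..1} (\<lambda>t. s2 t powr (3/2))\<bar> \<le>
     2 * (2 * (m0 * \<delta> / r) * ks + ks^2) + 2 * (\<delta> * K2 * (eta2 + c2 * (2 * b + 6 * h) + eta1))
     + 8 * \<delta> * (2 * sqrt c2 * C * h powr a)"
proof -
  have Hp: "\<bar>s2 s powr (3/2) - s2 t powr (3/2)\<bar> \<le> 2 * sqrt c2 * C * \<bar>s - t\<bar> powr a" if "s \<in> {0..1}" "t \<in> {0..1}" for s t
  proof -
    have "\<bar>s2 s powr (3/2) - s2 t powr (3/2)\<bar> \<le> 2 * sqrt c2 * \<bar>s2 s - s2 t\<bar>"
      using s2b[OF that(1)] s2b[OF that(2)] s0 S0 by (intro powr_three_halves_lipschitz) (auto simp: c2_def)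
    also have "\<dots> \<le> 2 * sqrt c2 * (C * \<bar>s - t\<bar> powr a)" using c12 by (intro mult_left_mono H that) auto
    finally show ?thesis by simp
  qed
  have C': "0 \<le> 2 * sqrt c2 * C" using c12 C by simp
  have "\<bar>(\<Sum>k<N. h * s2 (0 + real k * h) powr (3/2)) - integral {0..0 + real N * h} (\<lambda>t. s2 t powr (3/2))\<bar> \<le> real N * h * (2 * sqrt c2 * C * h powr a)"
    by (rule holder_riemann[OF Hp continuous_powr_s2 C' a hpos]) (use N in auto)
  then have R: "\<bar>(\<Sum>k<N. h * s2 (real k * h) powr (3/2)) - integral {0..1} (\<lambda>t. s2 t powr (3/2))\<bar> \<le> 2 * sqrt c2 * C * h powr a"
    using N by simp
  define Sm where "Sm = (\<Sum>p\<in>P. (mcoef p * Dz p)^2)"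
  have "K2 \<ge> 0" using c12 kden0 by (simp add: K2_def)
  have "\<bar>Sm - 4 * \<delta> * (\<Sum>k<N. h * s2 (real k * h) powr (3/2))\<bar> \<le> (\<Sum>k<N. \<delta> * h * (K2 * (\<bar>f k - s2 (real k * h)\<bar> + eta1)))"
    unfolding Sm_def sum_P_split sum_distrib_left sum_subtractf[symmetric]
    by (rule abs_sum_mult_le) (use block_sum in auto)
  also have "\<dots> = \<delta> * K2 * ((\<Sum>k<N. h * \<bar>f k - s2 (real k * h)\<bar>) + (\<Sum>k<N. h * eta1))"
    unfolding sum.distrib[symmetric] sum_distrib_left by (intro sum.cong refl) (simp add: algebra_simps)
  also have "(\<Sum>k<N. h * eta1) = eta1" using N by simp
  also have "\<delta> * K2 * ((\<Sum>k<N. h * \<bar>f k - s2 (real k * h)\<bar>) + eta1) \<le> \<delta> * K2 * ((eta2 + c2 * (2 * b + 6 * h)) + eta1)"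
    using \<delta>(1) \<open>K2 \<ge> 0\<close> by (intro mult_left_mono add_right_mono pilot_bias_sum) auto
  finally have 1: "\<bar>Sm - 4 * \<delta> * (\<Sum>k<N. h * s2 (real k * h) powr (3/2))\<bar> \<le> \<delta> * K2 * (eta2 + c2 * (2 * b + 6 * h) + eta1)" .
  define Rs I where "Rs = (\<Sum>k<N. h * s2 (real k * h) powr (3/2))" and "I = integral {0..1} (\<lambda>t. s2 t powr (3/2))"
  have "8 * \<delta> * (Rs - I) \<le> 8 * \<delta> * (2 * sqrt c2 * C * h powr a)" "8 * \<delta> * (I - Rs) \<le> 8 * \<delta> * (2 * sqrt c2 * C * h powr a)"
    using R \<delta>(1) unfolding Rs_def[symmetric] I_def[symmetric] by (auto intro!: mult_left_mono)
  then have 2: "\<bar>8 * \<delta> * Rs - 8 * \<delta> * I\<bar> \<le> 8 * \<delta> * (2 * sqrt c2 * C * h powr a)" by (simp add: right_diff_distrib abs_le_iff)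
  have comb: "\<bar>2 * F - i\<bar> \<le> 2 * x + 2 * y + z" if "\<bar>F - s\<bar> \<le> x" "\<bar>s - u\<bar> \<le> y" "\<bar>2 * u - i\<bar> \<le> z" for F i s u x y z :: real
    using that by linarith
  have "2 * (4 * \<delta> * Rs) = 8 * \<delta> * Rs" by simp
  then show ?thesis
    using comb[OF main_frob[folded Sm_def] 1[folded Rs_def], of "8 * \<delta> * I"] 2 unfolding Sm_def[symmetric] Rs_def[symmetric] I_def[symmetric] by simp
qed

end

section \<open>From the linear part to the characteristic function of the estimation error\<close>

lemma exp_minus_lipschitz:
  fixes p q :: real assumes "0 \<le> p" "0 \<le> q" shows "\<bar>exp (- p) - exp (- q)\<bar> \<le> \<bar>p - q\<bar>"
proof -
  have 1: "exp (- x) - exp (- y) \<le> y - x" if "0 \<le> x" "x \<le> y" for x y :: real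
  proof -
    have "exp (- x) - exp (- y) = exp (- x) * (1 - exp (- (y - x)))" by (simp add: algebra_simps flip: exp_add)
    also have "\<dots> \<le> 1 * (y - x)"
    proof (rule mult_mono)
      show "1 - exp (- (y - x)) \<le> y - x" using exp_ge_add_one_self[of "- (y - x)"] by linarith
    qed (use that in auto)
    finally show ?thesis by simp
  qed
  show ?thesis
  proof (cases "p \<le> q")
    case True
    then have "exp (- q) \<le> exp (- p)" by simp
    then show ?thesis using 1[of p q] assms True by simp
  next
    case False
    then have "exp (- p) \<le> exp (- q)" by simp
    then show ?thesis using 1[of q p] assms False by simp
  qed
qed

text \<open>The integrand is at most the smaller of 2 and \<open>\<bar>t\<bar>\<close> times the
  difference, so closeness is needed only in a truncated mean. This matches the truncated bound for
  the remainder.\<close>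

lemma (in prob_space) expectation_trig_diff:
  fixes u u' :: "real \<Rightarrow> real"
  assumes [measurable]: "A \<in> borel_measurable M" "B \<in> borel_measurable M"
    and d: "\<And>t. (u has_real_derivative u' t) (at t)" and b: "\<And>t. \<bar>u t\<bar> \<le> 1" "\<And>t. \<bar>u' t\<bar> \<le> 1"
  shows "\<bar>expectation (\<lambda>\<omega>. u (t * A \<omega>)) - expectation (\<lambda>\<omega>. u (t * B \<omega>))\<bar> \<le> (2 + \<bar>t\<bar>) * expectation (\<lambda>\<omega>. min 1 \<bar>A \<omega> - B \<omega>\<bar>)"
proof -
  have "continuous_on UNIV u" using d by (meson DERIV_continuous_on has_field_derivative_at_within)
  then have [measurable]: "u \<in> borel_measurable borel" by (rule borel_measurable_continuous_onI)
  have int: "integrable M (\<lambda>\<omega>. u (t * A \<omega>))" "integrable M (\<lambda>\<omega>. u (t * B \<omega>))"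
    by (rule integrable_const_bound[of _ 1]; use b in simp)+
  have lip: "\<bar>u x - u y\<bar> \<le> \<bar>x - y\<bar>" for x y
    using field_differentiable_bound[of UNIV u u' 1 y x] d b(2) by (auto intro: has_field_derivative_at_within)
  have "\<bar>expectation (\<lambda>\<omega>. u (t * A \<omega>)) - expectation (\<lambda>\<omega>. u (t * B \<omega>))\<bar> = \<bar>expectation (\<lambda>\<omega>. u (t * A \<omega>) - u (t * B \<omega>))\<bar>"
    using int by simp
  then have "\<bar>expectation (\<lambda>\<omega>. u (t * A \<omega>)) - expectation (\<lambda>\<omega>. u (t * B \<omega>))\<bar> \<le> expectation (\<lambda>\<omega>. \<bar>u (t * A \<omega>) - u (t * B \<omega>)\<bar>)"
    using integral_abs_bound[of M "\<lambda>\<omega>. u (t * A \<omega>) - u (t * B \<omega>)"] by simp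
  also have "\<dots> \<le> expectation (\<lambda>\<omega>. (2 + \<bar>t\<bar>) * min 1 \<bar>A \<omega> - B \<omega>\<bar>)"
  proof (rule integral_mono)
    show "integrable M (\<lambda>\<omega>. \<bar>u (t * A \<omega>) - u (t * B \<omega>)\<bar>)" using int by simp
    show "integrable M (\<lambda>\<omega>. (2 + \<bar>t\<bar>) * min 1 \<bar>A \<omega> - B \<omega>\<bar>)"
      by (intro integrable_mult_right integrable_const_bound[of _ 1]) auto
    fix \<omega>
    have "\<bar>u (t * A \<omega>) - u (t * B \<omega>)\<bar> \<le> \<bar>t\<bar> * \<bar>A \<omega> - B \<omega>\<bar>"
      using lip[of "t * A \<omega>" "t * B \<omega>"] by (simp add: right_diff_distrib[symmetric] abs_mult)
    moreover have "\<bar>u (t * A \<omega>) - u (t * B \<omega>)\<bar> \<le> 2" using b(1)[of "t * A \<omega>"] b(1)[of "t * B \<omega>"] by linarith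
    ultimately show "\<bar>u (t * A \<omega>) - u (t * B \<omega>)\<bar> \<le> (2 + \<bar>t\<bar>) * min 1 \<bar>A \<omega> - B \<omega>\<bar>"
      by (cases "\<bar>A \<omega> - B \<omega>\<bar> \<le> 1") (auto simp: min_def distrib_right intro: order_trans)
  qed
  finally show ?thesis by simp
qed

context stage begin

text \<open>The bounds are rewritten in a few quantities with known limits. \<open>be\<close>
  compares \<open>n^(-1/4)\<close> with the bandwidth and tends to 0; \<open>om\<close> is the
  rescaled \<open>Bq\<close>, which stays bounded because \<open>r n e\<close> tends to 0.\<close>

definition "be = 1 / (b * r)"
definition "om = pi ^ 4 / \<delta>^2 * (\<delta> ^ 4 * (S + 1)^2 + (r * (real n * e))^2 / \<delta>)"
definition "aN \<kappa> = 2 / c1 * sqrt (32 * m0^2 * \<delta> + 4 * \<kappa>^2)"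
text \<open>Final bounds with \<open>\<kappa>\<close> in place of \<open>ks\<close>: they are
  monotone in it, so an explicit majorant of \<open>ks\<close> with known rate can be
  inserted.\<close>

definition F1 :: "real \<Rightarrow> nat \<Rightarrow> real" where
  "F1 \<kappa> L = 24 / c1 ^ 4 * (9 * om^2 * be^2 / \<delta> ^ 3) + real L * be * sqrt (8 * om / \<delta>) * aN \<kappa>
     + sqrt (3 / \<delta> * om * be) * aN \<kappa> + 160 / c1^2 * (3 / \<delta> * om * be) * (8 * m0 + \<kappa>) + (\<kappa> + C * (r * h powr a))"
definition "F4 \<kappa> = 3 * ((m0 * \<delta> / r)^2 * (8 * m0^2 * \<delta>) + 4 * (m0 * \<delta> / r)^2 * \<kappa>^2 + \<kappa> ^ 4)"
definition "F2 \<kappa> = 2 * (2 * (m0 * \<delta> / r) * \<kappa> + \<kappa>^2) + 2 * (\<delta> * K2 * (eta2 + c2 * (2 * b + 6 * h) + eta1))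
     + 8 * \<delta> * (2 * sqrt c2 * C * h powr a)"

lemma r4: "r ^ 4 = real n"
proof -
  have "r ^ 4 = (r^2)^2" by (simp flip: power_mult)
  then show ?thesis by (simp add: r_sq)
qed

lemma r1: "1 \<le> r" unfolding r_def using n by (intro ge_one_powr_ge_zero) auto

lemma be0: "0 < be" using b rpos by (simp add: be_def)
lemma om0: "0 \<le> om" using \<delta>(1) by (simp add: om_def)

text \<open>With \<open>G = r^2 / \<delta>\<close> and \<open>n = r^4\<close> all powers of the
  sample size combine into \<open>be^2 / r^2\<close>, which makes the moments of the pilot
  fluctuation comparable with the number of blocks.\<close>

lemma Bq_eq: "Bq = om * be^2 / r^2"
proof -
  have Gr: "real G = r^2 / \<delta>" using G \<delta> n by (simp add: r_sq field_simps)
  have "Bq = 4 * (pi^2 * r^2 / (2 * b * \<delta>))^2 * ((\<delta>^2 / r ^ 4 * (S + 1))^2 + r^2 / \<delta> * e^2)"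
    unfolding Bq_def kap_def Dbar_def Gr by (simp add: r_sq r4)
  also have "\<dots> = pi ^ 4 / \<delta>^2 * (\<delta> ^ 4 * (S + 1)^2 + (r * (r ^ 4 * e))^2 / \<delta>) * (1 / (b * r))^2 / r^2"
    using rpos b \<delta>(1) by (simp add: field_simps power_mult_distrib power2_eq_square eval_nat_numeral)
  finally show ?thesis by (simp add: om_def be_def r4)
qed

lemma xx_eq: "xx = 3 / \<delta> * om * be / r"
proof -
  have "b / g = b * r^2 / \<delta>" using \<delta> n by (simp add: r_sq)
  then have "xx = 3 * (b * r^2 / \<delta>) * (om * be^2 / r^2)" by (simp only: xx_def Bq_eq)
  also have "\<dots> = 3 / \<delta> * om * be * (b * be)" using rpos by (simp add: power2_eq_square)
  also have "b * be = 1 / r" using b by (simp add: be_def)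
  finally show ?thesis by simp
qed

lemma xx_le: "xx \<le> 3 / \<delta> * om * be"
proof -
  have "0 \<le> 3 / \<delta> * om * be" using \<delta>(1) om0 be0 by simp
  then have "3 / \<delta> * om * be / r \<le> 3 / \<delta> * om * be / 1" using r1 by (intro divide_left_mono) auto
  then show ?thesis unfolding xx_eq by simp
qed

lemma N_eq: "real N = r^2 / (\<delta> * h0)" using r_sq_h N h0pos \<delta>(1) rpos by (simp add: field_simps)

lemma N_xx: "real N * xx^2 \<le> 9 * om^2 * be^2 / \<delta> ^ 3"
proof -
  have "real N * xx^2 = 9 * om^2 * be^2 / \<delta> ^ 3 / h0"
    unfolding N_eq xx_eq using rpos \<delta>(1) h0pos by (simp add: field_simps power2_eq_square eval_nat_numeral)
  also have "\<dots> \<le> 9 * om^2 * be^2 / \<delta> ^ 3 / 1" using h0 \<delta>(1) by (intro divide_left_mono) auto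
  finally show ?thesis by simp
qed

lemma alpha_eq: "alpha = aN ks * sqrt h"
proof -
  have "32 * m0^2 * (r * h)^2 / h0 + 4 * ks^2 * h = (32 * m0^2 * \<delta> + 4 * ks^2) * h"
    unfolding rh_sq using h0pos by (simp add: algebra_simps)
  then show ?thesis unfolding alpha_def aN_def by (simp add: real_sqrt_mult)
qed

lemma aN_mono: "0 \<le> x \<Longrightarrow> x \<le> x' \<Longrightarrow> aN x \<le> aN x'"
  unfolding aN_def using c12 by (intro mult_left_mono real_sqrt_le_mono add_left_mono power_mono) auto
lemma aN0: "0 \<le> aN x" using c12 \<delta>(1) by (simp add: aN_def)

lemma vv_alpha: "vv * alpha * real N = be * sqrt (8 * om / \<delta>) * aN ks"
proof -
  have "vv * sqrt h * real N = sqrt (8 * h0 * Bq * h * (real N)^2)"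
    by (simp add: vv_def real_sqrt_mult)
  also have "8 * h0 * Bq * h * (real N)^2 = 8 * h0 * Bq * real N" using N by (simp add: power2_eq_square)
  also have "\<dots> = be^2 * (8 * om / \<delta>)" unfolding Bq_eq N_eq using rpos h0pos \<delta>(1) by (simp add: field_simps)
  also have "sqrt (be^2 * (8 * om / \<delta>)) = be * sqrt (8 * om / \<delta>)" unfolding real_sqrt_mult[of "be^2"] using be0 by simp
  finally show ?thesis unfolding alpha_eq by (simp add: mult_ac)
qed

lemma err_stat_F1:
  assumes L: "N \<le> 2 ^ L" "2 ^ L \<le> 2 * N" and \<kappa>: "ks \<le> \<kappa>"
  shows "expectation (\<lambda>\<omega>. min 1 \<bar>err_stat \<omega> - main_term \<omega>\<bar>) \<le> F1 \<kappa> L"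
proof -
  have k0: "0 \<le> \<kappa>" using ks0 \<kappa> by linarith
  have "real N * (24 * xx^2 / c1 ^ 4) = 24 / c1 ^ 4 * (real N * xx^2)" by simp
  also have "\<dots> \<le> 24 / c1 ^ 4 * (9 * om^2 * be^2 / \<delta> ^ 3)" using N_xx c12 by (intro mult_left_mono) auto
  finally have 1: "real N * (24 * xx^2 / c1 ^ 4) \<le> 24 / c1 ^ 4 * (9 * om^2 * be^2 / \<delta> ^ 3)" .
  have 2: "real L * (vv * alpha * 2 ^ L / 2) \<le> real L * be * sqrt (8 * om / \<delta>) * aN \<kappa>"
  proof -
    have "real (2 ^ L) \<le> real (2 * N)" using L(2) by (simp only: of_nat_le_iff)
    then have "2 ^ L / 2 \<le> real N" by simp
    then have "vv * alpha * (2 ^ L / 2) \<le> vv * alpha * real N"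
      using alpha0 h0pos Bq0 by (intro mult_left_mono mult_nonneg_nonneg) (auto simp: vv_def)
    also have "\<dots> = be * sqrt (8 * om / \<delta>) * aN ks" by (rule vv_alpha)
    also have "\<dots> \<le> be * sqrt (8 * om / \<delta>) * aN \<kappa>" using be0 om0 \<delta>(1) ks0 \<kappa> by (intro mult_left_mono aN_mono) auto
    finally have "real L * (vv * alpha * (2 ^ L / 2)) \<le> real L * (be * sqrt (8 * om / \<delta>) * aN \<kappa>)" by (rule mult_left_mono) simp
    then show ?thesis by (simp add: mult_ac)
  qed
  have 3: "sqrt xx * (alpha * sqrt (real N)) \<le> sqrt (3 / \<delta> * om * be) * aN \<kappa>"
  proof -
    have "sqrt h * sqrt (real N) = 1" using N by (simp flip: real_sqrt_mult)
    then have "alpha * sqrt (real N) = aN ks" unfolding alpha_eq by (simp add: mult.assoc)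
    then show ?thesis using xx_le ks0 \<kappa> xx0 aN0 aN_mono by (intro mult_mono) auto
  qed
  have 4: "160 / c1^2 * xx * (8 * m0 * r + ks) \<le> 160 / c1^2 * (3 / \<delta> * om * be) * (8 * m0 + \<kappa>)"
  proof -
    have p: "0 \<le> 3 / \<delta> * om * be" using \<delta>(1) om0 be0 by simp
    have "xx * (8 * m0 * r + ks) = 3 / \<delta> * om * be * (8 * m0 + ks / r)"
      unfolding xx_eq using rpos by (simp add: field_simps)
    also have "\<dots> \<le> 3 / \<delta> * om * be * (8 * m0 + \<kappa>)"
    proof (intro mult_left_mono add_left_mono p)
      have "ks / r \<le> ks / 1" using r1 ks0 by (intro divide_left_mono) auto
      then show "ks / r \<le> \<kappa>" using \<kappa> by simp
    qed
    finally have "160 / c1^2 * (xx * (8 * m0 * r + ks)) \<le> 160 / c1^2 * (3 / \<delta> * om * be * (8 * m0 + \<kappa>))" by (rule mult_left_mono) simp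
    then show ?thesis by (simp only: mult.assoc)
  qed
  have 5: "ks + r * (C * h powr a) \<le> \<kappa> + C * (r * h powr a)" using \<kappa> by (simp add: mult_ac)
  show ?thesis using err_stat_bound[OF L(1)] 1 2 3 4 5 unfolding F1_def by linarith
qed

text \<open>Two intermediate quantities link the error to its limit: the linear part
  \<open>main_term\<close>, and a normal law with the exact variance of that part. The three
  summands of the bound are the three passages.\<close>

theorem err_stat_trig:
  assumes L: "N \<le> 2 ^ L" "2 ^ L \<le> 2 * N" and \<kappa>: "ks \<le> \<kappa>"
    and u: "\<And>t. (u has_real_derivative u' t) (at t)" "\<And>t. (u' has_real_derivative - u t) (at t)"
      "\<And>t. \<bar>u t\<bar> \<le> 1" "\<And>t. \<bar>u' t\<bar> \<le> 1"
  defines "v \<equiv> 8 * \<delta> * integral {0..1} (\<lambda>t. s2 t powr (3/2))"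
  shows "\<bar>expectation (\<lambda>\<omega>. u (t * err_stat \<omega>)) - u 0 * exp (- (v * t^2 / 2))\<bar>
    \<le> (2 + \<bar>t\<bar>) * F1 \<kappa> L + t^2 * (2 * sqrt (2 * F4 \<kappa>)) + t^2 / 2 * F2 \<kappa>"
proof -
  let ?w = "2 * chaos2_frob P Cz mcoef"
  have k0: "0 \<le> ks" "0 \<le> \<kappa>" using ks0 \<kappa> by linarith+
  have "\<bar>expectation (\<lambda>\<omega>. u (t * err_stat \<omega>)) - expectation (\<lambda>\<omega>. u (t * main_term \<omega>))\<bar> \<le> (2 + \<bar>t\<bar>) * expectation (\<lambda>\<omega>. min 1 \<bar>err_stat \<omega> - main_term \<omega>\<bar>)"
    by (rule expectation_trig_diff[OF err_stat_measurable u(1,3,4)])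
  also have "\<dots> \<le> (2 + \<bar>t\<bar>) * F1 \<kappa> L" by (intro mult_left_mono err_stat_F1 L \<kappa>) auto
  finally have 1: "\<bar>expectation (\<lambda>\<omega>. u (t * err_stat \<omega>)) - expectation (\<lambda>\<omega>. u (t * main_term \<omega>))\<bar> \<le> (2 + \<bar>t\<bar>) * F1 \<kappa> L" .
  have rm: "0 \<le> m0 * \<delta> / r" using m00 \<delta>(1) rpos by simp
  have f4: "chaos2_frob4 P Cz mcoef \<le> F4 \<kappa>"
  proof -
    have "3 * ((m0 * \<delta> / r)^2 * (8 * m0^2 * \<delta>) + 4 * (m0 * \<delta> / r)^2 * ks^2 + ks ^ 4) \<le> F4 \<kappa>"
      unfolding F4_def using k0 \<kappa> by (intro mult_left_mono add_mono order_refl power_mono) auto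
    then show ?thesis using main_frob4 by linarith
  qed
  have "\<bar>expectation (\<lambda>\<omega>. u (t * main_term \<omega>)) - u 0 * exp (- (?w * t^2 / 2))\<bar> \<le> t^2 * (2 * sqrt (2 * chaos2_frob4 P Cz mcoef))"
    unfolding main_term_def by (rule gaussian_array_chaos2(5)[OF gz u])
  also have "\<dots> \<le> t^2 * (2 * sqrt (2 * F4 \<kappa>))" using f4 by (intro mult_left_mono real_sqrt_le_mono) auto
  finally have 2: "\<bar>expectation (\<lambda>\<omega>. u (t * main_term \<omega>)) - u 0 * exp (- (?w * t^2 / 2))\<bar> \<le> t^2 * (2 * sqrt (2 * F4 \<kappa>))" .
  have "0 \<le> ?w" unfolding gaussian_array_chaos2(3)[OF gz, of mcoef, symmetric] by (rule integral_nonneg_AE) simp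
  moreover have "0 \<le> v" unfolding v_def using \<delta>(1) Henstock_Kurzweil_Integration.integral_nonneg[OF integrable_continuous_real[OF continuous_powr_s2]] by simp
  ultimately have "\<bar>exp (- (?w * t^2 / 2)) - exp (- (v * t^2 / 2))\<bar> \<le> \<bar>?w * t^2 / 2 - v * t^2 / 2\<bar>"
    by (intro exp_minus_lipschitz) auto
  also have "?w * t^2 / 2 - v * t^2 / 2 = t^2 / 2 * (?w - v)" by (simp add: algebra_simps)
  also have "\<bar>t\<^sup>2 / 2 * (?w - v)\<bar> = t^2 / 2 * \<bar>?w - v\<bar>" by (simp add: abs_mult)
  also have "\<dots> \<le> t^2 / 2 * F2 \<kappa>"
  proof (rule mult_left_mono)
    have "2 * (2 * (m0 * \<delta> / r) * ks + ks^2) \<le> 2 * (2 * (m0 * \<delta> / r) * \<kappa> + \<kappa>^2)"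
      using k0 \<kappa> rm by (intro mult_left_mono add_mono power_mono) auto
    then show "\<bar>?w - v\<bar> \<le> F2 \<kappa>" using main_variance unfolding v_def F2_def by linarith
  qed simp
  finally have "\<bar>exp (- (?w * t^2 / 2)) - exp (- (v * t^2 / 2))\<bar> \<le> t^2 / 2 * F2 \<kappa>" .
  then have "\<bar>u 0\<bar> * \<bar>exp (- (?w * t^2 / 2)) - exp (- (v * t^2 / 2))\<bar> \<le> 1 * (t^2 / 2 * F2 \<kappa>)"
    using u(3)[of 0] by (intro mult_mono) auto
  moreover have "u 0 * exp (- (?w * t^2 / 2)) - u 0 * exp (- (v * t^2 / 2)) = u 0 * (exp (- (?w * t^2 / 2)) - exp (- (v * t^2 / 2)))"
    by (simp add: right_diff_distrib)
  ultimately have 3: "\<bar>u 0 * exp (- (?w * t^2 / 2)) - u 0 * exp (- (v * t^2 / 2))\<bar> \<le> t^2 / 2 * F2 \<kappa>"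
    by (simp add: abs_mult)
  show ?thesis using 1 2 3 by linarith
qed

text \<open>Each of the three covariance errors meets one sum of the majorant, so the bound is free
  of \<open>J\<close>. The last term is of order \<open>n^(1/4)\<close> times
  \<open>n^(-3/8)\<close>; it vanishes because the exponent \<open>3/4\<close> exceeds
  \<open>1/2\<close>.\<close>

lemma ks_bound:
  assumes ee_eq: "\<And>j. ee j = K * (h powr (2 + a) / (real j)^2 + 1 / (real n)^2 + (real j / (h * real n)) powr (3/4) / real n)"
    and K: "K \<ge> 0"
  shows "ks \<le> 8 * (pi^2 * Kw * K) * (r * h powr a + r / (\<delta>^2 * real n) + r / \<delta>^2 * (1 / (\<delta> * sqrt (real n))) powr (3/4))"
proof -
  define x where "x = (1 / (\<delta> * sqrt (real n))) powr (3/4)"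
  let ?c = "r * real N * pi^2 * Kw * K"
  have c0: "0 \<le> ?c" using rpos Kw0 K by simp
  have hh: "h0 / (h * real n) = 1 / (\<delta> * sqrt (real n))"
    unfolding h0(1) using hpos n \<delta>(1) by (simp add: field_simps)
  have each: "cb j * ee j = ?c * (h powr (2 + a) * wmaj h0 j + 1 / (real n)^2 * (wmaj h0 j * (real j)^2) + x / real n * (wmaj h0 j * (real j)^2 * (real j / h0) powr (3/4)))"
    if j: "j \<in> {1..J}" for j
  proof -
    have "real j / (h * real n) = (real j / h0) * (h0 / (h * real n))" using h0pos by simp
    then have "(real j / (h * real n)) powr (3/4) = (real j / h0) powr (3/4) * x"
      unfolding x_def hh[symmetric] using h0pos hpos by (subst powr_mult[symmetric]) auto
    then show ?thesis using j by (simp add: cb_def q_def ee_eq algebra_simps)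
  qed
  have "ks = real N * (?c * (h powr (2 + a) * (\<Sum>j=1..J. wmaj h0 j) + 1 / (real n)^2 * (\<Sum>j=1..J. wmaj h0 j * (real j)^2)
      + x / real n * (\<Sum>j=1..J. wmaj h0 j * (real j)^2 * (real j / h0) powr (3/4))))"
    unfolding ks_def sum_distrib_left sum.distrib[symmetric] by (intro sum.cong refl) (simp only: each)
  also have "\<dots> \<le> real N * (?c * (h powr (2 + a) * 8 + 1 / (real n)^2 * (8 * h0^2) + x / real n * (8 * h0^2)))"
    using c0 by (intro mult_left_mono add_mono wmaj_sums h0pos) (auto simp: x_def)
  also have "\<dots> = 8 * (pi^2 * Kw * K) * (r * ((real N)^2 * h powr (2 + a)) + r / (real n)^2 * ((real N)^2 * h0^2) + r * (x / real n) * ((real N)^2 * h0^2))"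
    by (simp add: power2_eq_square algebra_simps)
  also have "(real N)^2 * h powr (2 + a) = h powr a"
    using N hpos by (simp add: powr_add power_divide)
  also have "(real N)^2 * h0^2 = real n / \<delta>^2"
    unfolding h0(1) using N by (simp add: power_mult_distrib power_divide)
  also have "r * h powr a + r / (real n)^2 * (real n / \<delta>^2) + r * (x / real n) * (real n / \<delta>^2) = r * h powr a + r / (\<delta>^2 * real n) + r / \<delta>^2 * x"
    using n \<delta>(1) by (simp add: field_simps power2_eq_square)
  finally show ?thesis by (simp only: x_def)
qed

end

section \<open>Rates along the sequence of sample sizes\<close>

lemma exists_power2_between:
  assumes "(n::nat) > 0" shows "\<exists>L. n \<le> 2 ^ L \<and> 2 ^ L \<le> 2 * n"
  using assms
proof (induction n rule: nat_induct_non_zero)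
  case 1
  show ?case by (rule exI[of _ 0]) simp
next
  case (Suc n)
  then obtain L where L: "n \<le> 2 ^ L" "2 ^ L \<le> 2 * n" by blast
  show ?case
  proof (cases "Suc n \<le> 2 ^ L")
    case True
    then show ?thesis using L by (intro exI[of _ L]) simp
  next
    case False
    then have "n = 2 ^ L" using L by simp
    then show ?thesis by (intro exI[of _ "Suc L"]) simp
  qed
qed

text \<open>Sample sizes run through an increasing sequence \<open>N m\<close>, since the pilot
  blocks have to fill \<open>[0,1]\<close> exactly, that is, \<open>sqrt n / \<delta>\<close> has to
  be a natural number. \<open>H m\<close> is the number of blocks of the estimator.\<close>

locale sieve_model = prob_space M for M :: "'a measure" +
  fixes B X :: "real \<Rightarrow> 'a \<Rightarrow> real" and eps :: "nat \<Rightarrow> 'a \<Rightarrow> real" and s2 :: "real \<Rightarrow> real"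
    and \<delta> a C S s0 :: real and N H J :: "nat \<Rightarrow> nat" and b :: "nat \<Rightarrow> real"
  assumes \<delta>: "\<delta> > 0" and BM: "std_brownian_motion B"
    and X: "\<And>t. t \<in> {0..1} \<Longrightarrow> wiener_integral B (\<lambda>s. sqrt (s2 s)) t (X t)"
    and eps: "\<And>i. distributed M lborel (eps i) (normal_density 0 \<delta>)" "indep_vars (\<lambda>_. borel) eps UNIV"
    and ind: "indep_set
           (sigma_sets (space M) {B t -` U \<inter> space M | t U. U \<in> sets borel})
           (sigma_sets (space M) {eps i -` U \<inter> space M | i U. U \<in> sets borel})"
    and cont: "continuous_on {0..1} s2"
    and hol: "\<And>s t. s \<in> {0..1} \<Longrightarrow> t \<in> {0..1} \<Longrightarrow> \<bar>s2 s - s2 t\<bar> \<le> C * \<bar>s - t\<bar> powr a" and C: "C \<ge> 0" and a: "a > 1/2"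
    and s0: "s0 > 0" and s2b: "\<And>t. t \<in> {0..1} \<Longrightarrow> s0 \<le> s2 t \<and> s2 t \<le> S"
    and N: "strict_mono N" and Nat: "\<And>m. sqrt (real (N m)) / \<delta> \<in> \<nat>"
    and b: "\<And>m. b m > 0" "b \<in> \<Theta>(\<lambda>m. (real (N m) powr (-1/2) * ln (real (N m))) powr (1 / (2 * a + 1)))"
    and H: "\<And>m. H m > 0" "(\<lambda>m. 1 / real (H m)) \<in> \<Theta>(\<lambda>m. real (N m) powr (-1/2) * ln (real (N m)))"
    and J: "filterlim (\<lambda>m. real (J m) / ln (real (N m))) at_top sequentially"
begin

definition "x m = real (N m)"
definition "w m = x m powr (-1/2) * ln (x m)"
definition "r m = x m powr (1/4)"
definition "h m = 1 / real (H m)"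
definition "h0 m = h m * sqrt (x m) / \<delta>"
definition "g m = \<delta> / sqrt (x m)"
definition "K = max (6 * C * 2 powr a) (max (6 * S) (392 * \<delta>^2))"
text \<open>The covariance error bound with the block width \<open>\<eta>\<close> as an argument,
  because the same sample size is used with two widths, \<open>g m\<close> for the pilot and
  \<open>h m\<close> for the estimator.\<close>

definition berr :: "real \<Rightarrow> nat \<Rightarrow> nat \<Rightarrow> real" where
  "berr \<eta> m j = K * (\<eta> powr (2 + a) / (real j)^2 + 1 / (x m)^2 + (real j / (\<eta> * x m)) powr (3/4) / x m)"
definition "e m = berr (g m) m 1"
definition "L m = (SOME L. H m \<le> 2 ^ L \<and> 2 ^ L \<le> 2 * H m)"
definition "be m = 1 / (b m * r m)"

lemma S0: "S > 0" using s2b[of 0] s0 by simp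
lemma K: "6 * C * 2 powr a \<le> K" "6 * S \<le> K" "392 * \<delta>^2 \<le> K" "0 \<le> K"
  using S0 by (auto simp: K_def max_def)
lemma berr0: "0 \<le> berr \<eta> m j" using K by (simp add: berr_def x_def)
lemma hpos: "h m > 0" using H(1) by (simp add: h_def)

lemma L: "H m \<le> 2 ^ L m" "2 ^ L m \<le> 2 * H m"
  unfolding L_def using someI_ex[OF exists_power2_between[OF H(1)[of m]]] by auto

lemma x_at_top: "filterlim x at_top sequentially"
  unfolding x_def by (rule filterlim_compose[OF filterlim_real_sequentially filterlim_subseq[OF N]])

lemma at_x: "((\<lambda>y. f y) \<longlongrightarrow> l) at_top \<Longrightarrow> (\<lambda>m. f (x m)) \<longlonglongrightarrow> l" for f :: "real \<Rightarrow> real"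
  by (rule filterlim_compose[OF _ x_at_top])

lemma ev_x: "\<forall>\<^sub>F m in sequentially. c \<le> x m"
  using x_at_top by (simp add: filterlim_at_top)

lemma ev_ln: "\<forall>\<^sub>F m in sequentially. 1 \<le> x m \<and> 1 \<le> ln (x m)"
  using ev_x[of "exp 1"]
proof eventually_elim
  case (elim m)
  have "1 \<le> exp (1::real)" by simp
  then have "1 \<le> x m" using elim by linarith
  moreover have "ln (exp 1) \<le> ln (x m)" using elim by (subst ln_le_cancel_iff) (use \<open>1 \<le> x m\<close> in auto)
  ultimately show ?case by simp
qed

lemma r_at_top: "filterlim r at_top sequentially"
proof -
  have "filterlim (\<lambda>y::real. y powr (1/4)) at_top at_top" by real_asymp
  then show ?thesis unfolding r_def by (rule filterlim_compose[OF _ x_at_top])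
qed

lemma inv_r: "(\<lambda>m. 1 / r m) \<longlonglongrightarrow> 0"
  using tendsto_inverse_0_at_top[OF r_at_top] by (simp add: inverse_eq_divide)

lemma w_lim: "w \<longlonglongrightarrow> 0"
proof -
  have "((\<lambda>y::real. y powr (-1/2) * ln y) \<longlongrightarrow> 0) at_top" by real_asymp
  then show ?thesis unfolding w_def by (rule at_x)
qed

lemma ev_w: "\<forall>\<^sub>F m in sequentially. 0 \<le> w m"
  using ev_ln by eventually_elim (simp add: w_def)

text \<open>Pulling \<open>r m\<close> into the power gives \<open>x^(1/(4a))\<close> times
  \<open>w\<close>, that is, a logarithm times a power of \<open>x\<close> with exponent
  \<open>1/(4a) - 1/2\<close>. It is negative exactly when \<open>a > 1/2\<close>.\<close>

lemma powr_rate: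
  assumes s: "\<forall>\<^sub>F m in sequentially. 0 \<le> s m \<and> s m \<le> c * w m" and c: "c \<ge> 0"
  shows "(\<lambda>m. r m * s m powr a) \<longlonglongrightarrow> 0"
proof -
  define \<gamma> where "\<gamma> = 1/2 - 1/(4 * a)"
  have \<gamma>: "\<gamma> > 0" using a by (simp add: \<gamma>_def field_simps)
  have "((\<lambda>y::real. ln y * y powr (-\<gamma>)) \<longlongrightarrow> 0) at_top" using \<gamma> by real_asymp
  then have "(\<lambda>m. ln (x m) * x m powr (-\<gamma>)) \<longlonglongrightarrow> 0" by (rule at_x)
  then have "(\<lambda>m. c * (ln (x m) * x m powr (-\<gamma>))) \<longlonglongrightarrow> 0" by (rule tendsto_mult_right_zero)
  then have lim: "(\<lambda>m. (c * (ln (x m) * x m powr (-\<gamma>))) powr a) \<longlonglongrightarrow> 0"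
    by (rule tendsto_zero_powrI[OF _ tendsto_const]) (use a c in \<open>auto intro: eventually_mono[OF ev_ln]\<close>)
  show ?thesis
  proof (rule tendsto_sandwich[OF _ _ tendsto_const lim])
    show "\<forall>\<^sub>F m in sequentially. 0 \<le> r m * s m powr a" by (simp add: r_def)
    show "\<forall>\<^sub>F m in sequentially. r m * s m powr a \<le> (c * (ln (x m) * x m powr (-\<gamma>))) powr a"
      using s ev_ln
    proof eventually_elim
      case (elim m)
      have "r m = (x m powr (1/(4 * a))) powr a" using a by (simp add: r_def powr_powr)
      then have "r m * s m powr a = (x m powr (1/(4 * a)) * s m) powr a"
        using elim by (simp add: powr_mult)
      also have "\<dots> \<le> (x m powr (1/(4 * a)) * (c * w m)) powr a"
        using elim a by (intro powr_mono2 mult_left_mono) auto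
      also have "x m powr (1/(4 * a)) * (c * w m) = c * (ln (x m) * (x m powr (1/(4 * a)) * x m powr (-1/2)))"
        by (simp add: w_def mult_ac)
      also have "x m powr (1/(4 * a)) * x m powr (-1/2) = x m powr (-\<gamma>)" by (subst powr_add[symmetric]) (simp add: \<gamma>_def)
      finally show ?case .
    qed
  qed
qed

lemma h_le: obtains c where "c > 0" "\<forall>\<^sub>F m in sequentially. 0 \<le> h m \<and> h m \<le> c * w m"
proof -
  obtain c where c: "c > 0" "\<forall>\<^sub>F m in sequentially. norm (h m) \<le> c * norm (w m)"
    using landau_o.bigE[OF bigthetaD1[OF H(2)]] unfolding h_def w_def x_def by blast
  have "\<forall>\<^sub>F m in sequentially. 0 \<le> h m \<and> h m \<le> c * w m"
    using c(2) ev_w by eventually_elim (simp add: h_def)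
  then show thesis using c(1) that by blast
qed

lemma h_ge: obtains c where "c > 0" "\<forall>\<^sub>F m in sequentially. c * w m \<le> h m"
proof -
  obtain c where c: "c > 0" "\<forall>\<^sub>F m in sequentially. c * norm (w m) \<le> norm (h m)"
    using landau_omega.bigE[OF bigthetaD2[OF H(2)]] unfolding h_def w_def x_def by blast
  have "\<forall>\<^sub>F m in sequentially. c * w m \<le> h m"
    using c(2) ev_w by eventually_elim (simp add: h_def)
  then show thesis using c(1) that by blast
qed

lemma rate_zero:
  assumes s: "\<forall>\<^sub>F m in sequentially. 0 \<le> s m \<and> s m \<le> c * w m" shows "s \<longlonglongrightarrow> 0"
  by (rule tendsto_sandwich[OF _ _ tendsto_const tendsto_mult_right_zero[OF w_lim, of c]])
    (use s in \<open>auto elim: eventually_mono\<close>)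

lemma h_lim: "h \<longlonglongrightarrow> 0" using rate_zero h_le by metis
lemma rh_lim: "(\<lambda>m. r m * h m powr a) \<longlonglongrightarrow> 0" using powr_rate h_le less_imp_le by metis

lemma g_le: "\<forall>\<^sub>F m in sequentially. 0 \<le> g m \<and> g m \<le> \<delta> * w m"
  using ev_ln
proof eventually_elim
  case (elim m)
  have "g m = \<delta> * x m powr (-1/2)" using elim by (simp add: g_def powr_minus_divide powr_half_sqrt)
  also have "\<dots> \<le> \<delta> * w m" using elim \<delta> by (simp add: w_def)
  finally show ?case using \<delta> by (simp add: g_def x_def)
qed

lemma rg_lim: "(\<lambda>m. r m * g m powr a) \<longlonglongrightarrow> 0" by (rule powr_rate[OF g_le]) (use \<delta> in simp)

lemma sqrt_w: "x m \<ge> 1 \<Longrightarrow> w m * sqrt (x m) = ln (x m)"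
  by (simp add: w_def powr_minus_divide powr_half_sqrt)

lemma h0_at_top: "filterlim h0 at_top sequentially"
proof -
  obtain c where c: "c > 0" "\<forall>\<^sub>F m in sequentially. c * w m \<le> h m" by (rule h_ge)
  have "filterlim (\<lambda>y::real. c * ln y / \<delta>) at_top at_top" using c(1) \<delta> by real_asymp
  then have "filterlim (\<lambda>m. c * ln (x m) / \<delta>) at_top sequentially" by (rule filterlim_compose[OF _ x_at_top])
  then show ?thesis
  proof (rule filterlim_at_top_mono)
    show "\<forall>\<^sub>F m in sequentially. c * ln (x m) / \<delta> \<le> h0 m"
      using c(2) ev_ln
    proof eventually_elim
      case (elim m)
      have "c * ln (x m) = c * w m * sqrt (x m)" using sqrt_w[of m] elim by simp
      also have "\<dots> \<le> h m * sqrt (x m)" using elim by (intro mult_right_mono) auto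
      finally show ?case using \<delta> by (simp add: h0_def divide_right_mono)
    qed
  qed
qed

text \<open>\<open>h0\<close> grows like \<open>ln n\<close>, so the growth condition on
  \<open>J\<close> says that cutting the Riemann sum of the normalizer at \<open>J\<close> loses a
  vanishing tail.\<close>

lemma h0_J: "(\<lambda>m. h0 m / real (J m)) \<longlonglongrightarrow> 0"
proof -
  obtain c where c: "c > 0" "\<forall>\<^sub>F m in sequentially. 0 \<le> h m \<and> h m \<le> c * w m" by (rule h_le)
  have "(\<lambda>m. inverse (real (J m) / ln (x m))) \<longlonglongrightarrow> 0" using tendsto_inverse_0_at_top[OF J] by (simp add: x_def)
  then have lim: "(\<lambda>m. c / \<delta> * (ln (x m) / real (J m))) \<longlonglongrightarrow> 0" by (intro tendsto_mult_right_zero) simp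
  show ?thesis
  proof (rule tendsto_sandwich[OF _ _ tendsto_const lim])
    show "\<forall>\<^sub>F m in sequentially. 0 \<le> h0 m / real (J m)" using \<delta> by (simp add: h0_def h_def x_def)
    show "\<forall>\<^sub>F m in sequentially. h0 m / real (J m) \<le> c / \<delta> * (ln (x m) / real (J m))"
      using c(2) ev_ln
    proof eventually_elim
      case (elim m)
      have "h m * sqrt (x m) \<le> c * w m * sqrt (x m)" using elim by (intro mult_right_mono) auto
      also have "\<dots> = c * ln (x m)" using sqrt_w[of m] elim by simp
      finally have "h0 m \<le> c / \<delta> * ln (x m)" using \<delta> by (simp add: h0_def divide_right_mono)
      then have "h0 m / real (J m) \<le> c / \<delta> * ln (x m) / real (J m)" by (rule divide_right_mono) simp
      then show ?case by simp
    qed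
  qed
qed

lemma b_lim: "b \<longlonglongrightarrow> 0"
proof -
  obtain c where c: "c > 0" "\<forall>\<^sub>F m in sequentially. norm (b m) \<le> c * norm (w m powr (1 / (2 * a + 1)))"
    using landau_o.bigE[OF bigthetaD1[OF b(2)]] unfolding w_def x_def by blast
  have "(\<lambda>m. w m powr (1 / (2 * a + 1))) \<longlonglongrightarrow> 0"
    by (rule tendsto_zero_powrI[OF w_lim tendsto_const ev_w]) (use a in simp)
  then have lim: "(\<lambda>m. c * w m powr (1 / (2 * a + 1))) \<longlonglongrightarrow> 0" by (rule tendsto_mult_right_zero)
  show ?thesis
    by (rule tendsto_sandwich[OF _ _ tendsto_const lim]) (use c(2) b(1) in \<open>auto elim!: eventually_mono simp: less_imp_le\<close>)
qed

text \<open>The bandwidth is at least of order \<open>x^(-\<beta>/2)\<close> with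
  \<open>\<beta> = 1 / (2 * a + 1)\<close>, so \<open>b * r\<close> grows at least like
  \<open>x^\<gamma>\<close> with \<open>\<gamma> = 1/4 - \<beta>/2\<close>, again positive exactly
  for \<open>a > 1/2\<close>. The logarithm is then harmless.\<close>

lemma ln_be: "(\<lambda>m. ln (x m) * be m) \<longlonglongrightarrow> 0"
proof -
  obtain c where c: "c > 0" "\<forall>\<^sub>F m in sequentially. c * norm (w m powr (1 / (2 * a + 1))) \<le> norm (b m)"
    using landau_omega.bigE[OF bigthetaD2[OF b(2)]] unfolding w_def x_def by blast
  define \<beta> where "\<beta> = 1 / (2 * a + 1)"
  define \<gamma> where "\<gamma> = 1/4 - \<beta> / 2"
  have \<beta>: "\<beta> > 0" and \<gamma>: "\<gamma> > 0" using a by (auto simp: \<beta>_def \<gamma>_def field_simps)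
  have "((\<lambda>y::real. ln y * y powr (-\<gamma>)) \<longlongrightarrow> 0) at_top" using \<gamma> by real_asymp
  then have "(\<lambda>m. ln (x m) * x m powr (-\<gamma>)) \<longlonglongrightarrow> 0" by (rule at_x)
  then have lim: "(\<lambda>m. 1 / c * (ln (x m) * x m powr (-\<gamma>))) \<longlonglongrightarrow> 0" by (rule tendsto_mult_right_zero)
  show ?thesis
  proof (rule tendsto_sandwich[OF _ _ tendsto_const lim])
    show "\<forall>\<^sub>F m in sequentially. 0 \<le> ln (x m) * be m"
      using ev_ln by eventually_elim (use b(1) in \<open>simp add: be_def r_def less_imp_le\<close>)
    show "\<forall>\<^sub>F m in sequentially. ln (x m) * be m \<le> 1 / c * (ln (x m) * x m powr (-\<gamma>))"
      using c(2) ev_ln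
    proof eventually_elim
      case (elim m)
      have x0: "x m > 0" using elim by linarith
      have "(x m powr (-1/2)) powr \<beta> \<le> w m powr \<beta>"
        using elim \<beta> by (intro powr_mono2) (auto simp: w_def)
      then have "c * x m powr (-\<beta>/2) \<le> c * w m powr \<beta>" using c(1) by (simp add: powr_powr)
      also have "\<dots> \<le> b m" using elim(1) b(1)[of m] by (simp add: \<beta>_def)
      finally have bl: "c * x m powr (-\<beta>/2) \<le> b m" .
      have "c * x m powr \<gamma> = c * x m powr (-\<beta>/2) * r m"
        unfolding r_def mult.assoc by (subst powr_add[symmetric]) (simp add: \<gamma>_def)
      also have "\<dots> \<le> b m * r m" using bl by (intro mult_right_mono) (auto simp: r_def)
      finally have "be m \<le> 1 / (c * x m powr \<gamma>)"
        unfolding be_def using x0 c(1) b(1)[of m] by (intro divide_left_mono mult_pos_pos) (auto simp: r_def)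
      also have "\<dots> = 1 / c * x m powr (-\<gamma>)" by (simp add: powr_minus_divide)
      finally have "ln (x m) * be m \<le> ln (x m) * (1 / c * x m powr (-\<gamma>))" using elim by (intro mult_left_mono) auto
      then show ?case by (simp add: mult_ac)
    qed
  qed
qed

lemma be0: "0 \<le> be m" using b(1)[of m] by (simp add: be_def r_def less_imp_le)

lemma be_lim: "be \<longlonglongrightarrow> 0"
proof (rule tendsto_sandwich[OF _ _ tendsto_const ln_be])
  show "\<forall>\<^sub>F m in sequentially. 0 \<le> be m" by (simp add: be0)
  show "\<forall>\<^sub>F m in sequentially. be m \<le> ln (x m) * be m"
    using ev_ln
  proof eventually_elim
    case (elim m)
    then show ?case using mult_right_mono[of 1 "ln (x m)" "be m"] be0[of m] by simp
  qed
qed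

lemma ev_h0: "\<forall>\<^sub>F m in sequentially. c \<le> h0 m"
  using h0_at_top by (simp add: filterlim_at_top)

lemma ev_H: "\<forall>\<^sub>F m in sequentially. real (H m) \<le> x m"
  using ev_h0[of 1] ev_x[of 1] ev_x[of "1/\<delta>^2"]
proof eventually_elim
  case (elim m)
  have s: "sqrt (x m) > 0" using elim by simp
  have "1 / \<delta> \<le> sqrt (x m)" using elim \<delta> by (intro real_le_rsqrt) (simp add: power_divide)
  then have "sqrt (x m) / \<delta> \<le> sqrt (x m) * sqrt (x m)" using mult_right_mono[of "1/\<delta>" "sqrt (x m)" "sqrt (x m)"] s by simp
  moreover have "real (H m) \<le> sqrt (x m) / \<delta>" using elim(1) H(1)[of m] \<delta> by (simp add: h0_def h_def field_simps)
  ultimately show ?case using elim by simp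
qed

text \<open>The number \<open>L\<close> of dyadic levels is of order \<open>ln n\<close>, because
  there are at most \<open>n\<close> blocks. From \<open>L * ln 2 <= ln 2 + ln n\<close> and
  \<open>ln 2 >= 1/2\<close> one gets the factor 4.\<close>

lemma L_be: "(\<lambda>m. real (L m) * be m) \<longlonglongrightarrow> 0"
proof (rule tendsto_sandwich[OF _ _ tendsto_const tendsto_mult_right_zero[OF ln_be, of 4]])
  show "\<forall>\<^sub>F m in sequentially. 0 \<le> real (L m) * be m" by (simp add: be0)
  show "\<forall>\<^sub>F m in sequentially. real (L m) * be m \<le> 4 * (ln (x m) * be m)"
    using ev_ln ev_H
  proof eventually_elim
    case (elim m)
    have "real (2 ^ L m) \<le> real (2 * H m)" using L(2)[of m] by (simp only: of_nat_le_iff)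
    then have "2 ^ L m \<le> 2 * real (H m)" by simp
    then have "2 ^ L m \<le> 2 * x m" using elim by linarith
    then have "ln (2 ^ L m) \<le> ln (2 * x m)" using elim by (subst ln_le_cancel_iff) auto
    then have "real (L m) * ln 2 \<le> ln 2 + ln (x m)" using elim by (simp add: ln_realpow ln_mult)
    moreover have "real (L m) * (1/2) \<le> real (L m) * ln 2" using ln2_ge_two_thirds by (intro mult_left_mono) auto
    moreover have "ln 2 \<le> (1::real)" using ln_le_minus_one[of "2::real"] by simp
    ultimately have "real (L m) \<le> 4 * ln (x m)" using elim by linarith
    then show ?case using mult_right_mono[OF _ be0, of "real (L m)" "4 * ln (x m)" m] by simp
  qed
qed

lemma ev_g2: "\<forall>\<^sub>F m in sequentially. x m * (g m)^2 = \<delta>^2"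
  using ev_x[of 1] by eventually_elim (simp add: g_def power_divide)

text \<open>Since \<open>x * g^2\<close> is constant, \<open>x * e\<close> reduces to
  \<open>g powr a\<close>, \<open>1 / x\<close> and the \<open>3/4\<close> power of a multiple of
  \<open>x^(-1/2)\<close>; each of them beats \<open>x^(1/4)\<close>.\<close>

lemma rxe_lim: "(\<lambda>m. r m * (x m * e m)) \<longlonglongrightarrow> 0"
proof -
  have "((\<lambda>y::real. y powr (1/4) / y) \<longlongrightarrow> 0) at_top" by real_asymp
  then have 1: "(\<lambda>m. r m / x m) \<longlonglongrightarrow> 0" unfolding r_def by (rule at_x)
  have "((\<lambda>y::real. y powr (1/4) * (1 / (\<delta> / sqrt y * y)) powr (3/4)) \<longlongrightarrow> 0) at_top" using \<delta> by real_asymp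
  then have 2: "(\<lambda>m. r m * (1 / (g m * x m)) powr (3/4)) \<longlonglongrightarrow> 0" unfolding r_def g_def by (rule at_x)
  have lim: "(\<lambda>m. K * (\<delta>^2 * (r m * g m powr a) + r m / x m + r m * (1 / (g m * x m)) powr (3/4))) \<longlonglongrightarrow> 0"
    using tendsto_mult_right_zero[OF tendsto_add_zero[OF tendsto_add_zero[OF tendsto_mult_right_zero[OF rg_lim] 1] 2]] .
  show ?thesis
  proof (rule Lim_transform_eventually[OF lim])
    show "\<forall>\<^sub>F m in sequentially. K * (\<delta>^2 * (r m * g m powr a) + r m / x m + r m * (1 / (g m * x m)) powr (3/4)) = r m * (x m * e m)"
      using ev_g2 ev_x[of 1]
    proof eventually_elim
      case (elim m)
      have "g m powr (2 + a) = (g m)^2 * g m powr a" using elim(2) \<delta> by (simp add: powr_add g_def)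
      then have "x m * g m powr (2 + a) = \<delta>^2 * g m powr a" unfolding elim(1)[symmetric] by simp
      then have "r m * (x m * e m) = K * (r m * (\<delta>^2 * g m powr a) + r m * (x m / (x m)^2) + r m * (x m * ((1 / (g m * x m)) powr (3/4) / x m)))"
        using elim(2) by (simp add: e_def berr_def algebra_simps)
      also have "x m / (x m)^2 = 1 / x m" using elim by (simp add: power2_eq_square)
      also have "x m * ((1 / (g m * x m)) powr (3/4) / x m) = (1 / (g m * x m)) powr (3/4)" using elim by simp
      finally show ?case by (simp add: mult_ac)
    qed
  qed
qed

lemma xe_lim: "(\<lambda>m. x m / \<delta>^2 * pi^2 * e m) \<longlonglongrightarrow> 0"
proof -
  have lim: "(\<lambda>m. pi^2 / \<delta>^2 * (r m * (x m * e m) * (1 / r m))) \<longlonglongrightarrow> 0"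
    by (rule tendsto_mult_right_zero[OF tendsto_mult_zero[OF rxe_lim inv_r]])
  show ?thesis
    by (rule Lim_transform_eventually[OF lim], rule eventually_mono[OF ev_x[of 1]]) (simp add: r_def)
qed

lemma gb_lim: "(\<lambda>m. g m / b m) \<longlonglongrightarrow> 0"
proof -
  have lim: "(\<lambda>m. \<delta> * (be m * (1 / r m))) \<longlonglongrightarrow> 0"
    by (rule tendsto_mult_right_zero[OF tendsto_mult_zero[OF be_lim inv_r]])
  show ?thesis
  proof (rule Lim_transform_eventually[OF lim], rule eventually_mono[OF ev_x[of 1]])
    fix m assume "1 \<le> x m"
    have "r m * r m = sqrt (x m)" unfolding r_def by (subst powr_add[symmetric]) (use \<open>1 \<le> x m\<close> in \<open>simp add: powr_half_sqrt\<close>)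
    then show "\<delta> * (be m * (1 / r m)) = g m / b m" by (simp add: be_def g_def mult_ac)
  qed
qed

end

section \<open>The limit law along the admissible sample sizes\<close>

context sieve_model begin

definition "T m = (\<lambda>\<omega>. r m * (IVhat X eps \<delta> (N m) (H m) (J m) (b m) \<omega> - integral {0..1} s2))"

lemma y0_measurable: "y0 X eps n \<eta> j k \<in> borel_measurable M"
proof -
  have Y: "Yobs X eps n i \<in> borel_measurable M" if "i \<le> n" for i
  proof (cases "i = 0")
    case True
    then show ?thesis by (simp add: Yobs_def[abs_def])
  next
    case False
    then have "real i / real n \<in> {0..1}" using that by auto
    then have "X (real i / real n) \<in> borel_measurable M" using X by (auto simp: wiener_integral_def)
    moreover have "eps i \<in> borel_measurable M" using eps(1)[of i] by (auto dest: distributed_measurable)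
    ultimately show ?thesis using False by (simp add: Yobs_def[abs_def])
  qed
  show ?thesis unfolding y0_def[abs_def]
    by (intro borel_measurable_sum borel_measurable_times borel_measurable_diff borel_measurable_const Y) auto
qed

lemma T_measurable: "T m \<in> borel_measurable M"
proof -
  note [measurable] = y0_measurable
  have [measurable]: "sigma_tilde X eps \<delta> n \<beta> t \<in> borel_measurable M" for n \<beta> t
    unfolding sigma_tilde_def[abs_def] Let_def by measurable
  show ?thesis unfolding T_def IVhat_def[abs_def] weight_def Let_def by measurable
qed

definition "Gm m = nat \<lfloor>sqrt (real (N m)) / \<delta>\<rfloor>"

lemma Gm: "real (Gm m) = sqrt (x m) / \<delta>"
proof -
  obtain k where k: "sqrt (real (N m)) / \<delta> = of_nat k" using Nat[of m] by (rule Nats_cases)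
  show ?thesis unfolding Gm_def x_def k by simp
qed

lemma array:
  assumes "N m > 0" "finite P"
  shows "gaussian_array P (\<lambda>p. y0 X eps (N m) \<eta> (fst p) (snd p)) (y0_cov s2 \<delta> (N m) \<eta>)"
proof (rule y0_gaussian_array[OF BM assms(1) \<delta> X eps ind _ cont hol C _ assms(2)])
  show "0 < s2 t" if "t \<in> {0..1}" for t using s2b[OF that] s0 by linarith
qed (use a in auto)

lemma gram:
  assumes G: "0 < G" "\<eta> = 1 / real G" "G \<le> N m" and p: "0 < fst p" "snd p < G" "0 < fst p'" "snd p' < G"
  shows "\<bar>y0_cov s2 \<delta> (N m) \<eta> p p' -
      (if p = p' then s2 (real (snd p) * \<eta>) * (\<eta>^2 / (pi * real (fst p))^2) + \<delta>^2 / real (N m) else 0)\<bar>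
     \<le> sqrt (berr \<eta> m (fst p) * berr \<eta> m (fst p'))"
proof -
  have v: "valid G p" "valid G p'" using p by (auto simp: valid_def[OF G])
  have Sb: "\<bar>s2 t\<bar> \<le> S" if "t \<in> {0..1}" for t using s2b[OF that] s0 by simp
  have a0: "a > 0" using a by simp
  show ?thesis
    using gram_approx[OF G v cont hol C a0 Sb K(1-3)] unfolding block_err_def[OF G] berr_def x_def by simp
qed

text \<open>All smallness conditions of the fixed-size setting hold from some index on: bandwidth
  and block ratio by their limits, the pilot bias by the rate of \<open>e\<close>, and
  \<open>h0 <= J\<close> by the growth of \<open>J\<close>.\<close>

lemma ev_stage:
  "\<forall>\<^sub>F m in sequentially. 0 < N m \<and> H m \<le> N m \<and> stage M (\<lambda>p. y0 X eps (N m) (g m) (fst p) (snd p)) (y0_cov s2 \<delta> (N m) (g m)) s2 (g m) (b m) \<delta> C a S s0 (e m) (Gm m) (N m)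
     (\<lambda>p. y0 X eps (N m) (h m) (fst p) (snd p)) (y0_cov s2 \<delta> (N m) (h m)) (H m) (J m) (h m) (h0 m) (berr (h m) m)"
proof -
  have e1: "\<forall>\<^sub>F m in sequentially. b m < 1/2" using b_lim by (rule order_tendstoD) simp
  have e2: "\<forall>\<^sub>F m in sequentially. g m / b m < 1/4" using gb_lim by (rule order_tendstoD) simp
  have e3: "\<forall>\<^sub>F m in sequentially. x m / \<delta>^2 * pi^2 * e m < s0 / 4" using xe_lim by (rule order_tendstoD) (use s0 in simp)
  have e4: "\<forall>\<^sub>F m in sequentially. h0 m / real (J m) < 1" using h0_J by (rule order_tendstoD) simp
  have e5: "\<forall>\<^sub>F m in sequentially. 1 \<le> real (J m) / ln (x m)" using J by (simp add: filterlim_at_top x_def)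
  show ?thesis
    using e1 e2 e3 e4 e5 ev_H ev_h0[of 1] ev_x[of 1] ev_x[of "1 / \<delta>^2"]
  proof eventually_elim
    case (elim m)
    have N0: "0 < N m" using elim(8) by (simp add: x_def)
    have HN: "H m \<le> N m" using elim(6) by (simp add: x_def)
    have s: "sqrt (x m) > 0" using elim(8) by simp
    have G0: "0 < Gm m" using Gm[of m] s \<delta> by (metis divide_pos_pos of_nat_0_less_iff)
    have gG: "g m = 1 / real (Gm m)" by (simp add: Gm g_def)
    have GN: "Gm m \<le> N m"
    proof -
      have "1 / \<delta> \<le> sqrt (x m)" using elim(9) \<delta> by (intro real_le_rsqrt) (simp add: power_divide)
      then have "sqrt (x m) / \<delta> \<le> sqrt (x m) * sqrt (x m)" using mult_right_mono[of "1/\<delta>" "sqrt (x m)" "sqrt (x m)"] s by simp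
      then have "real (Gm m) \<le> real (N m)" unfolding Gm by (simp add: x_def)
      then show ?thesis by simp
    qed
    have J0: "J m > 0" using elim(5) by (cases "J m") auto
    have "stage M (\<lambda>p. y0 X eps (N m) (g m) (fst p) (snd p)) (y0_cov s2 \<delta> (N m) (g m)) s2 (g m) (b m) \<delta> C a S s0 (e m) (Gm m) (N m)
     (\<lambda>p. y0 X eps (N m) (h m) (fst p) (snd p)) (y0_cov s2 \<delta> (N m) (h m)) (H m) (J m) (h m) (h0 m) (berr (h m) m)"
    proof (intro stage.intro pilot.intro pilot_axioms.intro stage_axioms.intro prob_space_axioms)
      show "gaussian_array ({1} \<times> {..<Gm m}) (\<lambda>p. y0 X eps (N m) (g m) (fst p) (snd p)) (y0_cov s2 \<delta> (N m) (g m))" by (rule array[OF N0]) simp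
      show "gaussian_array ({1..J m} \<times> {..<H m}) (\<lambda>p. y0 X eps (N m) (h m) (fst p) (snd p)) (y0_cov s2 \<delta> (N m) (h m))" by (rule array[OF N0]) simp
      show "g m = \<delta> / sqrt (real (N m))" by (simp add: g_def x_def)
      show "h0 m = h m * sqrt (real (N m)) / \<delta>" by (simp add: h0_def x_def)
      show "real (N m) / \<delta>^2 * pi^2 * e m \<le> s0 / 4" using elim(3) by (simp add: x_def)
      show "h0 m \<le> real (J m)" using elim(4) J0 by (simp add: divide_less_eq)
      show "h m = 1 / real (H m)" by (simp add: h_def)
      fix p p'
      show "p \<in> {1} \<times> {..<Gm m} \<Longrightarrow> p' \<in> {1} \<times> {..<Gm m} \<Longrightarrow> \<bar>y0_cov s2 \<delta> (N m) (g m) p p' -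
        (if p = p' then s2 (real (snd p) * g m) * ((g m)^2 / (pi * real (fst p))^2) + \<delta>^2 / real (N m) else 0)\<bar> \<le> sqrt (e m * e m)"
        using gram[OF G0 gG GN, of p p'] unfolding e_def by (cases p; cases p') (simp del: real_sqrt_abs2)
      show "p \<in> {1..J m} \<times> {..<H m} \<Longrightarrow> p' \<in> {1..J m} \<times> {..<H m} \<Longrightarrow> \<bar>y0_cov s2 \<delta> (N m) (h m) p p' -
        (if p = p' then s2 (real (snd p) * h m) * ((h m)^2 / (pi * real (fst p))^2) + \<delta>^2 / real (N m) else 0)\<bar> \<le> sqrt (berr (h m) m (fst p) * berr (h m) m (fst p'))"
        using gram[OF H(1) h_def HN, of p p'] by (cases p; cases p') simp
    qed (use N0 G0 gG \<delta> b(1) elim hol C a s0 s2b berr0 cont H(1) in \<open>auto simp: e_def\<close>)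
    then show ?case using N0 HN by blast
  qed
qed

text \<open>The constants and bounds of the fixed-size setting are repeated here, either free of
  \<open>m\<close> or as sequences in \<open>m\<close>, so that limits can be formed; each time the
  setting is instantiated they are identified with its own.\<close>

definition "c1 = s0 / 8"
definition "c2 = 2 * S + s0 / 8"
definition "Kw = 2 * (c2 + pi^2)^2 / (min c1 1)^2"
definition "m0 = pi^2 * Kw * (S + 1)"
definition "kden = 1 / (2 * (c2 + pi^2)^2)"
definition "K2 = (2 / c1 + c2 / c1^2) / kden + 4 * c2 powr (3/2) / kden + 8 * sqrt c2"
definition "om m = pi ^ 4 / \<delta>^2 * (\<delta> ^ 4 * (S + 1)^2 + (r m * (x m * e m))^2 / \<delta>)"
definition "kp m = 8 * (pi^2 * Kw * K) * (r m * h m powr a + r m / (\<delta>^2 * x m) + r m / \<delta>^2 * (1 / (\<delta> * sqrt (x m))) powr (3/4))"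
definition "aN m = 2 / c1 * sqrt (32 * m0^2 * \<delta> + 4 * (kp m)^2)"
definition "eta1 m = 1 / (c1^2 * h0 m) + h0 m / (c1 * real (J m))"
definition "eta2 m = 2 * (C * b m powr a + x m / \<delta>^2 * pi^2 * e m) + 2 * S * (g m / b m)"
definition "F1 m = 24 / c1 ^ 4 * (9 * (om m)^2 * (be m)^2 / \<delta> ^ 3) + real (L m) * be m * sqrt (8 * om m / \<delta>) * aN m
     + sqrt (3 / \<delta> * om m * be m) * aN m + 160 / c1^2 * (3 / \<delta> * om m * be m) * (8 * m0 + kp m) + (kp m + C * (r m * h m powr a))"
definition "F4 m = 3 * ((m0 * \<delta> / r m)^2 * (8 * m0^2 * \<delta>) + 4 * (m0 * \<delta> / r m)^2 * (kp m)^2 + kp m ^ 4)"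
definition "F2 m = 2 * (2 * (m0 * \<delta> / r m) * kp m + (kp m)^2) + 2 * (\<delta> * K2 * (eta2 m + c2 * (2 * b m + 6 * h m) + eta1 m))
     + 8 * \<delta> * (2 * sqrt c2 * C * h m powr a)"
definition "v = 8 * \<delta> * integral {0..1} (\<lambda>t. s2 t powr (3/2))"

lemma trig_bound:
  assumes u: "\<And>t. (u has_real_derivative u' t) (at t)" "\<And>t. (u' has_real_derivative - u t) (at t)"
      "\<And>t. \<bar>u t\<bar> \<le> 1" "\<And>t. \<bar>u' t\<bar> \<le> 1"
  shows "\<forall>\<^sub>F m in sequentially. \<bar>expectation (\<lambda>\<omega>. u (t * T m \<omega>)) - u 0 * exp (- (v * t^2 / 2))\<bar>
    \<le> (2 + \<bar>t\<bar>) * F1 m + t^2 * (2 * sqrt (2 * F4 m)) + t^2 / 2 * F2 m"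
  using ev_stage
proof eventually_elim
  case (elim m)
  interpret st: stage M "\<lambda>p. y0 X eps (N m) (g m) (fst p) (snd p)" "y0_cov s2 \<delta> (N m) (g m)" s2 "g m" "b m" \<delta> C a S s0 "e m" "Gm m" "N m"
     "\<lambda>p. y0 X eps (N m) (h m) (fst p) (snd p)" "y0_cov s2 \<delta> (N m) (h m)" "H m" "J m" "h m" "h0 m" "berr (h m) m"
    using elim by blast
  \<comment> \<open>Writing the pilot estimator as mean plus fluctuation identifies the scaled
    estimation error with \<open>err_stat\<close> pointwise, not just in law.\<close>
  have T: "T m \<omega> = st.err_stat \<omega>" for \<omega>
  proof -
    have "sigma_tilde X eps \<delta> (N m) (b m) t \<omega> = st.pdet t + st.pvar t \<omega>" for t
    proof -
      have win: "{k. k < Gm m \<and> \<bar>real k * \<delta> / sqrt (real (N m)) - t\<bar> \<le> b m} = pilot_win (g m) (Gm m) (b m) t"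
        by (simp add: pilot_win_def g_def x_def)
      have "\<delta> / (2 * b m * sqrt (real (N m))) = g m / (2 * b m)" by (simp add: g_def x_def)
      then have "sigma_tilde X eps \<delta> (N m) (b m) t \<omega> =
        (\<Sum>k\<in>pilot_win (g m) (Gm m) (b m) t. g m / (2 * b m) * (real (N m) / \<delta>^2 * pi^2 * (y0 X eps (N m) (g m) 1 k \<omega>)^2 - pi\<^sup>2))"
        unfolding sigma_tilde_def Let_def Gm_def[symmetric] win sum_distrib_left by (simp add: g_def x_def mult.commute)
      then show ?thesis using st.pilot_decomp[where t = t and \<omega> = \<omega>] by simp
    qed
    then show ?thesis
      unfolding T_def st.err_stat_def IVhat_def Let_def st.f_def st.V_def by (simp add: r_def x_def st.r_def h_def h0_def)
  qed
  have "st.ks \<le> kp m"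
    using st.ks_bound[of K] K(4) unfolding berr_def kp_def Kw_def c1_def c2_def st.Kw_def st.c1_def st.c2_def
    by (simp add: st.r_def r_def x_def)
  note bound = st.err_stat_trig[OF L(1) L(2) this u, of t]
  have cs: "st.c1 = c1" "st.c2 = c2" "st.Kw = Kw" "st.m0 = m0" "st.kden = kden" "st.K2 = K2"
    by (simp_all add: c1_def c2_def Kw_def m0_def kden_def K2_def st.c1_def st.c2_def st.Kw_def st.m0_def st.kden_def st.K2_def)
  have r: "st.r = r m" by (simp add: r_def st.r_def x_def)
  have om: "st.om = om m" "st.be = be m" by (simp_all add: om_def be_def st.om_def st.be_def r x_def)
  have "st.F1 (kp m) (L m) = F1 m" unfolding st.F1_def F1_def st.aN_def aN_def cs om r ..
  moreover have "st.F4 (kp m) = F4 m" unfolding st.F4_def F4_def cs r ..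
  moreover have "st.F2 (kp m) = F2 m"
    unfolding st.F2_def F2_def cs r st.eta1_def st.eta2_def eta1_def eta2_def by (simp add: x_def)
  ultimately show ?case using bound unfolding T v_def by simp
qed

lemma c12: "0 < c1" "0 < c2" using s0 S0 by (auto simp: c1_def c2_def)

lemma kp_lim: "kp \<longlonglongrightarrow> 0"
proof -
  have "((\<lambda>y::real. y powr (1/4) / (\<delta>^2 * y)) \<longlongrightarrow> 0) at_top" using \<delta> by real_asymp
  then have 1: "(\<lambda>m. r m / (\<delta>^2 * x m)) \<longlonglongrightarrow> 0" unfolding r_def by (rule at_x)
  have "((\<lambda>y::real. y powr (1/4) / \<delta>^2 * (1 / (\<delta> * sqrt y)) powr (3/4)) \<longlongrightarrow> 0) at_top" using \<delta> by real_asymp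
  then have 2: "(\<lambda>m. r m / \<delta>^2 * (1 / (\<delta> * sqrt (x m))) powr (3/4)) \<longlonglongrightarrow> 0" unfolding r_def by (rule at_x)
  show ?thesis unfolding kp_def
    by (rule tendsto_mult_right_zero[OF tendsto_add_zero[OF tendsto_add_zero[OF rh_lim 1] 2]])
qed

lemma om_lim: "om \<longlonglongrightarrow> pi ^ 4 / \<delta>^2 * (\<delta> ^ 4 * (S + 1)^2)"
proof -
  define s where "s m = r m * (x m * e m)" for m
  have "s \<longlonglongrightarrow> 0" using rxe_lim by (simp add: s_def[abs_def])
  then show ?thesis unfolding om_def s_def[symmetric] using \<delta> by (auto intro!: tendsto_eq_intros)
qed

lemma aN_lim: "aN \<longlonglongrightarrow> 2 / c1 * sqrt (32 * m0^2 * \<delta>)"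
  unfolding aN_def using c12 by (auto intro!: tendsto_eq_intros kp_lim)

lemma F1_lim: "F1 \<longlonglongrightarrow> 0"
proof -
  define s s' where "s m = real (L m) * be m" and "s' m = r m * h m powr a" for m
  have "s \<longlonglongrightarrow> 0" "s' \<longlonglongrightarrow> 0" using L_be rh_lim by (simp_all add: s_def[abs_def] s'_def[abs_def])
  then show ?thesis
    unfolding F1_def s_def[symmetric] s'_def[symmetric] using \<delta> c12 by (auto intro!: tendsto_eq_intros om_lim be_lim aN_lim kp_lim)
qed

lemma mr_lim: "(\<lambda>m. m0 * \<delta> / r m) \<longlonglongrightarrow> 0"
  using tendsto_mult_right_zero[OF inv_r, of "m0 * \<delta>"] by simp

lemma F4_lim: "F4 \<longlonglongrightarrow> 0"
proof -
  define s where "s m = m0 * \<delta> / r m" for m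
  have "s \<longlonglongrightarrow> 0" using mr_lim by (simp add: s_def[abs_def])
  then show ?thesis unfolding F4_def s_def[symmetric] by (auto intro!: tendsto_eq_intros kp_lim)
qed

lemma eta1_lim: "eta1 \<longlonglongrightarrow> 0"
proof -
  have 1: "(\<lambda>m. 1 / c1^2 * inverse (h0 m)) \<longlonglongrightarrow> 0" by (rule tendsto_mult_right_zero[OF tendsto_inverse_0_at_top[OF h0_at_top]])
  have 2: "(\<lambda>m. 1 / c1 * (h0 m / real (J m))) \<longlonglongrightarrow> 0" by (rule tendsto_mult_right_zero[OF h0_J])
  show ?thesis using tendsto_add_zero[OF 1 2] by (simp add: eta1_def[abs_def] inverse_eq_divide)
qed

lemma powr_lim: "s \<longlonglongrightarrow> 0 \<Longrightarrow> (\<And>m. 0 \<le> s m) \<Longrightarrow> (\<lambda>m. s m powr a) \<longlonglongrightarrow> 0"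
  using a by (intro tendsto_zero_powrI[OF _ tendsto_const]) auto

lemma eta2_lim: "eta2 \<longlonglongrightarrow> 0"
proof -
  have 1: "(\<lambda>m. b m powr a) \<longlonglongrightarrow> 0" using b(1) by (intro powr_lim b_lim) (simp add: less_imp_le)
  show ?thesis unfolding eta2_def
    by (rule tendsto_add_zero[OF tendsto_mult_right_zero[OF tendsto_add_zero[OF tendsto_mult_right_zero[OF 1] xe_lim]] tendsto_mult_right_zero[OF gb_lim]])
qed

lemma F2_lim: "F2 \<longlonglongrightarrow> 0"
proof -
  define s s' where "s m = m0 * \<delta> / r m" and "s' m = h m powr a" for m
  have "s' \<longlonglongrightarrow> 0" unfolding s'_def using hpos by (intro powr_lim h_lim) (simp add: less_imp_le)
  moreover have "s \<longlonglongrightarrow> 0" using mr_lim by (simp add: s_def[abs_def])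
  ultimately show ?thesis
    unfolding F2_def s_def[symmetric] s'_def[symmetric] by (auto intro!: tendsto_eq_intros kp_lim eta1_lim eta2_lim b_lim h_lim)
qed

lemma trig_lim:
  assumes u: "\<And>t. (u has_real_derivative u' t) (at t)" "\<And>t. (u' has_real_derivative - u t) (at t)"
      "\<And>t. \<bar>u t\<bar> \<le> 1" "\<And>t. \<bar>u' t\<bar> \<le> 1"
  shows "(\<lambda>m. expectation (\<lambda>\<omega>. u (t * T m \<omega>))) \<longlonglongrightarrow> u 0 * exp (- (v * t^2 / 2))"
proof (rule LIM_zero_cancel)
  have "(\<lambda>m. (2 + \<bar>t\<bar>) * F1 m + t^2 * (2 * sqrt (2 * F4 m)) + t^2 / 2 * F2 m) \<longlonglongrightarrow> 0"
    by (auto intro!: tendsto_eq_intros F1_lim F2_lim F4_lim)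
  then show "(\<lambda>m. expectation (\<lambda>\<omega>. u (t * T m \<omega>)) - u 0 * exp (- (v * t^2 / 2))) \<longlonglongrightarrow> 0"
    by (rule Lim_null_comparison[rotated]) (use trig_bound[OF u, of t] in simp)
qed

lemma v_pos: "v > 0"
proof -
  have c: "continuous_on {0..1} (\<lambda>t. s2 t powr (3/2))"
    using s2b s0 by (intro continuous_on_powr cont continuous_on_const) fastforce
  have le: "integral {0..1::real} (\<lambda>_. s0 powr (3/2)) \<le> integral {0..1} (\<lambda>t. s2 t powr (3/2))"
    using s2b s0 by (intro integral_le integrable_continuous_real c continuous_on_const powr_mono2) auto
  have "0 < s0 powr (3/2)" using s0 by simp
  also have "\<dots> = integral {0..1::real} (\<lambda>_. s0 powr (3/2))" by simp
  also note le
  finally have "0 < integral {0..1} (\<lambda>t. s2 t powr (3/2))" .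
  then show ?thesis using \<delta> by (simp add: v_def)
qed

text \<open>Levy continuity: the real and imaginary parts of the characteristic function are the
  cosine and sine cases of \<open>trig_lim\<close>, with \<open>u 0\<close> equal to 1 and
  0.\<close>

theorem T_weak_limit: "weak_conv_m (\<lambda>m. distr M borel (T m)) (density lborel (normal_density 0 (sqrt v)))"
proof (rule levy_continuity)
  show "real_distribution (distr M borel (T m))" for m by (rule real_distribution_distr[OF T_measurable])
  have "prob_space (density lborel (normal_density 0 (sqrt v)))" using v_pos by (intro prob_space_normal_density) simp
  then show "real_distribution (density lborel (normal_density 0 (sqrt v)))"
    by (simp add: real_distribution_def real_distribution_axioms_def)
  fix t
  have 1: "(\<lambda>m. expectation (\<lambda>\<omega>. cos (t * T m \<omega>))) \<longlonglongrightarrow> cos 0 * exp (- (v * t^2 / 2))"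
    by (rule trig_lim[where u' = "\<lambda>x. - sin x"]) (auto intro!: derivative_eq_intros)
  have 2: "(\<lambda>m. expectation (\<lambda>\<omega>. sin (t * T m \<omega>))) \<longlonglongrightarrow> sin 0 * exp (- (v * t^2 / 2))"
    by (rule trig_lim[where u' = cos]) (auto intro!: derivative_eq_intros)
  have "(\<lambda>m. complex_of_real (expectation (\<lambda>\<omega>. cos (t * T m \<omega>))) + \<i> * complex_of_real (expectation (\<lambda>\<omega>. sin (t * T m \<omega>))))
     \<longlonglongrightarrow> complex_of_real (cos 0 * exp (- (v * t^2 / 2))) + \<i> * complex_of_real (sin 0 * exp (- (v * t^2 / 2)))"
    by (intro tendsto_add tendsto_mult tendsto_const tendsto_of_real 1 2)
  then show "(\<lambda>m. char (distr M borel (T m)) t) \<longlonglongrightarrow> char (density lborel (normal_density 0 (sqrt v))) t"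
    unfolding char_eq_cos_sin[OF T_measurable] using v_pos by (simp add: char_normal_density power_mult_distrib)
qed

end

theorem theorem8p1:
  fixes M :: "'a measure"
    and B X :: "real \<Rightarrow> 'a \<Rightarrow> real"
    and eps :: "nat \<Rightarrow> 'a \<Rightarrow> real"
    and s2 :: "real \<Rightarrow> real"
    and \<delta> \<alpha> :: real
    and N H J :: "nat \<Rightarrow> nat"
    and b :: "nat \<Rightarrow> real"
  assumes "prob_space M"
    and "\<delta> > 0"
    and "\<forall>t\<in>{0..1}. s2 t > 0"
    and "\<alpha> > 1/2" and "holder_on \<alpha> s2 {0..1}"
    and "prob_space.std_brownian_motion M B"
    and "\<forall>t\<in>{0..1}. prob_space.wiener_integral M B (\<lambda>s. sqrt (s2 s)) t (X t)"
    and "\<forall>i. distributed M lborel (eps i) (normal_density 0 \<delta>)"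
    and "prob_space.indep_vars M (\<lambda>_. borel) eps UNIV"
    and "prob_space.indep_set M
           (sigma_sets (space M) {B t -` U \<inter> space M | t U. U \<in> sets borel})
           (sigma_sets (space M) {eps i -` U \<inter> space M | i U. U \<in> sets borel})"
    and "strict_mono N"
    and "\<forall>m. sqrt (real (N m)) / \<delta> \<in> \<nat>"
    and "\<forall>m. b m > 0"
    and "b \<in> \<Theta>(\<lambda>m. (real (N m) powr (-1/2) * ln (real (N m))) powr (1 / (2 * \<alpha> + 1)))"
    and "\<forall>m. H m > 0"
    and "(\<lambda>m. 1 / real (H m)) \<in> \<Theta>(\<lambda>m. real (N m) powr (-1/2) * ln (real (N m)))"
    and "filterlim (\<lambda>m. real (J m) / ln (real (N m))) at_top sequentially"
  shows "weak_conv_m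
           (\<lambda>m. distr M borel (\<lambda>\<omega>. real (N m) powr (1/4) *
               (IVhat X eps \<delta> (N m) (H m) (J m) (b m) \<omega> - integral {0..1} s2)))
           (density lborel (normal_density 0 (sqrt (8 * \<delta> * integral {0..1} (\<lambda>t. s2 t powr (3/2))))))"
proof -
  interpret prob_space M by fact
  obtain C0 where C0: "\<And>s t. s \<in> {0..1} \<Longrightarrow> t \<in> {0..1} \<Longrightarrow> \<bar>s2 s - s2 t\<bar> \<le> C0 * \<bar>s - t\<bar> powr \<alpha>"
    using assms(5) unfolding holder_on_def by blast
  \<comment> \<open>The maximum with 0 makes the Hoelder constant visibly nonnegative.\<close>
  define C where "C = max C0 0"
  have hol: "\<bar>s2 s - s2 t\<bar> \<le> C * \<bar>s - t\<bar> powr \<alpha>" if "s \<in> {0..1}" "t \<in> {0..1}" for s t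
    by (rule order_trans[OF C0[OF that]]) (auto simp: C_def intro: mult_right_mono)
  have cont: "continuous_on {0..1} s2"
    unfolding continuous_on_def
  proof
    fix t :: real assume t: "t \<in> {0..1}"
    have "((\<lambda>s. \<bar>s - t\<bar>) \<longlongrightarrow> 0) (at t within {0..1})" by (auto intro!: tendsto_eq_intros)
    then have "((\<lambda>s. \<bar>s - t\<bar> powr \<alpha>) \<longlongrightarrow> 0) (at t within {0..1})"
      by (rule tendsto_zero_powrI[OF _ tendsto_const]) (use assms(4) in auto)
    then have "((\<lambda>s. C * \<bar>s - t\<bar> powr \<alpha>) \<longlongrightarrow> 0) (at t within {0..1})" by (rule tendsto_mult_right_zero)
    then have "((\<lambda>s. s2 s - s2 t) \<longlongrightarrow> 0) (at t within {0..1})"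
      by (rule Lim_null_comparison[rotated]) (use hol t in \<open>auto simp: eventually_at_filter\<close>)
    then show "(s2 \<longlongrightarrow> s2 t) (at t within {0..1})" by (rule LIM_zero_cancel)
  qed
  \<comment> \<open>Hoelder continuity gives continuity, and compactness of \<open>[0,1]\<close>
    turns pointwise positivity into the uniform bounds \<open>s2 t0\<close> and
    \<open>s2 t1\<close>.\<close>
  obtain t0 where t0: "t0 \<in> {0..1}" "\<And>t. t \<in> {0..1} \<Longrightarrow> s2 t0 \<le> s2 t"
    using continuous_attains_inf[OF compact_Icc _ cont] by auto
  obtain t1 where t1: "t1 \<in> {0..1}" "\<And>t. t \<in> {0..1} \<Longrightarrow> s2 t \<le> s2 t1"
    using continuous_attains_sup[OF compact_Icc _ cont] by auto
  interpret sieve_model M B X eps s2 \<delta> \<alpha> C "s2 t1" "s2 t0" N H J b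
  proof (unfold_locales)
    show "\<bar>s2 s - s2 t\<bar> \<le> C * \<bar>s - t\<bar> powr \<alpha>" if "s \<in> {0..1}" "t \<in> {0..1}" for s t by (rule hol[OF that])
    show "continuous_on {0..1} s2" by (rule cont)
    show "C \<ge> 0" by (simp add: C_def)
  qed (use assms t0 t1 in simp_all)
  show ?thesis using T_weak_limit unfolding T_def r_def x_def v_def .
qed

end
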